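(* Let $\Lambda$ be a locally convex row-finite $k$-graph. Then the following are equivalent. (1) $C^*(\Lambda)$ is decomposable. (2) There exist nonempty, disjoint $H_1,H_2\in\mathcal{H}_\Lambda$ such that for every $v\in\Lambda^0\setminus(H_1\cup H_2)$ there is some $n\in\mathbb{N}^k$ with $s(v\Lambda^{\le n})\subseteq H_1\cup H_2$. (3) There exists a nonempty $H\in\mathcal{H}_\Lambda$ such that $\Lambda^0\succ H$. Moreover, for $H_1,H_2$ as in (2) we have $$C^*(\Lambda)=I_{H_1}\oplus I_{H_2}\cong C^*(\Lambda\setminus\Lambda H_2)\oplus C^*(\Lambda\setminus\Lambda H_1),$$ and for $H$ as in (3) we have $$C^*(\Lambda)\cong C^*(\Lambda\setminus\Lambda H)\oplus I_H\cong C^*(\Lambda\setminus\Lambda H)\oplus C^*(\Lambda\setminus\Lambda H'),$$ where $H'=\Sigma(\Delta(\Lambda^0,H))$.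
   Context: Fix an integer $k\ge 1$. $\mathbb{N}^k$ carries the coordinatewise order, with standard generators $e_1,\dots,e_k$. A $k$-graph is a countable small category $\Lambda$ with range and source maps $r,s$ and a degree functor $d:\Lambda\to\mathbb{N}^k$ such that whenever $d(\lambda)=m+n$ there are unique $\mu,\nu\in\Lambda$ with $d(\mu)=m$, $d(\nu)=n$, $\lambda=\mu\nu$ (the product $\mu\nu$ is defined iff $s(\mu)=r(\nu)$). $\Lambda^n:=d^{-1}(n)$, and $\Lambda^0$ is the set of vertices. For $v\in\Lambda^0$, $H\subseteq\Lambda^0$, $E\subseteq\Lambda$: $vE=\{\mu\in E:r(\mu)=v\}$, $EH=\{\mu\in E:s(\mu)\in H\}$. $\Lambda$ is row-finite if every $v\Lambda^n$ is finite; locally convex if for all $v$, $i\ne j$, $\lambda\in v\Lambda^{e_i}$, $\mu\in v\Lambda^{e_j}$ we have $s(\lambda)\Lambda^{e_j}\neq\emptyset$ and $s(\mu)\Lambda^{e_i}\ne\emptyset$. $\Lambda^{\le n}:=\{\lambda: d(\lambda)\le n,\text{ and } d(\lambda)_i<n_i\Rightarrow s(\lambda)\Lambda^{e_i}=\emptyset\}$. $C^*(\Lambda)$ is the universal $C^*$-algebra generated by partial isometries $\{s_\lambda:\lambda\in\Lambda\}$ with: $s_vs_w=\delta_{v,w}s_v$ ($v,w\in\Lambda^0$); $s_\lambda s_{\lambda'}=s_{\lambda\lambda'}$ if $s(\lambda)=r(\lambda')$; $s_\lambda^*s_\lambda=s_{s(\lambda)}$; $s_v=\sum_{\lambda\in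 v\Lambda^{\le n}}s_\lambda s_\lambda^*$ for all $v\in\Lambda^0,n\in\mathbb{N}^k$. Ideals are closed and two-sided. $C^*(\Lambda)$ is decomposable if $C^*(\Lambda)=A\oplus B$ for two nonzero $C^*$-algebras $A,B$ (which are then ideals of $C^*(\Lambda)$). $H\subseteq\Lambda^0$ is hereditary if $r(\lambda)\in H$ implies $s(\lambda)\in H$ for every $\lambda\in\Lambda$; saturated if $v\in\Lambda^0$ and $s(v\Lambda^{\le n})\subseteq H$ for some $n\in\mathbb{N}^k$ imply $v\in H$. $\Sigma(H)$ is the smallest saturated subset of $\Lambda^0$ containing $H$. $\mathcal{H}_\Lambda$ is the collection of saturated hereditary subsets of $\Lambda^0$. For $H\in\mathcal{H}_\Lambda$, $I_H$ is the ideal of $C^*(\Lambda)$ generated by $\{s_v:v\in H\}$, and $\Lambda\setminus\Lambda H$ is a locally convex row-finite $k$-graph (a subcategory of $\Lambda$, with vertex set $\Lambda^0\setminus H$). For $v\in\Lambda^0$, $T(v):=\{s(\mu):\mu\in v\Lambda\}$. For $H_1,H_2\in\mathcal{H}_\Lambda$ with $H_1\supseteq H_2$: $\Delta(H_1,H_2):=\{v\in H_1:T(v)\cap H_2=\emptyset\}$ and $\Omega(H_1,H_2):=\{v\in H_1\setminus H_2:T(v)\cap H_2\neq\emptyset\}$. We write $H_1\succ H_2$ iff (a) $H_1\supseteq H_2$; (b) $\Delta(H_1,H_2)\ne\emptyset$; (c) for every $v\in\Omega(H_1,H_2)$ there is $n\in\mathbb{N}^k$ with $s(v\Lambda^{\le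 n})\subseteq H_2\cup\Delta(H_1,H_2)$. *)

theory Defs
  imports "HOL-Analysis.Analysis" "HOL-Library.Poly_Mapping"
begin

section \<open>Higher-rank graphs\<close>

text \<open>
  Small categories are given by their arrows only: a vertex is identified with its identity
  morphism, so range and source take values among the morphisms. Composition is
  read as \<open>\<mu>\<nu>\<close> with \<open>src \<mu> = rng \<nu>\<close>, and its values at non-composable pairs are irrelevant.
  The monoid of degrees is \<^typ>\<open>nat ^ 'k\<close> with componentwise order, where \<open>k\<close> is the
  (positive) cardinality of the finite type \<^typ>\<open>'k\<close>; its generators are \<open>axis i 1\<close>.
\<close>

record ('a, 'k::finite) kgraph =
  mor :: "'a set"
  rng :: "'a \<Rightarrow> 'a"
  src :: "'a \<Rightarrow> 'a"
  cmp :: "'a \<Rightarrow> 'a \<Rightarrow> 'a"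
  deg :: "'a \<Rightarrow> nat ^ 'k"

locale k_graph =
  fixes \<Lambda> :: "('a, 'k::finite) kgraph"
  assumes countable_mor: "countable (mor \<Lambda>)"
    and rng_mor: "\<kappa> \<in> mor \<Lambda> \<Longrightarrow> rng \<Lambda> \<kappa> \<in> mor \<Lambda>"
    and src_mor: "\<kappa> \<in> mor \<Lambda> \<Longrightarrow> src \<Lambda> \<kappa> \<in> mor \<Lambda>"
    and rng_rng: "\<kappa> \<in> mor \<Lambda> \<Longrightarrow> rng \<Lambda> (rng \<Lambda> \<kappa>) = rng \<Lambda> \<kappa>"
    and src_rng: "\<kappa> \<in> mor \<Lambda> \<Longrightarrow> src \<Lambda> (rng \<Lambda> \<kappa>) = rng \<Lambda> \<kappa>"
    and rng_src: "\<kappa> \<in> mor \<Lambda> \<Longrightarrow> rng \<Lambda> (src \<Lambda> \<kappa>) = src \<Lambda> \<kappa>"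
    and src_src: "\<kappa> \<in> mor \<Lambda> \<Longrightarrow> src \<Lambda> (src \<Lambda> \<kappa>) = src \<Lambda> \<kappa>"
    and cmp_mor: "\<mu> \<in> mor \<Lambda> \<Longrightarrow> \<nu> \<in> mor \<Lambda> \<Longrightarrow> src \<Lambda> \<mu> = rng \<Lambda> \<nu> \<Longrightarrow> cmp \<Lambda> \<mu> \<nu> \<in> mor \<Lambda>"
    and rng_cmp: "\<mu> \<in> mor \<Lambda> \<Longrightarrow> \<nu> \<in> mor \<Lambda> \<Longrightarrow> src \<Lambda> \<mu> = rng \<Lambda> \<nu> \<Longrightarrow>
      rng \<Lambda> (cmp \<Lambda> \<mu> \<nu>) = rng \<Lambda> \<mu>"
    and src_cmp: "\<mu> \<in> mor \<Lambda> \<Longrightarrow> \<nu> \<in> mor \<Lambda> \<Longrightarrow> src \<Lambda> \<mu> = rng \<Lambda> \<nu> \<Longrightarrow>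
      src \<Lambda> (cmp \<Lambda> \<mu> \<nu>) = src \<Lambda> \<nu>"
    and cmp_id_left: "\<kappa> \<in> mor \<Lambda> \<Longrightarrow> cmp \<Lambda> (rng \<Lambda> \<kappa>) \<kappa> = \<kappa>"
    and cmp_id_right: "\<kappa> \<in> mor \<Lambda> \<Longrightarrow> cmp \<Lambda> \<kappa> (src \<Lambda> \<kappa>) = \<kappa>"
    and cmp_assoc: "\<kappa> \<in> mor \<Lambda> \<Longrightarrow> \<mu> \<in> mor \<Lambda> \<Longrightarrow> \<nu> \<in> mor \<Lambda> \<Longrightarrow>
      src \<Lambda> \<kappa> = rng \<Lambda> \<mu> \<Longrightarrow> src \<Lambda> \<mu> = rng \<Lambda> \<nu> \<Longrightarrow>
      cmp \<Lambda> (cmp \<Lambda> \<kappa> \<mu>) \<nu> = cmp \<Lambda> \<kappa> (cmp \<Lambda> \<mu> \<nu>)"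
    and deg_id: "\<kappa> \<in> mor \<Lambda> \<Longrightarrow> deg \<Lambda> (rng \<Lambda> \<kappa>) = 0" "\<kappa> \<in> mor \<Lambda> \<Longrightarrow> deg \<Lambda> (src \<Lambda> \<kappa>) = 0"
    and deg_cmp: "\<mu> \<in> mor \<Lambda> \<Longrightarrow> \<nu> \<in> mor \<Lambda> \<Longrightarrow> src \<Lambda> \<mu> = rng \<Lambda> \<nu> \<Longrightarrow>
      deg \<Lambda> (cmp \<Lambda> \<mu> \<nu>) = deg \<Lambda> \<mu> + deg \<Lambda> \<nu>"
    and factorization: "\<kappa> \<in> mor \<Lambda> \<Longrightarrow> deg \<Lambda> \<kappa> = m + n \<Longrightarrow>
      \<exists>!(\<mu>, \<nu>). \<mu> \<in> mor \<Lambda> \<and> \<nu> \<in> mor \<Lambda> \<and> deg \<Lambda> \<mu> = m \<and> deg \<Lambda> \<nu> = n \<and>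
        src \<Lambda> \<mu> = rng \<Lambda> \<nu> \<and> \<kappa> = cmp \<Lambda> \<mu> \<nu>"

definition vertices :: "('a, 'k::finite) kgraph \<Rightarrow> 'a set" where
  "vertices \<Lambda> = {\<kappa> \<in> mor \<Lambda>. deg \<Lambda> \<kappa> = 0}"

text \<open>\<open>v\<Lambda>\<^sup>n\<close>\<close>

definition paths :: "('a, 'k::finite) kgraph \<Rightarrow> 'a \<Rightarrow> nat ^ 'k \<Rightarrow> 'a set" where
  "paths \<Lambda> v n = {\<kappa> \<in> mor \<Lambda>. rng \<Lambda> \<kappa> = v \<and> deg \<Lambda> \<kappa> = n}"

text \<open>\<open>v\<Lambda>\<^sup>\<le>\<^sup>n\<close>\<close>

definition paths_le :: "('a, 'k::finite) kgraph \<Rightarrow> 'a \<Rightarrow> nat ^ 'k \<Rightarrow> 'a set" where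
  "paths_le \<Lambda> v n = {\<kappa> \<in> mor \<Lambda>. rng \<Lambda> \<kappa> = v \<and> deg \<Lambda> \<kappa> \<le> n \<and>
     (\<forall>i. deg \<Lambda> \<kappa> $ i < n $ i \<longrightarrow> paths \<Lambda> (src \<Lambda> \<kappa>) (axis i 1) = {})}"

definition row_finite :: "('a, 'k::finite) kgraph \<Rightarrow> bool" where
  "row_finite \<Lambda> \<longleftrightarrow> (\<forall>v \<in> vertices \<Lambda>. \<forall>n. finite (paths \<Lambda> v n))"

definition locally_convex :: "('a, 'k::finite) kgraph \<Rightarrow> bool" where
  "locally_convex \<Lambda> \<longleftrightarrow>
    (\<forall>v \<in> vertices \<Lambda>. \<forall>i j. i \<noteq> j \<longrightarrow>
      (\<forall>\<kappa> \<in> paths \<Lambda> v (axis i 1). \<forall>\<mu> \<in> paths \<Lambda> v (axis j 1).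
        paths \<Lambda> (src \<Lambda> \<kappa>) (axis j 1) \<noteq> {} \<and> paths \<Lambda> (src \<Lambda> \<mu>) (axis i 1) \<noteq> {}))"

definition hereditary :: "('a, 'k::finite) kgraph \<Rightarrow> 'a set \<Rightarrow> bool" where
  "hereditary \<Lambda> H \<longleftrightarrow> H \<subseteq> vertices \<Lambda> \<and> (\<forall>\<kappa> \<in> mor \<Lambda>. rng \<Lambda> \<kappa> \<in> H \<longrightarrow> src \<Lambda> \<kappa> \<in> H)"

definition saturated :: "('a, 'k::finite) kgraph \<Rightarrow> 'a set \<Rightarrow> bool" where
  "saturated \<Lambda> H \<longleftrightarrow> H \<subseteq> vertices \<Lambda> \<and>
    (\<forall>v \<in> vertices \<Lambda>. (\<exists>n. src \<Lambda> ` paths_le \<Lambda> v n \<subseteq> H) \<longrightarrow> v \<in> H)"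

definition saturation :: "('a, 'k::finite) kgraph \<Rightarrow> 'a set \<Rightarrow> 'a set" where
  "saturation \<Lambda> H = \<Inter>{K. saturated \<Lambda> K \<and> H \<subseteq> K}"

definition sat_her :: "('a, 'k::finite) kgraph \<Rightarrow> 'a set set" where
  "sat_her \<Lambda> = {H. saturated \<Lambda> H \<and> hereditary \<Lambda> H}"

text \<open>\<open>\<Lambda> \<setminus> \<Lambda>H\<close>\<close>

definition remove :: "('a, 'k::finite) kgraph \<Rightarrow> 'a set \<Rightarrow> ('a, 'k) kgraph" where
  "remove \<Lambda> H = \<Lambda>\<lparr>mor := {\<kappa> \<in> mor \<Lambda>. src \<Lambda> \<kappa> \<notin> H}\<rparr>"

definition tree :: "('a, 'k::finite) kgraph \<Rightarrow> 'a \<Rightarrow> 'a set" where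
  "tree \<Lambda> v = src \<Lambda> ` {\<mu> \<in> mor \<Lambda>. rng \<Lambda> \<mu> = v}"

definition Delta :: "('a, 'k::finite) kgraph \<Rightarrow> 'a set \<Rightarrow> 'a set \<Rightarrow> 'a set" where
  "Delta \<Lambda> H1 H2 = {v \<in> H1. tree \<Lambda> v \<inter> H2 = {}}"

definition Omega :: "('a, 'k::finite) kgraph \<Rightarrow> 'a set \<Rightarrow> 'a set \<Rightarrow> 'a set" where
  "Omega \<Lambda> H1 H2 = {v \<in> H1 - H2. tree \<Lambda> v \<inter> H2 \<noteq> {}}"

definition succ_rel :: "('a, 'k::finite) kgraph \<Rightarrow> 'a set \<Rightarrow> 'a set \<Rightarrow> bool" where
  "succ_rel \<Lambda> H1 H2 \<longleftrightarrow> H1 \<supseteq> H2 \<and> Delta \<Lambda> H1 H2 \<noteq> {} \<and>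
    (\<forall>v \<in> Omega \<Lambda> H1 H2. \<exists>n. src \<Lambda> ` paths_le \<Lambda> v n \<subseteq> H2 \<union> Delta \<Lambda> H1 H2)"


section \<open>C*-algebras\<close>

text \<open>
  Complex C*-algebras, not necessarily unital, on an explicit carrier (the algebras below
  depend on a term, the graph, and so cannot be types).
\<close>

record 'b cstar =
  ccarrier :: "'b set"
  czero :: 'b
  cadd :: "'b \<Rightarrow> 'b \<Rightarrow> 'b"
  cscale :: "complex \<Rightarrow> 'b \<Rightarrow> 'b"
  cmult :: "'b \<Rightarrow> 'b \<Rightarrow> 'b"
  cadj :: "'b \<Rightarrow> 'b"
  cnorm :: "'b \<Rightarrow> real"

definition cdiff :: "'b cstar \<Rightarrow> 'b \<Rightarrow> 'b \<Rightarrow> 'b" where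
  "cdiff A a b = cadd A a (cscale A (-1) b)"

definition cconverges :: "'b cstar \<Rightarrow> (nat \<Rightarrow> 'b) \<Rightarrow> 'b \<Rightarrow> bool" where
  "cconverges A X l \<longleftrightarrow> (\<lambda>n. cnorm A (cdiff A (X n) l)) \<longlonglongrightarrow> 0"

definition ccauchy :: "'b cstar \<Rightarrow> (nat \<Rightarrow> 'b) \<Rightarrow> bool" where
  "ccauchy A X \<longleftrightarrow> (\<forall>e>0. \<exists>N. \<forall>m\<ge>N. \<forall>n\<ge>N. cnorm A (cdiff A (X m) (X n)) < e)"

locale cstar_algebra =
  fixes A :: "'b cstar"
  assumes zero_closed: "czero A \<in> ccarrier A"
    and add_closed: "a \<in> ccarrier A \<Longrightarrow> b \<in> ccarrier A \<Longrightarrow> cadd A a b \<in> ccarrier A"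
    and scale_closed: "a \<in> ccarrier A \<Longrightarrow> cscale A z a \<in> ccarrier A"
    and mult_closed: "a \<in> ccarrier A \<Longrightarrow> b \<in> ccarrier A \<Longrightarrow> cmult A a b \<in> ccarrier A"
    and adj_closed: "a \<in> ccarrier A \<Longrightarrow> cadj A a \<in> ccarrier A"
    and add_assoc: "a \<in> ccarrier A \<Longrightarrow> b \<in> ccarrier A \<Longrightarrow> c \<in> ccarrier A \<Longrightarrow>
      cadd A (cadd A a b) c = cadd A a (cadd A b c)"
    and add_commute: "a \<in> ccarrier A \<Longrightarrow> b \<in> ccarrier A \<Longrightarrow> cadd A a b = cadd A b a"
    and add_zero: "a \<in> ccarrier A \<Longrightarrow> cadd A a (czero A) = a"
    and add_neg: "a \<in> ccarrier A \<Longrightarrow> cadd A a (cscale A (-1) a) = czero A"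
    and scale_add: "a \<in> ccarrier A \<Longrightarrow> b \<in> ccarrier A \<Longrightarrow>
      cscale A z (cadd A a b) = cadd A (cscale A z a) (cscale A z b)"
    and add_scale: "a \<in> ccarrier A \<Longrightarrow> cscale A (z + w) a = cadd A (cscale A z a) (cscale A w a)"
    and scale_scale: "a \<in> ccarrier A \<Longrightarrow> cscale A (z * w) a = cscale A z (cscale A w a)"
    and scale_one: "a \<in> ccarrier A \<Longrightarrow> cscale A 1 a = a"
    and mult_assoc: "a \<in> ccarrier A \<Longrightarrow> b \<in> ccarrier A \<Longrightarrow> c \<in> ccarrier A \<Longrightarrow>
      cmult A (cmult A a b) c = cmult A a (cmult A b c)"
    and mult_add_left: "a \<in> ccarrier A \<Longrightarrow> b \<in> ccarrier A \<Longrightarrow> c \<in> ccarrier A \<Longrightarrow>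
      cmult A (cadd A a b) c = cadd A (cmult A a c) (cmult A b c)"
    and mult_add_right: "a \<in> ccarrier A \<Longrightarrow> b \<in> ccarrier A \<Longrightarrow> c \<in> ccarrier A \<Longrightarrow>
      cmult A a (cadd A b c) = cadd A (cmult A a b) (cmult A a c)"
    and mult_scale_left: "a \<in> ccarrier A \<Longrightarrow> b \<in> ccarrier A \<Longrightarrow>
      cmult A (cscale A z a) b = cscale A z (cmult A a b)"
    and mult_scale_right: "a \<in> ccarrier A \<Longrightarrow> b \<in> ccarrier A \<Longrightarrow>
      cmult A a (cscale A z b) = cscale A z (cmult A a b)"
    and adj_adj: "a \<in> ccarrier A \<Longrightarrow> cadj A (cadj A a) = a"
    and adj_add: "a \<in> ccarrier A \<Longrightarrow> b \<in> ccarrier A \<Longrightarrow>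
      cadj A (cadd A a b) = cadd A (cadj A a) (cadj A b)"
    and adj_scale: "a \<in> ccarrier A \<Longrightarrow> cadj A (cscale A z a) = cscale A (cnj z) (cadj A a)"
    and adj_mult: "a \<in> ccarrier A \<Longrightarrow> b \<in> ccarrier A \<Longrightarrow>
      cadj A (cmult A a b) = cmult A (cadj A b) (cadj A a)"
    and norm_nonneg: "a \<in> ccarrier A \<Longrightarrow> 0 \<le> cnorm A a"
    and norm_eq_zero: "a \<in> ccarrier A \<Longrightarrow> cnorm A a = 0 \<longleftrightarrow> a = czero A"
    and norm_triangle: "a \<in> ccarrier A \<Longrightarrow> b \<in> ccarrier A \<Longrightarrow>
      cnorm A (cadd A a b) \<le> cnorm A a + cnorm A b"
    and norm_scale: "a \<in> ccarrier A \<Longrightarrow> cnorm A (cscale A z a) = cmod z * cnorm A a"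
    and norm_mult: "a \<in> ccarrier A \<Longrightarrow> b \<in> ccarrier A \<Longrightarrow>
      cnorm A (cmult A a b) \<le> cnorm A a * cnorm A b"
    and norm_adj_mult: "a \<in> ccarrier A \<Longrightarrow> cnorm A (cmult A (cadj A a) a) = (cnorm A a)\<^sup>2"
    and complete: "(\<And>n. X n \<in> ccarrier A) \<Longrightarrow> ccauchy A X \<Longrightarrow> \<exists>l \<in> ccarrier A. cconverges A X l"

definition star_hom :: "'b cstar \<Rightarrow> 'c cstar \<Rightarrow> ('b \<Rightarrow> 'c) \<Rightarrow> bool" where
  "star_hom A B f \<longleftrightarrow>
    (\<forall>a \<in> ccarrier A. f a \<in> ccarrier B) \<and>
    (\<forall>a \<in> ccarrier A. \<forall>b \<in> ccarrier A. f (cadd A a b) = cadd B (f a) (f b)) \<and>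
    (\<forall>z. \<forall>a \<in> ccarrier A. f (cscale A z a) = cscale B z (f a)) \<and>
    (\<forall>a \<in> ccarrier A. \<forall>b \<in> ccarrier A. f (cmult A a b) = cmult B (f a) (f b)) \<and>
    (\<forall>a \<in> ccarrier A. f (cadj A a) = cadj B (f a))"

text \<open>Bijective *-homomorphisms of C*-algebras are automatically isometric.\<close>

definition star_iso :: "'b cstar \<Rightarrow> 'c cstar \<Rightarrow> ('b \<Rightarrow> 'c) \<Rightarrow> bool" where
  "star_iso A B f \<longleftrightarrow> star_hom A B f \<and> bij_betw f (ccarrier A) (ccarrier B)"

definition cstar_isomorphic :: "'b cstar \<Rightarrow> 'c cstar \<Rightarrow> bool" (infix "\<cong>\<^sub>*" 50) where
  "A \<cong>\<^sub>* B \<longleftrightarrow> (\<exists>f. star_iso A B f)"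

definition crestrict :: "'b cstar \<Rightarrow> 'b set \<Rightarrow> 'b cstar" (infixl "\<restriction>\<^sub>*" 75) where
  "A \<restriction>\<^sub>* S = A\<lparr>ccarrier := S\<rparr>"

definition direct_sum :: "'b cstar \<Rightarrow> 'c cstar \<Rightarrow> ('b \<times> 'c) cstar" (infixr "\<oplus>\<^sub>*" 65) where
  "A \<oplus>\<^sub>* B = \<lparr>
     ccarrier = ccarrier A \<times> ccarrier B,
     czero = (czero A, czero B),
     cadd = (\<lambda>(a, b) (a', b'). (cadd A a a', cadd B b b')),
     cscale = (\<lambda>z (a, b). (cscale A z a, cscale B z b)),
     cmult = (\<lambda>(a, b) (a', b'). (cmult A a a', cmult B b b')),
     cadj = (\<lambda>(a, b). (cadj A a, cadj B b)),
     cnorm = (\<lambda>(a, b). max (cnorm A a) (cnorm B b))\<rparr>"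

text \<open>
  The equality \<open>A = S \<oplus> T\<close> for C*-algebras \<open>S\<close>, \<open>T\<close> sitting inside \<open>A\<close>: the addition map
  is an isomorphism from the (external) direct sum. In particular \<open>S\<close> and \<open>T\<close> are ideals.
\<close>

definition internal_direct_sum :: "'b cstar \<Rightarrow> 'b set \<Rightarrow> 'b set \<Rightarrow> bool" where
  "internal_direct_sum A S T \<longleftrightarrow>
    S \<subseteq> ccarrier A \<and> T \<subseteq> ccarrier A \<and>
    cstar_algebra (A \<restriction>\<^sub>* S) \<and> cstar_algebra (A \<restriction>\<^sub>* T) \<and>
    star_iso (A \<restriction>\<^sub>* S \<oplus>\<^sub>* A \<restriction>\<^sub>* T) A (\<lambda>(a, b). cadd A a b)"

definition decomposable :: "'b cstar \<Rightarrow> bool" where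
  "decomposable A \<longleftrightarrow>
    (\<exists>S T. internal_direct_sum A S T \<and> S \<noteq> {czero A} \<and> T \<noteq> {czero A})"

definition closed_ideal :: "'b cstar \<Rightarrow> 'b set \<Rightarrow> bool" where
  "closed_ideal A I \<longleftrightarrow>
    I \<subseteq> ccarrier A \<and> czero A \<in> I \<and>
    (\<forall>a \<in> I. \<forall>b \<in> I. cadd A a b \<in> I) \<and>
    (\<forall>z. \<forall>a \<in> I. cscale A z a \<in> I) \<and>
    (\<forall>a \<in> I. \<forall>b \<in> ccarrier A. cmult A a b \<in> I \<and> cmult A b a \<in> I) \<and>
    (\<forall>X. \<forall>l \<in> ccarrier A. (\<forall>n. X n \<in> I) \<longrightarrow> cconverges A X l \<longrightarrow> l \<in> I)"

definition ideal_generated :: "'b cstar \<Rightarrow> 'b set \<Rightarrow> 'b set" where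
  "ideal_generated A X = \<Inter>{I. closed_ideal A I \<and> X \<subseteq> I}"


section \<open>Universal C*-algebras given by generators and relations\<close>

text \<open>
  Words in letters \<open>x = (x, False)\<close> and \<open>x\<^sup>* = (x, True)\<close>, a monoid under concatenation.
  The finitely supported functions on words are then the free unital *-algebra: their ring
  structure from the library is the convolution product.
\<close>

datatype 'g star_word = Word (letters: "('g \<times> bool) list")

instantiation star_word :: (type) monoid_add
begin

definition "0 = Word []"

definition "u + v = Word (letters u @ letters v)"

instance
  by standard (auto simp: zero_star_word_def plus_star_word_def)

end

definition word_adj :: "'g star_word \<Rightarrow> 'g star_word" where
  "word_adj w = Word (rev (map (\<lambda>(x, b). (x, \<not> b)) (letters w)))"

type_synonym 'g star_poly = "'g star_word \<Rightarrow>\<^sub>0 complex"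

definition gen :: "'g \<Rightarrow> 'g star_poly" where
  "gen x = Poly_Mapping.single (Word [(x, False)]) 1"

definition poly_scale :: "complex \<Rightarrow> 'g star_poly \<Rightarrow> 'g star_poly" where
  "poly_scale z f = Poly_Mapping.map ((*) z) f"

text \<open>
  \<open>map_key\<close> is precomposition with \<open>word_adj\<close>, which is injective (an involution), so the
  coefficient of \<open>w\<close> in \<open>f\<^sup>*\<close> is the conjugate of the coefficient of \<open>w\<^sup>*\<close> in \<open>f\<close>.
\<close>

definition poly_adj :: "'g star_poly \<Rightarrow> 'g star_poly" where
  "poly_adj f = Poly_Mapping.map cnj (Poly_Mapping.map_key word_adj f)"

text \<open>The free \<^emph>\<open>non-unital\<close> *-algebra on \<open>G\<close>: the empty word is excluded.\<close>

definition free_star_algebra :: "'g set \<Rightarrow> 'g star_poly set" where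
  "free_star_algebra G =
    {f. \<forall>w \<in> Poly_Mapping.keys f. w \<noteq> 0 \<and> fst ` set (letters w) \<subseteq> G}"

definition cstar_seminorm :: "'g set \<Rightarrow> ('g star_poly \<Rightarrow> real) \<Rightarrow> bool" where
  "cstar_seminorm G p \<longleftrightarrow>
    (\<forall>a \<in> free_star_algebra G. 0 \<le> p a \<and> p (poly_adj a * a) = (p a)\<^sup>2 \<and>
      (\<forall>z. p (poly_scale z a) = cmod z * p a) \<and>
      (\<forall>b \<in> free_star_algebra G. p (a + b) \<le> p a + p b \<and> p (a * b) \<le> p a * p b))"

text \<open>
  The universal C*-algebra on generators \<open>G\<close> subject to the relations \<open>x = 0\<close>, \<open>x \<in> R\<close>, is the
  completion of the free *-algebra in the largest C*-seminorm that vanishes on \<open>R\<close>. These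
  seminorms are precisely \<open>a \<mapsto> \<parallel>\<pi>(a)\<parallel>\<close> for \<open>\<pi>\<close> a *-homomorphism to some C*-algebra that
  satisfies the relations (complete the quotient by the null space for the converse), so the
  supremum below needs no restriction on the types on which the C*-algebras live. As usual this
  presupposes that the relations bound each generator, which holds for the relations of a graph.
\<close>

definition universal_seminorm :: "'g set \<Rightarrow> 'g star_poly set \<Rightarrow> 'g star_poly \<Rightarrow> real" where
  "universal_seminorm G R a = Sup {p a | p. cstar_seminorm G p \<and> (\<forall>x \<in> R. p x = 0)}"

definition cauchy_seqs :: "'g set \<Rightarrow> ('g star_poly \<Rightarrow> real) \<Rightarrow> (nat \<Rightarrow> 'g star_poly) set" where
  "cauchy_seqs G p = {X. (\<forall>n. X n \<in> free_star_algebra G) \<and>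
    (\<forall>e>0. \<exists>N. \<forall>m\<ge>N. \<forall>n\<ge>N. p (X m - X n) < e)}"

definition null_rel ::
  "'g set \<Rightarrow> ('g star_poly \<Rightarrow> real) \<Rightarrow> ((nat \<Rightarrow> 'g star_poly) \<times> (nat \<Rightarrow> 'g star_poly)) set" where
  "null_rel G p = {(X, Y). X \<in> cauchy_seqs G p \<and> Y \<in> cauchy_seqs G p \<and>
    (\<lambda>n. p (X n - Y n)) \<longlonglongrightarrow> 0}"

definition free_completion ::
  "'g set \<Rightarrow> ('g star_poly \<Rightarrow> real) \<Rightarrow> (nat \<Rightarrow> 'g star_poly) set cstar" where
  "free_completion G p = \<lparr>
     ccarrier = cauchy_seqs G p // null_rel G p,
     czero = null_rel G p `` {\<lambda>n. 0},
     cadd = (\<lambda>a b. \<Union>X \<in> a. \<Union>Y \<in> b. null_rel G p `` {\<lambda>n. X n + Y n}),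
     cscale = (\<lambda>z a. \<Union>X \<in> a. null_rel G p `` {\<lambda>n. poly_scale z (X n)}),
     cmult = (\<lambda>a b. \<Union>X \<in> a. \<Union>Y \<in> b. null_rel G p `` {\<lambda>n. X n * Y n}),
     cadj = (\<lambda>a. \<Union>X \<in> a. null_rel G p `` {\<lambda>n. poly_adj (X n)}),
     cnorm = (\<lambda>a. THE r. \<forall>X \<in> a. (\<lambda>n. p (X n)) \<longlonglongrightarrow> r)\<rparr>"

definition universal_cstar :: "'g set \<Rightarrow> 'g star_poly set \<Rightarrow> (nat \<Rightarrow> 'g star_poly) set cstar" where
  "universal_cstar G R = free_completion G (universal_seminorm G R)"

definition universal_gen :: "'g set \<Rightarrow> 'g star_poly set \<Rightarrow> 'g \<Rightarrow> (nat \<Rightarrow> 'g star_poly) set" where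
  "universal_gen G R x = null_rel G (universal_seminorm G R) `` {\<lambda>n. gen x}"


section \<open>The C*-algebra of a higher-rank graph\<close>

text \<open>The first family of relators says that the generators are partial isometries.\<close>

definition ck_relators :: "('a, 'k::finite) kgraph \<Rightarrow> 'a star_poly set" where
  "ck_relators \<Lambda> =
    {gen \<kappa> * poly_adj (gen \<kappa>) * gen \<kappa> - gen \<kappa> | \<kappa>. \<kappa> \<in> mor \<Lambda>} \<union>
    {gen v * gen w - (if v = w then gen v else 0) | v w. v \<in> vertices \<Lambda> \<and> w \<in> vertices \<Lambda>} \<union>
    {gen \<kappa> * gen \<mu> - gen (cmp \<Lambda> \<kappa> \<mu>) | \<kappa> \<mu>.
       \<kappa> \<in> mor \<Lambda> \<and> \<mu> \<in> mor \<Lambda> \<and> src \<Lambda> \<kappa> = rng \<Lambda> \<mu>} \<union>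
    {poly_adj (gen \<kappa>) * gen \<kappa> - gen (src \<Lambda> \<kappa>) | \<kappa>. \<kappa> \<in> mor \<Lambda>} \<union>
    {gen v - (\<Sum>\<kappa> \<in> paths_le \<Lambda> v n. gen \<kappa> * poly_adj (gen \<kappa>)) | v n. v \<in> vertices \<Lambda>}"

definition graph_cstar :: "('a, 'k::finite) kgraph \<Rightarrow> (nat \<Rightarrow> 'a star_poly) set cstar" where
  "graph_cstar \<Lambda> = universal_cstar (mor \<Lambda>) (ck_relators \<Lambda>)"

definition graph_gen :: "('a, 'k::finite) kgraph \<Rightarrow> 'a \<Rightarrow> (nat \<Rightarrow> 'a star_poly) set" where
  "graph_gen \<Lambda> = universal_gen (mor \<Lambda>) (ck_relators \<Lambda>)"

text \<open>\<open>I\<^sub>H\<close>\<close>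

definition graph_ideal :: "('a, 'k::finite) kgraph \<Rightarrow> 'a set \<Rightarrow> (nat \<Rightarrow> 'a star_poly) set set" where
  "graph_ideal \<Lambda> H = ideal_generated (graph_cstar \<Lambda>) (graph_gen \<Lambda> ` H)"

definition splitting_pair :: "('a, 'k::finite) kgraph \<Rightarrow> 'a set \<Rightarrow> 'a set \<Rightarrow> bool" where
  "splitting_pair \<Lambda> H1 H2 \<longleftrightarrow>
    H1 \<in> sat_her \<Lambda> \<and> H2 \<in> sat_her \<Lambda> \<and> H1 \<noteq> {} \<and> H2 \<noteq> {} \<and> H1 \<inter> H2 = {} \<and>
    (\<forall>v \<in> vertices \<Lambda> - (H1 \<union> H2). \<exists>n. src \<Lambda> ` paths_le \<Lambda> v n \<subseteq> H1 \<union> H2)"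

definition splitting_set :: "('a, 'k::finite) kgraph \<Rightarrow> 'a set \<Rightarrow> bool" where
  "splitting_set \<Lambda> H \<longleftrightarrow> H \<in> sat_her \<Lambda> \<and> H \<noteq> {} \<and> succ_rel \<Lambda> (vertices \<Lambda>) H"

end

theory Submission
  imports Defs
begin

text \<open>
  If \<open>H\<^sub>1, H\<^sub>2\<close> are as in (2), the ideals they generate are orthogonal because every element is a
  limit of combinations of \<open>s\<^sub>\<alpha> s\<^sub>\<beta>\<^sup>*\<close> with \<open>s(\<alpha>) = s(\<beta>)\<close>, and their sum is closed and contains all
  \<open>s\<^sub>v\<close>. Forgetting the paths that end in \<open>H\<^sub>2\<close> gives a homomorphism to \<open>C\<^sup>*(\<Lambda> \<setminus> \<Lambda>H\<^sub>2)\<close>; it is isometric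
  on the first ideal since the norm of the first component is a C*-seminorm that satisfies the
  relations of \<open>\<Lambda> \<setminus> \<Lambda>H\<^sub>2\<close>.

  Conversely, let \<open>C\<^sup>*(\<Lambda>) = S \<oplus> T\<close> and let \<open>e\<close> be the \<open>S\<close>-component of \<open>s\<^sub>v\<close>. Its gauge translates are
  projections that commute with it and vary continuously, hence \<open>e\<close> is gauge invariant and close to a
  combination \<open>f\<close> of \<open>s\<^sub>\<alpha> s\<^sub>\<beta>\<^sup>*\<close> with \<open>d(\<alpha>) = d(\<beta>)\<close>. For large \<open>n\<close> and \<open>\<tau> \<in> v\<Lambda>\<^sup>\<le>\<^sup>n\<close>, \<open>s\<^sub>\<tau>\<^sup>* f s\<^sub>\<tau>\<close> is a multiple
  of \<open>s\<^sub>w\<close> with \<open>w = s(\<tau>)\<close>, so the \<open>S\<close>-component of \<open>s\<^sub>w\<close> is near a scalar multiple of \<open>s\<^sub>w\<close>: it is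
  \<open>0\<close> or \<open>s\<^sub>w\<close>. Thus \<open>w\<close> lies in \<open>H\<^sub>2 = {w. s\<^sub>w \<in> T}\<close> or \<open>H\<^sub>1 = {w. s\<^sub>w \<in> S}\<close>, disjoint because \<open>s\<^sub>w \<noteq> 0\<close>.
\<close>

section \<open>The free *-algebra\<close>

text \<open>The algebra is handled throughout by C*-seminorms on the free *-algebra and by equality
  modulo null polynomials, so every use of positivity or of a representation has to be turned into a
  norm estimate. This shapes three places. The relations only say that the range projections over
  \<open>paths_le \<Lambda> v n\<close> add up to \<open>s\<^sub>v\<close>; their mutual
  orthogonality, usually read off from positivity, is extracted from the C*-identity and the
  triangle inequality by a random walk. Nonvanishing of \<open>s\<^sub>v\<close> requires operators
  that satisfy the relations; finite paths take the place of infinite boundary paths, and operator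
  norms are taken in the limit over ever longer paths. Finally, the seminorms \<open>r1\<close> and
  \<open>r2\<close> of the two summands are not known to be gauge invariant, so whatever is to be
  moved by the gauge action is first estimated in the universal seminorm, which is. The invariant
  approximant is found by averaging over roots of unity, which suffices because a polynomial
  involves finitely many degrees. The thresholds 1/1000 and 1/10 only have to keep values near 0
  apart from values near 1.\<close>

abbreviation scal :: "complex \<Rightarrow> 'g star_poly" where
  "scal z \<equiv> Poly_Mapping.single 0 z"

text \<open>Constants lie outside the non-unital free algebra, but multiplication by them preserves
  it. In this form scalars are central elements of a ring and ring simplification applies to
  them.\<close>

lemma poly_scale_scal: "poly_scale z f = scal z * f"
  by (simp add: poly_scale_def mult_map_scale_conv_mult)

lemma poly_mapping_expand: "f = (\<Sum>w\<in>Poly_Mapping.keys f. Poly_Mapping.single w (Poly_Mapping.lookup f w))"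
  by (rule poly_mapping_eqI)
    (auto simp: lookup_sum lookup_single when_def in_keys_iff intro!: sum.neutral)

text \<open>Only words in the support of \<open>f\<close> enter the monomial case, so anything known
  about the words of \<open>f\<close> is available there.\<close>

lemma poly_mapping_sum_induct:
  fixes f :: "'w \<Rightarrow>\<^sub>0 complex"
  assumes "P 0" "\<And>w c. w \<in> Poly_Mapping.keys f \<Longrightarrow> P (Poly_Mapping.single w c)"
    "\<And>f g. P f \<Longrightarrow> P g \<Longrightarrow> P (f + g)"
  shows "P f"
proof -
  have "P (\<Sum>w\<in>S. Poly_Mapping.single w (Poly_Mapping.lookup f w))"
    if "finite S" "S \<subseteq> Poly_Mapping.keys f" for S
    using that by (induction S rule: finite_induct) (auto intro: assms)
  from this[of "Poly_Mapping.keys f"] show ?thesis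
    using poly_mapping_expand[of f] by simp
qed

lemma additive_eqI:
  fixes h k :: "('w \<Rightarrow>\<^sub>0 complex) \<Rightarrow> 'b::ab_group_add"
  assumes "\<And>f g. h (f + g) = h f + h g" "\<And>f g. k (f + g) = k f + k g"
    and "\<And>w c. h (Poly_Mapping.single w c) = k (Poly_Mapping.single w c)"
  shows "h f = k f"
proof (rule poly_mapping_sum_induct[where P="\<lambda>f. h f = k f"])
  show "h 0 = k 0" using assms(1)[of 0 0] assms(2)[of 0 0] by simp
qed (use assms in auto)

text \<open>Monomials span, so the two arguments can be reduced to monomials one after the other.
  Multiplicativity of adjoints, twists and path operators becomes a statement about words this
  way.\<close>

lemma additive2_eqI:
  fixes h k :: "('v \<Rightarrow>\<^sub>0 complex) \<Rightarrow> ('w \<Rightarrow>\<^sub>0 complex) \<Rightarrow> 'b::ab_group_add"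
  assumes "\<And>f f' g. h (f + f') g = h f g + h f' g" "\<And>f g g'. h f (g + g') = h f g + h f g'"
    "\<And>f f' g. k (f + f') g = k f g + k f' g" "\<And>f g g'. k f (g + g') = k f g + k f g'"
    and "\<And>v c w d. h (Poly_Mapping.single v c) (Poly_Mapping.single w d) =
      k (Poly_Mapping.single v c) (Poly_Mapping.single w d)"
  shows "h f g = k f g"
proof (rule additive_eqI[where h="\<lambda>f. h f g" and k="\<lambda>f. k f g"])
  show "h (Poly_Mapping.single v c) g = k (Poly_Mapping.single v c) g" for v c
    by (rule additive_eqI[where h="h (Poly_Mapping.single v c)"]) (use assms in auto)
qed (use assms in auto)

lemma scal_commute: "f * scal z = scal z * (f :: 'g star_poly)"
  by (rule additive_eqI[where h="\<lambda>f. f * scal z"]) (auto simp: algebra_simps mult_single)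

lemma mult_scal_right: "f * (scal z * g) = scal z * (f * g)" for f g :: "'g star_poly"
  by (metis mult.assoc scal_commute)

lemma scal_scal: "scal z * (scal w * f) = scal (z * w) * f" for f :: "'g star_poly"
  by (simp flip: mult.assoc add: mult_single)

lemma scal_one: "scal 1 = (1 :: 'g star_poly)"
  by simp

lemma scal_minus_one: "scal (-1) * f = - (f :: 'g star_poly)"
  by (metis mult_minus1 scal_one single_uminus)

section \<open>The involution on words and polynomials\<close>

lemma word_adj_word_adj [simp]: "word_adj (word_adj w) = w"
proof -
  have "map ((\<lambda>(x, b). (x, \<not> b)) \<circ> (\<lambda>(x, b). (x, \<not> b))) (letters w) = letters w"
    by (rule map_idI) auto
  then show ?thesis
    by (simp add: word_adj_def rev_map)
qed

lemma word_adj_add: "word_adj (u + v) = word_adj v + word_adj u"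
  by (simp add: word_adj_def plus_star_word_def)

lemma word_adj_zero [simp]: "word_adj 0 = 0"
  by (simp add: word_adj_def zero_star_word_def)

lemma word_adj_eq_zero [simp]: "word_adj w = 0 \<longleftrightarrow> w = 0"
  by (metis word_adj_word_adj word_adj_zero)

lemma inj_word_adj: "inj word_adj"
  by (metis injI word_adj_word_adj)

lemma letters_word_adj: "fst ` set (letters (word_adj w)) = fst ` set (letters w)"
  by (force simp: word_adj_def)

lemma lookup_poly_adj: "Poly_Mapping.lookup (poly_adj f) w = cnj (Poly_Mapping.lookup f (word_adj w))"
  by (simp add: poly_adj_def map.rep_eq map_key.rep_eq inj_word_adj when_def)

lemma poly_adj_add: "poly_adj (f + g) = poly_adj f + poly_adj g"
  by (rule poly_mapping_eqI) (simp add: lookup_poly_adj lookup_add)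

lemma poly_adj_diff: "poly_adj (f - g) = poly_adj f - poly_adj g"
  by (rule poly_mapping_eqI) (simp add: lookup_poly_adj lookup_minus)

lemma poly_adj_zero [simp]: "poly_adj 0 = 0"
  by (rule poly_mapping_eqI) (simp add: lookup_poly_adj)

lemma poly_adj_poly_adj [simp]: "poly_adj (poly_adj f) = f"
  by (rule poly_mapping_eqI) (simp add: lookup_poly_adj)

lemma poly_adj_single: "poly_adj (Poly_Mapping.single w c) = Poly_Mapping.single (word_adj w) (cnj c)"
  by (rule poly_mapping_eqI) (auto simp: lookup_poly_adj lookup_single when_def)

lemma poly_adj_mult: "poly_adj (f * g) = poly_adj g * poly_adj f"
  by (rule additive2_eqI[where h="\<lambda>f g. poly_adj (f * g)"])
    (auto simp: algebra_simps poly_adj_add mult_single poly_adj_single word_adj_add)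

lemma poly_adj_scal: "poly_adj (scal z * f) = scal (cnj z) * poly_adj f"
  by (simp add: poly_adj_mult poly_adj_single scal_commute)

section \<open>Membership in the non-unital free algebra\<close>

lemma free_star_algebra_iff:
  "f \<in> free_star_algebra G \<longleftrightarrow> Poly_Mapping.keys f \<subseteq> {w. w \<noteq> 0 \<and> fst ` set (letters w) \<subseteq> G}"
  by (auto simp: free_star_algebra_def)

lemma free_single: "w \<noteq> 0 \<Longrightarrow> fst ` set (letters w) \<subseteq> G \<Longrightarrow> Poly_Mapping.single w c \<in> free_star_algebra G"
  by (simp add: free_star_algebra_iff)

lemma free_zero [simp, intro]: "0 \<in> free_star_algebra G"
  by (simp add: free_star_algebra_iff)

lemma free_add [simp, intro]: "f \<in> free_star_algebra G \<Longrightarrow> g \<in> free_star_algebra G \<Longrightarrow> f + g \<in> free_star_algebra G"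
  using keys_add[of f g] unfolding free_star_algebra_iff by blast

lemma free_uminus [simp, intro]: "f \<in> free_star_algebra G \<Longrightarrow> - f \<in> free_star_algebra G"
  by (simp add: free_star_algebra_iff in_keys_iff subset_iff)

lemma free_diff [simp, intro]: "f \<in> free_star_algebra G \<Longrightarrow> g \<in> free_star_algebra G \<Longrightarrow> f - g \<in> free_star_algebra G"
  using free_add[of f G "- g"] by simp

lemma free_mult [simp, intro]: "f \<in> free_star_algebra G \<Longrightarrow> g \<in> free_star_algebra G \<Longrightarrow> f * g \<in> free_star_algebra G"
  unfolding free_star_algebra_iff
proof (rule order_trans[OF keys_mult], rule subsetI)
  fix w assume "Poly_Mapping.keys f \<subseteq> {w. w \<noteq> 0 \<and> fst ` set (letters w) \<subseteq> G}"
    "Poly_Mapping.keys g \<subseteq> {w. w \<noteq> 0 \<and> fst ` set (letters w) \<subseteq> G}"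
    and "w \<in> {u + v |u v. u \<in> Poly_Mapping.keys f \<and> v \<in> Poly_Mapping.keys g}"
  then obtain u v where "w = u + v" "u \<noteq> 0" "fst ` set (letters u) \<subseteq> G" "fst ` set (letters v) \<subseteq> G"
    by blast
  then show "w \<in> {w. w \<noteq> 0 \<and> fst ` set (letters w) \<subseteq> G}"
    by (cases u) (auto simp: zero_star_word_def plus_star_word_def)
qed

lemma free_scal [simp, intro]: "f \<in> free_star_algebra G \<Longrightarrow> scal z * f \<in> free_star_algebra G"
  unfolding free_star_algebra_iff
  by (rule order_trans[OF keys_mult]) (auto split: if_splits)

lemma free_adj [simp, intro]: "f \<in> free_star_algebra G \<Longrightarrow> poly_adj f \<in> free_star_algebra G"
  unfolding free_star_algebra_iff
proof (rule subsetI)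
  fix w assume f: "Poly_Mapping.keys f \<subseteq> {w. w \<noteq> 0 \<and> fst ` set (letters w) \<subseteq> G}"
    and w: "w \<in> Poly_Mapping.keys (poly_adj f)"
  then have "word_adj w \<in> Poly_Mapping.keys f" by (auto simp: in_keys_iff lookup_poly_adj)
  with f have "word_adj w \<in> {w. w \<noteq> 0 \<and> fst ` set (letters w) \<subseteq> G}" by blast
  then show "w \<in> {w. w \<noteq> 0 \<and> fst ` set (letters w) \<subseteq> G}" by (simp add: letters_word_adj)
qed

lemma free_sum [simp, intro]: "(\<And>x. x \<in> S \<Longrightarrow> h x \<in> free_star_algebra G) \<Longrightarrow> sum h S \<in> free_star_algebra G"
  by (induction S rule: infinite_finite_induct) auto

lemma free_gen [simp, intro]: "x \<in> G \<Longrightarrow> gen x \<in> free_star_algebra G"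
  by (simp add: gen_def free_star_algebra_iff zero_star_word_def)

lemma free_mono: "G \<subseteq> G' \<Longrightarrow> f \<in> free_star_algebra G \<Longrightarrow> f \<in> free_star_algebra G'"
  by (auto simp: free_star_algebra_def)

lemma free_induct_words [consumes 1, case_names zero single add]:
  assumes "f \<in> free_star_algebra G" "P 0"
    and "\<And>w c. w \<noteq> 0 \<Longrightarrow> fst ` set (letters w) \<subseteq> G \<Longrightarrow> P (Poly_Mapping.single w c)"
    and "\<And>f g. f \<in> free_star_algebra G \<Longrightarrow> g \<in> free_star_algebra G \<Longrightarrow> P f \<Longrightarrow> P g \<Longrightarrow> P (f + g)"
  shows "P f"
proof -
  have "f \<in> free_star_algebra G \<and> P f"
  proof (rule poly_mapping_sum_induct[of "\<lambda>f. f \<in> free_star_algebra G \<and> P f" f])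
    fix w c assume "w \<in> Poly_Mapping.keys f"
    with assms(1) have "w \<noteq> 0" "fst ` set (letters w) \<subseteq> G" by (auto simp: free_star_algebra_iff)
    then show "Poly_Mapping.single w c \<in> free_star_algebra G \<and> P (Poly_Mapping.single w c)"
      using assms(3) free_single by blast
  qed (use assms in auto)
  then show ?thesis ..
qed

definition lett :: "'g \<times> bool \<Rightarrow> 'g star_poly" where
  "lett l = (if snd l then poly_adj (gen (fst l)) else gen (fst l))"

lemma lett_single: "lett l = Poly_Mapping.single (Word [l]) 1"
  by (cases l) (auto simp: lett_def gen_def poly_adj_single word_adj_def)

lemma free_lett [simp, intro]: "fst l \<in> G \<Longrightarrow> lett l \<in> free_star_algebra G"
  by (auto simp: lett_def)

lemma single_Word_Cons:
  "Poly_Mapping.single (Word (l # ls)) (1::complex) = lett l * Poly_Mapping.single (Word ls) 1"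
  by (simp add: lett_single mult_single plus_star_word_def)

lemma single_scal: "Poly_Mapping.single w c = scal c * Poly_Mapping.single w 1"
  by (simp add: mult_single)

text \<open>The empty word is excluded, so the induction starts at single letters. The predicate
  receives the word next to its monomial in order to carry data such as the degree of the
  word.\<close>

lemma word_induct [consumes 2, case_names lett Cons]:
  assumes "w \<noteq> 0" "fst ` set (letters w) \<subseteq> G"
    and "\<And>l. fst l \<in> G \<Longrightarrow> P (Word [l]) (lett l)"
    and "\<And>l u. fst l \<in> G \<Longrightarrow> u \<noteq> 0 \<Longrightarrow> fst ` set (letters u) \<subseteq> G \<Longrightarrow> P u (Poly_Mapping.single u 1) \<Longrightarrow>
      P (Word [l] + u) (lett l * Poly_Mapping.single u 1)"
  shows "P w (Poly_Mapping.single w (1::complex))"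
proof -
  have "P (Word ls) (Poly_Mapping.single (Word ls) 1)" if "ls \<noteq> []" "fst ` set ls \<subseteq> G" for ls
    using that
  proof (induction ls)
    case (Cons l ls)
    show ?case
    proof (cases "ls = []")
      case True
      then show ?thesis using assms(3)[of l] Cons by (simp add: lett_single)
    next
      case False
      with Cons have "P (Word ls) (Poly_Mapping.single (Word ls) 1)" by auto
      moreover have "Word ls \<noteq> 0" using False by (simp add: zero_star_word_def)
      ultimately have "P (Word [l] + Word ls) (lett l * Poly_Mapping.single (Word ls) 1)"
        using Cons.prems by (intro assms(4)) auto
      then show ?thesis by (simp add: single_Word_Cons) (simp add: plus_star_word_def)
    qed
  qed simp
  from this[of "letters w"] assms(1,2) show ?thesis by (cases w) (auto simp: zero_star_word_def)
qed

lemma free_induct [consumes 1, case_names zero gen add scal mult adj]: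
  assumes "f \<in> free_star_algebra G" "P 0"
    and "\<And>x. x \<in> G \<Longrightarrow> P (gen x)"
    and "\<And>f g. f \<in> free_star_algebra G \<Longrightarrow> g \<in> free_star_algebra G \<Longrightarrow> P f \<Longrightarrow> P g \<Longrightarrow> P (f + g)"
    and "\<And>z f. f \<in> free_star_algebra G \<Longrightarrow> P f \<Longrightarrow> P (scal z * f)"
    and "\<And>f g. f \<in> free_star_algebra G \<Longrightarrow> g \<in> free_star_algebra G \<Longrightarrow> P f \<Longrightarrow> P g \<Longrightarrow> P (f * g)"
    and "\<And>f. f \<in> free_star_algebra G \<Longrightarrow> P f \<Longrightarrow> P (poly_adj f)"
  shows "P f"
  using assms(1)
proof (induction rule: free_induct_words)
  case (single w c)
  have lett: "P (lett l)" if "fst l \<in> G" for l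
    using that assms(3,7) by (auto simp: lett_def)
  from single(1,2) have "P (Poly_Mapping.single w 1)"
  proof (induction rule: word_induct)
    case (Cons l u)
    then show ?case by (intro assms(6) lett free_single) auto
  qed (use lett in auto)
  with single show ?case
    by (subst single_scal) (auto intro!: assms(5) free_single)
qed (use assms in auto)

text \<open>When \<open>c\<close> is a character of the word monoid compatible with adjoints
  (\<open>word_char\<close>), this is a *-homomorphism. Unimodular characters give the gauge action,
  and characters with values 0 and 1 on letters give the maps that forget generators.\<close>

definition twist :: "('g star_word \<Rightarrow> complex) \<Rightarrow> 'g star_poly \<Rightarrow> 'g star_poly" where
  "twist c f = Poly_Mapping.mapp (\<lambda>w a. c w * a) f"

lemma lookup_twist: "Poly_Mapping.lookup (twist c f) w = c w * Poly_Mapping.lookup f w"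
  by (auto simp: twist_def lookup_mapp when_def in_keys_iff)

lemma twist_add: "twist c (f + g) = twist c f + twist c g"
  by (rule poly_mapping_eqI) (simp add: lookup_twist lookup_add algebra_simps)

lemma twist_diff: "twist c (f - g) = twist c f - twist c g"
  by (rule poly_mapping_eqI) (simp add: lookup_twist lookup_minus algebra_simps)

lemma twist_zero [simp]: "twist c 0 = 0"
  by (rule poly_mapping_eqI) (simp add: lookup_twist)

lemma twist_single: "twist c (Poly_Mapping.single w a) = Poly_Mapping.single w (c w * a)"
  by (rule poly_mapping_eqI) (auto simp: lookup_twist lookup_single when_def)

lemma twist_sum: "twist c (sum h S) = (\<Sum>x\<in>S. twist c (h x))"
  by (induction S rule: infinite_finite_induct) (auto simp: twist_add)

lemma free_twist [simp, intro]: "f \<in> free_star_algebra G \<Longrightarrow> twist c f \<in> free_star_algebra G"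
  by (auto simp: free_star_algebra_iff in_keys_iff lookup_twist subset_iff)

definition word_char :: "('g star_word \<Rightarrow> complex) \<Rightarrow> bool" where
  "word_char c \<longleftrightarrow> c 0 = 1 \<and> (\<forall>u v. c (u + v) = c u * c v) \<and> (\<forall>w. c (word_adj w) = cnj (c w))"

lemma twist_mult: "word_char c \<Longrightarrow> twist c (f * g) = twist c f * twist c g"
  by (rule additive2_eqI[where h="\<lambda>f g. twist c (f * g)"])
    (auto simp: algebra_simps twist_add mult_single twist_single word_char_def)

lemma twist_adj: "word_char c \<Longrightarrow> twist c (poly_adj f) = poly_adj (twist c f)"
  by (rule additive_eqI[where h="\<lambda>f. twist c (poly_adj f)"])
    (auto simp: algebra_simps twist_add poly_adj_add twist_single poly_adj_single word_char_def)

lemma twist_scal: "word_char c \<Longrightarrow> twist c (scal z * f) = scal z * twist c f"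
  by (simp add: twist_mult twist_single word_char_def)

lemma twist_gen: "twist c (gen x) = scal (c (Word [(x, False)])) * gen x"
  by (simp add: gen_def twist_single mult_single)

definition char_of :: "('g \<Rightarrow> complex) \<Rightarrow> 'g star_word \<Rightarrow> complex" where
  "char_of h w = prod_list (map (\<lambda>(x, b). if b then cnj (h x) else h x) (letters w))"

lemma word_char_char_of: "word_char (char_of h)"
proof -
  have "char_of h (Word (rev (map (\<lambda>(x, b). (x, \<not> b)) ls))) = cnj (char_of h (Word ls))" for ls
  proof (induction ls)
    case (Cons l ls)
    then show ?case by (cases l; cases "snd l") (auto simp: char_of_def)
  qed (simp add: char_of_def)
  then show ?thesis
    by (auto simp: word_char_def char_of_def zero_star_word_def plus_star_word_def word_adj_def)
qed

lemma twist_char_of_gen: "twist (char_of h) (gen x) = scal (h x) * gen x"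
  by (simp add: twist_gen char_of_def)

section \<open>C*-seminorms on the free *-algebra\<close>

locale free_seminorm =
  fixes G :: "'g set" and p :: "'g star_poly \<Rightarrow> real"
  assumes cstar_seminorm: "cstar_seminorm G p"
begin

abbreviation F where "F \<equiv> free_star_algebra G"

lemma p_nonneg [simp]: "f \<in> F \<Longrightarrow> 0 \<le> p f"
  and p_cstar: "f \<in> F \<Longrightarrow> p (poly_adj f * f) = (p f)\<^sup>2"
  and p_scal: "f \<in> F \<Longrightarrow> p (scal z * f) = cmod z * p f"
  and p_add: "f \<in> F \<Longrightarrow> g \<in> F \<Longrightarrow> p (f + g) \<le> p f + p g"
  and p_mult: "f \<in> F \<Longrightarrow> g \<in> F \<Longrightarrow> p (f * g) \<le> p f * p g"
  using cstar_seminorm by (auto simp: cstar_seminorm_def poly_scale_scal)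

lemma p_zero [simp]: "p 0 = 0"
  using p_scal[of 0 0] by simp

lemma p_uminus [simp]: "f \<in> F \<Longrightarrow> p (- f) = p f"
  using p_scal[of f "-1"] by (simp add: scal_minus_one)

lemma p_diff: "f \<in> F \<Longrightarrow> g \<in> F \<Longrightarrow> p (f - g) \<le> p f + p g"
  using p_add[of f "- g"] by simp

lemma p_diff_commute: "f \<in> F \<Longrightarrow> g \<in> F \<Longrightarrow> p (f - g) = p (g - f)"
  using p_uminus[of "f - g"] by simp

lemma p_diff_triangle: "f \<in> F \<Longrightarrow> g \<in> F \<Longrightarrow> h \<in> F \<Longrightarrow> p (f - h) \<le> p (f - g) + p (g - h)"
  using p_add[of "f - g" "g - h"] by simp

lemma p_abs_diff: "f \<in> F \<Longrightarrow> g \<in> F \<Longrightarrow> \<bar>p f - p g\<bar> \<le> p (f - g)"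
  using p_add[of "f - g" g] p_add[of "g - f" f] p_diff_commute[of f g] by auto

lemma p_adj [simp]:
  assumes "f \<in> F" shows "p (poly_adj f) = p f"
proof -
  have le: "p f \<le> p (poly_adj f)" if "f \<in> F" for f
  proof (cases "p f = 0")
    case False
    have "p f * p f \<le> p (poly_adj f) * p f"
      using p_mult[of "poly_adj f" f] p_cstar[of f] that by (simp add: power2_eq_square)
    then show ?thesis using False p_nonneg[OF that] by simp
  qed (use that in auto)
  from le[of f] le[of "poly_adj f"] assms show ?thesis by simp
qed

lemma p_cstar': "f \<in> F \<Longrightarrow> p (f * poly_adj f) = (p f)\<^sup>2"
  using p_cstar[of "poly_adj f"] by simp

lemma p_sum: "(\<And>x. x \<in> S \<Longrightarrow> h x \<in> F) \<Longrightarrow> p (sum h S) \<le> (\<Sum>x\<in>S. p (h x))"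
proof (induction S rule: infinite_finite_induct)
  case (insert x S)
  then show ?case using p_add[of "h x" "sum h S"] by fastforce
qed auto

lemma p_diff_mult:
  assumes "f \<in> F" "f' \<in> F" "g \<in> F" "g' \<in> F"
  shows "p (f * g - f' * g') \<le> p (f - f') * p g + p f' * p (g - g')"
proof -
  have "f * g - f' * g' = (f - f') * g + f' * (g - g')" by (simp add: algebra_simps)
  also have "p \<dots> \<le> p ((f - f') * g) + p (f' * (g - g'))" using assms by (intro p_add) auto
  also have "\<dots> \<le> p (f - f') * p g + p f' * p (g - g')"
    using assms by (intro add_mono p_mult) auto
  finally show ?thesis .
qed

text \<open>Modulo null elements \<open>y\<close> is a projection, so the C*-identity collapses to
  \<open>(p y)\<^sup>2 = p y\<close>.\<close>

lemma p_projection: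
  assumes "y \<in> F" "p (y * y - y) = 0" "p (poly_adj y - y) = 0"
  shows "p y = 0 \<or> p y = 1"
proof -
  have "\<bar>p (poly_adj y * y) - p (y * y)\<bar> \<le> p (poly_adj y * y - y * y)"
    using assms by (intro p_abs_diff) auto
  also have "\<dots> \<le> p (poly_adj y - y) * p y"
    using p_mult[of "poly_adj y - y" y] assms by (simp add: algebra_simps)
  finally have "p (y * y) = (p y)\<^sup>2" using assms by (simp add: p_cstar)
  moreover have "\<bar>p (y * y) - p y\<bar> \<le> 0" using assms p_abs_diff[of "y * y" y] by simp
  ultimately have "p y * (p y - 1) = 0" by (simp add: power2_eq_square algebra_simps)
  then show ?thesis by simp
qed

text \<open>The element \<open>y = x\<^sup>* x\<close> is a projection modulo null elements because
  \<open>y y - y = x\<^sup>* (x x\<^sup>* x - x)\<close>; hence \<open>(p x)\<^sup>2 = p y\<close>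
  is 0 or 1.\<close>

lemma p_partial_isometry:
  assumes "x \<in> F" "p (x * poly_adj x * x - x) = 0"
  shows "p x \<le> 1"
proof -
  let ?y = "poly_adj x * x"
  have "p (?y * ?y - ?y) = p (poly_adj x * (x * poly_adj x * x - x))" by (simp add: algebra_simps)
  also have "\<dots> \<le> p (poly_adj x) * p (x * poly_adj x * x - x)" using assms by (intro p_mult) auto
  finally have "p (?y * ?y - ?y) \<le> 0" using assms by simp
  moreover have "0 \<le> p (?y * ?y - ?y)" using assms by auto
  ultimately have "p (?y * ?y - ?y) = 0" by simp
  moreover have "poly_adj ?y = ?y" by (simp add: poly_adj_mult)
  ultimately have "p ?y = 0 \<or> p ?y = 1" using assms by (intro p_projection) auto
  then have "(p x)\<^sup>2 \<le> 1\<^sup>2" using p_cstar[of x] assms by auto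
  then show ?thesis by (rule power2_le_imp_le) simp
qed

end

text \<open>These relators bound every generator by 1 and hence every polynomial uniformly over all
  admissible seminorms, which makes the supremum behind \<open>U\<close> meaningful. The locale is
  interpreted for \<open>\<Lambda>\<close> and again for the relators of
  \<open>remove \<Lambda> H\<close>.\<close>

locale partial_isometry_relators =
  fixes G :: "'g set" and R :: "'g star_poly set"
  assumes partial_isometry: "x \<in> G \<Longrightarrow> gen x * poly_adj (gen x) * gen x - gen x \<in> R"
begin

abbreviation "seminorms \<equiv> {p. cstar_seminorm G p \<and> (\<forall>x \<in> R. p x = 0)}"
abbreviation "U \<equiv> universal_seminorm G R"

lemma seminorms_bounded:
  assumes "f \<in> free_star_algebra G"
  shows "\<exists>B\<ge>0. \<forall>p\<in>seminorms. p f \<le> B"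
  using assms
proof (induction rule: free_induct)
  case (gen x)
  have "p (gen x) \<le> 1" if "p \<in> seminorms" for p
  proof -
    interpret free_seminorm G p using that by unfold_locales auto
    show ?thesis using that gen partial_isometry by (intro p_partial_isometry) auto
  qed
  then show ?case by (intro exI[of _ 1]) auto
next
  case zero
  have "p 0 \<le> 0" if "p \<in> seminorms" for p
  proof -
    interpret free_seminorm G p using that by unfold_locales auto
    show ?thesis by simp
  qed
  then show ?case by blast
next
  case (add f g)
  then obtain B C where "0 \<le> B" "0 \<le> C" and B: "\<forall>p\<in>seminorms. p f \<le> B" and C: "\<forall>p\<in>seminorms. p g \<le> C"
    by blast
  have "p (f + g) \<le> B + C" if "p \<in> seminorms" for p
  proof -
    interpret free_seminorm G p using that by unfold_locales auto
    have "p f \<le> B" "p g \<le> C" using that B C by auto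
    then show ?thesis using p_add[OF add(1,2)] by linarith
  qed
  with \<open>0 \<le> B\<close> \<open>0 \<le> C\<close> show ?case by (intro exI[of _ "B + C"]) auto
next
  case (scal z f)
  then obtain B where "0 \<le> B" and B: "\<forall>p\<in>seminorms. p f \<le> B" by blast
  have "p (scal z * f) \<le> cmod z * B" if "p \<in> seminorms" for p
  proof -
    interpret free_seminorm G p using that by unfold_locales auto
    have "p f \<le> B" using that B by auto
    then show ?thesis using p_scal[OF scal(1)] by (simp add: mult_left_mono)
  qed
  with \<open>0 \<le> B\<close> show ?case by (intro exI[of _ "cmod z * B"]) auto
next
  case (mult f g)
  then obtain B C where "0 \<le> B" "0 \<le> C" and B: "\<forall>p\<in>seminorms. p f \<le> B" and C: "\<forall>p\<in>seminorms. p g \<le> C"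
    by blast
  have "p (f * g) \<le> B * C" if "p \<in> seminorms" for p
  proof -
    interpret free_seminorm G p using that by unfold_locales auto
    have "p f \<le> B" "p g \<le> C" using that B C by auto
    then have "p f * p g \<le> B * C" using \<open>0 \<le> B\<close> mult by (intro mult_mono) auto
    then show ?thesis using p_mult[OF mult(1,2)] by linarith
  qed
  with \<open>0 \<le> B\<close> \<open>0 \<le> C\<close> show ?case by (intro exI[of _ "B * C"]) auto
next
  case (adj f)
  then obtain B where "0 \<le> B" and B: "\<forall>p\<in>seminorms. p f \<le> B" by blast
  have "p (poly_adj f) \<le> B" if "p \<in> seminorms" for p
  proof -
    interpret free_seminorm G p using that by unfold_locales auto
    show ?thesis using that B adj by simp
  qed
  with \<open>0 \<le> B\<close> show ?case by blast
qed

text \<open>This makes the set of admissible seminorms nonempty, as a conditionally complete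
  supremum requires.\<close>

lemma zero_seminorm: "(\<lambda>_. 0) \<in> seminorms"
  by (simp add: cstar_seminorm_def)

lemma universal_upper:
  assumes "p \<in> seminorms" "f \<in> free_star_algebra G" shows "p f \<le> U f"
proof -
  obtain B where "\<forall>p\<in>seminorms. p f \<le> B" using seminorms_bounded[OF assms(2)] by blast
  then have "bdd_above {p f | p. cstar_seminorm G p \<and> (\<forall>x \<in> R. p x = 0)}" by (auto intro!: bdd_aboveI[of _ B])
  then show ?thesis unfolding universal_seminorm_def using assms(1) by (intro cSup_upper) auto
qed

lemma universal_least:
  assumes "\<And>p. p \<in> seminorms \<Longrightarrow> p f \<le> c" shows "U f \<le> c"
  unfolding universal_seminorm_def
  using zero_seminorm by (intro cSup_least) (auto intro: assms)

lemma universal_nonneg: "f \<in> free_star_algebra G \<Longrightarrow> 0 \<le> U f"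
  using universal_upper[OF zero_seminorm] by simp

lemma universal_relator: "x \<in> R \<Longrightarrow> U x = 0"
  unfolding universal_seminorm_def
proof -
  assume "x \<in> R"
  then have "{p x | p. cstar_seminorm G p \<and> (\<forall>x \<in> R. p x = 0)} = {0}"
    using zero_seminorm by (auto intro!: exI[of _ "\<lambda>_. 0"])
  then show "Sup {p x | p. cstar_seminorm G p \<and> (\<forall>x \<in> R. p x = 0)} = 0" by simp
qed

lemma cstar_seminorm_universal: "cstar_seminorm G U"
  unfolding cstar_seminorm_def
proof (intro ballI conjI allI)
  fix a assume a: "a \<in> free_star_algebra G"
  show nn: "0 \<le> U a" using a by (rule universal_nonneg)
  show "U (poly_adj a * a) = (U a)\<^sup>2"
  proof (rule antisym)
    show "U (poly_adj a * a) \<le> (U a)\<^sup>2"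
    proof (rule universal_least)
      fix p assume p: "p \<in> seminorms"
      then interpret free_seminorm G p by unfold_locales auto
      show "p (poly_adj a * a) \<le> (U a)\<^sup>2"
        using a universal_upper[OF p a] by (simp add: p_cstar power_mono)
    qed
    \<comment> \<open>Under the square root the C*-identity of each single \<open>p\<close> becomes
      a bound for \<open>p a\<close> that is independent of \<open>p\<close>.\<close>
    have "U a \<le> sqrt (U (poly_adj a * a))"
    proof (rule universal_least)
      fix p assume p: "p \<in> seminorms"
      then interpret free_seminorm G p by unfold_locales auto
      show "p a \<le> sqrt (U (poly_adj a * a))"
        using a universal_upper[OF p, of "poly_adj a * a"] by (intro real_le_rsqrt) (auto simp: p_cstar)
    qed
    then show "(U a)\<^sup>2 \<le> U (poly_adj a * a)"
      using nn a by (metis sqrt_ge_absD abs_of_nonneg)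
  qed
  show "U (poly_scale z a) = cmod z * U a" for z
  proof (rule antisym)
    show "U (poly_scale z a) \<le> cmod z * U a"
    proof (rule universal_least)
      fix p assume p: "p \<in> seminorms"
      then interpret free_seminorm G p by unfold_locales auto
      show "p (poly_scale z a) \<le> cmod z * U a"
        using a universal_upper[OF p a] by (simp add: poly_scale_scal p_scal mult_left_mono)
    qed
    show "cmod z * U a \<le> U (poly_scale z a)"
    proof (cases "z = 0")
      case False
      have "U a \<le> U (poly_scale z a) / cmod z"
      proof (rule universal_least)
        fix p assume p: "p \<in> seminorms"
        then interpret free_seminorm G p by unfold_locales auto
        show "p a \<le> U (poly_scale z a) / cmod z"
          using a universal_upper[OF p, of "poly_scale z a"] False
          by (simp add: poly_scale_scal p_scal field_simps)
      qed
      then show ?thesis using False by (simp add: field_simps)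
    qed (use a universal_nonneg in \<open>auto simp: poly_scale_scal\<close>)
  qed
  fix b assume b: "b \<in> free_star_algebra G"
  show "U (a + b) \<le> U a + U b"
  proof (rule universal_least)
    fix p assume p: "p \<in> seminorms"
    then interpret free_seminorm G p by unfold_locales auto
    show "p (a + b) \<le> U a + U b"
      using universal_upper[OF p a] universal_upper[OF p b] p_add[OF a b] by linarith
  qed
  show "U (a * b) \<le> U a * U b"
  proof (rule universal_least)
    fix p assume p: "p \<in> seminorms"
    then interpret free_seminorm G p by unfold_locales auto
    have "p a * p b \<le> U a * U b"
      using universal_upper[OF p a] universal_upper[OF p b] a b nn by (intro mult_mono) auto
    then show "p (a * b) \<le> U a * U b"
      using p_mult[OF a b] by linarith
  qed
qed

sublocale free_seminorm G U
  by unfold_locales (rule cstar_seminorm_universal)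

end

text \<open>Composing with gauge automorphisms or with \<open>drop H\<close> produces new
  competitors in the supremum that defines a universal seminorm.\<close>

lemma cstar_seminorm_pullback:
  assumes "cstar_seminorm G' q"
    and "\<And>f. f \<in> free_star_algebra G \<Longrightarrow> \<phi> f \<in> free_star_algebra G'"
    and "\<And>f g. \<phi> (f + g) = \<phi> f + \<phi> g" "\<And>f g. \<phi> (f * g) = \<phi> f * \<phi> g"
    and "\<And>f. \<phi> (poly_adj f) = poly_adj (\<phi> f)" "\<And>z f. \<phi> (scal z * f) = scal z * \<phi> f"
  shows "cstar_seminorm G (\<lambda>f. q (\<phi> f))"
  using assms by (simp add: cstar_seminorm_def poly_scale_scal)

section \<open>The completion\<close>

context free_seminorm
begin

abbreviation A where "A \<equiv> free_completion G p"
abbreviation CS where "CS \<equiv> cauchy_seqs G p"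

definition cls :: "(nat \<Rightarrow> 'g star_poly) \<Rightarrow> (nat \<Rightarrow> 'g star_poly) set" where
  "cls X = null_rel G p `` {X}"

definition emb :: "'g star_poly \<Rightarrow> (nat \<Rightarrow> 'g star_poly) set" where
  "emb f = cls (\<lambda>n. f)"

lemma CS_F: "X \<in> CS \<Longrightarrow> X n \<in> F"
  by (simp add: cauchy_seqs_def)

lemma CS_const [simp]: "f \<in> F \<Longrightarrow> (\<lambda>n. f) \<in> CS"
  by (simp add: cauchy_seqs_def)

lemma CS_convergent:
  assumes "X \<in> CS" shows "convergent (\<lambda>n. p (X n))"
proof -
  have "Cauchy (\<lambda>n. p (X n))"
  proof (rule metric_CauchyI)
    fix e :: real assume "0 < e"
    then obtain N where "\<forall>m\<ge>N. \<forall>n\<ge>N. p (X m - X n) < e"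
      using assms by (auto simp: cauchy_seqs_def)
    then show "\<exists>M. \<forall>m\<ge>M. \<forall>n\<ge>M. dist (p (X m)) (p (X n)) < e"
      using p_abs_diff CS_F[OF assms] unfolding dist_real_def by (meson le_less_trans)
  qed
  then show ?thesis by (simp add: Cauchy_convergent)
qed

lemma CS_bounded:
  assumes "X \<in> CS" obtains B where "B > 0" "\<And>n. p (X n) \<le> B"
proof -
  obtain B where "B > 0" "\<And>n. norm (p (X n)) \<le> B"
    using convergent_imp_Bseq[OF CS_convergent[OF assms]] by (auto simp: Bseq_def)
  then show ?thesis using that[of B] by (simp add: abs_le_iff)
qed

text \<open>One Lipschitz criterion covers all operations; unary ones take \<open>C = 0\<close>. For
  products the constants are bounds of the two Cauchy sequences.\<close>

lemma CS_le_lin: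
  assumes "\<And>n. Z n \<in> F" "X \<in> CS" "Y \<in> CS" "B \<ge> 0" "C \<ge> 0"
    and "\<And>m n. p (Z m - Z n) \<le> B * p (X m - X n) + C * p (Y m - Y n)"
  shows "Z \<in> CS"
  unfolding cauchy_seqs_def
proof (safe)
  fix e :: real assume e: "0 < e"
  define d where "d = e / (B + C + 1)"
  have d: "d > 0" "(B + C) * d < e"
    using assms(4,5) e by (auto simp: d_def field_simps)
  obtain N where N: "\<forall>m\<ge>N. \<forall>n\<ge>N. p (X m - X n) < d"
    using assms(2) d by (auto simp: cauchy_seqs_def)
  obtain M where M: "\<forall>m\<ge>M. \<forall>n\<ge>M. p (Y m - Y n) < d"
    using assms(3) d by (auto simp: cauchy_seqs_def)
  show "\<exists>N. \<forall>m\<ge>N. \<forall>n\<ge>N. p (Z m - Z n) < e"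
  proof (intro exI allI impI)
    fix m n assume "m \<ge> max N M" "n \<ge> max N M"
    then have "B * p (X m - X n) \<le> B * d" "C * p (Y m - Y n) \<le> C * d"
      using N M assms(4,5) by (auto intro!: mult_left_mono simp: less_imp_le)
    then show "p (Z m - Z n) < e"
      using assms(6)[of m n] d(2) by (simp add: algebra_simps)
  qed
qed (use assms in auto)

lemma CS_add [simp]: "X \<in> CS \<Longrightarrow> Y \<in> CS \<Longrightarrow> (\<lambda>n. X n + Y n) \<in> CS"
proof (rule CS_le_lin[where B=1 and C=1])
  fix m n assume "X \<in> CS" "Y \<in> CS"
  then show "p (X m + Y m - (X n + Y n)) \<le> 1 * p (X m - X n) + 1 * p (Y m - Y n)"
    using p_add[of "X m - X n" "Y m - Y n"] CS_F by (simp add: algebra_simps)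
qed (auto intro: CS_F)

lemma CS_scal [simp]: "X \<in> CS \<Longrightarrow> (\<lambda>n. scal z * X n) \<in> CS"
proof (rule CS_le_lin[where B="cmod z" and C=0])
  fix m n assume "X \<in> CS"
  then show "p (scal z * X m - scal z * X n) \<le> cmod z * p (X m - X n) + 0 * p (X m - X n)"
    using p_scal[of "X m - X n" z] CS_F by (simp add: algebra_simps)
qed (auto intro: CS_F)

lemma CS_mult [simp]: assumes "X \<in> CS" "Y \<in> CS" shows "(\<lambda>n. X n * Y n) \<in> CS"
proof -
  obtain B where B: "B > 0" "\<And>n. p (X n) \<le> B" using assms CS_bounded by blast
  obtain C where C: "C > 0" "\<And>n. p (Y n) \<le> C" using assms CS_bounded by blast
  show ?thesis
  proof (rule CS_le_lin[where B=C and C=B])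
    fix m n
    have "p (X m * Y m - X n * Y n) \<le> p (X m - X n) * p (Y m) + p (X n) * p (Y m - Y n)"
      using assms CS_F by (intro p_diff_mult) auto
    also have "\<dots> \<le> p (X m - X n) * C + B * p (Y m - Y n)"
      using assms CS_F B C by (intro add_mono mult_left_mono mult_right_mono) auto
    finally show "p (X m * Y m - X n * Y n) \<le> C * p (X m - X n) + B * p (Y m - Y n)"
      by (simp add: mult.commute)
  qed (use assms CS_F B C in auto)
qed

lemma CS_adj [simp]: "X \<in> CS \<Longrightarrow> (\<lambda>n. poly_adj (X n)) \<in> CS"
proof (rule CS_le_lin[where B=1 and C=0])
  fix m n assume "X \<in> CS"
  then show "p (poly_adj (X m) - poly_adj (X n)) \<le> 1 * p (X m - X n) + 0 * p (X m - X n)"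
    using CS_F by (simp flip: poly_adj_diff)
qed (auto intro: CS_F)

lemma null_rel_iff: "(X, Y) \<in> null_rel G p \<longleftrightarrow> X \<in> CS \<and> Y \<in> CS \<and> (\<lambda>n. p (X n - Y n)) \<longlonglongrightarrow> 0"
  by (simp add: null_rel_def)

lemma null_relI:
  assumes "X \<in> CS" "Y \<in> CS" "\<And>n. p (X n - Y n) \<le> h n" "h \<longlonglongrightarrow> 0"
  shows "(X, Y) \<in> null_rel G p"
  unfolding null_rel_iff
  using assms CS_F by (auto intro!: tendsto_sandwich[OF _ _ tendsto_const assms(4)] always_eventually)

lemma equiv_null_rel: "equiv CS (null_rel G p)"
proof (rule equivI)
  show "null_rel G p \<subseteq> CS \<times> CS" by (auto simp: null_rel_def)
  show "refl_on CS (null_rel G p)"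
    by (auto simp: refl_on_def null_rel_def)
  show "sym (null_rel G p)"
    using CS_F by (auto simp: sym_def null_rel_iff p_diff_commute)
  show "trans (null_rel G p)"
  proof (rule transI)
    fix X Y Z assume XY: "(X, Y) \<in> null_rel G p" and YZ: "(Y, Z) \<in> null_rel G p"
    then show "(X, Z) \<in> null_rel G p"
      using CS_F tendsto_add[of "\<lambda>n. p (X n - Y n)" 0 sequentially "\<lambda>n. p (Y n - Z n)" 0]
      by (intro null_relI[where h="\<lambda>n. p (X n - Y n) + p (Y n - Z n)"])
        (auto simp: null_rel_iff intro: p_diff_triangle)
  qed
qed

lemma cls_eq_iff: "X \<in> CS \<Longrightarrow> Y \<in> CS \<Longrightarrow> cls X = cls Y \<longleftrightarrow> (\<lambda>n. p (X n - Y n)) \<longlonglongrightarrow> 0"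
  unfolding cls_def using eq_equiv_class_iff[OF equiv_null_rel] by (simp add: null_rel_iff)

lemma cls_carrier [simp]: "X \<in> CS \<Longrightarrow> cls X \<in> ccarrier A"
  by (simp add: free_completion_def cls_def quotientI)

lemma carrier_cases:
  assumes "a \<in> ccarrier A" obtains X where "X \<in> CS" "a = cls X"
  using assms unfolding free_completion_def cls_def by (auto elim: quotientE)

lemma cls_respects:
  assumes "\<And>X. X \<in> CS \<Longrightarrow> \<phi> X \<in> CS" "\<And>X Y. (X, Y) \<in> null_rel G p \<Longrightarrow> (\<phi> X, \<phi> Y) \<in> null_rel G p"
    and "X \<in> CS"
  shows "(\<Union>Y\<in>cls X. null_rel G p `` {\<phi> Y}) = cls (\<phi> X)"
  unfolding cls_def
  by (rule UN_equiv_class[OF equiv_null_rel _ assms(3)])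
    (auto simp: congruent_def intro!: equiv_class_eq[OF equiv_null_rel] assms)

lemma cls_respects2:
  assumes "\<And>X Y X' Y'. (X, X') \<in> null_rel G p \<Longrightarrow> (Y, Y') \<in> null_rel G p \<Longrightarrow>
      (\<phi> X Y, \<phi> X' Y') \<in> null_rel G p"
    and "X \<in> CS" "Y \<in> CS"
  shows "(\<Union>X'\<in>cls X. \<Union>Y'\<in>cls Y. null_rel G p `` {\<phi> X' Y'}) = cls (\<phi> X Y)"
  unfolding cls_def
  by (rule UN_equiv_class2[OF equiv_null_rel equiv_null_rel _ assms(2,3)])
    (auto simp: congruent2_def intro!: equiv_class_eq[OF equiv_null_rel] assms)

lemma czero_cls: "czero A = emb 0"
  by (simp add: free_completion_def cls_def emb_def)

lemma cadd_cls [simp]: "X \<in> CS \<Longrightarrow> Y \<in> CS \<Longrightarrow> cadd A (cls X) (cls Y) = cls (\<lambda>n. X n + Y n)"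
  unfolding free_completion_def cstar.simps
proof (rule cls_respects2)
  fix X Y X' Y' assume *: "(X, X') \<in> null_rel G p" "(Y, Y') \<in> null_rel G p"
  show "(\<lambda>n. X n + Y n, \<lambda>n. X' n + Y' n) \<in> null_rel G p"
  proof (rule null_relI)
    show "p (X n + Y n - (X' n + Y' n)) \<le> p (X n - X' n) + p (Y n - Y' n)" for n
      using p_add[of "X n - X' n" "Y n - Y' n"] CS_F * by (simp add: null_rel_iff algebra_simps)
    show "(\<lambda>n. p (X n - X' n) + p (Y n - Y' n)) \<longlonglongrightarrow> 0"
      using tendsto_add[of "\<lambda>n. p (X n - X' n)" 0 sequentially "\<lambda>n. p (Y n - Y' n)" 0] *
      by (simp add: null_rel_iff)
  qed (use * in \<open>auto simp: null_rel_iff\<close>)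
qed

lemma cscale_cls [simp]: "X \<in> CS \<Longrightarrow> cscale A z (cls X) = cls (\<lambda>n. scal z * X n)"
  unfolding free_completion_def cstar.simps poly_scale_scal
proof (rule cls_respects)
  fix X X' assume *: "(X, X') \<in> null_rel G p"
  show "(\<lambda>n. scal z * X n, \<lambda>n. scal z * X' n) \<in> null_rel G p"
  proof (rule null_relI)
    show "p (scal z * X n - scal z * X' n) \<le> cmod z * p (X n - X' n)" for n
      using p_scal[of "X n - X' n" z] CS_F * by (simp add: null_rel_iff algebra_simps)
    show "(\<lambda>n. cmod z * p (X n - X' n)) \<longlonglongrightarrow> 0"
      using tendsto_mult_right_zero[of "\<lambda>n. p (X n - X' n)"] * by (simp add: null_rel_iff)
  qed (use * in \<open>auto simp: null_rel_iff\<close>)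
qed auto

lemma cadj_cls [simp]: "X \<in> CS \<Longrightarrow> cadj A (cls X) = cls (\<lambda>n. poly_adj (X n))"
  unfolding free_completion_def cstar.simps
proof (rule cls_respects)
  fix X X' assume *: "(X, X') \<in> null_rel G p"
  show "(\<lambda>n. poly_adj (X n), \<lambda>n. poly_adj (X' n)) \<in> null_rel G p"
  proof (rule null_relI)
    show "p (poly_adj (X n) - poly_adj (X' n)) \<le> p (X n - X' n)" for n
      using CS_F * by (simp add: null_rel_iff flip: poly_adj_diff)
    show "(\<lambda>n. p (X n - X' n)) \<longlonglongrightarrow> 0" using * by (simp add: null_rel_iff)
  qed (use * in \<open>auto simp: null_rel_iff\<close>)
qed auto

lemma cmult_cls [simp]: "X \<in> CS \<Longrightarrow> Y \<in> CS \<Longrightarrow> cmult A (cls X) (cls Y) = cls (\<lambda>n. X n * Y n)"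
  unfolding free_completion_def cstar.simps
proof (rule cls_respects2)
  fix X Y X' Y' assume *: "(X, X') \<in> null_rel G p" "(Y, Y') \<in> null_rel G p"
  then have CS: "X \<in> CS" "X' \<in> CS" "Y \<in> CS" "Y' \<in> CS"
    and lim: "(\<lambda>n. p (X n - X' n)) \<longlonglongrightarrow> 0" "(\<lambda>n. p (Y n - Y' n)) \<longlonglongrightarrow> 0" by (auto simp: null_rel_iff)
  obtain B where B: "B > 0" "\<And>n. p (X' n) \<le> B" using CS CS_bounded by blast
  obtain C where C: "C > 0" "\<And>n. p (Y n) \<le> C" using CS CS_bounded by blast
  show "(\<lambda>n. X n * Y n, \<lambda>n. X' n * Y' n) \<in> null_rel G p"
  proof (rule null_relI)
    fix n
    have "p (X n * Y n - X' n * Y' n) \<le> p (X n - X' n) * p (Y n) + p (X' n) * p (Y n - Y' n)"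
      using CS CS_F by (intro p_diff_mult) auto
    also have "\<dots> \<le> p (X n - X' n) * C + B * p (Y n - Y' n)"
      using CS CS_F B C by (intro add_mono mult_left_mono mult_right_mono) auto
    finally show "p (X n * Y n - X' n * Y' n) \<le> p (X n - X' n) * C + B * p (Y n - Y' n)" .
  next
    show "(\<lambda>n. p (X n - X' n) * C + B * p (Y n - Y' n)) \<longlonglongrightarrow> 0"
      using lim by (auto intro!: tendsto_eq_intros)
  qed (use CS in auto)
qed

lemma cnorm_cls:
  assumes "X \<in> CS" "(\<lambda>n. p (X n)) \<longlonglongrightarrow> r" shows "cnorm A (cls X) = r"
proof -
  have lim: "(\<lambda>n. p (Y n)) \<longlonglongrightarrow> r" if "Y \<in> cls X" for Y
  proof -
    have Y: "Y \<in> CS" "(\<lambda>n. p (X n - Y n)) \<longlonglongrightarrow> 0" using that by (auto simp: cls_def null_rel_iff)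
    have "(\<lambda>n. p (X n) - p (Y n)) \<longlonglongrightarrow> 0"
      using Y assms CS_F by (intro tendsto_rabs_zero_cancel
        [OF tendsto_sandwich[OF _ _ tendsto_const Y(2)]]) (auto intro: p_abs_diff always_eventually)
    from tendsto_diff[OF assms(2) this] show ?thesis by simp
  qed
  have "X \<in> cls X" using assms(1) equiv_class_self[OF equiv_null_rel] by (auto simp: cls_def)
  then have "(THE r. \<forall>Y\<in>cls X. (\<lambda>n. p (Y n)) \<longlonglongrightarrow> r) = r"
    using lim LIMSEQ_unique by (intro the_equality) blast+
  then show ?thesis by (simp add: free_completion_def)
qed

lemma cnorm_cls_lim: "X \<in> CS \<Longrightarrow> (\<lambda>n. p (X n)) \<longlonglongrightarrow> cnorm A (cls X)"
  using cnorm_cls CS_convergent convergent_def by metis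

lemma emb_carrier [simp]: "f \<in> F \<Longrightarrow> emb f \<in> ccarrier A"
  by (simp add: emb_def)

lemma cnorm_emb [simp]: "f \<in> F \<Longrightarrow> cnorm A (emb f) = p f"
  by (simp add: emb_def cnorm_cls)

lemma emb_add: "f \<in> F \<Longrightarrow> g \<in> F \<Longrightarrow> emb (f + g) = cadd A (emb f) (emb g)"
  and emb_mult: "f \<in> F \<Longrightarrow> g \<in> F \<Longrightarrow> emb (f * g) = cmult A (emb f) (emb g)"
  and emb_scal: "f \<in> F \<Longrightarrow> emb (scal z * f) = cscale A z (emb f)"
  and emb_adj: "f \<in> F \<Longrightarrow> emb (poly_adj f) = cadj A (emb f)"
  by (simp_all add: emb_def)

lemma emb_diff: "f \<in> F \<Longrightarrow> g \<in> F \<Longrightarrow> emb (f - g) = cdiff A (emb f) (emb g)"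
  by (simp add: emb_def cdiff_def scal_minus_one)

lemma emb_eq_iff: "f \<in> F \<Longrightarrow> g \<in> F \<Longrightarrow> emb f = emb g \<longleftrightarrow> p (f - g) = 0"
  by (auto simp: emb_def cls_eq_iff LIMSEQ_const_iff)

lemma cdiff_cls: "X \<in> CS \<Longrightarrow> Y \<in> CS \<Longrightarrow> cdiff A (cls X) (cls Y) = cls (\<lambda>n. X n - Y n)"
  using CS_scal[of Y "-1"] by (simp add: cdiff_def scal_minus_one)

lemma CS_diff [simp]: "X \<in> CS \<Longrightarrow> Y \<in> CS \<Longrightarrow> (\<lambda>n. X n - Y n) \<in> CS"
  using CS_add[of X "\<lambda>n. scal (-1) * Y n"] CS_scal[of Y "-1"] by (simp add: scal_minus_one)

lemma emb_dense:
  assumes "a \<in> ccarrier A" "0 < e"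
  obtains f where "f \<in> F" "cnorm A (cdiff A a (emb f)) < e"
proof -
  obtain X where X: "X \<in> CS" "a = cls X" using assms carrier_cases by blast
  obtain N where N: "\<forall>m\<ge>N. \<forall>n\<ge>N. p (X m - X n) < e / 2"
    using X(1) half_gt_zero[OF assms(2)] unfolding cauchy_seqs_def by blast
  have "(\<lambda>n. p (X n - X N)) \<longlonglongrightarrow> cnorm A (cls (\<lambda>n. X n - X N))"
    using X CS_F by (intro cnorm_cls_lim) auto
  then have "cnorm A (cls (\<lambda>n. X n - X N)) \<le> e / 2"
    using N by (intro LIMSEQ_le_const2) (auto intro!: exI[of _ N] less_imp_le)
  then show ?thesis
    using that[of "X N"] X assms CS_F by (simp add: emb_def cdiff_cls)
qed

lemma emb_sequence:
  assumes "\<And>n. a n \<in> ccarrier A" obtains X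
  where "\<And>n. X n \<in> F" "\<And>n. cnorm A (cdiff A (a n) (emb (X n))) < 1 / real (Suc n)"
proof -
  have "\<exists>f. f \<in> F \<and> cnorm A (cdiff A (a n) (emb f)) < 1 / real (Suc n)" for n
    using emb_dense[OF assms, of "1 / real (Suc n)" n] by (metis of_nat_0_less_iff zero_less_Suc zero_less_divide_1_iff)
  then show ?thesis using that by metis
qed

lemma cnorm_cdiff_triangle:
  assumes "a \<in> ccarrier A" "b \<in> ccarrier A" "c \<in> ccarrier A"
  shows "cnorm A (cdiff A a c) \<le> cnorm A (cdiff A a b) + cnorm A (cdiff A b c)"
proof -
  obtain X Y Z where XYZ: "X \<in> CS" "a = cls X" "Y \<in> CS" "b = cls Y" "Z \<in> CS" "c = cls Z"
    using assms by (elim carrier_cases)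
  have "(\<lambda>n. p (X n - Z n)) \<longlonglongrightarrow> cnorm A (cdiff A a c)"
    and "(\<lambda>n. p (X n - Y n) + p (Y n - Z n)) \<longlonglongrightarrow> cnorm A (cdiff A a b) + cnorm A (cdiff A b c)"
    using XYZ by (auto simp: cdiff_cls intro!: tendsto_add cnorm_cls_lim)
  then show ?thesis
    by (rule LIMSEQ_le) (use XYZ CS_F in \<open>auto intro!: p_diff_triangle\<close>)
qed

lemma cnorm_cdiff_commute:
  assumes "a \<in> ccarrier A" "b \<in> ccarrier A"
  shows "cnorm A (cdiff A a b) = cnorm A (cdiff A b a)"
proof -
  obtain X Y where XYZ: "X \<in> CS" "a = cls X" "Y \<in> CS" "b = cls Y"
    using assms by (elim carrier_cases)
  then have "(\<lambda>n. p (X n - Y n)) \<longlonglongrightarrow> cnorm A (cdiff A a b)" "(\<lambda>n. p (Y n - X n)) \<longlonglongrightarrow> cnorm A (cdiff A b a)"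
    by (auto simp: cdiff_cls intro!: cnorm_cls_lim)
  then show ?thesis using XYZ CS_F LIMSEQ_unique by (auto simp: p_diff_commute)
qed

text \<open>A diagonal argument: each \<open>a n\<close> is replaced by a polynomial
  \<open>X n\<close> within \<open>1 / (n + 1)\<close>. The sequence \<open>X\<close> is then itself
  Cauchy for \<open>p\<close>, and its class is the limit.\<close>

lemma free_completion_complete:
  assumes a: "\<And>n. a n \<in> ccarrier A" and "ccauchy A a"
  shows "\<exists>l \<in> ccarrier A. cconverges A a l"
proof -
  obtain X where X: "\<And>n. X n \<in> F" "\<And>n. cnorm A (cdiff A (a n) (emb (X n))) < 1 / real (Suc n)"
    by (rule emb_sequence[of a, OF a]) blast
  have small: "\<exists>N. \<forall>n\<ge>N. 1 / real (Suc n) < e" if "e > 0" for e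
    using that LIMSEQ_D[OF LIMSEQ_inverse_real_of_nat that] by (auto simp: inverse_eq_divide)
  have XCS: "X \<in> CS" unfolding cauchy_seqs_def
  proof safe
    fix e :: real assume "0 < e"
    then have e: "e / 3 > 0" by simp
    obtain N where N: "\<forall>n\<ge>N. 1 / real (Suc n) < e / 3" using small[OF e] by blast
    obtain M where M: "\<forall>m\<ge>M. \<forall>n\<ge>M. cnorm A (cdiff A (a m) (a n)) < e / 3"
      using assms(2) e unfolding ccauchy_def by blast
    show "\<exists>N. \<forall>m\<ge>N. \<forall>n\<ge>N. p (X m - X n) < e"
    proof (intro exI allI impI)
      fix m n assume mn: "m \<ge> max N M" "n \<ge> max N M"
      have "p (X m - X n) = cnorm A (cdiff A (emb (X m)) (emb (X n)))"
        using X(1) by (simp flip: emb_diff)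
      also have "\<dots> \<le> cnorm A (cdiff A (emb (X m)) (a m)) + (cnorm A (cdiff A (a m) (a n)) + cnorm A (cdiff A (a n) (emb (X n))))"
        using cnorm_cdiff_triangle[of "emb (X m)" "a m" "emb (X n)"] cnorm_cdiff_triangle[of "a m" "a n" "emb (X n)"] X(1) a
        by simp
      also have "\<dots> < e / 3 + (e / 3 + e / 3)"
        using X(2)[of m] X(2)[of n] N M mn cnorm_cdiff_commute[of "emb (X m)" "a m"] X(1) a
        by (intro add_strict_mono) (auto intro: less_trans)
      finally show "p (X m - X n) < e" by simp
    qed
  qed (use X in auto)
  have "cconverges A a (cls X)" unfolding cconverges_def
  proof (rule LIMSEQ_I)
    fix e :: real assume "0 < e"
    then have e: "e / 2 > 0" by simp
    obtain N where N: "\<forall>n\<ge>N. 1 / real (Suc n) < e / 2" using small[OF e] by blast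
    obtain M where M: "\<forall>m\<ge>M. \<forall>n\<ge>M. p (X m - X n) < e / 2"
      using XCS e unfolding cauchy_seqs_def by blast
    have "norm (cnorm A (cdiff A (a n) (cls X)) - 0) < e" if n: "n \<ge> max N M" for n
    proof -
      have "(\<lambda>m. p (X n - X m)) \<longlonglongrightarrow> cnorm A (cdiff A (emb (X n)) (cls X))"
        using X XCS unfolding emb_def by (subst cdiff_cls) (auto intro!: cnorm_cls_lim)
      then have "cnorm A (cdiff A (emb (X n)) (cls X)) \<le> e / 2"
        by (rule LIMSEQ_le_const2) (use M n in \<open>auto intro!: exI[of _ M] less_imp_le\<close>)
      moreover have "cnorm A (cdiff A (a n) (emb (X n))) < e / 2" using X(2)[of n] N n by (auto intro: less_trans)
      moreover have "0 \<le> cnorm A (cdiff A (a n) (cls X))"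
      proof -
        obtain Y where Y: "Y \<in> CS" "a n = cls Y" using a[of n] by (rule carrier_cases)
        have "(\<lambda>m. p (Y m - X m)) \<longlonglongrightarrow> cnorm A (cdiff A (a n) (cls X))"
          using Y XCS by (auto simp: cdiff_cls intro!: cnorm_cls_lim)
        then show ?thesis by (rule LIMSEQ_le_const) (use Y XCS CS_F in auto)
      qed
      ultimately show ?thesis
        using cnorm_cdiff_triangle[of "a n" "emb (X n)" "cls X"] X XCS a by simp
    qed
    then show "\<exists>no. \<forall>n\<ge>no. norm (cnorm A (cdiff A (a n) (cls X)) - 0) < e" by blast
  qed
  then show ?thesis using XCS by auto
qed

lemma cstar_algebra_completion: "cstar_algebra A"
proof
  show "czero A \<in> ccarrier A" by (simp add: czero_cls)
  show "(\<And>n. X n \<in> ccarrier A) \<Longrightarrow> ccauchy A X \<Longrightarrow> \<exists>l\<in>ccarrier A. cconverges A X l" for X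
    by (rule free_completion_complete)
  fix a assume "a \<in> ccarrier A"
  then obtain X where X [simp]: "X \<in> CS" and a [simp]: "a = cls X" by (rule carrier_cases)
  have XF [simp]: "X n \<in> F" for n by (simp add: CS_F)
  show "cscale A z a \<in> ccarrier A" for z by simp
  show "cadj A a \<in> ccarrier A" by simp
  show "cadd A a (czero A) = a" by (simp add: czero_cls emb_def)
  show "cadd A a (cscale A (- 1) a) = czero A"
    using CS_scal[of X "-1"] by (simp add: czero_cls emb_def scal_minus_one)
  show "cscale A (z + w) a = cadd A (cscale A z a) (cscale A w a)" for z w
    by (simp add: single_add distrib_right)
  show "cscale A (z * w) a = cscale A z (cscale A w a)" for z w
    by (simp add: scal_scal)
  show "cscale A 1 a = a" by simp
  show "cadj A (cadj A a) = a" by simp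
  show "cadj A (cscale A z a) = cscale A (cnj z) (cadj A a)" for z
    by (simp add: poly_adj_scal)
  show "0 \<le> cnorm A a"
    using LIMSEQ_le_const[OF cnorm_cls_lim[OF X]] by simp
  show "cnorm A a = 0 \<longleftrightarrow> a = czero A"
  proof -
    have "a = czero A \<longleftrightarrow> (\<lambda>n. p (X n)) \<longlonglongrightarrow> 0"
      using cls_eq_iff[of X "\<lambda>n. 0"] by (simp add: czero_cls emb_def)
    also have "\<dots> \<longleftrightarrow> cnorm A a = 0"
      using cnorm_cls[OF X, of 0] cnorm_cls_lim[OF X] by (metis a)
    finally show ?thesis by simp
  qed
  show "cnorm A (cscale A z a) = cmod z * cnorm A a" for z
    by (simp, rule cnorm_cls) (auto simp: p_scal intro!: tendsto_mult_left cnorm_cls_lim)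
  show "cnorm A (cmult A (cadj A a) a) = (cnorm A a)\<^sup>2"
    by (simp, rule cnorm_cls) (auto simp: p_cstar intro!: tendsto_power cnorm_cls_lim)
  fix b assume "b \<in> ccarrier A"
  then obtain Y where Y [simp]: "Y \<in> CS" and b [simp]: "b = cls Y" by (rule carrier_cases)
  have YF [simp]: "Y n \<in> F" for n by (simp add: CS_F)
  show "cadd A a b \<in> ccarrier A" "cmult A a b \<in> ccarrier A" by simp_all
  show "cadd A a b = cadd A b a" by (simp add: add.commute)
  show "cscale A z (cadd A a b) = cadd A (cscale A z a) (cscale A z b)" for z
    by (simp add: distrib_left)
  show "cmult A (cscale A z a) b = cscale A z (cmult A a b)" for z by (simp add: mult.assoc)
  show "cmult A a (cscale A z b) = cscale A z (cmult A a b)" for z by (simp add: mult_scal_right)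
  show "cadj A (cadd A a b) = cadd A (cadj A a) (cadj A b)" by (simp add: poly_adj_add)
  show "cadj A (cmult A a b) = cmult A (cadj A b) (cadj A a)" by (simp add: poly_adj_mult)
  have "(\<lambda>n. p (X n + Y n)) \<longlonglongrightarrow> cnorm A (cadd A a b)" "(\<lambda>n. p (X n) + p (Y n)) \<longlonglongrightarrow> cnorm A a + cnorm A b"
    by (auto intro!: cnorm_cls_lim tendsto_add)
  then show "cnorm A (cadd A a b) \<le> cnorm A a + cnorm A b"
    by (rule LIMSEQ_le) (auto intro!: p_add)
  have "(\<lambda>n. p (X n * Y n)) \<longlonglongrightarrow> cnorm A (cmult A a b)" "(\<lambda>n. p (X n) * p (Y n)) \<longlonglongrightarrow> cnorm A a * cnorm A b"
    by (auto intro!: cnorm_cls_lim tendsto_mult)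
  then show "cnorm A (cmult A a b) \<le> cnorm A a * cnorm A b"
    by (rule LIMSEQ_le) (auto intro!: p_mult)
  fix c assume "c \<in> ccarrier A"
  then obtain Z where Z [simp]: "Z \<in> CS" and c [simp]: "c = cls Z" by (rule carrier_cases)
  show "cadd A (cadd A a b) c = cadd A a (cadd A b c)" by (simp add: add.assoc)
  show "cmult A (cmult A a b) c = cmult A a (cmult A b c)" by (simp add: mult.assoc)
  show "cmult A (cadd A a b) c = cadd A (cmult A a c) (cmult A b c)" by (simp add: distrib_right)
  show "cmult A a (cadd A b c) = cadd A (cmult A a b) (cmult A a c)" by (simp add: distrib_left)
qed

end

section \<open>C*-algebras and direct sums\<close>

context cstar_algebra
begin

abbreviation C where "C \<equiv> ccarrier A"

declare zero_closed [simp] add_closed [simp] scale_closed [simp] mult_closed [simp] adj_closed [simp]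

lemma diff_closed [simp]: "a \<in> C \<Longrightarrow> b \<in> C \<Longrightarrow> cdiff A a b \<in> C"
  by (simp add: cdiff_def)

lemma zero_add: "a \<in> C \<Longrightarrow> cadd A (czero A) a = a"
  using add_commute[of "czero A" a] by (simp add: add_zero)

lemma add_left_commute: "a \<in> C \<Longrightarrow> b \<in> C \<Longrightarrow> c \<in> C \<Longrightarrow> cadd A a (cadd A b c) = cadd A b (cadd A a c)"
  using add_assoc[of a b c] add_assoc[of b a c] add_commute[of a b] by simp

lemma neg_add: "a \<in> C \<Longrightarrow> cadd A (cscale A (-1) a) a = czero A"
  using add_commute[of "cscale A (-1) a" a] by (simp add: add_neg)

lemma add_left_cancel: "a \<in> C \<Longrightarrow> b \<in> C \<Longrightarrow> c \<in> C \<Longrightarrow> cadd A a b = cadd A a c \<Longrightarrow> b = c"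
  by (metis add_assoc neg_add scale_closed zero_add)

lemma scale_zero_left [simp]: "a \<in> C \<Longrightarrow> cscale A 0 a = czero A"
  using add_scale[of a 1 "-1"] by (simp add: scale_one add_neg)

lemma scale_zero_right [simp]: "cscale A z (czero A) = czero A"
  using scale_scale[of "czero A" z 0] by simp

lemma mult_zero_right [simp]: "a \<in> C \<Longrightarrow> cmult A a (czero A) = czero A"
  using mult_scale_right[of a "czero A" 0] by simp

lemma mult_zero_left [simp]: "a \<in> C \<Longrightarrow> cmult A (czero A) a = czero A"
  using mult_scale_left[of "czero A" a 0] by simp

lemma adj_zero [simp]: "cadj A (czero A) = czero A"
  using adj_scale[of "czero A" 0] by simp

lemma norm_zero [simp]: "cnorm A (czero A) = 0"
  using norm_eq_zero[of "czero A"] by simp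

lemma diff_eq_zero: "a \<in> C \<Longrightarrow> b \<in> C \<Longrightarrow> cdiff A a b = czero A \<longleftrightarrow> a = b"
  unfolding cdiff_def by (metis add_assoc add_neg add_zero neg_add scale_closed zero_add)

lemma diff_self [simp]: "a \<in> C \<Longrightarrow> cdiff A a a = czero A"
  by (simp add: diff_eq_zero)

lemma diff_zero [simp]: "a \<in> C \<Longrightarrow> cdiff A a (czero A) = a"
  by (simp add: cdiff_def add_zero)

lemma norm_adj [simp]:
  assumes "a \<in> C" shows "cnorm A (cadj A a) = cnorm A a"
proof -
  have le: "cnorm A a \<le> cnorm A (cadj A a)" if "a \<in> C" for a
  proof (cases "cnorm A a = 0")
    case False
    have "cnorm A a * cnorm A a \<le> cnorm A (cadj A a) * cnorm A a"
      using norm_mult[of "cadj A a" a] norm_adj_mult[of a] that by (simp add: power2_eq_square)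
    then show ?thesis using False norm_nonneg[OF that] by simp
  qed (use that norm_nonneg in auto)
  from le[of a] le[of "cadj A a"] assms show ?thesis by (simp add: adj_adj)
qed

lemma diff_add: "a \<in> C \<Longrightarrow> b \<in> C \<Longrightarrow> c \<in> C \<Longrightarrow> cdiff A a c = cadd A (cdiff A a b) (cdiff A b c)"
proof -
  assume *: "a \<in> C" "b \<in> C" "c \<in> C"
  let ?n = "cscale A (-1)"
  have "cadd A (cdiff A a b) (cdiff A b c) = cadd A a (cadd A (cadd A (?n b) b) (?n c))"
    unfolding cdiff_def using * by (simp add: add_assoc)
  then show ?thesis using * by (simp add: neg_add zero_add cdiff_def)
qed

lemma norm_diff_triangle: "a \<in> C \<Longrightarrow> b \<in> C \<Longrightarrow> c \<in> C \<Longrightarrow>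
  cnorm A (cdiff A a c) \<le> cnorm A (cdiff A a b) + cnorm A (cdiff A b c)"
  by (subst diff_add[of a b c]) (auto intro: norm_triangle)

lemma neg_diff: "a \<in> C \<Longrightarrow> b \<in> C \<Longrightarrow> cscale A (-1) (cdiff A a b) = cdiff A b a"
  unfolding cdiff_def by (simp add: scale_add scale_scale[symmetric] scale_one) (rule add_commute; simp)

lemma norm_diff_commute: "a \<in> C \<Longrightarrow> b \<in> C \<Longrightarrow> cnorm A (cdiff A a b) = cnorm A (cdiff A b a)"
  using norm_scale[of "cdiff A a b" "-1"] by (simp add: neg_diff)

lemma diff_add_add: "a \<in> C \<Longrightarrow> b \<in> C \<Longrightarrow> c \<in> C \<Longrightarrow> d \<in> C \<Longrightarrow>
  cdiff A (cadd A a b) (cadd A c d) = cadd A (cdiff A a c) (cdiff A b d)"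
  unfolding cdiff_def by (simp add: scale_add add_assoc add_left_commute)

lemma diff_mult_left: "a \<in> C \<Longrightarrow> b \<in> C \<Longrightarrow> c \<in> C \<Longrightarrow> cmult A (cdiff A a b) c = cdiff A (cmult A a c) (cmult A b c)"
  by (simp add: cdiff_def mult_add_left mult_scale_left)

lemma diff_mult_right: "a \<in> C \<Longrightarrow> b \<in> C \<Longrightarrow> c \<in> C \<Longrightarrow> cmult A a (cdiff A b c) = cdiff A (cmult A a b) (cmult A a c)"
  by (simp add: cdiff_def mult_add_right mult_scale_right)

lemma diff_adj: "a \<in> C \<Longrightarrow> b \<in> C \<Longrightarrow> cadj A (cdiff A a b) = cdiff A (cadj A a) (cadj A b)"
  by (simp add: cdiff_def adj_add adj_scale)

lemma diff_scale: "a \<in> C \<Longrightarrow> b \<in> C \<Longrightarrow> cscale A z (cdiff A a b) = cdiff A (cscale A z a) (cscale A z b)"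
  by (simp add: cdiff_def scale_add scale_scale[symmetric] mult.commute)

lemma norm_le_diff: "a \<in> C \<Longrightarrow> b \<in> C \<Longrightarrow> cnorm A a \<le> cnorm A (cdiff A a b) + cnorm A b"
  using norm_diff_triangle[of a b "czero A"] by simp

section \<open>Limits in norm\<close>

lemma converges_le:
  assumes "\<And>n. X n \<in> C" "l \<in> C" "\<And>n. cnorm A (cdiff A (X n) l) \<le> h n" "h \<longlonglongrightarrow> 0"
  shows "cconverges A X l"
  unfolding cconverges_def
  using assms by (auto intro!: tendsto_sandwich[OF _ _ tendsto_const assms(4)] always_eventually norm_nonneg)

lemma converges_unique:
  assumes "\<And>n. X n \<in> C" "l \<in> C" "m \<in> C" "cconverges A X l" "cconverges A X m"
  shows "l = m"
proof -
  have "(\<lambda>n. cnorm A (cdiff A (X n) l) + cnorm A (cdiff A (X n) m)) \<longlonglongrightarrow> 0 + 0"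
    using assms unfolding cconverges_def by (intro tendsto_add)
  moreover have "cnorm A (cdiff A l m) \<le> cnorm A (cdiff A (X n) l) + cnorm A (cdiff A (X n) m)" for n
    using norm_diff_triangle[of l "X n" m] norm_diff_commute[of l "X n"] assms by simp
  ultimately have "cnorm A (cdiff A l m) \<le> 0 + 0"
    by (intro LIMSEQ_le_const) auto
  then have "cnorm A (cdiff A l m) = 0" using norm_nonneg[of "cdiff A l m"] assms by simp
  then show ?thesis using assms by (simp add: norm_eq_zero diff_eq_zero)
qed

lemma converges_const: "a \<in> C \<Longrightarrow> cconverges A (\<lambda>n. a) a"
  by (simp add: cconverges_def)

lemma converges_mult_left:
  assumes "\<And>n. X n \<in> C" "l \<in> C" "b \<in> C" "cconverges A X l"
  shows "cconverges A (\<lambda>n. cmult A b (X n)) (cmult A b l)"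
proof (rule converges_le)
  show "(\<lambda>n. cnorm A b * cnorm A (cdiff A (X n) l)) \<longlonglongrightarrow> 0"
    using assms(4) tendsto_mult_right_zero unfolding cconverges_def by blast
  show "cnorm A (cdiff A (cmult A b (X n)) (cmult A b l)) \<le> cnorm A b * cnorm A (cdiff A (X n) l)" for n
    using norm_mult[of b "cdiff A (X n) l"] assms by (simp add: diff_mult_right)
qed (use assms in auto)

lemma converges_mult_right:
  assumes "\<And>n. X n \<in> C" "l \<in> C" "b \<in> C" "cconverges A X l"
  shows "cconverges A (\<lambda>n. cmult A (X n) b) (cmult A l b)"
proof (rule converges_le)
  show "(\<lambda>n. cnorm A (cdiff A (X n) l) * cnorm A b) \<longlonglongrightarrow> 0"
    using assms(4) tendsto_mult_left_zero unfolding cconverges_def by blast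
  show "cnorm A (cdiff A (cmult A (X n) b) (cmult A l b)) \<le> cnorm A (cdiff A (X n) l) * cnorm A b" for n
    using norm_mult[of "cdiff A (X n) l" b] assms by (simp add: diff_mult_left)
qed (use assms in auto)

lemma converges_adj:
  assumes "\<And>n. X n \<in> C" "l \<in> C" "cconverges A X l"
  shows "cconverges A (\<lambda>n. cadj A (X n)) (cadj A l)"
  using assms unfolding cconverges_def by (simp flip: diff_adj)

lemma converges_cauchy:
  assumes "\<And>n. X n \<in> C" "l \<in> C" "cconverges A X l"
  shows "ccauchy A X"
  unfolding ccauchy_def
proof (intro allI impI)
  fix e :: real assume "0 < e"
  then obtain N where N: "\<forall>n\<ge>N. norm (cnorm A (cdiff A (X n) l)) < e / 2"
    using LIMSEQ_D[OF assms(3)[unfolded cconverges_def], of "e / 2"] by auto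
  show "\<exists>N. \<forall>m\<ge>N. \<forall>n\<ge>N. cnorm A (cdiff A (X m) (X n)) < e"
  proof (intro exI allI impI)
    fix m n assume mn: "m \<ge> N" "n \<ge> N"
    have "cnorm A (cdiff A (X m) l) < e / 2" "cnorm A (cdiff A (X n) l) < e / 2"
      using N[rule_format, OF mn(1)] N[rule_format, OF mn(2)] by auto
    then show "cnorm A (cdiff A (X m) (X n)) < e"
      using norm_diff_triangle[of "X m" l "X n"] norm_diff_commute[of l "X n"] assms by simp
  qed
qed

definition closed_set where
  "closed_set S \<longleftrightarrow> (\<forall>X. \<forall>l \<in> C. (\<forall>n. X n \<in> S) \<longrightarrow> cconverges A X l \<longrightarrow> l \<in> S)"

lemma cstar_algebra_restrict:
  assumes "S \<subseteq> C" "czero A \<in> S" "\<And>a b. a \<in> S \<Longrightarrow> b \<in> S \<Longrightarrow> cadd A a b \<in> S"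
    "\<And>z a. a \<in> S \<Longrightarrow> cscale A z a \<in> S" "\<And>a b. a \<in> S \<Longrightarrow> b \<in> S \<Longrightarrow> cmult A a b \<in> S"
    "\<And>a. a \<in> S \<Longrightarrow> cadj A a \<in> S" "closed_set S"
  shows "cstar_algebra (A \<restriction>\<^sub>* S)"
proof -
  have SC: "a \<in> S \<Longrightarrow> a \<in> C" for a using assms(1) by auto
  have d: "cdiff (A \<restriction>\<^sub>* S) = cdiff A" by (simp add: cdiff_def crestrict_def fun_eq_iff)
  have c: "cconverges (A \<restriction>\<^sub>* S) = cconverges A" "ccauchy (A \<restriction>\<^sub>* S) = ccauchy A"
    by (simp_all add: cconverges_def ccauchy_def d fun_eq_iff) (simp_all add: crestrict_def)
  show ?thesis
  proof
    fix X assume X: "\<And>n. X n \<in> ccarrier (A \<restriction>\<^sub>* S)" and cau: "ccauchy (A \<restriction>\<^sub>* S) X"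
    have "X n \<in> C" for n using X[of n] SC by (simp add: crestrict_def)
    moreover have "ccauchy A X" using cau by (simp add: c)
    ultimately obtain l where "l \<in> C" "cconverges A X l"
      using complete[of X] by blast
    moreover have "l \<in> S"
      using assms(7) X calculation by (auto simp: closed_set_def crestrict_def)
    ultimately show "\<exists>l\<in>ccarrier (A \<restriction>\<^sub>* S). cconverges (A \<restriction>\<^sub>* S) X l"
      unfolding c by (auto simp: crestrict_def)
  qed (use assms SC in \<open>auto simp: crestrict_def add_assoc add_zero add_neg scale_add add_scale scale_scale
      scale_one mult_assoc mult_add_left mult_add_right mult_scale_left mult_scale_right adj_adj adj_add
      adj_scale adj_mult norm_nonneg norm_eq_zero norm_triangle norm_scale norm_mult norm_adj_mult
      intro: add_commute\<close>)
qed

section \<open>Closed ideals and their generation\<close>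

lemma closed_ideal_iff:
  "closed_ideal A I \<longleftrightarrow> I \<subseteq> C \<and> czero A \<in> I \<and> (\<forall>a \<in> I. \<forall>b \<in> I. cadd A a b \<in> I) \<and>
    (\<forall>z. \<forall>a \<in> I. cscale A z a \<in> I) \<and>
    (\<forall>a \<in> I. \<forall>b \<in> C. cmult A a b \<in> I \<and> cmult A b a \<in> I) \<and> closed_set I"
  by (simp add: closed_ideal_def closed_set_def)

lemma closed_set_carrier: "closed_set C"
  by (simp add: closed_set_def)

lemma closed_ideal_carrier: "closed_ideal A C"
  by (simp add: closed_ideal_iff closed_set_carrier)

lemma closed_ideal_generated: "Y \<subseteq> C \<Longrightarrow> closed_ideal A (ideal_generated A Y)"
proof -
  assume "Y \<subseteq> C"
  then have "ideal_generated A Y \<subseteq> C" using closed_ideal_carrier by (auto simp: ideal_generated_def)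
  moreover have "closed_set (ideal_generated A Y)"
    unfolding closed_set_def
  proof (intro allI ballI impI)
    fix X l assume "l \<in> C" "\<forall>n. X n \<in> ideal_generated A Y" "cconverges A X l"
    then have "l \<in> I" if "closed_ideal A I" "Y \<subseteq> I" for I
      using that unfolding closed_ideal_def ideal_generated_def by blast
    then show "l \<in> ideal_generated A Y" by (auto simp: ideal_generated_def)
  qed
  ultimately show ?thesis
    unfolding closed_ideal_iff by (auto simp: ideal_generated_def closed_ideal_iff)
qed

lemma generated_superset: "Y \<subseteq> ideal_generated A Y"
  by (auto simp: ideal_generated_def)

lemma generated_least: "closed_ideal A I \<Longrightarrow> Y \<subseteq> I \<Longrightarrow> ideal_generated A Y \<subseteq> I"
  by (auto simp: ideal_generated_def)

text \<open>The elements of the ideal whose adjoints also belong to it form a closed ideal that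
  contains \<open>Y\<close>, so they exhaust the ideal.\<close>

lemma generated_adj:
  assumes "Y \<subseteq> C" "\<And>y. y \<in> Y \<Longrightarrow> cadj A y \<in> Y" "a \<in> ideal_generated A Y"
  shows "cadj A a \<in> ideal_generated A Y"
proof -
  let ?I = "ideal_generated A Y"
  have I: "closed_ideal A ?I" using assms(1) by (rule closed_ideal_generated)
  then have IC: "a \<in> C" if "a \<in> ?I" for a using that by (auto simp: closed_ideal_iff)
  have "closed_ideal A {a \<in> ?I. cadj A a \<in> ?I}"
    unfolding closed_ideal_iff
  proof (intro conjI ballI allI)
    show "closed_set {a \<in> ?I. cadj A a \<in> ?I}"
      unfolding closed_set_def
    proof (intro allI ballI impI)
      fix X l assume X: "l \<in> C" "\<forall>n. X n \<in> {a \<in> ?I. cadj A a \<in> ?I}" "cconverges A X l"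
      then have "l \<in> ?I" using I by (auto simp: closed_ideal_def)
      moreover have "cadj A l \<in> ?I"
        using X I converges_adj[of X l] IC unfolding closed_ideal_def
        by (auto elim!: allE[of _ "\<lambda>n. cadj A (X n)"])
      ultimately show "l \<in> {a \<in> ?I. cadj A a \<in> ?I}" by simp
    qed
  qed (use I IC in \<open>auto simp: closed_ideal_iff adj_add adj_scale adj_mult\<close>)
  moreover have "Y \<subseteq> {a \<in> ?I. cadj A a \<in> ?I}" using generated_superset[of Y] assms(2) by auto
  ultimately have "?I \<subseteq> {a \<in> ?I. cadj A a \<in> ?I}" by (rule generated_least)
  with assms(3) show ?thesis by auto
qed

text \<open>The clause with the middle factor \<open>b\<close> gives stability under multiplication
  on the right. Without a unit the clause \<open>a y = 0\<close> is not an instance of it, so both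
  are carried.\<close>

lemma closed_ideal_left_annihilator:
  assumes "y \<in> C"
  shows "closed_ideal A {a \<in> C. cmult A a y = czero A \<and> (\<forall>b\<in>C. cmult A (cmult A a b) y = czero A)}"
  unfolding closed_ideal_iff
proof (intro conjI ballI allI)
  show "closed_set {a \<in> C. cmult A a y = czero A \<and> (\<forall>b\<in>C. cmult A (cmult A a b) y = czero A)}"
    unfolding closed_set_def
  proof (intro allI ballI impI)
    fix X l assume X: "l \<in> C" "cconverges A X l"
      "\<forall>n. X n \<in> {a \<in> C. cmult A a y = czero A \<and> (\<forall>b\<in>C. cmult A (cmult A a b) y = czero A)}"
    have "cmult A l z = czero A" if "z \<in> C" "\<And>n. cmult A (X n) z = czero A" for z
      using converges_mult_right[of X l z] X that
      by (intro converges_unique[of "\<lambda>n. cmult A (X n) z" "cmult A l z" "czero A"]) (auto intro: converges_const)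
    moreover have "cmult A (X n) (cmult A b y) = czero A" if "b \<in> C" for n b
      using X(3) that assms by (simp flip: mult_assoc)
    ultimately show "l \<in> {a \<in> C. cmult A a y = czero A \<and> (\<forall>b\<in>C. cmult A (cmult A a b) y = czero A)}"
      using X assms by (simp add: mult_assoc)
  qed
next
  fix a b assume "a \<in> {a \<in> C. cmult A a y = czero A \<and> (\<forall>b\<in>C. cmult A (cmult A a b) y = czero A)}" "b \<in> C"
  then have ab: "a \<in> C" "b \<in> C" "cmult A a y = czero A" "\<And>b. b \<in> C \<Longrightarrow> cmult A (cmult A a b) y = czero A" by auto
  have "cmult A (cmult A (cmult A a b) c) y = czero A" if "c \<in> C" for c
    using ab(4)[of "cmult A b c"] ab that by (simp add: mult_assoc)
  then show "cmult A a b \<in> {a \<in> C. cmult A a y = czero A \<and> (\<forall>b\<in>C. cmult A (cmult A a b) y = czero A)}"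
    using ab by simp
  have "cmult A (cmult A b a) z = cmult A b (cmult A a z)" if "z \<in> C" for z
    using ab that by (simp add: mult_assoc)
  moreover have "cmult A (cmult A (cmult A b a) c) y = cmult A b (cmult A (cmult A a c) y)" if "c \<in> C" for c
    using ab that assms by (simp add: mult_assoc)
  ultimately show "cmult A b a \<in> {a \<in> C. cmult A a y = czero A \<and> (\<forall>b\<in>C. cmult A (cmult A a b) y = czero A)}"
    using ab assms by simp
qed (use assms in \<open>auto simp: mult_add_left mult_scale_left add_zero\<close>)

lemma closed_ideal_right_annihilator:
  assumes "x \<in> C"
  shows "closed_ideal A {a \<in> C. cmult A x a = czero A \<and> (\<forall>b\<in>C. cmult A (cmult A x b) a = czero A)}"
  unfolding closed_ideal_iff
proof (intro conjI ballI allI)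
  show "closed_set {a \<in> C. cmult A x a = czero A \<and> (\<forall>b\<in>C. cmult A (cmult A x b) a = czero A)}"
    unfolding closed_set_def
  proof (intro allI ballI impI)
    fix X l assume X: "l \<in> C" "cconverges A X l"
      "\<forall>n. X n \<in> {a \<in> C. cmult A x a = czero A \<and> (\<forall>b\<in>C. cmult A (cmult A x b) a = czero A)}"
    have "cmult A z l = czero A" if "z \<in> C" "\<And>n. cmult A z (X n) = czero A" for z
      using converges_mult_left[of X l z] X that
      by (intro converges_unique[of "\<lambda>n. cmult A z (X n)" "cmult A z l" "czero A"]) (auto intro: converges_const)
    with X assms show "l \<in> {a \<in> C. cmult A x a = czero A \<and> (\<forall>b\<in>C. cmult A (cmult A x b) a = czero A)}"
      by auto
  qed
next
  fix a b assume "a \<in> {a \<in> C. cmult A x a = czero A \<and> (\<forall>b\<in>C. cmult A (cmult A x b) a = czero A)}" "b \<in> C"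
  then have ab: "a \<in> C" "b \<in> C" "cmult A x a = czero A" "\<And>b. b \<in> C \<Longrightarrow> cmult A (cmult A x b) a = czero A" by auto
  have "cmult A x (cmult A b a) = czero A"
    using ab(4)[of b] ab assms by (simp add: mult_assoc)
  moreover have "cmult A (cmult A x c) (cmult A b a) = czero A" if "c \<in> C" for c
    using ab(4)[of "cmult A c b"] ab that assms by (simp add: mult_assoc)
  ultimately show "cmult A b a \<in> {a \<in> C. cmult A x a = czero A \<and> (\<forall>b\<in>C. cmult A (cmult A x b) a = czero A)}"
    using ab by simp
  have "cmult A z (cmult A a b) = cmult A (cmult A z a) b" if "z \<in> C" for z
    using ab that by (simp add: mult_assoc)
  then show "cmult A a b \<in> {a \<in> C. cmult A x a = czero A \<and> (\<forall>b\<in>C. cmult A (cmult A x b) a = czero A)}"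
    using ab assms by simp
qed (use assms in \<open>auto simp: mult_add_right mult_scale_right add_zero\<close>)

text \<open>Orthogonality spreads in two rounds: for fixed \<open>z\<close> the left annihilator
  absorbs the ideal of \<open>Y\<close>, then for a fixed element \<open>s\<close> of that ideal the
  right annihilator absorbs the ideal of \<open>Z\<close>.\<close>

lemma generated_orthogonal:
  assumes "Y \<subseteq> C" "Z \<subseteq> C"
    and yz: "\<And>y z. y \<in> Y \<Longrightarrow> z \<in> Z \<Longrightarrow> cmult A y z = czero A"
    and ybz: "\<And>y b z. y \<in> Y \<Longrightarrow> b \<in> C \<Longrightarrow> z \<in> Z \<Longrightarrow> cmult A (cmult A y b) z = czero A"
    and "s \<in> ideal_generated A Y" "t \<in> ideal_generated A Z"
  shows "cmult A s t = czero A"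
proof -
  have 1: "cmult A a z = czero A \<and> (\<forall>b\<in>C. cmult A (cmult A a b) z = czero A)"
    if "a \<in> ideal_generated A Y" "z \<in> Z" for a z
  proof -
    have "ideal_generated A Y \<subseteq> {a \<in> C. cmult A a z = czero A \<and> (\<forall>b\<in>C. cmult A (cmult A a b) z = czero A)}"
      using that assms by (intro generated_least closed_ideal_left_annihilator) auto
    then show ?thesis using that by auto
  qed
  have "s \<in> C" using closed_ideal_generated[OF assms(1)] assms(5) by (auto simp: closed_ideal_iff)
  then have "ideal_generated A Z \<subseteq> {a \<in> C. cmult A s a = czero A \<and> (\<forall>b\<in>C. cmult A (cmult A s b) a = czero A)}"
    using assms(2,5) 1 by (intro generated_least closed_ideal_right_annihilator) auto
  then show ?thesis using assms(6) by auto
qed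

end

text \<open>A purely algebraic form of \<open>A = S \<oplus> T\<close>, reached from an internal
  direct sum in one direction of the equivalence and from two orthogonal ideals in the
  other.\<close>

locale cstar_splitting = cstar_algebra A for A :: "'b cstar" +
  fixes S T :: "'b set"
  assumes S_sub: "S \<subseteq> ccarrier A" and T_sub: "T \<subseteq> ccarrier A"
    and S_zero: "czero A \<in> S" and T_zero: "czero A \<in> T"
    and S_add: "a \<in> S \<Longrightarrow> b \<in> S \<Longrightarrow> cadd A a b \<in> S" and T_add: "a \<in> T \<Longrightarrow> b \<in> T \<Longrightarrow> cadd A a b \<in> T"
    and S_scale: "a \<in> S \<Longrightarrow> cscale A z a \<in> S" and T_scale: "a \<in> T \<Longrightarrow> cscale A z a \<in> T"
    and S_mult: "a \<in> S \<Longrightarrow> b \<in> S \<Longrightarrow> cmult A a b \<in> S" and T_mult: "a \<in> T \<Longrightarrow> b \<in> T \<Longrightarrow> cmult A a b \<in> T"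
    and S_adj: "a \<in> S \<Longrightarrow> cadj A a \<in> S" and T_adj: "a \<in> T \<Longrightarrow> cadj A a \<in> T"
    and orth: "a \<in> S \<Longrightarrow> b \<in> T \<Longrightarrow> cmult A a b = czero A"
    and span: "c \<in> ccarrier A \<Longrightarrow> \<exists>a\<in>S. \<exists>b\<in>T. c = cadd A a b"
begin

lemma S_C [simp]: "a \<in> S \<Longrightarrow> a \<in> C" and T_C [simp]: "a \<in> T \<Longrightarrow> a \<in> C"
  using S_sub T_sub by auto

lemma orth': "a \<in> S \<Longrightarrow> b \<in> T \<Longrightarrow> cmult A b a = czero A"
  using orth[OF S_adj T_adj, of a b] by (metis S_C T_C adj_adj adj_mult adj_zero mult_closed)

text \<open>Multiplying by the adjoint of \<open>s\<close> erases \<open>t\<close>, so the square of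
  the norm of \<open>s\<close> is at most the norm of \<open>s\<close> times that of
  \<open>s + t\<close>. Uniqueness of components and contractivity of \<open>proj\<close>
  follow.\<close>

lemma norm_S_le:
  assumes "s \<in> S" "t \<in> T" shows "cnorm A s \<le> cnorm A (cadd A s t)"
proof (cases "cnorm A s = 0")
  case True then show ?thesis using assms by (simp add: norm_nonneg)
next
  case False
  have "cmult A (cadj A s) (cadd A s t) = cmult A (cadj A s) s"
    using assms by (simp add: mult_add_right orth S_adj add_zero)
  then have "cnorm A s * cnorm A s \<le> cnorm A s * cnorm A (cadd A s t)"
    using norm_mult[of "cadj A s" "cadd A s t"] norm_adj_mult[of s] assms by (simp add: power2_eq_square)
  then show ?thesis using False norm_nonneg[of s] assms by simp
qed

lemma swap: "cstar_splitting A T S"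
proof
  fix c assume "c \<in> C"
  then obtain a b where "a \<in> S" "b \<in> T" "c = cadd A a b" using span by blast
  then show "\<exists>a\<in>T. \<exists>b\<in>S. c = cadd A a b" using add_commute by (metis S_C T_C)
qed (use S_sub T_sub S_zero T_zero S_add T_add S_scale T_scale S_mult T_mult S_adj T_adj orth' in auto)

lemma S_diff: "a \<in> S \<Longrightarrow> b \<in> S \<Longrightarrow> cdiff A a b \<in> S" and T_diff: "a \<in> T \<Longrightarrow> b \<in> T \<Longrightarrow> cdiff A a b \<in> T"
  by (simp_all add: cdiff_def S_add S_scale T_add T_scale)

lemma unique:
  assumes "s \<in> S" "t \<in> T" "s' \<in> S" "t' \<in> T" "cadd A s t = cadd A s' t'"
  shows "s = s'" "t = t'"
proof -
  have "cnorm A (cdiff A s s') \<le> cnorm A (cadd A (cdiff A s s') (cdiff A t t'))"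
    using assms by (intro norm_S_le S_diff T_diff)
  also have "cadd A (cdiff A s s') (cdiff A t t') = czero A"
    using assms by (subst diff_add_add[symmetric]) (auto simp: diff_eq_zero)
  finally have "cnorm A (cdiff A s s') = 0" using norm_nonneg[of "cdiff A s s'"] assms by simp
  then show "s = s'" using assms by (simp add: norm_eq_zero diff_eq_zero)
  then show "t = t'" using assms add_left_cancel[of s t t'] by simp
qed

definition proj where "proj a = (SOME s. s \<in> S \<and> (\<exists>t\<in>T. a = cadd A s t))"

lemma proj_add [simp]: "s \<in> S \<Longrightarrow> t \<in> T \<Longrightarrow> proj (cadd A s t) = s"
  unfolding proj_def by (rule some_equality) (auto dest: unique)

lemma proj_S [simp]: "s \<in> S \<Longrightarrow> proj s = s"
  using proj_add[OF _ T_zero, of s] by (simp add: add_zero)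

lemma proj_T [simp]: "t \<in> T \<Longrightarrow> proj t = czero A"
  using proj_add[OF S_zero, of t] by (simp add: zero_add)

lemma split_cases:
  assumes "a \<in> C" obtains s t where "s \<in> S" "t \<in> T" "a = cadd A s t"
  using span[OF assms] by blast

lemma proj_in_S: "a \<in> C \<Longrightarrow> proj a \<in> S"
  by (elim split_cases) simp

lemma split_arith:
  assumes "s \<in> S" "t \<in> T" "s' \<in> S" "t' \<in> T"
  shows "cadd A (cadd A s t) (cadd A s' t') = cadd A (cadd A s s') (cadd A t t')"
    "cmult A (cadd A s t) (cadd A s' t') = cadd A (cmult A s s') (cmult A t t')"
    "cscale A z (cadd A s t) = cadd A (cscale A z s) (cscale A z t)"
    "cadj A (cadd A s t) = cadd A (cadj A s) (cadj A t)"
  using assms by (simp_all add: add_assoc add_left_commute mult_add_left mult_add_right orth orth' add_zero zero_add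
    scale_add adj_add)

lemma proj_plus:
  assumes "a \<in> C" "b \<in> C" shows "proj (cadd A a b) = cadd A (proj a) (proj b)"
proof -
  obtain s t s' t' where *: "s \<in> S" "t \<in> T" "a = cadd A s t" "s' \<in> S" "t' \<in> T" "b = cadd A s' t'"
    using assms by (elim split_cases)
  then have "proj (cadd A a b) = proj (cadd A (cadd A s s') (cadd A t t'))"
    using split_arith(1)[of s t s' t'] by simp
  also have "\<dots> = cadd A s s'" using * by (intro proj_add S_add T_add)
  finally show ?thesis using * by simp
qed

lemma star_hom_proj: "star_hom A A proj"
  unfolding star_hom_def
  by (auto simp: proj_in_S proj_plus split_arith S_add T_add S_mult T_mult S_scale T_scale S_adj T_adj elim!: split_cases)

lemma norm_proj_le: "a \<in> C \<Longrightarrow> cnorm A (proj a) \<le> cnorm A a"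
  by (elim split_cases) (simp add: norm_S_le)

lemma internal_direct_sum:
  assumes "closed_set S" "closed_set T" shows "internal_direct_sum A S T"
proof -
  have "cstar_algebra (A \<restriction>\<^sub>* S)" "cstar_algebra (A \<restriction>\<^sub>* T)"
    using assms S_sub T_sub S_zero T_zero S_add T_add S_scale T_scale S_mult T_mult S_adj T_adj
    by (auto intro!: cstar_algebra_restrict)
  moreover have "star_iso (A \<restriction>\<^sub>* S \<oplus>\<^sub>* A \<restriction>\<^sub>* T) A (\<lambda>(a, b). cadd A a b)"
    unfolding star_iso_def star_hom_def
  proof (intro conjI)
    show "bij_betw (\<lambda>(a, b). cadd A a b) (ccarrier (A \<restriction>\<^sub>* S \<oplus>\<^sub>* A \<restriction>\<^sub>* T)) C"
      unfolding bij_betw_def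
    proof
      show "inj_on (\<lambda>(a, b). cadd A a b) (ccarrier (A \<restriction>\<^sub>* S \<oplus>\<^sub>* A \<restriction>\<^sub>* T))"
        by (auto simp: inj_on_def direct_sum_def crestrict_def dest: unique)
      show "(\<lambda>(a, b). cadd A a b) ` ccarrier (A \<restriction>\<^sub>* S \<oplus>\<^sub>* A \<restriction>\<^sub>* T) = C"
        using span by (force simp: direct_sum_def crestrict_def)
    qed
  qed (auto simp: direct_sum_def crestrict_def split_arith(2-) intro: split_arith(1)[symmetric])
  ultimately show ?thesis using S_sub T_sub by (simp add: internal_direct_sum_def)
qed

end

lemma (in cstar_algebra) splitting_of_internal_direct_sum:
  assumes "internal_direct_sum A S T" shows "cstar_splitting A S T"
proof -
  let ?f = "\<lambda>(a, b). cadd A a b" and ?D = "A \<restriction>\<^sub>* S \<oplus>\<^sub>* A \<restriction>\<^sub>* T"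
  have sub: "S \<subseteq> C" "T \<subseteq> C" and alg: "cstar_algebra (A \<restriction>\<^sub>* S)" "cstar_algebra (A \<restriction>\<^sub>* T)"
    and hom: "star_hom ?D A ?f" and bij: "bij_betw ?f (ccarrier ?D) C"
    using assms by (auto simp: internal_direct_sum_def star_iso_def)
  have S: "czero A \<in> S" "\<And>a b. a \<in> S \<Longrightarrow> b \<in> S \<Longrightarrow> cadd A a b \<in> S" "\<And>z a. a \<in> S \<Longrightarrow> cscale A z a \<in> S"
    "\<And>a b. a \<in> S \<Longrightarrow> b \<in> S \<Longrightarrow> cmult A a b \<in> S" "\<And>a. a \<in> S \<Longrightarrow> cadj A a \<in> S"
    using cstar_algebra.zero_closed[OF alg(1)] cstar_algebra.add_closed[OF alg(1)]
      cstar_algebra.scale_closed[OF alg(1)] cstar_algebra.mult_closed[OF alg(1)] cstar_algebra.adj_closed[OF alg(1)]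
    by (auto simp: crestrict_def)
  have T: "czero A \<in> T" "\<And>a b. a \<in> T \<Longrightarrow> b \<in> T \<Longrightarrow> cadd A a b \<in> T" "\<And>z a. a \<in> T \<Longrightarrow> cscale A z a \<in> T"
    "\<And>a b. a \<in> T \<Longrightarrow> b \<in> T \<Longrightarrow> cmult A a b \<in> T" "\<And>a. a \<in> T \<Longrightarrow> cadj A a \<in> T"
    using cstar_algebra.zero_closed[OF alg(2)] cstar_algebra.add_closed[OF alg(2)]
      cstar_algebra.scale_closed[OF alg(2)] cstar_algebra.mult_closed[OF alg(2)] cstar_algebra.adj_closed[OF alg(2)]
    by (auto simp: crestrict_def)
  have mult: "cadd A (cmult A a a') (cmult A b b') = cmult A (cadd A a b) (cadd A a' b')"
    if "a \<in> S" "b \<in> T" "a' \<in> S" "b' \<in> T" for a b a' b'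
    using hom that by (force simp: star_hom_def direct_sum_def crestrict_def)
  show ?thesis
  proof
    \<comment> \<open>Multiplicativity of the addition map at the pairs \<open>(a, 0)\<close> and
      \<open>(0, b)\<close>, whose product in the external sum is zero.\<close>
    show "cmult A a b = czero A" if "a \<in> S" "b \<in> T" for a b
      using mult[OF that(1) T(1) S(1) that(2)] that sub by (auto simp: add_zero zero_add subset_iff)
    show "\<exists>a\<in>S. \<exists>b\<in>T. c = cadd A a b" if "c \<in> C" for c
      using bij that by (force simp: bij_betw_def direct_sum_def crestrict_def)
  qed (use sub S T in auto)
qed

text \<open>The set \<open>I + J\<close> is an ideal, and it is closed: by orthogonality the
  \<open>I\<close>-component is contractive, so the components of a Cauchy sequence are Cauchy.
  Assumption \<open>all\<close> then forces \<open>I + J\<close> to be everything.\<close>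

lemma (in cstar_algebra) splitting_of_orthogonal_ideals:
  assumes I: "closed_ideal A I" "\<And>a. a \<in> I \<Longrightarrow> cadj A a \<in> I"
    and J: "closed_ideal A J" "\<And>a. a \<in> J \<Longrightarrow> cadj A a \<in> J"
    and orth: "\<And>a b. a \<in> I \<Longrightarrow> b \<in> J \<Longrightarrow> cmult A a b = czero A"
    and all: "\<And>K. closed_ideal A K \<Longrightarrow> I \<subseteq> K \<Longrightarrow> J \<subseteq> K \<Longrightarrow> C \<subseteq> K"
  shows "cstar_splitting A I J"
proof -
  have IC: "a \<in> C" if "a \<in> I" for a using I that by (auto simp: closed_ideal_iff)
  have JC: "a \<in> C" if "a \<in> J" for a using J that by (auto simp: closed_ideal_iff)
  let ?K = "{cadd A a b |a b. a \<in> I \<and> b \<in> J}"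
  have le: "cnorm A a \<le> cnorm A (cadd A a b)" if "a \<in> I" "b \<in> J" for a b
  proof (cases "cnorm A a = 0")
    case True then show ?thesis using that IC JC by (simp add: norm_nonneg)
  next
    case False
    have "cmult A (cadj A a) (cadd A a b) = cmult A (cadj A a) a"
      using that by (simp add: mult_add_right orth I IC JC add_zero)
    then have "cnorm A a * cnorm A a \<le> cnorm A a * cnorm A (cadd A a b)"
      using norm_mult[of "cadj A a" "cadd A a b"] norm_adj_mult[of a] that IC JC by (simp add: power2_eq_square)
    then show ?thesis using False norm_nonneg[of a] that IC by simp
  qed
  have diffI: "cdiff A a b \<in> I" if "a \<in> I" "b \<in> I" for a b
    using I that by (auto simp: closed_ideal_iff cdiff_def)
  have diffJ: "cdiff A a b \<in> J" if "a \<in> J" "b \<in> J" for a b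
    using J that by (auto simp: closed_ideal_iff cdiff_def)
  have "closed_ideal A ?K"
    unfolding closed_ideal_iff
  proof (intro conjI ballI allI)
    show "?K \<subseteq> C" using IC JC by auto
    show "czero A \<in> ?K"
      using I J add_zero[of "czero A"] unfolding closed_ideal_iff by (force intro!: exI[of _ "czero A"])
    show "cadd A c d \<in> ?K" if cd: "c \<in> ?K" "d \<in> ?K" for c d
    proof -
      obtain a b where 1: "a \<in> I" "b \<in> J" "c = cadd A a b" using cd(1) by blast
      obtain a' b' where "a' \<in> I" "b' \<in> J" "d = cadd A a' b'" using cd(2) by blast
      note * = 1 this
      then have "cadd A c d = cadd A (cadd A a a') (cadd A b b')"
        by (simp add: IC JC add_assoc add_left_commute)
      moreover have "cadd A a a' \<in> I" "cadd A b b' \<in> J" using I J * by (auto simp: closed_ideal_iff)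
      ultimately show ?thesis by blast
    qed
    show "cscale A z c \<in> ?K" if cK: "c \<in> ?K" for z c
    proof -
      obtain a b where *: "a \<in> I" "b \<in> J" "c = cadd A a b" using cK by blast
      then have "cscale A z c = cadd A (cscale A z a) (cscale A z b)" by (simp add: IC JC scale_add)
      moreover have "cscale A z a \<in> I" "cscale A z b \<in> J" using I J * by (auto simp: closed_ideal_iff)
      ultimately show ?thesis by blast
    qed
    show "cmult A c d \<in> ?K" "cmult A d c \<in> ?K" if cK: "c \<in> ?K" and "d \<in> C" for c d
    proof -
      obtain a b where *: "a \<in> I" "b \<in> J" "c = cadd A a b" using cK by blast
      then have "cmult A c d = cadd A (cmult A a d) (cmult A b d)" "cmult A d c = cadd A (cmult A d a) (cmult A d b)"
        using that by (simp_all add: IC JC mult_add_left mult_add_right)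
      moreover have "cmult A a d \<in> I" "cmult A b d \<in> J" "cmult A d a \<in> I" "cmult A d b \<in> J"
        using I J * that by (auto simp: closed_ideal_iff)
      ultimately show "cmult A c d \<in> ?K" "cmult A d c \<in> ?K" by blast+
    qed
    show "closed_set ?K" unfolding closed_set_def
    proof (intro allI ballI impI)
      fix X l assume l: "l \<in> C" "\<forall>n. X n \<in> ?K" "cconverges A X l"
      then have "\<forall>n. \<exists>a b. a \<in> I \<and> b \<in> J \<and> X n = cadd A a b" by blast
      then obtain a b where ab: "\<And>n. a n \<in> I" "\<And>n. b n \<in> J" "\<And>n. X n = cadd A (a n) (b n)" by metis
      have cau: "ccauchy A X" using l IC JC ab by (intro converges_cauchy[of X l]) auto
      have "ccauchy A a" unfolding ccauchy_def
      proof (intro allI impI)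
        fix e :: real assume "0 < e"
        then obtain N where N: "\<forall>m\<ge>N. \<forall>n\<ge>N. cnorm A (cdiff A (X m) (X n)) < e"
          using cau unfolding ccauchy_def by blast
        have "cnorm A (cdiff A (a m) (a n)) \<le> cnorm A (cdiff A (X m) (X n))" for m n
          unfolding ab(3) using ab(1,2) IC JC by (simp add: diff_add_add le diffI diffJ)
        then show "\<exists>N. \<forall>m\<ge>N. \<forall>n\<ge>N. cnorm A (cdiff A (a m) (a n)) < e"
          using N by (meson le_less_trans)
      qed
      then obtain a' where a': "a' \<in> C" "cconverges A a a'" using complete[of a] ab IC by blast
      then have a'I: "a' \<in> I" using I(1) ab(1) unfolding closed_ideal_def by blast
      have b: "b n = cdiff A (X n) (a n)" for n
      proof -
        have "cdiff A (cadd A (a n) (b n)) (cadd A (a n) (czero A)) = b n"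
          using ab IC JC by (subst diff_add_add) (auto simp: zero_add)
        then show ?thesis using ab IC by (simp add: add_zero)
      qed
      have XC: "X n \<in> C" for n using ab IC JC by simp
      have "cconverges A b (cdiff A l a')"
      proof (rule converges_le)
        show "(\<lambda>n. cnorm A (cdiff A (X n) l) + cnorm A (cdiff A (a n) a')) \<longlonglongrightarrow> 0"
          using tendsto_add[OF l(3)[unfolded cconverges_def] a'(2)[unfolded cconverges_def]] by simp
        fix n
        have "cdiff A (b n) (cdiff A l a') = cadd A (cdiff A (X n) l) (cscale A (-1) (cdiff A (a n) a'))"
          using a' l(1) ab(1) IC XC diff_add_add[of "X n" "cscale A (-1) (a n)" l "cscale A (-1) a'"]
          unfolding b by (simp add: diff_scale flip: cdiff_def)
        then show "cnorm A (cdiff A (b n) (cdiff A l a')) \<le> cnorm A (cdiff A (X n) l) + cnorm A (cdiff A (a n) a')"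
          using norm_triangle[of "cdiff A (X n) l" "cscale A (-1) (cdiff A (a n) a')"] a' l ab IC JC
          by (simp add: norm_scale)
      qed (use a' l ab JC in auto)
      then have bJ: "cdiff A l a' \<in> J" using J(1) ab(2) diff_closed[OF l(1) a'(1)] unfolding closed_ideal_def by blast
      have "cadd A a' (cdiff A l a') = l"
        using a' l by (simp add: cdiff_def add_left_commute[of a' l] add_neg add_zero)
      with a'I bJ show "l \<in> ?K" by force
    qed
  qed
  moreover have "I \<subseteq> ?K" "J \<subseteq> ?K"
  proof -
    have "czero A \<in> I" "czero A \<in> J" using I J by (auto simp: closed_ideal_iff)
    moreover have "a = cadd A a (czero A)" if "a \<in> I" for a using that IC by (simp add: add_zero)
    moreover have "b = cadd A (czero A) b" if "b \<in> J" for b using that JC by (simp add: zero_add)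
    ultimately show "I \<subseteq> ?K" "J \<subseteq> ?K" by blast+
  qed
  ultimately have "C \<subseteq> ?K" by (rule all)
  then have span: "\<exists>a\<in>I. \<exists>b\<in>J. c = cadd A a b" if "c \<in> C" for c
    using that by blast
  show ?thesis
  proof
    show "\<exists>a\<in>I. \<exists>b\<in>J. c = cadd A a b" if "c \<in> C" for c using that by (rule span)
    show "cmult A a b = czero A" if "a \<in> I" "b \<in> J" for a b using that by (rule orth)
    show "cmult A a b \<in> I" if "a \<in> I" "b \<in> I" for a b using that I(1) IC unfolding closed_ideal_iff by blast
    show "cmult A a b \<in> J" if "a \<in> J" "b \<in> J" for a b using that J(1) JC unfolding closed_ideal_iff by blast
    show "cadj A a \<in> I" if "a \<in> I" for a using that by (rule I(2))
    show "cadj A a \<in> J" if "a \<in> J" for a using that by (rule J(2))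
  qed (use I(1) J(1) in \<open>simp_all add: closed_ideal_iff\<close>)
qed

section \<open>Homomorphisms and isomorphisms\<close>

lemma star_homD:
  assumes "star_hom A B f" "a \<in> ccarrier A"
  shows "f a \<in> ccarrier B" "b \<in> ccarrier A \<Longrightarrow> f (cadd A a b) = cadd B (f a) (f b)"
    "f (cscale A z a) = cscale B z (f a)" "b \<in> ccarrier A \<Longrightarrow> f (cmult A a b) = cmult B (f a) (f b)"
    "f (cadj A a) = cadj B (f a)"
  using assms by (auto simp: star_hom_def)

lemma star_hom_comp: "star_hom A B f \<Longrightarrow> star_hom B D g \<Longrightarrow> star_hom A D (\<lambda>x. g (f x))"
  by (simp add: star_hom_def)

text \<open>Precisely the closure conditions that make the inverse of a bijective *-homomorphism a
  *-homomorphism. They pass to direct sums directly, without any discussion of norms and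
  completeness.\<close>

definition star_closed :: "'b cstar \<Rightarrow> bool" where
  "star_closed A \<longleftrightarrow> (\<forall>a \<in> ccarrier A. \<forall>b \<in> ccarrier A. cadd A a b \<in> ccarrier A \<and> cmult A a b \<in> ccarrier A) \<and>
    (\<forall>a \<in> ccarrier A. cadj A a \<in> ccarrier A \<and> (\<forall>z. cscale A z a \<in> ccarrier A))"

lemma star_closed_cstar_algebra: "cstar_algebra A \<Longrightarrow> star_closed A"
  by (simp add: star_closed_def cstar_algebra.add_closed cstar_algebra.scale_closed cstar_algebra.mult_closed
      cstar_algebra.adj_closed)

lemma star_closed_direct_sum: "star_closed A \<Longrightarrow> star_closed B \<Longrightarrow> star_closed (A \<oplus>\<^sub>* B)"
  by (auto simp: star_closed_def direct_sum_def)

lemma star_isomorphic_sym: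
  assumes "star_closed A" "A \<cong>\<^sub>* B" shows "B \<cong>\<^sub>* A"
proof -
  obtain f where f: "star_hom A B f" "bij_betw f (ccarrier A) (ccarrier B)"
    using assms(2) by (auto simp: cstar_isomorphic_def star_iso_def)
  define g where "g = inv_into (ccarrier A) f"
  have gf: "g (f a) = a" if "a \<in> ccarrier A" for a
    using f that unfolding g_def by (simp add: bij_betw_def)
  have ex: "\<exists>a\<in>ccarrier A. b = f a" if "b \<in> ccarrier B" for b
    using f that by (auto simp: bij_betw_def)
  have "star_hom B A g"
    unfolding star_hom_def
    using assms(1) by (auto simp: star_closed_def gf star_homD(2-5)[OF f(1), symmetric] dest!: ex)
  moreover have "bij_betw g (ccarrier B) (ccarrier A)"
    unfolding g_def by (rule bij_betw_inv_into[OF f(2)])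
  ultimately show ?thesis by (auto simp: cstar_isomorphic_def star_iso_def)
qed

lemma star_isomorphic_trans:
  assumes "A \<cong>\<^sub>* B" "B \<cong>\<^sub>* D" shows "A \<cong>\<^sub>* D"
proof -
  obtain f g where "star_hom A B f" "bij_betw f (ccarrier A) (ccarrier B)"
    "star_hom B D g" "bij_betw g (ccarrier B) (ccarrier D)"
    using assms by (auto simp: cstar_isomorphic_def star_iso_def)
  then have "star_iso A D (\<lambda>x. g (f x))"
    using star_hom_comp bij_betw_trans[of f _ _ g] by (auto simp: star_iso_def comp_def)
  then show ?thesis by (auto simp: cstar_isomorphic_def)
qed

lemma star_isomorphic_direct_sum:
  assumes "A \<cong>\<^sub>* A'" "B \<cong>\<^sub>* B'" shows "A \<oplus>\<^sub>* B \<cong>\<^sub>* A' \<oplus>\<^sub>* B'"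
proof -
  obtain f where f: "star_hom A A' f" "bij_betw f (ccarrier A) (ccarrier A')"
    using assms(1) by (auto simp: cstar_isomorphic_def star_iso_def)
  obtain g where g: "star_hom B B' g" "bij_betw g (ccarrier B) (ccarrier B')"
    using assms(2) by (auto simp: cstar_isomorphic_def star_iso_def)
  have "star_hom (A \<oplus>\<^sub>* B) (A' \<oplus>\<^sub>* B') (map_prod f g)"
    unfolding star_hom_def by (auto simp: direct_sum_def star_homD[OF f(1)] star_homD[OF g(1)])
  moreover have "bij_betw (map_prod f g) (ccarrier (A \<oplus>\<^sub>* B)) (ccarrier (A' \<oplus>\<^sub>* B'))"
    using bij_betw_map_prod[OF f(2) g(2)] by (simp add: direct_sum_def)
  ultimately show ?thesis by (auto simp: cstar_isomorphic_def star_iso_def)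
qed

lemma star_isomorphic_refl: "A \<cong>\<^sub>* A"
  unfolding cstar_isomorphic_def star_iso_def star_hom_def by (intro exI[of _ "\<lambda>x. x"]) (simp add: bij_betw_def)

lemma star_hom_diff:
  assumes "star_hom A B f" "a \<in> ccarrier A" "b \<in> ccarrier A" "cstar_algebra A"
  shows "f (cdiff A a b) = cdiff B (f a) (f b)"
  using assms by (simp add: cdiff_def star_homD[OF assms(1)] cstar_algebra.scale_closed)

text \<open>An isometry on a complete space has closed range, so dense range gives surjectivity:
  preimages of approximants form a Cauchy sequence whose limit stays in \<open>I\<close>.\<close>

lemma star_iso_isometric_dense:
  assumes A: "cstar_algebra A" and B: "cstar_algebra B" and h: "star_hom A B h"
    and I: "closed_ideal A I"
    and iso: "\<And>a. a \<in> I \<Longrightarrow> cnorm B (h a) = cnorm A a"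
    and dense: "\<And>b e. b \<in> ccarrier B \<Longrightarrow> 0 < e \<Longrightarrow> \<exists>a\<in>I. cnorm B (cdiff B b (h a)) < e"
  shows "A \<restriction>\<^sub>* I \<cong>\<^sub>* B"
proof -
  interpret A: cstar_algebra A by (rule A)
  interpret B: cstar_algebra B by (rule B)
  have IC: "a \<in> A.C" if "a \<in> I" for a using I that by (auto simp: A.closed_ideal_iff)
  have diffI: "cdiff A a b \<in> I" if "a \<in> I" "b \<in> I" for a b
    using I that by (auto simp: A.closed_ideal_iff cdiff_def)
  have hB: "h a \<in> B.C" if "a \<in> I" for a using h IC that by (auto simp: star_hom_def)
  have isod: "cnorm A (cdiff A a b) = cnorm B (cdiff B (h a) (h b))" if "a \<in> I" "b \<in> I" for a b
    using iso[OF diffI[OF that]] star_hom_diff[OF h IC IC A, of a b] that by simp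
  have "inj_on h I"
  proof (rule inj_onI)
    fix a b assume ab: "a \<in> I" "b \<in> I" "h a = h b"
    then have "cnorm A (cdiff A a b) = 0" using isod[of a b] hB by simp
    then show "a = b" using ab IC by (simp add: A.norm_eq_zero A.diff_eq_zero)
  qed
  moreover have "b \<in> h ` I" if b: "b \<in> B.C" for b
  proof -
    have "\<exists>a\<in>I. cnorm B (cdiff B b (h a)) < 1 / real (Suc n)" for n
      using dense[OF b, of "1 / real (Suc n)"] by simp
    then obtain a where a: "\<And>n. a n \<in> I" "\<And>n. cnorm B (cdiff B b (h (a n))) < 1 / real (Suc n)" by metis
    have "cconverges B (\<lambda>n. h (a n)) b"
    proof (rule B.converges_le)
      show "cnorm B (cdiff B (h (a n)) b) \<le> 1 / real (Suc n)" for n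
        using a(2)[of n] B.norm_diff_commute[of b "h (a n)"] hB a(1) b by simp
      show "(\<lambda>n. 1 / real (Suc n)) \<longlonglongrightarrow> 0" using LIMSEQ_inverse_real_of_nat by (simp add: inverse_eq_divide)
    qed (use a hB b in auto)
    then have "ccauchy B (\<lambda>n. h (a n))" using a hB b by (intro B.converges_cauchy[of _ b]) auto
    then have "ccauchy A a" unfolding ccauchy_def using isod[OF a(1) a(1)] by simp
    then obtain l where l: "l \<in> A.C" "cconverges A a l" using A.complete[of a] a IC by blast
    then have lI: "l \<in> I" using I a(1) unfolding closed_ideal_def by blast
    then have "cconverges B (\<lambda>n. h (a n)) (h l)"
      using l isod[OF a(1) lI] by (simp add: cconverges_def)
    then have "h l = b"
      using \<open>cconverges B (\<lambda>n. h (a n)) b\<close> a hB b lI by (intro B.converges_unique[of "\<lambda>n. h (a n)"]) auto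
    with lI show ?thesis by blast
  qed
  ultimately have "bij_betw h I B.C" using hB by (auto simp: bij_betw_def)
  moreover have "star_hom (A \<restriction>\<^sub>* I) B h"
    using h IC by (auto simp: star_hom_def crestrict_def)
  ultimately show ?thesis
    unfolding cstar_isomorphic_def star_iso_def by (intro exI[of _ h]) (simp add: crestrict_def)
qed

lemma isomorphic_of_internal_direct_sum:
  assumes "internal_direct_sum A S T"
  shows "A \<cong>\<^sub>* A \<restriction>\<^sub>* S \<oplus>\<^sub>* A \<restriction>\<^sub>* T"
proof (rule star_isomorphic_sym)
  show "star_closed (A \<restriction>\<^sub>* S \<oplus>\<^sub>* A \<restriction>\<^sub>* T)"
    using assms unfolding internal_direct_sum_def
    by (intro star_closed_direct_sum) (auto intro: star_closed_cstar_algebra)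
  show "A \<restriction>\<^sub>* S \<oplus>\<^sub>* A \<restriction>\<^sub>* T \<cong>\<^sub>* A"
    using assms by (auto simp: internal_direct_sum_def cstar_isomorphic_def)
qed

lemma (in free_seminorm) cstar_seminorm_hom:
  assumes "cstar_algebra B" "star_hom A B h"
  shows "cstar_seminorm G (\<lambda>f. cnorm B (h (emb f)))"
proof -
  interpret B: cstar_algebra B by fact
  interpret A: cstar_algebra A by (rule cstar_algebra_completion)
  have [simp]: "f \<in> F \<Longrightarrow> h (emb f) \<in> B.C" for f using star_homD(1)[OF assms(2)] by simp
  show ?thesis
    unfolding cstar_seminorm_def poly_scale_scal
    by (auto simp: emb_add emb_mult emb_scal emb_adj star_homD[OF assms(2)] B.norm_nonneg
      B.norm_adj_mult B.norm_scale B.norm_triangle B.norm_mult)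
qed

text \<open>Contractivity on polynomials sends Cauchy sequences to Cauchy sequences and null
  differences to null differences, so \<open>\<phi>\<close> can be applied termwise to
  representatives.\<close>

lemma induced_hom:
  assumes "cstar_seminorm G p" "cstar_seminorm G' p'"
    and \<phi>: "\<And>f. f \<in> free_star_algebra G \<Longrightarrow> \<phi> f \<in> free_star_algebra G'"
    "\<And>f g. \<phi> (f + g) = \<phi> f + \<phi> g" "\<And>f g. \<phi> (f * g) = \<phi> f * \<phi> g"
    "\<And>f. \<phi> (poly_adj f) = poly_adj (\<phi> f)" "\<And>z f. \<phi> (scal z * f) = scal z * \<phi> f"
    and le: "\<And>f. f \<in> free_star_algebra G \<Longrightarrow> p' (\<phi> f) \<le> p f"
  obtains h where "star_hom (free_completion G p) (free_completion G' p') h"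
    "\<And>f. f \<in> free_star_algebra G \<Longrightarrow> h (free_seminorm.emb G p f) = free_seminorm.emb G' p' (\<phi> f)"
    "\<And>a. a \<in> ccarrier (free_completion G p) \<Longrightarrow>
      cnorm (free_completion G' p') (h a) \<le> cnorm (free_completion G p) a"
proof -
  interpret A: free_seminorm G p by unfold_locales fact
  interpret B: free_seminorm G' p' by unfold_locales fact
  have diff: "\<phi> (f - g) = \<phi> f - \<phi> g" for f g
    using \<phi>(2)[of "f - g" g] by (simp add: algebra_simps)
  define h where "h a = (\<Union>X\<in>a. null_rel G' p' `` {\<lambda>n. \<phi> (X n)})" for a
  have CS: "(\<lambda>n. \<phi> (X n)) \<in> B.CS" if X: "X \<in> A.CS" for X
    unfolding cauchy_seqs_def
  proof safe
    fix e :: real assume "0 < e"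
    then obtain N where N: "\<forall>m\<ge>N. \<forall>n\<ge>N. p (X m - X n) < e" using X \<open>0 < e\<close> unfolding cauchy_seqs_def by blast
    have "p' (\<phi> (X m) - \<phi> (X n)) \<le> p (X m - X n)" for m n
      using le[of "X m - X n"] A.CS_F[OF that] by (simp add: diff)
    with N show "\<exists>N. \<forall>m\<ge>N. \<forall>n\<ge>N. p' (\<phi> (X m) - \<phi> (X n)) < e" by (meson le_less_trans)
  qed (use A.CS_F[OF that] \<phi>(1) in auto)
  have h_cls: "h (A.cls X) = B.cls (\<lambda>n. \<phi> (X n))" if X: "X \<in> A.CS" for X
    unfolding h_def A.cls_def
  proof (subst UN_equiv_class[OF A.equiv_null_rel _ X])
    show "(\<lambda>X. null_rel G' p' `` {\<lambda>n. \<phi> (X n)}) respects null_rel G p"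
    proof (rule congruentI)
      fix Y Z assume YZ: "(Y, Z) \<in> null_rel G p"
      then have "((\<lambda>n. \<phi> (Y n)), (\<lambda>n. \<phi> (Z n))) \<in> null_rel G' p'"
        using le[of "Y n - Z n" for n] A.CS_F CS
        by (intro B.null_relI[where h="\<lambda>n. p (Y n - Z n)"]) (auto simp: A.null_rel_iff diff)
      then show "null_rel G' p' `` {\<lambda>n. \<phi> (Y n)} = null_rel G' p' `` {\<lambda>n. \<phi> (Z n)}"
        by (rule equiv_class_eq[OF B.equiv_null_rel])
    qed
  qed (simp add: B.cls_def)
  show ?thesis
  proof
    show "star_hom A.A B.A h"
    proof -
      have "h (cscale A.A z a) = cscale B.A z (h a)" if "a \<in> ccarrier A.A" for z a
        using that by (auto simp: h_cls CS \<phi>(5) elim!: A.carrier_cases)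
      then show ?thesis
        unfolding star_hom_def by (auto simp: h_cls CS \<phi>(1-4) elim!: A.carrier_cases)
    qed
    show "h (A.emb f) = B.emb (\<phi> f)" if "f \<in> A.F" for f
      using that by (simp add: A.emb_def B.emb_def h_cls)
    show "cnorm B.A (h a) \<le> cnorm A.A a" if "a \<in> ccarrier A.A" for a
    proof -
      obtain X where X: "X \<in> A.CS" "a = A.cls X" using \<open>a \<in> ccarrier A.A\<close> by (rule A.carrier_cases)
      have "(\<lambda>n. p' (\<phi> (X n))) \<longlonglongrightarrow> cnorm B.A (h a)" "(\<lambda>n. p (X n)) \<longlonglongrightarrow> cnorm A.A a"
        using X CS by (auto simp: h_cls intro!: A.cnorm_cls_lim B.cnorm_cls_lim)
      then show ?thesis by (rule LIMSEQ_le) (use X le A.CS_F in auto)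
    qed
  qed
qed

section \<open>Paths in higher-rank graphs\<close>

context k_graph
begin

declare rng_mor [simp] src_mor [simp] rng_rng [simp] src_rng [simp] rng_src [simp] src_src [simp]
  cmp_mor [simp] rng_cmp [simp] src_cmp [simp] cmp_id_left [simp] cmp_id_right [simp] deg_id [simp] deg_cmp [simp]

lemma cmp_cancel:
  assumes "\<mu> \<in> mor \<Lambda>" "\<nu> \<in> mor \<Lambda>" "src \<Lambda> \<mu> = rng \<Lambda> \<nu>"
    "\<mu>' \<in> mor \<Lambda>" "\<nu>' \<in> mor \<Lambda>" "src \<Lambda> \<mu>' = rng \<Lambda> \<nu>'"
    "cmp \<Lambda> \<mu> \<nu> = cmp \<Lambda> \<mu>' \<nu>'" "deg \<Lambda> \<mu> = deg \<Lambda> \<mu>'"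
  shows "\<mu> = \<mu>'" "\<nu> = \<nu>'"
proof -
  have "deg \<Lambda> \<mu> + deg \<Lambda> \<nu> = deg \<Lambda> \<mu>' + deg \<Lambda> \<nu>'" using assms deg_cmp by metis
  then have d: "deg \<Lambda> \<nu> = deg \<Lambda> \<nu>'" using assms(8) by simp
  let ?P = "\<lambda>(\<alpha>, \<beta>). \<alpha> \<in> mor \<Lambda> \<and> \<beta> \<in> mor \<Lambda> \<and> deg \<Lambda> \<alpha> = deg \<Lambda> \<mu> \<and> deg \<Lambda> \<beta> = deg \<Lambda> \<nu> \<and>
        src \<Lambda> \<alpha> = rng \<Lambda> \<beta> \<and> cmp \<Lambda> \<mu> \<nu> = cmp \<Lambda> \<alpha> \<beta>"
  have "\<exists>!x. ?P x"
    by (rule factorization) (rule cmp_mor deg_cmp; fact assms(1-3))+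
  moreover have "?P (\<mu>, \<nu>)" "?P (\<mu>', \<nu>')" using assms d by auto
  ultimately have "(\<mu>, \<nu>) = (\<mu>', \<nu>')" by blast
  then show "\<mu> = \<mu>'" "\<nu> = \<nu>'" by auto
qed

text \<open>A morphism \<open>v\<close> of degree 0 factors both as \<open>r(v) v\<close> and as
  \<open>v s(v)\<close> with all degrees 0; uniqueness of factorization identifies the
  three.\<close>

lemma vertexD:
  assumes "v \<in> vertices \<Lambda>" shows "v \<in> mor \<Lambda>" "rng \<Lambda> v = v" "src \<Lambda> v = v" "deg \<Lambda> v = 0"
proof -
  show v: "v \<in> mor \<Lambda>" "deg \<Lambda> v = 0" using assms by (auto simp: vertices_def)
  show "rng \<Lambda> v = v" by (rule cmp_cancel(1)[of "rng \<Lambda> v" v v "src \<Lambda> v"]) (use v in simp_all)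
  show "src \<Lambda> v = v" by (rule cmp_cancel(2)[of "rng \<Lambda> v" v v "src \<Lambda> v", symmetric]) (use v in simp_all)
qed

lemma rng_vertex [simp]: "\<kappa> \<in> mor \<Lambda> \<Longrightarrow> rng \<Lambda> \<kappa> \<in> vertices \<Lambda>"
  and src_vertex [simp]: "\<kappa> \<in> mor \<Lambda> \<Longrightarrow> src \<Lambda> \<kappa> \<in> vertices \<Lambda>"
  by (simp_all add: vertices_def)

lemma deg_zero_vertex: "\<kappa> \<in> mor \<Lambda> \<Longrightarrow> deg \<Lambda> \<kappa> = 0 \<Longrightarrow> \<kappa> \<in> vertices \<Lambda>"
  by (simp add: vertices_def)

declare vertexD [simp]

lemma factorE:
  assumes "\<kappa> \<in> mor \<Lambda>" "m \<le> deg \<Lambda> \<kappa>"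
  obtains \<mu> \<nu> where "\<mu> \<in> mor \<Lambda>" "\<nu> \<in> mor \<Lambda>" "deg \<Lambda> \<mu> = m" "deg \<Lambda> \<nu> = deg \<Lambda> \<kappa> - m"
    "src \<Lambda> \<mu> = rng \<Lambda> \<nu>" "\<kappa> = cmp \<Lambda> \<mu> \<nu>"
proof -
  have "deg \<Lambda> \<kappa> = m + (deg \<Lambda> \<kappa> - m)"
    using assms(2) by (simp add: vec_eq_iff less_eq_vec_def)
  from factorization[OF assms(1) this] show ?thesis using that by blast
qed

lemma axis_le_iff: "axis i 1 \<le> (n :: nat ^ 'k) \<longleftrightarrow> 0 < n $ i"
  by (auto simp: less_eq_vec_def axis_def Suc_le_eq)

lemma first_edge:
  assumes "\<kappa> \<in> mor \<Lambda>" "0 < deg \<Lambda> \<kappa> $ i"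
  shows "paths \<Lambda> (rng \<Lambda> \<kappa>) (axis i 1) \<noteq> {}"
proof -
  obtain \<mu> \<nu> where "\<mu> \<in> mor \<Lambda>" "\<nu> \<in> mor \<Lambda>" "deg \<Lambda> \<mu> = axis i 1" "src \<Lambda> \<mu> = rng \<Lambda> \<nu>" "\<kappa> = cmp \<Lambda> \<mu> \<nu>"
    using assms axis_le_iff by (metis factorE)
  then show ?thesis by (auto simp: paths_def)
qed

lemma paths_le_self: "\<kappa> \<in> mor \<Lambda> \<Longrightarrow> \<kappa> \<in> paths_le \<Lambda> (rng \<Lambda> \<kappa>) (deg \<Lambda> \<kappa>)"
  by (simp add: paths_le_def)

lemma paths_leD:
  assumes "\<kappa> \<in> paths_le \<Lambda> v n"
  shows "\<kappa> \<in> mor \<Lambda>" "rng \<Lambda> \<kappa> = v" "deg \<Lambda> \<kappa> \<le> n"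
  using assms by (auto simp: paths_le_def)

text \<open>Where \<open>\<alpha>\<close> is shorter than \<open>n\<close>, no edge in that
  direction leaves its source, so \<open>\<beta>\<close> contributes nothing there. The degree of
  \<open>\<alpha>\<close> is thus determined by the product, which makes the factorization through
  \<open>paths_le \<Lambda> v n\<close> unique.\<close>

lemma paths_le_deg:
  assumes "\<alpha> \<in> paths_le \<Lambda> v n" "\<beta> \<in> mor \<Lambda>" "src \<Lambda> \<alpha> = rng \<Lambda> \<beta>"
  shows "deg \<Lambda> \<alpha> $ i = min (deg \<Lambda> (cmp \<Lambda> \<alpha> \<beta>) $ i) (n $ i)"
proof (cases "deg \<Lambda> \<alpha> $ i < n $ i")
  case True
  then have "paths \<Lambda> (rng \<Lambda> \<beta>) (axis i 1) = {}" using assms by (auto simp: paths_le_def)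
  then have "deg \<Lambda> \<beta> $ i = 0" using first_edge[OF assms(2), of i] by auto
  with True assms paths_leD[OF assms(1)] show ?thesis by simp
next
  case False
  then show ?thesis using assms paths_leD[OF assms(1)] by (simp add: less_eq_vec_def min_def antisym)
qed

lemma paths_le_unique:
  assumes "\<alpha> \<in> paths_le \<Lambda> v n" "\<beta> \<in> mor \<Lambda>" "src \<Lambda> \<alpha> = rng \<Lambda> \<beta>"
    and "\<alpha>' \<in> paths_le \<Lambda> w n" "\<beta>' \<in> mor \<Lambda>" "src \<Lambda> \<alpha>' = rng \<Lambda> \<beta>'"
    and "cmp \<Lambda> \<alpha> \<beta> = cmp \<Lambda> \<alpha>' \<beta>'"
  shows "\<alpha> = \<alpha>'" "\<beta> = \<beta>'"
proof -
  have "deg \<Lambda> \<alpha> = deg \<Lambda> \<alpha>'"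
    using paths_le_deg[OF assms(1-3)] paths_le_deg[OF assms(4-6)] assms(7) by (simp add: vec_eq_iff)
  then show "\<alpha> = \<alpha>'" "\<beta> = \<beta>'" using cmp_cancel assms paths_leD by metis+
qed

lemma finite_degrees_le: "finite {m :: nat ^ 'k. m \<le> n}"
proof (rule finite_subset)
  show "{m. m \<le> n} \<subseteq> vec_lambda ` (UNIV \<rightarrow>\<^sub>E {..Max (range (($) n))})"
  proof
    fix m :: "nat ^ 'k" assume "m \<in> {m. m \<le> n}"
    then have "m $ i \<le> Max (range (($) n))" for i
      by (auto simp: less_eq_vec_def intro!: order_trans[of "m $ i" "n $ i", OF _ Max_ge])
    then have "(($) m) \<in> UNIV \<rightarrow>\<^sub>E {..Max (range (($) n))}" by auto
    then show "m \<in> vec_lambda ` (UNIV \<rightarrow>\<^sub>E {..Max (range (($) n))})"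
      by (intro image_eqI[where x="($) m"]) auto
  qed
  show "finite (vec_lambda ` (UNIV \<rightarrow>\<^sub>E {..Max (range (($) n))}))"
    by (intro finite_imageI finite_PiE) auto
qed

text \<open>Among the paths from \<open>v\<close> of degree at most \<open>n\<close>, one of maximal
  total degree cannot be extended inside the box, which is what membership asks for.\<close>

lemma paths_le_nonempty:
  assumes v: "v \<in> vertices \<Lambda>" shows "paths_le \<Lambda> v n \<noteq> {}"
proof -
  define D where "D = {m. m \<le> n \<and> paths \<Lambda> v m \<noteq> {}}"
  have "finite D" unfolding D_def by (rule finite_subset[OF _ finite_degrees_le[of n]]) auto
  moreover have "v \<in> paths \<Lambda> v 0" using v by (simp add: paths_def)
  then have "0 \<in> D" by (auto simp: D_def less_eq_vec_def)
  ultimately have "finite ((\<lambda>m. \<Sum>i\<in>UNIV. m $ i) ` D)" "(\<lambda>m. \<Sum>i\<in>UNIV. m $ i) ` D \<noteq> {}" by auto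
  then obtain m where m: "m \<in> D" and max: "\<And>m'. m' \<in> D \<Longrightarrow> (\<Sum>i\<in>UNIV. m' $ i) \<le> (\<Sum>i\<in>UNIV. m $ i)"
    by (metis (mono_tags, lifting) Max_ge Max_in imageE imageI)
  from m obtain \<kappa> where \<kappa>: "\<kappa> \<in> mor \<Lambda>" "rng \<Lambda> \<kappa> = v" "deg \<Lambda> \<kappa> = m" "m \<le> n" by (auto simp: D_def paths_def)
  have "paths \<Lambda> (src \<Lambda> \<kappa>) (axis i 1) = {}" if "m $ i < n $ i" for i
  proof (rule ccontr)
    assume "paths \<Lambda> (src \<Lambda> \<kappa>) (axis i 1) \<noteq> {}"
    then obtain \<nu> where \<nu>: "\<nu> \<in> mor \<Lambda>" "rng \<Lambda> \<nu> = src \<Lambda> \<kappa>" "deg \<Lambda> \<nu> = axis i 1" by (auto simp: paths_def)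
    have "m + axis i 1 \<le> n" using \<kappa>(4) that by (auto simp: less_eq_vec_def axis_def)
    moreover have "cmp \<Lambda> \<kappa> \<nu> \<in> paths \<Lambda> v (m + axis i 1)" using \<kappa> \<nu> by (simp add: paths_def)
    ultimately have "m + axis i 1 \<in> D" by (auto simp: D_def)
    from max[OF this] have "(\<Sum>j\<in>UNIV. m $ j) + (\<Sum>j\<in>UNIV. axis i 1 $ j) \<le> (\<Sum>j\<in>UNIV. m $ j)"
      by (simp add: sum.distrib)
    moreover have "(\<Sum>j\<in>UNIV. axis i (1::nat) $ j) = 1" by (simp add: axis_def)
    ultimately show False by simp
  qed
  then have "\<kappa> \<in> paths_le \<Lambda> v n" using \<kappa> by (simp add: paths_le_def)
  then show ?thesis by auto
qed

lemma paths_le_extend: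
  assumes "\<mu> \<in> mor \<Lambda>" "deg \<Lambda> \<mu> \<le> m"
  obtains \<nu> where "\<nu> \<in> mor \<Lambda>" "src \<Lambda> \<mu> = rng \<Lambda> \<nu>" "cmp \<Lambda> \<mu> \<nu> \<in> paths_le \<Lambda> (rng \<Lambda> \<mu>) m"
proof -
  obtain \<nu> where \<nu>: "\<nu> \<in> paths_le \<Lambda> (src \<Lambda> \<mu>) (m - deg \<Lambda> \<mu>)"
    using paths_le_nonempty[of "src \<Lambda> \<mu>" "m - deg \<Lambda> \<mu>"] assms by auto
  note \<nu>' = paths_leD[OF \<nu>]
  have "cmp \<Lambda> \<mu> \<nu> \<in> paths_le \<Lambda> (rng \<Lambda> \<mu>) m"
  proof -
    have "deg \<Lambda> \<mu> + deg \<Lambda> \<nu> \<le> m"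
      using \<nu>'(3) assms(2) by (auto simp: less_eq_vec_def) (metis add.commute le_diff_conv2)
    moreover have "paths \<Lambda> (src \<Lambda> \<nu>) (axis i 1) = {}" if "deg \<Lambda> \<mu> $ i + deg \<Lambda> \<nu> $ i < m $ i" for i
      using \<nu> that by (auto simp: paths_le_def)
    ultimately show ?thesis using assms \<nu>' by (simp add: paths_le_def)
  qed
  then show ?thesis using that \<nu>' by auto
qed

end

locale rf_lc_graph = k_graph \<Lambda> for \<Lambda> :: "('a, 'k::finite) kgraph" +
  assumes row_finite: "row_finite \<Lambda>" and locally_convex: "locally_convex \<Lambda>"
begin

lemma finite_paths_le:
  assumes "v \<in> vertices \<Lambda>" shows "finite (paths_le \<Lambda> v n)"
proof (rule finite_subset)
  show "paths_le \<Lambda> v n \<subseteq> (\<Union>m\<in>{m. m \<le> n}. paths \<Lambda> v m)" by (auto simp: paths_le_def paths_def)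
  show "finite (\<Union>m\<in>{m. m \<le> n}. paths \<Lambda> v m)"
    using row_finite assms finite_degrees_le by (auto simp: row_finite_def)
qed

text \<open>Induction on the total degree: the first edge of \<open>\<kappa>\<close> has a direction
  \<open>j \<noteq> i\<close>, and local convexity carries an edge of direction \<open>i\<close>
  from its range to its source.\<close>

lemma edge_persists:
  assumes "\<kappa> \<in> mor \<Lambda>" "deg \<Lambda> \<kappa> $ i = 0" "paths \<Lambda> (rng \<Lambda> \<kappa>) (axis i 1) \<noteq> {}"
  shows "paths \<Lambda> (src \<Lambda> \<kappa>) (axis i 1) \<noteq> {}"
  using assms
proof (induction "\<Sum>j\<in>UNIV. deg \<Lambda> \<kappa> $ j" arbitrary: \<kappa> rule: less_induct)
  case less
  show ?case
  proof (cases "deg \<Lambda> \<kappa> = 0")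
    case True
    with less(2) have "\<kappa> \<in> vertices \<Lambda>" by (rule deg_zero_vertex)
    then have "src \<Lambda> \<kappa> = rng \<Lambda> \<kappa>" by simp
    then show ?thesis using less(4) by simp
  next
    case False
    then obtain j where j: "0 < deg \<Lambda> \<kappa> $ j" by (auto simp: vec_eq_iff)
    then have ij: "i \<noteq> j" using less(3) by auto
    obtain \<mu> \<nu> where *: "\<mu> \<in> mor \<Lambda>" "\<nu> \<in> mor \<Lambda>" "deg \<Lambda> \<mu> = axis j 1" "src \<Lambda> \<mu> = rng \<Lambda> \<nu>" "\<kappa> = cmp \<Lambda> \<mu> \<nu>"
      using less(2) j axis_le_iff by (metis factorE)
    obtain \<epsilon> where \<epsilon>: "\<epsilon> \<in> paths \<Lambda> (rng \<Lambda> \<mu>) (axis i 1)" using less(4) * by auto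
    have "\<mu> \<in> paths \<Lambda> (rng \<Lambda> \<mu>) (axis j 1)" using * by (simp add: paths_def)
    with \<epsilon> ij * have "paths \<Lambda> (rng \<Lambda> \<nu>) (axis i 1) \<noteq> {}"
      using locally_convex unfolding locally_convex_def by (metis rng_vertex)
    moreover have "deg \<Lambda> \<nu> $ i = 0" using less(3) * by simp
    moreover have "(\<Sum>j\<in>UNIV. deg \<Lambda> \<nu> $ j) < (\<Sum>j\<in>UNIV. deg \<Lambda> \<kappa> $ j)"
      using * by (intro sum_strict_mono_ex1) (auto simp: axis_def)
    ultimately show ?thesis using less(1)[of \<nu>] * by simp
  qed
qed

text \<open>The initial segment of degree \<open>min (deg \<kappa>) n\<close> works. Where it falls
  short of \<open>n\<close>, the rest of \<open>\<kappa>\<close> has no edge in that direction, so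
  an edge at its source would persist to the source of \<open>\<kappa>\<close> and contradict the
  maximality of \<open>\<kappa>\<close>.\<close>

lemma paths_le_factor:
  assumes "\<kappa> \<in> paths_le \<Lambda> v m" "n \<le> m"
  obtains \<alpha> \<beta> where "\<alpha> \<in> paths_le \<Lambda> v n" "\<beta> \<in> mor \<Lambda>" "src \<Lambda> \<alpha> = rng \<Lambda> \<beta>" "\<kappa> = cmp \<Lambda> \<alpha> \<beta>"
proof -
  note \<kappa> = paths_leD[OF assms(1)]
  let ?d = "\<chi> i. min (deg \<Lambda> \<kappa> $ i) (n $ i)"
  have "?d \<le> deg \<Lambda> \<kappa>" by (simp add: less_eq_vec_def)
  from factorE[OF \<kappa>(1) this] obtain \<alpha> \<beta> where *: "\<alpha> \<in> mor \<Lambda>" "\<beta> \<in> mor \<Lambda>" "deg \<Lambda> \<alpha> = ?d"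
    "deg \<Lambda> \<beta> = deg \<Lambda> \<kappa> - ?d" "src \<Lambda> \<alpha> = rng \<Lambda> \<beta>" "\<kappa> = cmp \<Lambda> \<alpha> \<beta>" .
  have "paths \<Lambda> (src \<Lambda> \<alpha>) (axis i 1) = {}" if "?d $ i < n $ i" for i
  proof (rule ccontr)
    assume "paths \<Lambda> (src \<Lambda> \<alpha>) (axis i 1) \<noteq> {}"
    moreover have "deg \<Lambda> \<beta> $ i = 0" using *(4) that by simp
    ultimately have "paths \<Lambda> (src \<Lambda> \<kappa>) (axis i 1) \<noteq> {}" using edge_persists[of \<beta> i] *(1,2,5) unfolding *(6) by simp
    moreover have "deg \<Lambda> \<kappa> $ i < m $ i" proof -
      have "n $ i \<le> m $ i" using assms(2) by (simp add: less_eq_vec_def)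
      then show ?thesis using that by simp
    qed
    ultimately show False using assms(1) by (auto simp: paths_le_def)
  qed
  moreover have "rng \<Lambda> \<alpha> = v" using *(1,2,5) \<kappa>(2) unfolding *(6) by simp
  ultimately have "\<alpha> \<in> paths_le \<Lambda> v n" using *(1) by (auto simp: paths_le_def less_eq_vec_def *(3))
  then show ?thesis using that * by blast
qed

end

section \<open>Calculus modulo null elements\<close>

context free_seminorm
begin

definition null where "null f \<longleftrightarrow> f \<in> F \<and> p f = 0"

text \<open>Equality of the classes in the completion, expressed on representatives. Membership in
  \<open>F\<close> is built in so that chains of equivalences carry it along.\<close>

definition eqv (infix "\<simeq>" 50) where "f \<simeq> g \<longleftrightarrow> f \<in> F \<and> g \<in> F \<and> p (f - g) = 0"

lemma eqv_null: "f \<simeq> g \<longleftrightarrow> f \<in> F \<and> g \<in> F \<and> null (f - g)"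
  by (auto simp: eqv_def null_def)

lemma null_zero [simp]: "null 0" by (simp add: null_def)

lemma null_add: "null f \<Longrightarrow> null g \<Longrightarrow> null (f + g)"
  using p_add[of f g] by (auto simp: null_def intro!: antisym)

lemma null_uminus: "null f \<Longrightarrow> null (- f)" by (simp add: null_def)

lemma null_diff: "null f \<Longrightarrow> null g \<Longrightarrow> null (f - g)"
  using null_add[of f "- g"] null_uminus[of g] by simp

lemma null_mult_left: "null f \<Longrightarrow> g \<in> F \<Longrightarrow> null (g * f)"
  using p_mult[of g f] by (auto simp: null_def intro!: antisym)

lemma null_mult_right: "null f \<Longrightarrow> g \<in> F \<Longrightarrow> null (f * g)"
  using p_mult[of f g] by (auto simp: null_def intro!: antisym)

lemma null_scal: "null f \<Longrightarrow> null (scal z * f)"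
  by (simp add: null_def p_scal)

lemma null_adj: "null f \<Longrightarrow> null (poly_adj f)"
  by (simp add: null_def)

lemma eqv_refl [simp]: "f \<in> F \<Longrightarrow> f \<simeq> f" by (simp add: eqv_def)

lemma eqv_sym: "f \<simeq> g \<Longrightarrow> g \<simeq> f" by (auto simp: eqv_def p_diff_commute)

lemma eqv_trans [trans]: "f \<simeq> g \<Longrightarrow> g \<simeq> h \<Longrightarrow> f \<simeq> h"
  using null_add[of "f - g" "g - h"] by (auto simp: eqv_null)

lemma eqv_F: "f \<simeq> g \<Longrightarrow> f \<in> F" "f \<simeq> g \<Longrightarrow> g \<in> F" by (auto simp: eqv_def)

lemma eqv_add: "f \<simeq> f' \<Longrightarrow> g \<simeq> g' \<Longrightarrow> f + g \<simeq> f' + g'"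
  using null_add[of "f - f'" "g - g'"] by (auto simp: eqv_null algebra_simps)

lemma eqv_diff: "f \<simeq> f' \<Longrightarrow> g \<simeq> g' \<Longrightarrow> f - g \<simeq> f' - g'"
  using null_diff[of "f - f'" "g - g'"] by (auto simp: eqv_null algebra_simps)

lemma eqv_mult: "f \<simeq> f' \<Longrightarrow> g \<simeq> g' \<Longrightarrow> f * g \<simeq> f' * g'"
  using null_add[OF null_mult_right[of "f - f'" g] null_mult_left[of "g - g'" f']]
  by (auto simp: eqv_null algebra_simps)

lemma eqv_mult_left: "g \<simeq> g' \<Longrightarrow> f \<in> F \<Longrightarrow> f * g \<simeq> f * g'"
  by (rule eqv_mult) simp_all

lemma eqv_mult_right: "f \<simeq> f' \<Longrightarrow> g \<in> F \<Longrightarrow> f * g \<simeq> f' * g"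
  by (rule eqv_mult) simp_all

lemma eqv_scal: "f \<simeq> f' \<Longrightarrow> scal z * f \<simeq> scal z * f'"
  using null_scal[of "f - f'" z] by (auto simp: eqv_null algebra_simps)

lemma eqv_adj: "f \<simeq> f' \<Longrightarrow> poly_adj f \<simeq> poly_adj f'"
  using null_adj[of "f - f'"] by (auto simp: eqv_null poly_adj_diff)

lemma eqv_p: "f \<simeq> g \<Longrightarrow> p f = p g"
  using p_abs_diff[of f g] by (auto simp: eqv_def)

lemma eqv_0: "f \<simeq> 0 \<longleftrightarrow> null f"
  by (auto simp: eqv_null null_def)

lemma p_projection': "e \<in> F \<Longrightarrow> poly_adj e = e \<Longrightarrow> null (e * e - e) \<Longrightarrow> p e \<le> 1"
  using p_projection[of e] by (auto simp: null_def)

lemma p_of_int: "f \<in> F \<Longrightarrow> p (of_int m * f) = \<bar>real_of_int m\<bar> * p f"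
  using p_scal[of f "of_int m"] by simp

lemma p_of_nat: "f \<in> F \<Longrightarrow> p (of_nat n * f) = real n * p f"
  using p_scal[of f "of_nat n"] by simp

lemma p_double: "f \<in> F \<Longrightarrow> p (f + f) = 2 * p f"
  using p_of_nat[of f 2] by (simp only: of_nat_numeral flip: mult_2)

lemma free_of_int [simp]: "f \<in> F \<Longrightarrow> of_int m * f \<in> F"
  using free_scal[of f G "of_int m"] by simp

lemma free_of_nat [simp]: "f \<in> F \<Longrightarrow> of_nat n * f \<in> F"
  using free_scal[of f G "of_nat n"] by simp

lemma null_of_int: "null f \<Longrightarrow> null (of_int m * f)"
  using null_scal[of f "of_int m"] by simp

lemma null_of_nat: "null f \<Longrightarrow> null (of_nat n * f)"
  using null_scal[of f "of_nat n"] by simp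

text \<open>Up to null elements \<open>1 - 2e\<close> is a self-adjoint unitary, so
  \<open>b - 2eb\<close> has the seminorm of \<open>b\<close>; and \<open>b - eb\<close> is the
  average of \<open>b\<close> and \<open>b - 2eb\<close>.\<close>

lemma p_complement_le:
  assumes e: "e \<in> F" "poly_adj e = e" "null (e * e - e)" and b: "b \<in> F"
  shows "p (b - e * b) \<le> p b"
proof -
  let ?u = "b - (e * b + e * b)" and ?z = "poly_adj b * (e * e - e) * b"
  have "poly_adj ?u * ?u - poly_adj b * b = (?z + ?z) + (?z + ?z)"
    by (simp add: poly_adj_diff poly_adj_add poly_adj_mult e algebra_simps)
  moreover have "null ?z"
    using e b by (intro null_mult_right null_mult_left) auto
  then have "null ((?z + ?z) + (?z + ?z))" by (intro null_add)
  ultimately have "poly_adj ?u * ?u \<simeq> poly_adj b * b" using e b by (simp add: eqv_null)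
  moreover have u: "?u \<in> F" using e b by auto
  ultimately have "(p ?u)\<^sup>2 = (p b)\<^sup>2" using b p_cstar[of ?u] p_cstar[of b] eqv_p by metis
  then have pu: "p ?u = p b" by (rule power2_eq_imp_eq) (rule p_nonneg; fact u b)+
  have eq: "(b - e * b) + (b - e * b) = b + ?u" by (simp add: algebra_simps)
  have "2 * p (b - e * b) = p (b + ?u)"
    using p_double[of "b - e * b"] e b unfolding eq by simp
  then have "2 * p (b - e * b) \<le> p b + p ?u"
    using p_add[OF b u] by simp
  then show ?thesis using pu by simp
qed

text \<open>A random walk estimate: \<open>2(mg + (n+1)x) = (g+x)((m+1)g + nx) + (g-x)((m-1)g + nx)\<close> when \<open>g\<close>
  is a unit for \<open>x\<close>, so \<open>\<parallel>mg + nx\<parallel>\<close> grows no faster than \<open>sqrt (m\<^sup>2 + n)\<close>.\<close>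

lemma walk_null:
  assumes F: "g \<in> F" "x \<in> F" and gg: "null (g * g - g)" and gx: "null (g * x - x)" and xg: "null (x * g - x)"
    and le: "p g \<le> 1" "p (g + x) \<le> 1" "p (g - x) \<le> 1"
  shows "null x"
proof -
  have bound: "p (of_int m * g + of_nat n * x) \<le> sqrt ((real_of_int m)\<^sup>2 + real n)" for n :: nat and m :: int
  proof (induction n arbitrary: m)
    case 0
    have "p (of_int m * g) \<le> \<bar>real_of_int m\<bar> * 1" using F le by (subst p_of_int) (auto intro!: mult_left_le)
    then show ?case by simp
  next
    case (Suc n)
    let ?w = "\<lambda>m. of_int m * g + of_nat n * x"
    have F': "?w k \<in> F" for k using F by auto
    define a b :: "'g star_poly" where "a = of_int m" and "b = of_nat n"
    have ab: "f * a = a * f" "f * b = b * f" for f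
      unfolding a_def b_def by (rule mult_of_int_commute[symmetric], rule mult_of_nat_commute[symmetric])
    have ab': "f * (a * h) = a * (f * h)" "f * (b * h) = b * (f * h)" for f h
      by (metis ab mult.assoc)+
    let ?L = "of_int m * g + of_nat (Suc n) * x"
    let ?rhs = "(g + x) * ?w (m + 1) + (g - x) * ?w (m - 1)"
    have "?rhs - (?L + ?L) = (a * (g * g - g) + a * (g * g - g)) + (b * (g * x - x) + b * (g * x - x)) + ((x * g - x) + (x * g - x))"
      by (simp add: algebra_simps ab' flip: a_def b_def)
    moreover have "null ((a * (g * g - g) + a * (g * g - g)) + (b * (g * x - x) + b * (g * x - x)) + ((x * g - x) + (x * g - x)))"
      using gg gx xg unfolding a_def b_def by (intro null_add null_of_int null_of_nat)
    ultimately have "null (?rhs - (?L + ?L))" by (simp only:)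
    moreover have LF: "?L \<in> F" using F free_of_int free_of_nat free_add by blast
    moreover have "?rhs \<in> F" using F F' free_mult free_add free_diff by meson
    ultimately have "?rhs \<simeq> ?L + ?L" unfolding eqv_null by blast
    from eqv_p[OF this] have "2 * p ?L = p ?rhs"
      using p_double[OF LF] by simp
    also have "\<dots> \<le> p ((g + x) * ?w (m + 1)) + p ((g - x) * ?w (m - 1))"
      by (rule p_add) (intro free_mult free_add free_diff free_of_int free_of_nat F)+
    also have "\<dots> \<le> p (g + x) * p (?w (m + 1)) + p (g - x) * p (?w (m - 1))"
      by (intro add_mono p_mult free_add free_diff free_of_int free_of_nat F)
    also have "\<dots> \<le> 1 * p (?w (m + 1)) + 1 * p (?w (m - 1))"
      by (intro add_mono mult_right_mono le p_nonneg F')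
    also have "\<dots> \<le> sqrt ((real_of_int (m + 1))\<^sup>2 + real n) + sqrt ((real_of_int (m - 1))\<^sup>2 + real n)"
      using Suc[of "m + 1"] Suc[of "m - 1"] by simp
    \<comment> \<open>The mean of \<open>(m + 1)\<^sup>2 + n\<close> and
      \<open>(m - 1)\<^sup>2 + n\<close> is \<open>m\<^sup>2 + n + 1\<close>; the rest is concavity
      of the square root.\<close>
    also have "\<dots> \<le> 2 * sqrt ((real_of_int m)\<^sup>2 + real (Suc n))"
    proof -
      let ?a = "(real_of_int (m + 1))\<^sup>2 + real n" and ?b = "(real_of_int (m - 1))\<^sup>2 + real n"
      have ab: "0 \<le> ?a" "0 \<le> ?b" by auto
      have "(sqrt ?a + sqrt ?b)\<^sup>2 \<le> 2 * ((sqrt ?a)\<^sup>2 + (sqrt ?b)\<^sup>2)"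
        using sum_squares_bound[of "sqrt ?a" "sqrt ?b"] by (simp add: power2_eq_square algebra_simps)
      also have "\<dots> = 2 * (?a + ?b)" using ab by simp
      also have "\<dots> = (2 * sqrt ((real_of_int m)\<^sup>2 + real (Suc n)))\<^sup>2"
        by (simp add: power_mult_distrib) (simp add: power2_eq_square algebra_simps)
      finally show ?thesis by (rule power2_le_imp_le) simp
    qed
    finally show ?case by simp
  qed
  have "p x = 0"
  proof (rule ccontr)
    assume "p x \<noteq> 0"
    then have px: "0 < p x" using F by (simp add: order_less_le)
    \<comment> \<open>At \<open>m = 0\<close> the bound reads \<open>n * p x \<le> sqrt n\<close>,
      which fails once \<open>n\<close> exceeds \<open>1 / (p x)\<^sup>2\<close>.\<close>
    obtain n :: nat where n: "1 / (p x)\<^sup>2 < real n" using reals_Archimedean2 by blast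
    then have "0 < real n" using px by (meson divide_nonneg_nonneg le_less_trans zero_le_one zero_le_power2)
    have "real n * p x \<le> sqrt (real n)" using bound[of 0 n] F by (simp add: p_of_nat)
    then have "(real n * p x)\<^sup>2 \<le> real n" using px by (metis mult_nonneg_nonneg of_nat_0_le_iff order_less_imp_le power_mono real_sqrt_pow2)
    then have "real n * (p x)\<^sup>2 \<le> 1" using \<open>0 < real n\<close> by (simp add: power2_eq_square field_simps)
    with n px show False by (simp add: field_simps)
  qed
  then show ?thesis using F by (simp add: null_def)
qed

text \<open>The compressions \<open>x\<^sub>l = e\<^sub>i e\<^sub>l e\<^sub>i\<close> (\<open>l \<noteq> i\<close>) add up to \<open>0\<close> and all \<open>e\<^sub>i - x\<^sub>l\<close> are contractions. Averaging them,
  \<open>e\<^sub>i \<plusminus> x\<^sub>j / M\<close> are contractions too, where \<open>M\<close> is the number of indices \<open>l \<noteq> i\<close>.\<close>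

lemma projections_orthogonal:
  assumes S: "finite S" and e: "\<And>i. i \<in> S \<Longrightarrow> e i \<in> F" "\<And>i. i \<in> S \<Longrightarrow> poly_adj (e i) = e i"
      "\<And>i. i \<in> S \<Longrightarrow> null (e i * e i - e i)"
    and sum: "\<And>i. i \<in> S \<Longrightarrow> null (e i * sum e S * e i - e i)"
    and ij: "i \<in> S" "j \<in> S" "i \<noteq> j"
  shows "null (e j * e i)"
proof -
  define g where "g = e i"
  define x where "x l = g * e l * g" for l
  define T where "T = S - {i}"
  define M where "M = card T"
  have g: "g \<in> F" "poly_adj g = g" "null (g * g - g)" "p g \<le> 1"
    using e ij p_projection' by (auto simp: g_def)
  have T: "finite T" "j \<in> T" "T \<subseteq> S" using S ij by (auto simp: T_def)
  then have M: "0 < M" by (auto simp: M_def card_gt_0_iff)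
  have xF: "x l \<in> F" if "l \<in> T" for l using that T e g by (auto simp: x_def)
  have ggg: "null (g * g * g - g)"
  proof -
    have eq: "g * g * g - g = (g * g - g) * g + (g * g - g)" by (simp add: algebra_simps)
    show ?thesis unfolding eq using g by (intro null_add null_mult_right)
  qed
  \<comment> \<open>Compressing the whole sum by \<open>g\<close> returns \<open>g\<close>, and so
    does the \<open>i\<close>-th term alone, so the other compressions cancel.\<close>
  have sum0: "null (\<Sum>l\<in>T. x l)"
  proof -
    have "g * sum e S * g = g * g * g + (\<Sum>l\<in>T. x l)"
      using S ij by (simp add: T_def g_def x_def sum.remove[of S i] distrib_left distrib_right sum_distrib_left sum_distrib_right)
    then have "(\<Sum>l\<in>T. x l) = (g * sum e S * g - g) - (g * g * g - g)" by simp
    then show ?thesis using sum[OF ij(1)] ggg by (simp only: g_def) (rule null_diff)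
  qed
  \<comment> \<open>With \<open>y = (1 - e l) g\<close>, the element \<open>g - x l\<close> is
    equivalent to \<open>y\<^sup>* y\<close>, and \<open>p_complement_le\<close> bounds
    \<open>y\<close> by \<open>g\<close>.\<close>
  have le1: "p (g - x l) \<le> 1" if l: "l \<in> T" for l
  proof -
    let ?y = "g - e l * g"
    have lS: "l \<in> S" using l T by auto
    have "poly_adj ?y * ?y - (g - x l) = (g * g - g) + g * (e l * e l - e l) * g"
      using e(2)[OF lS] g by (simp add: poly_adj_diff poly_adj_mult x_def algebra_simps)
    moreover have "null ((g * g - g) + g * (e l * e l - e l) * g)"
      using e lS g by (intro null_add null_mult_left null_mult_right) auto
    ultimately have "null (poly_adj ?y * ?y - (g - x l))" by (simp only:)
    then have "poly_adj ?y * ?y \<simeq> g - x l" unfolding eqv_null using e lS g xF[OF l] by auto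
    from eqv_p[OF this] have "p (g - x l) = (p ?y)\<^sup>2" using p_cstar[of ?y] e lS g by simp
    also have "p ?y \<le> p g" using e lS g by (intro p_complement_le) auto
    then have "(p ?y)\<^sup>2 \<le> 1" using g e lS by (intro power_le_one) (auto intro: p_nonneg)
    finally show ?thesis .
  qed
  let ?c = "scal (1 / of_nat M)"
  have Mc: "?c * (of_nat M * f) = f" for f :: "'g star_poly"
    using M scal_scal[of "1 / of_nat M" "of_nat M" f] by simp
  have Suc_M: "of_nat (M - 1) * g + g = of_nat M * g"
    using M by (cases M) (auto simp: algebra_simps)
  have pc: "p (?c * f) = p f / real M" if "f \<in> F" for f using that by (simp add: p_scal norm_divide)
  have "null (?c * x j)"
  proof (rule walk_null[of g])
    show "p (g - ?c * x j) \<le> 1"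
    proof -
      have "g - ?c * x j = ?c * (of_nat (M - 1) * g + (g - x j))"
      proof -
        have "of_nat (M - 1) * g + (g - x j) = of_nat M * g - x j" using Suc_M by (simp add: algebra_simps)
        then show ?thesis using Mc[of g] by (simp only: right_diff_distrib)
      qed
      also have "p \<dots> \<le> (p (of_nat (M - 1) * g) + p (g - x j)) / real M"
        using g xF T by (subst pc, blast intro: free_of_nat)
          (intro divide_right_mono p_add free_of_nat free_diff, auto)
      also have "\<dots> \<le> (real (M - 1) * 1 + 1) / real M"
        using g le1[OF T(2)] by (intro divide_right_mono add_mono) (auto simp: p_of_nat intro: mult_left_le)
      also have "\<dots> = 1" using M by (simp add: of_nat_diff)
      finally show ?thesis .
    qed
    \<comment> \<open>Since the compressions add up to 0, \<open>x j\<close> is minus the sum of the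
      others. Hence \<open>M g + x j\<close> is a sum of \<open>M\<close> contractions:
      \<open>g\<close> and the \<open>M - 1\<close> differences \<open>g - x l\<close> with
      \<open>l \<noteq> j\<close>.\<close>
    show "p (g + ?c * x j) \<le> 1"
    proof -
      let ?L = "T - {j}"
      have cL: "card ?L = M - 1" using T by (simp add: M_def)
      have "of_nat M * g + x j - (g + (\<Sum>l\<in>?L. g - x l)) = (\<Sum>l\<in>T. x l)"
      proof -
        have "(\<Sum>l\<in>?L. g - x l) = of_nat (M - 1) * g - (\<Sum>l\<in>?L. x l)"
          by (simp add: sum_subtractf cL)
        moreover have "(\<Sum>l\<in>T. x l) = x j + (\<Sum>l\<in>?L. x l)" using T by (simp add: sum.remove)
        ultimately show ?thesis using Suc_M by (simp add: algebra_simps)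
      qed
      then have "of_nat M * g + x j \<simeq> g + (\<Sum>l\<in>?L. g - x l)"
        using sum0 g xF T by (auto simp: eqv_null)
      from eqv_p[OF eqv_scal[OF this, of "1 / of_nat M"]]
      have "p (g + ?c * x j) = p (?c * (g + (\<Sum>l\<in>?L. g - x l)))"
        using Mc[of g] by (simp only: distrib_left)
      also have "\<dots> = p (g + (\<Sum>l\<in>?L. g - x l)) / real M"
        using g xF T by (intro pc) auto
      also have "\<dots> \<le> (p g + p (\<Sum>l\<in>?L. g - x l)) / real M"
        using g xF T by (intro divide_right_mono p_add) auto
      also have "\<dots> \<le> (1 + (\<Sum>l\<in>?L. 1)) / real M"
        using g xF T le1 by (intro divide_right_mono add_mono order_trans[OF p_sum] sum_mono) auto
      also have "\<dots> = 1" using M cL by (simp add: of_nat_diff)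
      finally show ?thesis .
    qed
    have eq: "g * x j - x j = (g * g - g) * e j * g" "x j * g - x j = g * e j * (g * g - g)"
      by (simp_all add: x_def algebra_simps)
    have "null (g * x j - x j)" unfolding eq(1) by (intro null_mult_right g e ij)
    moreover have "null (x j * g - x j)" unfolding eq(2) by (intro null_mult_left free_mult g e ij)
    ultimately have "null (g * x j - x j)" "null (x j * g - x j)" .
    from this[THEN null_scal, of "1 / of_nat M"]
    show "null (g * (?c * x j) - ?c * x j)" "null (?c * x j * g - ?c * x j)"
      by (simp_all add: right_diff_distrib mult_scal_right mult.assoc)
  qed (use g xF T in auto)
  from null_scal[OF this, of "of_nat M"] have "null (x j)"
    using M scal_scal[of "of_nat M" "1 / of_nat M" "x j"] by simp
  \<comment> \<open>The compression \<open>x j\<close> represents the square of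
    \<open>e j * g\<close>, so the C*-identity passes from one to the other.\<close>
  have "poly_adj (e j * g) * (e j * g) - x j = g * (e j * e j - e j) * g"
    using e ij g by (simp add: poly_adj_mult x_def algebra_simps)
  moreover have "null (g * (e j * e j - e j) * g)" using e ij g by (intro null_mult_left null_mult_right) auto
  ultimately have "null (poly_adj (e j * g) * (e j * g))"
    using \<open>null (x j)\<close> by (metis diff_add_cancel null_add)
  then show ?thesis using p_cstar[of "e j * g"] e ij g by (auto simp: null_def g_def)
qed

end

section \<open>Calculus of Cuntz--Krieger families\<close>

lemma ck_relator_cases [consumes 1, case_names pi vw cmp src sum]:
  assumes "x \<in> ck_relators \<Lambda>"
  obtains \<kappa> where "\<kappa> \<in> mor \<Lambda>" "x = gen \<kappa> * poly_adj (gen \<kappa>) * gen \<kappa> - gen \<kappa>"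
    | v w where "v \<in> vertices \<Lambda>" "w \<in> vertices \<Lambda>" "x = gen v * gen w - (if v = w then gen v else 0)"
    | \<kappa> \<mu> where "\<kappa> \<in> mor \<Lambda>" "\<mu> \<in> mor \<Lambda>" "src \<Lambda> \<kappa> = rng \<Lambda> \<mu>" "x = gen \<kappa> * gen \<mu> - gen (cmp \<Lambda> \<kappa> \<mu>)"
    | \<kappa> where "\<kappa> \<in> mor \<Lambda>" "x = poly_adj (gen \<kappa>) * gen \<kappa> - gen (src \<Lambda> \<kappa>)"
    | v n where "v \<in> vertices \<Lambda>" "x = gen v - (\<Sum>\<kappa>\<in>paths_le \<Lambda> v n. gen \<kappa> * poly_adj (gen \<kappa>))"
  using assms unfolding ck_relators_def by blast

lemma partial_isometry_ck_relators: "partial_isometry_relators (mor \<Lambda>) (ck_relators \<Lambda>)"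
  by unfold_locales (auto simp: ck_relators_def)

sublocale rf_lc_graph \<subseteq> partial_isometry_relators "mor \<Lambda>" "ck_relators \<Lambda>"
  by (rule partial_isometry_ck_relators)

context rf_lc_graph
begin

notation eqv (infix "\<simeq>" 50)

lemma null_mult: "null f \<or> null g \<Longrightarrow> f \<in> F \<Longrightarrow> g \<in> F \<Longrightarrow> null (f * g)"
  using null_mult_left null_mult_right by blast

section \<open>Immediate consequences of the relations\<close>

lemma gen_vertex_mult: "v \<in> vertices \<Lambda> \<Longrightarrow> w \<in> vertices \<Lambda> \<Longrightarrow> gen v * gen w \<simeq> (if v = w then gen v else 0)"
  unfolding eqv_def by (intro conjI universal_relator) (auto simp: ck_relators_def)

lemma gen_mult_gen: "\<kappa> \<in> mor \<Lambda> \<Longrightarrow> \<mu> \<in> mor \<Lambda> \<Longrightarrow> src \<Lambda> \<kappa> = rng \<Lambda> \<mu> \<Longrightarrow> gen \<kappa> * gen \<mu> \<simeq> gen (cmp \<Lambda> \<kappa> \<mu>)"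
  unfolding eqv_def by (intro conjI universal_relator) (auto simp: ck_relators_def)

lemma gen_adj_gen: "\<kappa> \<in> mor \<Lambda> \<Longrightarrow> poly_adj (gen \<kappa>) * gen \<kappa> \<simeq> gen (src \<Lambda> \<kappa>)"
  unfolding eqv_def by (intro conjI universal_relator) (auto simp: ck_relators_def)

lemma gen_partial_isometry: "\<kappa> \<in> mor \<Lambda> \<Longrightarrow> gen \<kappa> * poly_adj (gen \<kappa>) * gen \<kappa> \<simeq> gen \<kappa>"
  unfolding eqv_def by (intro conjI universal_relator) (auto simp: ck_relators_def)

lemma gen_vertex_sum: "v \<in> vertices \<Lambda> \<Longrightarrow> gen v \<simeq> (\<Sum>\<kappa>\<in>paths_le \<Lambda> v n. gen \<kappa> * poly_adj (gen \<kappa>))"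
  unfolding eqv_def by (intro conjI universal_relator) (auto simp: ck_relators_def paths_leD)

lemma gen_vertex_adj: "v \<in> vertices \<Lambda> \<Longrightarrow> poly_adj (gen v) \<simeq> gen v"
proof -
  assume v: "v \<in> vertices \<Lambda>"
  then have 1: "poly_adj (gen v) * gen v \<simeq> gen v" using gen_adj_gen[of v] by simp
  from eqv_adj[OF this] have "poly_adj (gen v) * gen v \<simeq> poly_adj (gen v)" by (simp add: poly_adj_mult)
  from eqv_trans[OF eqv_sym[OF this] 1] show ?thesis .
qed

lemma gen_rng: "\<kappa> \<in> mor \<Lambda> \<Longrightarrow> gen (rng \<Lambda> \<kappa>) * gen \<kappa> \<simeq> gen \<kappa>"
  using gen_mult_gen[of "rng \<Lambda> \<kappa>" \<kappa>] by simp

lemma gen_src: "\<kappa> \<in> mor \<Lambda> \<Longrightarrow> gen \<kappa> * gen (src \<Lambda> \<kappa>) \<simeq> gen \<kappa>"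
  using gen_mult_gen[of \<kappa> "src \<Lambda> \<kappa>"] by simp

lemma adj_gen_rng: "\<kappa> \<in> mor \<Lambda> \<Longrightarrow> poly_adj (gen \<kappa>) * gen (rng \<Lambda> \<kappa>) \<simeq> poly_adj (gen \<kappa>)"
proof -
  assume k: "\<kappa> \<in> mor \<Lambda>"
  have "poly_adj (gen \<kappa>) * gen (rng \<Lambda> \<kappa>) \<simeq> poly_adj (gen \<kappa>) * poly_adj (gen (rng \<Lambda> \<kappa>))"
    using k by (intro eqv_mult_left eqv_sym[OF gen_vertex_adj]) auto
  also have "\<dots> \<simeq> poly_adj (gen \<kappa>)" using eqv_adj[OF gen_rng[OF k]] by (simp add: poly_adj_mult)
  finally show ?thesis .
qed

lemma adj_gen_src: "\<kappa> \<in> mor \<Lambda> \<Longrightarrow> gen (src \<Lambda> \<kappa>) * poly_adj (gen \<kappa>) \<simeq> poly_adj (gen \<kappa>)"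
proof -
  assume k: "\<kappa> \<in> mor \<Lambda>"
  have "gen (src \<Lambda> \<kappa>) * poly_adj (gen \<kappa>) \<simeq> poly_adj (gen (src \<Lambda> \<kappa>)) * poly_adj (gen \<kappa>)"
    using k by (intro eqv_mult_right eqv_sym[OF gen_vertex_adj]) auto
  also have "\<dots> \<simeq> poly_adj (gen \<kappa>)" using eqv_adj[OF gen_src[OF k]] by (simp add: poly_adj_mult)
  finally show ?thesis .
qed

text \<open>The orthogonal projections of \<open>v\<close> and \<open>w\<close> can be inserted
  between \<open>f\<close> and \<open>g\<close>. Every vanishing of a product of mismatched paths
  comes from this.\<close>

lemma null_mult_vertices:
  assumes f: "f * gen v \<simeq> f" and g: "gen w * g \<simeq> g" and vw: "v \<in> vertices \<Lambda>" "w \<in> vertices \<Lambda>" "v \<noteq> w"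
  shows "null (f * g)"
proof -
  have F: "f \<in> F" "g \<in> F" using f g by (auto dest: eqv_F)
  have "f * g \<simeq> (f * gen v) * (gen w * g)" by (rule eqv_sym) (rule eqv_mult[OF f g])
  also have "(f * gen v) * (gen w * g) = f * (gen v * gen w) * g" by (simp add: mult.assoc)
  also have "\<dots> \<simeq> f * 0 * g"
    using gen_vertex_mult[OF vw(1,2)] vw(3) F by (intro eqv_mult_right eqv_mult_left) auto
  finally show ?thesis by (simp add: eqv_0)
qed

lemma gen_mult_null:
  "\<kappa> \<in> mor \<Lambda> \<Longrightarrow> \<mu> \<in> mor \<Lambda> \<Longrightarrow> src \<Lambda> \<kappa> \<noteq> rng \<Lambda> \<mu> \<Longrightarrow> null (gen \<kappa> * gen \<mu>)"
  by (rule null_mult_vertices[OF gen_src gen_rng]) auto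

lemma adj_gen_null:
  "\<kappa> \<in> mor \<Lambda> \<Longrightarrow> \<mu> \<in> mor \<Lambda> \<Longrightarrow> rng \<Lambda> \<kappa> \<noteq> rng \<Lambda> \<mu> \<Longrightarrow> null (poly_adj (gen \<kappa>) * gen \<mu>)"
  by (rule null_mult_vertices[OF adj_gen_rng gen_rng]) auto

text \<open>The range projections of these paths sum to \<open>gen v\<close>, which acts on each of
  them as a unit, so \<open>projections_orthogonal\<close> applies. Multiplying by the adjoint of
  \<open>gen \<kappa>\<close> on the left and by \<open>gen \<mu>\<close> on the right strips the
  product to the claim.\<close>

lemma adj_gen_orthogonal:
  assumes "\<kappa> \<in> paths_le \<Lambda> v n" "\<mu> \<in> paths_le \<Lambda> v n" "\<kappa> \<noteq> \<mu>"
  shows "null (poly_adj (gen \<kappa>) * gen \<mu>)"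
proof -
  have v: "v \<in> vertices \<Lambda>" using paths_leD[OF assms(1)] by auto
  let ?S = "paths_le \<Lambda> v n" and ?e = "\<lambda>\<kappa>. gen \<kappa> * poly_adj (gen \<kappa>)"
  have m: "\<tau> \<in> mor \<Lambda>" "rng \<Lambda> \<tau> = v" if "\<tau> \<in> ?S" for \<tau> using paths_leD[OF that] by auto
  have "null (?e \<kappa> * ?e \<mu>)"
  proof (rule projections_orthogonal[where S="?S" and e="?e"])
    show "finite ?S" by (rule finite_paths_le[OF v])
    fix \<tau> assume \<tau>: "\<tau> \<in> ?S"
    show eF: "?e \<tau> \<in> F" using m[OF \<tau>] by auto
    show "poly_adj (?e \<tau>) = ?e \<tau>" by (simp add: poly_adj_mult)
    have idem: "?e \<tau> * ?e \<tau> \<simeq> ?e \<tau>"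
      using eqv_mult_right[OF gen_partial_isometry[of \<tau>], of "poly_adj (gen \<tau>)"] m[OF \<tau>] by (simp add: mult.assoc)
    then show "null (?e \<tau> * ?e \<tau> - ?e \<tau>)" by (simp add: eqv_null)
    have "gen v * ?e \<tau> \<simeq> ?e \<tau>"
      using eqv_mult_right[OF gen_rng[of \<tau>], of "poly_adj (gen \<tau>)"] m[OF \<tau>] by (simp add: mult.assoc)
    then have 1: "?e \<tau> * (gen v * ?e \<tau>) \<simeq> ?e \<tau> * ?e \<tau>" using eF by (rule eqv_mult_left)
    have "?e \<tau> * sum ?e ?S * ?e \<tau> \<simeq> ?e \<tau> * gen v * ?e \<tau>"
      using eF by (intro eqv_mult_right eqv_mult_left eqv_sym[OF gen_vertex_sum[OF v]])
    also have "?e \<tau> * gen v * ?e \<tau> = ?e \<tau> * (gen v * ?e \<tau>)" by (simp only: mult.assoc)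
    also note 1
    also note idem
    finally have "?e \<tau> * sum ?e ?S * ?e \<tau> \<simeq> ?e \<tau>" .
    then show "null (?e \<tau> * sum ?e ?S * ?e \<tau> - ?e \<tau>)" by (simp add: eqv_null)
  qed (use assms in auto)
  have n: "null (poly_adj (gen \<kappa>) * (?e \<kappa> * ?e \<mu>) * gen \<mu>)"
    by (rule null_mult_right[OF null_mult_left[OF \<open>null (?e \<kappa> * ?e \<mu>)\<close>]])
      (use m assms in auto)
  have 1: "poly_adj (gen \<kappa>) * ?e \<kappa> \<simeq> poly_adj (gen \<kappa>)"
    using eqv_adj[OF gen_partial_isometry[of \<kappa>]] m assms by (simp add: poly_adj_mult mult.assoc)
  have 2: "?e \<mu> * gen \<mu> \<simeq> gen \<mu>" using gen_partial_isometry m assms by simp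
  have "poly_adj (gen \<kappa>) * gen \<mu> \<simeq> poly_adj (gen \<kappa>) * ?e \<kappa> * (?e \<mu> * gen \<mu>)"
    by (rule eqv_sym[OF eqv_mult[OF 1 2]])
  also have "\<dots> = poly_adj (gen \<kappa>) * (?e \<kappa> * ?e \<mu>) * gen \<mu>" by (simp only: mult.assoc)
  also have "\<dots> \<simeq> 0" using n by (simp add: eqv_0)
  finally show ?thesis by (simp add: eqv_0)
qed

text \<open>Write \<open>\<tau> = \<alpha>' \<eta>\<close> with \<open>\<alpha>'\<close> in
  \<open>paths_le\<close> for the degree of \<open>\<alpha>\<close>. As \<open>\<alpha>\<close> lies
  in the same set, either \<open>\<alpha>' = \<alpha>\<close> and the product is
  \<open>gen \<eta>\<close>, or the two are orthogonal.\<close>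

lemma adj_gen_path:
  assumes "\<alpha> \<in> mor \<Lambda>" "deg \<Lambda> \<alpha> \<le> n" "\<tau> \<in> paths_le \<Lambda> (rng \<Lambda> \<alpha>) n"
  shows "(\<exists>\<eta>\<in>mor \<Lambda>. src \<Lambda> \<alpha> = rng \<Lambda> \<eta> \<and> \<tau> = cmp \<Lambda> \<alpha> \<eta> \<and> poly_adj (gen \<alpha>) * gen \<tau> \<simeq> gen \<eta>) \<or>
    null (poly_adj (gen \<alpha>) * gen \<tau>)"
proof -
  obtain \<alpha>' \<eta> where \<eta>: "\<alpha>' \<in> paths_le \<Lambda> (rng \<Lambda> \<alpha>) (deg \<Lambda> \<alpha>)" "\<eta> \<in> mor \<Lambda>" "src \<Lambda> \<alpha>' = rng \<Lambda> \<eta>" "\<tau> = cmp \<Lambda> \<alpha>' \<eta>"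
    using paths_le_factor[OF assms(3,2)] .
  note \<alpha>' = paths_leD[OF \<eta>(1)]
  have "poly_adj (gen \<alpha>) * (gen \<alpha>' * gen \<eta>) \<simeq> poly_adj (gen \<alpha>) * gen \<tau>"
    using gen_mult_gen[of \<alpha>' \<eta>] \<eta> \<alpha>' assms(1) by (intro eqv_mult_left) auto
  then have 1: "poly_adj (gen \<alpha>) * gen \<tau> \<simeq> poly_adj (gen \<alpha>) * gen \<alpha>' * gen \<eta>"
    by (simp add: mult.assoc eqv_sym)
  show ?thesis
  proof (cases "\<alpha> = \<alpha>'")
    case True
    note 1
    also have "poly_adj (gen \<alpha>) * gen \<alpha>' * gen \<eta> \<simeq> gen (src \<Lambda> \<alpha>) * gen \<eta>"
      using gen_adj_gen[OF assms(1)] \<eta>(2) unfolding True by (intro eqv_mult_right) auto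
    also have "gen (src \<Lambda> \<alpha>) * gen \<eta> \<simeq> gen \<eta>" using gen_rng[OF \<eta>(2)] \<eta>(3) True by simp
    finally show ?thesis using \<eta>(2-4) True by blast
  next
    case False
    have "null (poly_adj (gen \<alpha>) * gen \<alpha>' * gen \<eta>)"
      using adj_gen_orthogonal[OF paths_le_self[OF assms(1)] \<eta>(1) False] \<eta>(2) null_mult_right by blast
    with 1 show ?thesis by (metis eqv_0 eqv_trans)
  qed
qed

text \<open>The elements that are equivalent to linear combinations of \<open>s\<^sub>\<alpha> s\<^sub>\<beta>\<^sup>*\<close> with \<open>d(\<alpha>) - d(\<beta>) = \<delta>\<close>.\<close>

inductive homogeneous :: "('k \<Rightarrow> int) \<Rightarrow> 'a star_poly \<Rightarrow> bool" for \<delta> where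
  base: "\<alpha> \<in> mor \<Lambda> \<Longrightarrow> \<beta> \<in> mor \<Lambda> \<Longrightarrow> src \<Lambda> \<alpha> = src \<Lambda> \<beta> \<Longrightarrow> (\<And>i. int (deg \<Lambda> \<alpha> $ i) - int (deg \<Lambda> \<beta> $ i) = \<delta> i) \<Longrightarrow>
    homogeneous \<delta> (gen \<alpha> * poly_adj (gen \<beta>))"
| zero: "homogeneous \<delta> 0"
| add: "homogeneous \<delta> f \<Longrightarrow> homogeneous \<delta> g \<Longrightarrow> homogeneous \<delta> (f + g)"
| scal: "homogeneous \<delta> f \<Longrightarrow> homogeneous \<delta> (scal z * f)"
| eqv: "homogeneous \<delta> f \<Longrightarrow> f \<simeq> g \<Longrightarrow> homogeneous \<delta> g"

lemma homogeneous_null: "null f \<Longrightarrow> homogeneous \<delta> f"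
  using homogeneous.eqv[OF homogeneous.zero] by (metis eqv_0 eqv_sym)

lemma homogeneous_sum: "(\<And>x. x \<in> S \<Longrightarrow> homogeneous \<delta> (h x)) \<Longrightarrow> homogeneous \<delta> (sum h S)"
  by (induction S rule: infinite_finite_induct) (auto intro: homogeneous.intros)

text \<open>Between the two factors the common range projection is expanded over
  \<open>paths_le\<close> for the join \<open>m\<close> of both degrees. Each \<open>\<tau>\<close>
  occurring there either kills a term or extends both \<open>\<beta>\<close> and
  \<open>\<gamma>\<close>, and the complementary segments \<open>\<eta>\<close>,
  \<open>\<xi>\<close> have the required difference of degrees.\<close>

lemma homogeneous_adj_gen_gen:
  assumes "\<beta> \<in> mor \<Lambda>" "\<gamma> \<in> mor \<Lambda>"
  shows "homogeneous (\<lambda>i. int (deg \<Lambda> \<gamma> $ i) - int (deg \<Lambda> \<beta> $ i)) (poly_adj (gen \<beta>) * gen \<gamma>)"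
proof (cases "rng \<Lambda> \<beta> = rng \<Lambda> \<gamma>")
  case False
  then show ?thesis using adj_gen_null assms by (intro homogeneous_null) auto
next
  case True
  let ?v = "rng \<Lambda> \<beta>" and ?\<delta> = "\<lambda>i. int (deg \<Lambda> \<gamma> $ i) - int (deg \<Lambda> \<beta> $ i)"
  define m where "m = (\<chi> i. max (deg \<Lambda> \<beta> $ i) (deg \<Lambda> \<gamma> $ i))"
  have m: "deg \<Lambda> \<beta> \<le> m" "deg \<Lambda> \<gamma> \<le> m" by (auto simp: m_def less_eq_vec_def)
  let ?S = "paths_le \<Lambda> ?v m" and ?b = "poly_adj (gen \<beta>)"
  have "(\<Sum>\<tau>\<in>?S. ?b * gen \<tau> * (poly_adj (gen \<tau>) * gen \<gamma>)) = ?b * (\<Sum>\<tau>\<in>?S. gen \<tau> * poly_adj (gen \<tau>)) * gen \<gamma>"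
    by (simp add: sum_distrib_left sum_distrib_right mult.assoc)
  also have "\<dots> \<simeq> ?b * gen ?v * gen \<gamma>"
    using assms by (intro eqv_mult_right eqv_mult_left eqv_sym[OF gen_vertex_sum]) auto
  also have "\<dots> \<simeq> ?b * gen \<gamma>" using assms by (intro eqv_mult_right adj_gen_rng) auto
  finally have eq: "(\<Sum>\<tau>\<in>?S. ?b * gen \<tau> * (poly_adj (gen \<tau>) * gen \<gamma>)) \<simeq> ?b * gen \<gamma>" .
  have "homogeneous ?\<delta> (?b * gen \<tau> * (poly_adj (gen \<tau>) * gen \<gamma>))" if \<tau>: "\<tau> \<in> ?S" for \<tau>
  proof -
    note \<tau>' = paths_leD[OF \<tau>]
    from adj_gen_path[OF assms(1) m(1) \<tau>] adj_gen_path[OF assms(2) m(2)] \<tau> True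
    consider "null (?b * gen \<tau>)" | "null (poly_adj (gen \<gamma>) * gen \<tau>)"
      | \<eta> \<xi> where "\<eta> \<in> mor \<Lambda>" "src \<Lambda> \<beta> = rng \<Lambda> \<eta>" "\<tau> = cmp \<Lambda> \<beta> \<eta>" "?b * gen \<tau> \<simeq> gen \<eta>"
        "\<xi> \<in> mor \<Lambda>" "src \<Lambda> \<gamma> = rng \<Lambda> \<xi>" "\<tau> = cmp \<Lambda> \<gamma> \<xi>" "poly_adj (gen \<gamma>) * gen \<tau> \<simeq> gen \<xi>"
      by (metis)
    then show ?thesis
    proof cases
      case 1
      show ?thesis by (rule homogeneous_null, rule null_mult_right[OF 1]) (use \<tau>' assms in auto)
    next
      case 2
      from null_adj[OF this] have "null (poly_adj (gen \<tau>) * gen \<gamma>)" by (simp add: poly_adj_mult)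
      then show ?thesis
        by (intro homogeneous_null, rule null_mult_left) (use \<tau>' assms in auto)
    next
      case 3
      have "poly_adj (gen \<tau>) * gen \<gamma> \<simeq> poly_adj (gen \<xi>)" using eqv_adj[OF 3(8)] by (simp add: poly_adj_mult)
      with 3(4) have e: "gen \<eta> * poly_adj (gen \<xi>) \<simeq> ?b * gen \<tau> * (poly_adj (gen \<tau>) * gen \<gamma>)"
        by (intro eqv_sym[OF eqv_mult])
      have "deg \<Lambda> \<tau> = deg \<Lambda> \<beta> + deg \<Lambda> \<eta>" using deg_cmp[OF assms(1) 3(1,2)] 3(3) by simp
      moreover have "deg \<Lambda> \<tau> = deg \<Lambda> \<gamma> + deg \<Lambda> \<xi>" using deg_cmp[OF assms(2) 3(5,6)] 3(7) by simp
      ultimately have "deg \<Lambda> \<beta> + deg \<Lambda> \<eta> = deg \<Lambda> \<gamma> + deg \<Lambda> \<xi>" by simp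
      then have "deg \<Lambda> \<beta> $ i + deg \<Lambda> \<eta> $ i = deg \<Lambda> \<gamma> $ i + deg \<Lambda> \<xi> $ i" for i
        by (metis vector_add_component)
      then have "int (deg \<Lambda> \<beta> $ i) + int (deg \<Lambda> \<eta> $ i) = int (deg \<Lambda> \<gamma> $ i) + int (deg \<Lambda> \<xi> $ i)" for i
        by (metis of_nat_add)
      then have d: "int (deg \<Lambda> \<eta> $ i) - int (deg \<Lambda> \<xi> $ i) = ?\<delta> i" for i by (simp add: algebra_simps)
      have "src \<Lambda> \<eta> = src \<Lambda> \<tau>" using src_cmp[OF assms(1) 3(1,2)] 3(3) by simp
      moreover have "src \<Lambda> \<xi> = src \<Lambda> \<tau>" using src_cmp[OF assms(2) 3(5,6)] 3(7) by simp
      ultimately have "homogeneous ?\<delta> (gen \<eta> * poly_adj (gen \<xi>))" using 3(1,5) d by (intro homogeneous.base) auto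
      then show ?thesis using e by (rule homogeneous.eqv)
    qed
  qed
  then show ?thesis using homogeneous.eqv[OF homogeneous_sum eq] by blast
qed

lemma homogeneous_mult_gen:
  assumes "homogeneous \<delta> f" "\<kappa> \<in> mor \<Lambda>"
  shows "homogeneous (\<lambda>i. int (deg \<Lambda> \<kappa> $ i) + \<delta> i) (gen \<kappa> * f)"
  using assms(1)
proof (induction rule: homogeneous.induct)
  case (base \<alpha> \<beta>)
  show ?case
  proof (cases "src \<Lambda> \<kappa> = rng \<Lambda> \<alpha>")
    case True
    have "gen (cmp \<Lambda> \<kappa> \<alpha>) * poly_adj (gen \<beta>) \<simeq> gen \<kappa> * gen \<alpha> * poly_adj (gen \<beta>)"
      using base assms True by (intro eqv_mult_right eqv_sym[OF gen_mult_gen]) auto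
    moreover have "homogeneous (\<lambda>i. int (deg \<Lambda> \<kappa> $ i) + \<delta> i) (gen (cmp \<Lambda> \<kappa> \<alpha>) * poly_adj (gen \<beta>))"
      using base(1-3) base(4)[symmetric] assms True by (intro homogeneous.base) auto
    ultimately show ?thesis unfolding mult.assoc[symmetric] by (rule homogeneous.eqv[rotated])
  next
    case False
    then have "null (gen \<kappa> * gen \<alpha> * poly_adj (gen \<beta>))"
      using base assms by (intro null_mult_right gen_mult_null) auto
    then show ?thesis by (intro homogeneous_null) (simp add: mult.assoc)
  qed
next
  case (eqv f g)
  then show ?case using assms(2) by (metis eqv_mult_left free_gen homogeneous.eqv)
qed (auto simp: distrib_left mult_scal_right intro: homogeneous.intros)

text \<open>The product of the adjoint of \<open>gen \<kappa>\<close> with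
  \<open>gen \<alpha>\<close> is homogeneous by \<open>homogeneous_adj_gen_gen\<close>; the inner
  induction appends the adjoint of \<open>gen \<beta>\<close> to such an element.\<close>

lemma homogeneous_mult_adj_gen:
  assumes "homogeneous \<delta> f" "\<kappa> \<in> mor \<Lambda>"
  shows "homogeneous (\<lambda>i. - int (deg \<Lambda> \<kappa> $ i) + \<delta> i) (poly_adj (gen \<kappa>) * f)"
  using assms(1)
proof (induction rule: homogeneous.induct)
  case (base \<alpha> \<beta>)
  have "homogeneous (\<lambda>i. - int (deg \<Lambda> \<kappa> $ i) + \<delta> i) (h * poly_adj (gen \<beta>))"
    if "homogeneous (\<lambda>i. int (deg \<Lambda> \<alpha> $ i) - int (deg \<Lambda> \<kappa> $ i)) h" for h
    using that
  proof (induction rule: homogeneous.induct)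
    case (base \<eta> \<xi>)
    show ?case
    proof (cases "src \<Lambda> \<beta> = rng \<Lambda> \<xi>")
      case True
      have "poly_adj (gen (cmp \<Lambda> \<beta> \<xi>)) \<simeq> poly_adj (gen \<xi>) * poly_adj (gen \<beta>)"
        using eqv_adj[OF eqv_sym[OF gen_mult_gen[of \<beta> \<xi>]]] base(2) \<open>\<beta> \<in> mor \<Lambda>\<close> True by (simp add: poly_adj_mult)
      then have "gen \<eta> * poly_adj (gen (cmp \<Lambda> \<beta> \<xi>)) \<simeq> gen \<eta> * poly_adj (gen \<xi>) * poly_adj (gen \<beta>)"
        unfolding mult.assoc using base by (intro eqv_mult_left) auto
      moreover have "homogeneous (\<lambda>i. - int (deg \<Lambda> \<kappa> $ i) + \<delta> i) (gen \<eta> * poly_adj (gen (cmp \<Lambda> \<beta> \<xi>)))"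
      proof (rule homogeneous.base)
        fix i
        show "int (deg \<Lambda> \<eta> $ i) - int (deg \<Lambda> (cmp \<Lambda> \<beta> \<xi>) $ i) = - int (deg \<Lambda> \<kappa> $ i) + \<delta> i"
          using base(4)[of i] \<open>\<And>i. int (deg \<Lambda> \<alpha> $ i) - int (deg \<Lambda> \<beta> $ i) = \<delta> i\<close>[of i] base(2) \<open>\<beta> \<in> mor \<Lambda>\<close> True
          by simp
      qed (use base \<open>\<beta> \<in> mor \<Lambda>\<close> True in auto)
      ultimately show ?thesis by (rule homogeneous.eqv[rotated])
    next
      case False
      then have "null (poly_adj (gen \<beta> * gen \<xi>))"
        using base \<open>\<beta> \<in> mor \<Lambda>\<close> by (intro null_adj gen_mult_null) auto
      then have "null (gen \<eta> * poly_adj (gen \<beta> * gen \<xi>))" using base by (intro null_mult_left) auto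
      then show ?thesis by (intro homogeneous_null) (simp add: poly_adj_mult mult.assoc)
    qed
  next
    case (eqv f g)
    then show ?case using \<open>\<beta> \<in> mor \<Lambda>\<close> by (metis eqv_mult_right free_adj free_gen homogeneous.eqv)
  qed (auto simp: distrib_right mult.assoc intro: homogeneous.intros)
  from this[OF homogeneous_adj_gen_gen[OF assms(2) base(1)]] show ?case by (simp add: mult.assoc)
next
  case (eqv f g)
  then show ?case using assms(2) by (metis eqv_mult_left free_adj free_gen homogeneous.eqv)
qed (auto simp: distrib_left mult_scal_right intro: homogeneous.intros)

definition word_degree :: "'a star_word \<Rightarrow> 'k \<Rightarrow> int" where
  "word_degree w i = (\<Sum>(x, b)\<leftarrow>letters w. if b then - int (deg \<Lambda> x $ i) else int (deg \<Lambda> x $ i))"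

lemma word_degree_Cons: "word_degree (Word [l] + u) i =
    (if snd l then - int (deg \<Lambda> (fst l) $ i) else int (deg \<Lambda> (fst l) $ i)) + word_degree u i"
  by (simp add: word_degree_def plus_star_word_def case_prod_unfold)

text \<open>Inserting the projection of the source vertex gives a single letter the form of a
  product \<open>s\<^sub>\<alpha> s\<^sub>\<beta>\<^sup>*\<close>; further letters are multiplied on
  the left.\<close>

lemma homogeneous_word:
  assumes "w \<noteq> 0" "fst ` set (letters w) \<subseteq> mor \<Lambda>"
  shows "homogeneous (word_degree w) (Poly_Mapping.single w 1)"
  using assms
proof (induction rule: word_induct)
  case (lett l)
  obtain x b where l: "l = (x, b)" by (cases l)
  with lett have x: "x \<in> mor \<Lambda>" by simp
  show ?case
  proof (cases b)
    case True
    have "homogeneous (word_degree (Word [l])) (gen (src \<Lambda> x) * poly_adj (gen x))"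
      using x True by (intro homogeneous.base) (auto simp: word_degree_def l)
    then show ?thesis using adj_gen_src[OF x] True by (auto simp: lett_def l intro: homogeneous.eqv)
  next
    case False
    have "homogeneous (word_degree (Word [l])) (gen x * poly_adj (gen (src \<Lambda> x)))"
      using x False by (intro homogeneous.base) (auto simp: word_degree_def l)
    moreover have "gen x * poly_adj (gen (src \<Lambda> x)) \<simeq> gen x * gen (src \<Lambda> x)"
      using x by (intro eqv_mult_left gen_vertex_adj) auto
    ultimately have "homogeneous (word_degree (Word [l])) (gen x)"
      using gen_src[OF x] by (metis eqv_trans homogeneous.eqv)
    then show ?thesis using False by (simp add: lett_def l)
  qed
next
  case (Cons l u)
  show ?case
  proof (cases "snd l")
    case True
    then have "word_degree (Word [l] + u) = (\<lambda>i. - int (deg \<Lambda> (fst l) $ i) + word_degree u i)"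
      by (simp add: word_degree_Cons fun_eq_iff)
    then show ?thesis using homogeneous_mult_adj_gen[OF Cons(4,1)] True by (simp add: lett_def)
  next
    case False
    then have "word_degree (Word [l] + u) = (\<lambda>i. int (deg \<Lambda> (fst l) $ i) + word_degree u i)"
      by (simp add: word_degree_Cons fun_eq_iff)
    then show ?thesis using homogeneous_mult_gen[OF Cons(4,1)] False by (simp add: lett_def)
  qed
qed

text \<open>If the term \<open>s\<^sub>v s\<^sub>\<alpha> s\<^sub>\<beta>\<^sup>* s\<^sub>w\<close>
  survives, then \<open>\<alpha>\<close> starts in \<open>H1\<close> and \<open>\<beta>\<close> in
  \<open>H2\<close>, so by heredity their common source would lie in both sets.\<close>

lemma hereditary_orthogonal:
  assumes H: "hereditary \<Lambda> H1" "hereditary \<Lambda> H2" "H1 \<inter> H2 = {}" and v: "v \<in> H1" and w: "w \<in> H2" and f: "f \<in> F"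
  shows "null (gen v * f * gen w)"
proof -
  have vw: "v \<in> vertices \<Lambda>" "w \<in> vertices \<Lambda>" using H v w by (auto simp: hereditary_def)
  have homog: "null (gen v * g * gen w)" if "homogeneous \<delta> g" for g \<delta>
    using that
  proof (induction rule: homogeneous.induct)
    case (base \<alpha> \<beta>)
    have "rng \<Lambda> \<alpha> \<noteq> v \<or> rng \<Lambda> \<beta> \<noteq> w"
      using base H v w by (auto simp: hereditary_def)
    then have "null (gen v * gen \<alpha>) \<or> null (poly_adj (gen \<beta>) * gen w)"
      using gen_mult_null[of v \<alpha>] adj_gen_null[of \<beta> w] base vw by auto
    then have "null (gen v * gen \<alpha> * (poly_adj (gen \<beta>) * gen w))"
      by (rule null_mult) (use base vw in auto)
    then show ?case by (simp add: mult.assoc)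
  next
    case (add f g)
    then show ?case by (simp add: distrib_left distrib_right null_add)
  next
    case (scal f z)
    then show ?case by (simp add: mult.assoc mult_scal_right null_scal)
  next
    case (eqv f g)
    have "gen v * f * gen w \<simeq> gen v * g * gen w"
      using eqv(2) vw by (intro eqv_mult_right eqv_mult_left) auto
    then show ?case using eqv by (metis eqv_0 eqv_sym eqv_trans)
  qed simp
  from f show ?thesis
  proof (induction rule: free_induct_words)
    case (single u c)
    then show ?case
      by (subst single_scal) (rule homog[OF homogeneous.scal[OF homogeneous_word]])
  next
    case (add f g)
    then show ?case by (simp add: distrib_left distrib_right null_add)
  qed simp
qed

text \<open>For \<open>m\<close> above the common degree of \<open>\<alpha>\<close> and
  \<open>\<beta>\<close>, the compression of \<open>s\<^sub>\<alpha> s\<^sub>\<beta>\<^sup>*\<close>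
  by \<open>s\<^sub>\<tau>\<close> vanishes unless both paths are initial segments of
  \<open>\<tau>\<close>. Having equal degrees they leave the same remainder \<open>\<eta>\<close>,
  and the compression is the projection at its source. For a linear combination the thresholds are
  added.\<close>

lemma homogeneous_zero_compress:
  assumes "homogeneous (\<lambda>_. 0) f"
  shows "\<exists>n. \<forall>m\<ge>n. \<forall>\<tau>\<in>paths_le \<Lambda> v m. \<exists>c. poly_adj (gen \<tau>) * f * gen \<tau> \<simeq> scal c * gen (src \<Lambda> \<tau>)"
  using assms
proof (induction rule: homogeneous.induct)
  case (base \<alpha> \<beta>)
  have deg: "deg \<Lambda> \<alpha> = deg \<Lambda> \<beta>" using base(4) by (simp add: vec_eq_iff)
  have "\<exists>c. poly_adj (gen \<tau>) * (gen \<alpha> * poly_adj (gen \<beta>)) * gen \<tau> \<simeq> scal c * gen (src \<Lambda> \<tau>)"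
    if m: "deg \<Lambda> \<alpha> \<le> m" and \<tau>: "\<tau> \<in> paths_le \<Lambda> v m" for m \<tau>
  proof -
    note \<tau>' = paths_leD[OF \<tau>]
    let ?a = "poly_adj (gen \<alpha>) * gen \<tau>" and ?b = "poly_adj (gen \<beta>) * gen \<tau>"
    have eq: "poly_adj (gen \<tau>) * (gen \<alpha> * poly_adj (gen \<beta>)) * gen \<tau> = poly_adj ?a * ?b"
      by (simp add: poly_adj_mult mult.assoc)
    have F: "?a \<in> F" "?b \<in> F" using base \<tau>' by auto
    show ?thesis
    proof (cases "null ?a \<or> null ?b")
      case True
      then have "null (poly_adj ?a * ?b)" using F null_mult[of "poly_adj ?a" ?b] null_adj[of ?a] by auto
      then show ?thesis unfolding eq using \<tau>' by (intro exI[of _ 0]) (simp add: eqv_0)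
    next
      case False
      then have r: "rng \<Lambda> \<alpha> = v" "rng \<Lambda> \<beta> = v"
        using adj_gen_null[OF base(1) \<tau>'(1)] adj_gen_null[OF base(2) \<tau>'(1)] \<tau>'(2) by auto
      obtain \<eta> where \<eta>: "\<eta> \<in> mor \<Lambda>" "src \<Lambda> \<alpha> = rng \<Lambda> \<eta>" "\<tau> = cmp \<Lambda> \<alpha> \<eta>" "?a \<simeq> gen \<eta>"
        using adj_gen_path[OF base(1) m, of \<tau>] \<tau> r False by auto
      obtain \<xi> where \<xi>: "\<xi> \<in> mor \<Lambda>" "src \<Lambda> \<beta> = rng \<Lambda> \<xi>" "\<tau> = cmp \<Lambda> \<beta> \<xi>" "?b \<simeq> gen \<xi>"
        using adj_gen_path[OF base(2), of m \<tau>] \<tau> r m deg False by auto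
      have "\<eta> = \<xi>"
        using cmp_cancel(2)[OF base(1) \<eta>(1,2) base(2) \<xi>(1,2)] \<eta>(3) \<xi>(3) deg by simp
      have "poly_adj ?a * ?b \<simeq> poly_adj (gen \<eta>) * gen \<xi>"
        by (rule eqv_mult[OF eqv_adj[OF \<eta>(4)] \<xi>(4)])
      also have "\<dots> \<simeq> gen (src \<Lambda> \<eta>)" unfolding \<open>\<eta> = \<xi>\<close> by (rule gen_adj_gen[OF \<xi>(1)])
      also have "src \<Lambda> \<eta> = src \<Lambda> \<tau>" using src_cmp[OF base(1) \<eta>(1,2)] \<eta>(3) by simp
      finally show ?thesis unfolding eq by (intro exI[of _ 1]) simp
    qed
  qed
  then show ?case by blast
next
  case zero
  show ?case by (intro exI[of _ 0] allI impI ballI exI[of _ "0::complex"]) simp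
next
  case (add f g)
  then obtain n n' where n: "\<forall>m\<ge>n. \<forall>\<tau>\<in>paths_le \<Lambda> v m. \<exists>c. poly_adj (gen \<tau>) * f * gen \<tau> \<simeq> scal c * gen (src \<Lambda> \<tau>)"
    and n': "\<forall>m\<ge>n'. \<forall>\<tau>\<in>paths_le \<Lambda> v m. \<exists>c. poly_adj (gen \<tau>) * g * gen \<tau> \<simeq> scal c * gen (src \<Lambda> \<tau>)" by blast
  have "\<exists>c. poly_adj (gen \<tau>) * (f + g) * gen \<tau> \<simeq> scal c * gen (src \<Lambda> \<tau>)"
    if m: "m \<ge> n + n'" and \<tau>: "\<tau> \<in> paths_le \<Lambda> v m" for m \<tau>
  proof -
    have "m \<ge> n" "m \<ge> n'" using m by (auto simp: less_eq_vec_def intro: order_trans[OF le_add1] order_trans[OF le_add2])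
    with n n' \<tau> obtain c c' where "poly_adj (gen \<tau>) * f * gen \<tau> \<simeq> scal c * gen (src \<Lambda> \<tau>)"
      "poly_adj (gen \<tau>) * g * gen \<tau> \<simeq> scal c' * gen (src \<Lambda> \<tau>)" by blast
    from eqv_add[OF this] show ?thesis
      by (intro exI[of _ "c + c'"]) (simp add: distrib_left distrib_right single_add)
  qed
  then show ?case by blast
next
  case (scal f z)
  then obtain n where n: "\<forall>m\<ge>n. \<forall>\<tau>\<in>paths_le \<Lambda> v m. \<exists>c. poly_adj (gen \<tau>) * f * gen \<tau> \<simeq> scal c * gen (src \<Lambda> \<tau>)"
    by blast
  have "\<exists>c. poly_adj (gen \<tau>) * (scal z * f) * gen \<tau> \<simeq> scal c * gen (src \<Lambda> \<tau>)"
    if m: "m \<ge> n" and \<tau>: "\<tau> \<in> paths_le \<Lambda> v m" for m \<tau>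
  proof -
    obtain c where "poly_adj (gen \<tau>) * f * gen \<tau> \<simeq> scal c * gen (src \<Lambda> \<tau>)" using n m \<tau> by blast
    from eqv_scal[OF this, of z]
    have "scal z * (poly_adj (gen \<tau>) * f * gen \<tau>) \<simeq> scal (z * c) * gen (src \<Lambda> \<tau>)"
      by (simp only: scal_scal)
    moreover have "scal z * (poly_adj (gen \<tau>) * f * gen \<tau>) = poly_adj (gen \<tau>) * (scal z * f) * gen \<tau>"
      by (simp add: mult.assoc mult_scal_right)
    ultimately show ?thesis by auto
  qed
  then show ?case by blast
next
  case (eqv f g)
  then obtain n where n: "\<forall>m\<ge>n. \<forall>\<tau>\<in>paths_le \<Lambda> v m. \<exists>c. poly_adj (gen \<tau>) * f * gen \<tau> \<simeq> scal c * gen (src \<Lambda> \<tau>)"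
    by blast
  have "\<exists>c. poly_adj (gen \<tau>) * g * gen \<tau> \<simeq> scal c * gen (src \<Lambda> \<tau>)"
    if m: "m \<ge> n" and \<tau>: "\<tau> \<in> paths_le \<Lambda> v m" for m \<tau>
  proof -
    have "poly_adj (gen \<tau>) * g * gen \<tau> \<simeq> poly_adj (gen \<tau>) * f * gen \<tau>"
      using paths_leD[OF \<tau>] by (intro eqv_mult_right eqv_mult_left eqv_sym[OF eqv(2)]) auto
    then show ?thesis using n m \<tau> by (meson eqv_trans)
  qed
  then show ?case by blast
qed

end

section \<open>The path representation\<close>

abbreviation (input) lk where "lk \<equiv> Poly_Mapping.lookup"

text \<open>Finitely supported functions on paths, with their inner product inherited from square
  summable functions, linear in the first argument. Operators enter only through their bounds on
  such vectors.\<close>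

definition vinner :: "('v \<Rightarrow>\<^sub>0 complex) \<Rightarrow> ('v \<Rightarrow>\<^sub>0 complex) \<Rightarrow> complex" where
  "vinner \<xi> \<eta> = (\<Sum>\<mu>\<in>Poly_Mapping.keys \<xi>. lk \<xi> \<mu> * cnj (lk \<eta> \<mu>))"

definition vnorm :: "('v \<Rightarrow>\<^sub>0 complex) \<Rightarrow> real" where
  "vnorm \<xi> = L2_set (\<lambda>\<mu>. cmod (lk \<xi> \<mu>)) (Poly_Mapping.keys \<xi>)"

lemma vinner_superset:
  "finite S \<Longrightarrow> Poly_Mapping.keys \<xi> \<subseteq> S \<Longrightarrow> vinner \<xi> \<eta> = (\<Sum>\<mu>\<in>S. lk \<xi> \<mu> * cnj (lk \<eta> \<mu>))"
  unfolding vinner_def by (rule sum.mono_neutral_left) (auto simp: in_keys_iff)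

lemma vnorm_superset:
  "finite S \<Longrightarrow> Poly_Mapping.keys \<xi> \<subseteq> S \<Longrightarrow> vnorm \<xi> = L2_set (\<lambda>\<mu>. cmod (lk \<xi> \<mu>)) S"
  unfolding vnorm_def L2_set_def
  by (rule arg_cong[where f=sqrt], rule sum.mono_neutral_left) (auto simp: in_keys_iff)

lemma vinner_add_left: "vinner (\<xi> + \<xi>') \<eta> = vinner \<xi> \<eta> + vinner \<xi>' \<eta>"
  unfolding vinner_def by (rule setsum_keys_plus_distrib) (auto simp: algebra_simps)

lemma vinner_add_right: "vinner \<xi> (\<eta> + \<eta>') = vinner \<xi> \<eta> + vinner \<xi> \<eta>'"
  by (simp add: vinner_def lookup_add distrib_left sum.distrib)

lemma vinner_zero [simp]: "vinner 0 \<eta> = 0" "vinner \<xi> 0 = 0"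
  by (simp_all add: vinner_def)

lemma vinner_single: "vinner (Poly_Mapping.single \<mu> a) (Poly_Mapping.single \<nu> b) = (if \<mu> = \<nu> then a * cnj b else 0)"
  by (auto simp: vinner_def lookup_single)

lemma vnorm_nonneg [simp]: "0 \<le> vnorm \<xi>"
  by (simp add: vnorm_def L2_set_nonneg)

lemma vnorm_zero [simp]: "vnorm 0 = 0"
  by (simp add: vnorm_def L2_set_def)

lemma vnorm_single [simp]: "vnorm (Poly_Mapping.single \<mu> 1) = 1"
  by (simp add: vnorm_def L2_set_def)

lemma vinner_self: "vinner \<xi> \<xi> = of_real ((vnorm \<xi>)\<^sup>2)"
  by (simp add: vinner_def vnorm_def L2_set_def sum_nonneg complex_norm_square flip: of_real_power)

lemma vinner_le: "cmod (vinner \<xi> \<eta>) \<le> vnorm \<xi> * vnorm \<eta>"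
proof -
  let ?S = "Poly_Mapping.keys \<xi> \<union> Poly_Mapping.keys \<eta>"
  have "cmod (vinner \<xi> \<eta>) \<le> (\<Sum>\<mu>\<in>?S. \<bar>cmod (lk \<xi> \<mu>)\<bar> * \<bar>cmod (lk \<eta> \<mu>)\<bar>)"
    by (subst vinner_superset[of ?S]) (auto intro!: order_trans[OF norm_sum] simp: norm_mult)
  also have "\<dots> \<le> L2_set (\<lambda>\<mu>. cmod (lk \<xi> \<mu>)) ?S * L2_set (\<lambda>\<mu>. cmod (lk \<eta> \<mu>)) ?S"
    by (rule L2_set_mult_ineq)
  also have "\<dots> = vnorm \<xi> * vnorm \<eta>"
    by (simp add: vnorm_superset[of ?S \<xi>] vnorm_superset[of ?S \<eta>])
  finally show ?thesis .
qed

lemma vnorm_triangle: "vnorm (\<xi> + \<eta>) \<le> vnorm \<xi> + vnorm \<eta>"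
proof -
  let ?S = "Poly_Mapping.keys \<xi> \<union> Poly_Mapping.keys \<eta>"
  have "vnorm (\<xi> + \<eta>) = L2_set (\<lambda>\<mu>. cmod (lk \<xi> \<mu> + lk \<eta> \<mu>)) ?S"
    using keys_add[of \<xi> \<eta>] by (simp add: vnorm_superset[of ?S] lookup_add)
  also have "\<dots> \<le> L2_set (\<lambda>\<mu>. cmod (lk \<xi> \<mu>) + cmod (lk \<eta> \<mu>)) ?S"
    by (rule L2_set_mono) (auto intro: norm_triangle_ineq)
  also have "\<dots> \<le> L2_set (\<lambda>\<mu>. cmod (lk \<xi> \<mu>)) ?S + L2_set (\<lambda>\<mu>. cmod (lk \<eta> \<mu>)) ?S"
    by (rule L2_set_triangle_ineq)
  also have "\<dots> = vnorm \<xi> + vnorm \<eta>"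
    by (simp add: vnorm_superset[of ?S \<xi>] vnorm_superset[of ?S \<eta>])
  finally show ?thesis .
qed

text \<open>Used for submultiplicativity of a seminorm defined as an infimum of bounds. Zero factors
  are treated apart because the argument divides by each factor in turn.\<close>

lemma le_Inf_mult_Inf:
  fixes x :: real
  assumes "A \<noteq> {}" "B \<noteq> {}" "\<And>c. c \<in> A \<Longrightarrow> 0 \<le> c" "\<And>d. d \<in> B \<Longrightarrow> 0 \<le> d"
    and le: "\<And>c d. c \<in> A \<Longrightarrow> d \<in> B \<Longrightarrow> x \<le> c * d"
  shows "x \<le> Inf A * Inf B"
proof -
  have nonneg: "0 \<le> Inf A" using assms by (intro cInf_greatest) auto
  have 1: "x \<le> Inf A * d" if d: "d \<in> B" for d
  proof (cases "d = 0")
    case True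
    then show ?thesis using assms(1) le[OF _ d] by auto
  next
    case False
    then have "0 < d" using assms(4)[OF d] by simp
    then have "x / d \<le> Inf A" using assms(1) le[OF _ d] by (intro cInf_greatest) (auto simp: field_simps)
    then show ?thesis using \<open>0 < d\<close> by (simp add: field_simps)
  qed
  show ?thesis
  proof (cases "Inf A = 0")
    case True
    then show ?thesis using assms(2) 1 by auto
  next
    case False
    then have "0 < Inf A" using nonneg by simp
    then have "x / Inf A \<le> Inf B" using assms(2) 1 by (intro cInf_greatest) (auto simp: field_simps)
    then show ?thesis using \<open>0 < Inf A\<close> by (simp add: field_simps)
  qed
qed

context rf_lc_graph
begin

text \<open>A letter \<open>\<kappa>\<close> prepends \<open>\<kappa>\<close> to a path and \<open>\<kappa>\<^sup>*\<close> removes an initial segment \<open>\<kappa>\<close>, if possible.\<close>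

definition act1 :: "'a \<times> bool \<Rightarrow> 'a \<Rightarrow> 'a option" where
  "act1 l \<mu> = (if snd l
     then (if \<exists>\<eta>\<in>mor \<Lambda>. rng \<Lambda> \<eta> = src \<Lambda> (fst l) \<and> \<mu> = cmp \<Lambda> (fst l) \<eta>
       then Some (THE \<eta>. \<eta> \<in> mor \<Lambda> \<and> rng \<Lambda> \<eta> = src \<Lambda> (fst l) \<and> \<mu> = cmp \<Lambda> (fst l) \<eta>) else None)
     else (if \<mu> \<in> mor \<Lambda> \<and> rng \<Lambda> \<mu> = src \<Lambda> (fst l) then Some (cmp \<Lambda> (fst l) \<mu>) else None))"

lemma act1_False: "act1 (\<kappa>, False) \<mu> = Some \<nu> \<longleftrightarrow> \<mu> \<in> mor \<Lambda> \<and> rng \<Lambda> \<mu> = src \<Lambda> \<kappa> \<and> \<nu> = cmp \<Lambda> \<kappa> \<mu>"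
  by (auto simp: act1_def)

lemma act1_True:
  assumes "\<kappa> \<in> mor \<Lambda>"
  shows "act1 (\<kappa>, True) \<mu> = Some \<nu> \<longleftrightarrow> \<nu> \<in> mor \<Lambda> \<and> rng \<Lambda> \<nu> = src \<Lambda> \<kappa> \<and> \<mu> = cmp \<Lambda> \<kappa> \<nu>"
proof -
  have u: "\<eta> = \<eta>'" if "\<eta> \<in> mor \<Lambda>" "rng \<Lambda> \<eta> = src \<Lambda> \<kappa>" "\<eta>' \<in> mor \<Lambda>" "rng \<Lambda> \<eta>' = src \<Lambda> \<kappa>"
    "cmp \<Lambda> \<kappa> \<eta> = cmp \<Lambda> \<kappa> \<eta>'" for \<eta> \<eta>'
    by (rule cmp_cancel(2)[of \<kappa> \<eta> \<kappa> \<eta>']) (use that assms in auto)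
  have t: "(THE \<eta>'. \<eta>' \<in> mor \<Lambda> \<and> rng \<Lambda> \<eta>' = src \<Lambda> \<kappa> \<and> cmp \<Lambda> \<kappa> \<eta> = cmp \<Lambda> \<kappa> \<eta>') = \<eta>"
    if "\<eta> \<in> mor \<Lambda>" "rng \<Lambda> \<eta> = src \<Lambda> \<kappa>" for \<eta>
    using that u by (intro the_equality) blast+
  show ?thesis using t by (auto simp: act1_def)
qed

lemma act1_adj: "fst l \<in> mor \<Lambda> \<Longrightarrow> act1 l \<mu> = Some \<nu> \<longleftrightarrow> act1 (fst l, \<not> snd l) \<nu> = Some \<mu>"
  by (cases l; cases "snd l") (auto simp: act1_False act1_True)

definition act :: "'a star_word \<Rightarrow> 'a \<Rightarrow> 'a option" where
  "act w \<mu> = foldr (\<lambda>l r. Option.bind r (act1 l)) (letters w) (Some \<mu>)"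

lemma act_zero [simp]: "act 0 \<mu> = Some \<mu>"
  by (simp add: act_def zero_star_word_def)

lemma act_letter [simp]: "act (Word [l]) \<mu> = act1 l \<mu>"
  by (simp add: act_def)

lemma act_add: "act (u + v) \<mu> = Option.bind (act v \<mu>) (act u)"
proof -
  let ?b = "\<lambda>l r. Option.bind r (act1 l)"
  have bind: "foldr (\<lambda>l r. Option.bind r (act1 l)) ls r = Option.bind r (\<lambda>\<mu>. foldr (\<lambda>l r. Option.bind r (act1 l)) ls (Some \<mu>))" for ls r
  proof (cases r)
    case None
    then show ?thesis by (induction ls) simp_all
  qed simp
  have "act (u + v) \<mu> = foldr ?b (letters u) (act v \<mu>)" by (simp add: act_def plus_star_word_def)
  also have "\<dots> = Option.bind (act v \<mu>) (\<lambda>\<mu>. foldr ?b (letters u) (Some \<mu>))" by (rule bind)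
  also have "\<dots> = Option.bind (act v \<mu>) (act u)" by (simp add: act_def[abs_def])
  finally show ?thesis .
qed

text \<open>Each letter acts as a partial injection with the opposite letter as its inverse, and
  taking adjoints of words reverses the order of the letters.\<close>

lemma act_adj:
  assumes "fst ` set (letters w) \<subseteq> mor \<Lambda>"
  shows "act w \<mu> = Some \<nu> \<longleftrightarrow> act (word_adj w) \<nu> = Some \<mu>"
proof -
  have "act (Word ls) \<mu> = Some \<nu> \<longleftrightarrow> act (word_adj (Word ls)) \<nu> = Some \<mu>" if "fst ` set ls \<subseteq> mor \<Lambda>" for ls \<mu> \<nu>
    using that
  proof (induction ls arbitrary: \<nu>)
    case Nil
    then show ?case using act_zero unfolding zero_star_word_def by (auto simp: word_adj_def)
  next
    case (Cons l ls)
    have 1: "Word (l # ls) = Word [l] + Word ls" by (simp add: plus_star_word_def)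
    have 2: "word_adj (Word (l # ls)) = word_adj (Word ls) + Word [(fst l, \<not> snd l)]"
      by (simp add: word_adj_def plus_star_word_def case_prod_unfold)
    show ?case unfolding 2 unfolding 1 using Cons act1_adj[of l]
      by (auto simp: act_add bind_eq_Some_conv)
  qed
  from this[of "letters w"] assms show ?thesis by simp
qed

definition tm :: "'a star_word \<Rightarrow> 'a \<Rightarrow> complex \<Rightarrow> ('a \<Rightarrow>\<^sub>0 complex)" where
  "tm w \<mu> a = (case act w \<mu> of None \<Rightarrow> 0 | Some \<nu> \<Rightarrow> Poly_Mapping.single \<nu> a)"

definition path_op :: "'a star_poly \<Rightarrow> ('a \<Rightarrow>\<^sub>0 complex) \<Rightarrow> ('a \<Rightarrow>\<^sub>0 complex)" where
  "path_op f \<xi> = (\<Sum>w\<in>Poly_Mapping.keys f. \<Sum>\<mu>\<in>Poly_Mapping.keys \<xi>. tm w \<mu> (lk f w * lk \<xi> \<mu>))"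

lemma tm_add: "tm w \<mu> (a + b) = tm w \<mu> a + tm w \<mu> b"
  by (auto simp: tm_def single_add split: option.splits)

lemma tm_zero [simp]: "tm w \<mu> 0 = 0"
  by (auto simp: tm_def split: option.splits)

lemma path_op_add_left: "path_op (f + g) \<xi> = path_op f \<xi> + path_op g \<xi>"
  unfolding path_op_def
  by (rule setsum_keys_plus_distrib) (auto simp: distrib_right tm_add sum.distrib)

lemma path_op_add_right: "path_op f (\<xi> + \<eta>) = path_op f \<xi> + path_op f \<eta>"
proof -
  have "(\<Sum>\<mu>\<in>Poly_Mapping.keys (\<xi> + \<eta>). tm w \<mu> (lk f w * lk (\<xi> + \<eta>) \<mu>)) =
      (\<Sum>\<mu>\<in>Poly_Mapping.keys \<xi>. tm w \<mu> (lk f w * lk \<xi> \<mu>)) + (\<Sum>\<mu>\<in>Poly_Mapping.keys \<eta>. tm w \<mu> (lk f w * lk \<eta> \<mu>))" for w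
    by (rule setsum_keys_plus_distrib[where f="\<lambda>\<mu> a. tm w \<mu> (lk f w * a)"]) (auto simp: distrib_left tm_add)
  then show ?thesis by (simp add: path_op_def sum.distrib)
qed

lemma path_op_single [simp]: "path_op (Poly_Mapping.single w c) (Poly_Mapping.single \<mu> a) = tm w \<mu> (c * a)"
  by (simp add: path_op_def)

lemma path_op_zero [simp]: "path_op 0 \<xi> = 0" "path_op f 0 = 0"
  by (simp_all add: path_op_def)

lemma path_op_mult: "path_op (f * g) \<xi> = path_op f (path_op g \<xi>)"
proof (rule additive_eqI[where h="\<lambda>f. path_op (f * g) \<xi>" and k="\<lambda>f. path_op f (path_op g \<xi>)"])
  show "path_op (Poly_Mapping.single w c * g) \<xi> = path_op (Poly_Mapping.single w c) (path_op g \<xi>)" for w c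
  proof (rule additive2_eqI[where h="\<lambda>g \<xi>. path_op (Poly_Mapping.single w c * g) \<xi>"
        and k="\<lambda>g \<xi>. path_op (Poly_Mapping.single w c) (path_op g \<xi>)"])
    show "path_op (Poly_Mapping.single w c * Poly_Mapping.single v d) (Poly_Mapping.single \<mu> a) =
        path_op (Poly_Mapping.single w c) (path_op (Poly_Mapping.single v d) (Poly_Mapping.single \<mu> a))" for v d \<mu> a
      by (simp add: mult_single tm_def act_add mult.assoc split: option.splits)
  qed (auto simp: distrib_left path_op_add_left path_op_add_right)
qed (auto simp: distrib_right path_op_add_left)

lemma path_op_adj:
  assumes "f \<in> F" shows "vinner (path_op f \<xi>) \<eta> = vinner \<xi> (path_op (poly_adj f) \<eta>)"
  using assms
proof (induction arbitrary: \<xi> \<eta> rule: free_induct_words)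
  case (single w c)
  show ?case
  proof (rule additive2_eqI[where h="\<lambda>\<xi> \<eta>. vinner (path_op (Poly_Mapping.single w c) \<xi>) \<eta>"
      and k="\<lambda>\<xi> \<eta>. vinner \<xi> (path_op (poly_adj (Poly_Mapping.single w c)) \<eta>)"])
    fix \<mu> a \<nu> b
    show "vinner (path_op (Poly_Mapping.single w c) (Poly_Mapping.single \<mu> a)) (Poly_Mapping.single \<nu> b) =
      vinner (Poly_Mapping.single \<mu> a) (path_op (poly_adj (Poly_Mapping.single w c)) (Poly_Mapping.single \<nu> b))"
      using act_adj[OF single(2), of \<mu> \<nu>]
      by (auto simp: poly_adj_single tm_def vinner_single split: option.splits)
  qed (auto simp: path_op_add_left path_op_add_right vinner_add_left vinner_add_right)
qed (auto simp: poly_adj_add path_op_add_left vinner_add_left vinner_add_right)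

lemma lookup_path_op_scal: "lk (path_op (scal z) \<xi>) \<mu> = z * lk \<xi> \<mu>"
  by (rule additive_eqI[where h="\<lambda>\<xi>. lk (path_op (scal z) \<xi>) \<mu>"])
    (auto simp: path_op_add_right lookup_add distrib_left tm_def lookup_single when_def)

lemma vnorm_path_op_scal: "vnorm (path_op (scal z) \<xi>) = cmod z * vnorm \<xi>"
proof -
  have "Poly_Mapping.keys (path_op (scal z) \<xi>) \<subseteq> Poly_Mapping.keys \<xi>"
    by (auto simp: in_keys_iff lookup_path_op_scal)
  then have "vnorm (path_op (scal z) \<xi>) = L2_set (\<lambda>\<mu>. cmod z * cmod (lk \<xi> \<mu>)) (Poly_Mapping.keys \<xi>)"
    by (simp add: vnorm_superset[of "Poly_Mapping.keys \<xi>"] lookup_path_op_scal norm_mult)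
  then show ?thesis by (simp add: vnorm_def L2_set_right_distrib)
qed

lemma lookup_path_op_word:
  assumes "fst ` set (letters w) \<subseteq> mor \<Lambda>"
  shows "lk (path_op (Poly_Mapping.single w 1) \<xi>) \<nu> = (case act (word_adj w) \<nu> of None \<Rightarrow> 0 | Some \<mu> \<Rightarrow> lk \<xi> \<mu>)"
proof (rule additive_eqI[where h="\<lambda>\<xi>. lk (path_op (Poly_Mapping.single w 1) \<xi>) \<nu>"])
  show "lk (path_op (Poly_Mapping.single w 1) (Poly_Mapping.single \<mu> a)) \<nu> =
    (case act (word_adj w) \<nu> of None \<Rightarrow> 0 | Some \<mu>' \<Rightarrow> lk (Poly_Mapping.single \<mu> a) \<mu>')" for \<mu> a
    using act_adj[OF assms, of \<mu> \<nu>]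
    by (auto simp: tm_def lookup_single when_def split: option.splits)
qed (auto simp: path_op_add_right lookup_add split: option.splits)

text \<open>A partial injection only relocates coefficients or discards them.\<close>

lemma vnorm_path_op_word:
  assumes "fst ` set (letters w) \<subseteq> mor \<Lambda>"
  shows "vnorm (path_op (Poly_Mapping.single w 1) \<xi>) \<le> vnorm \<xi>"
proof -
  let ?D = "Poly_Mapping.keys (path_op (Poly_Mapping.single w 1) \<xi>)" and ?g = "\<lambda>\<nu>. the (act (word_adj w) \<nu>)"
  have D: "act (word_adj w) \<nu> = Some (?g \<nu>) \<and> lk (path_op (Poly_Mapping.single w 1) \<xi>) \<nu> = lk \<xi> (?g \<nu>) \<and>
      ?g \<nu> \<in> Poly_Mapping.keys \<xi>" if "\<nu> \<in> ?D" for \<nu>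
    using that by (auto simp: in_keys_iff lookup_path_op_word[OF assms] split: option.splits)
  have inj: "inj_on ?g ?D"
  proof (rule inj_onI)
    fix \<nu> \<nu>' assume *: "\<nu> \<in> ?D" "\<nu>' \<in> ?D" "?g \<nu> = ?g \<nu>'"
    then have "act w (?g \<nu>) = Some \<nu>" "act w (?g \<nu>) = Some \<nu>'"
      using D[of \<nu>] D[of \<nu>'] act_adj[OF assms] by auto
    then show "\<nu> = \<nu>'" by simp
  qed
  have "(\<Sum>\<nu>\<in>?D. (cmod (lk (path_op (Poly_Mapping.single w 1) \<xi>) \<nu>))\<^sup>2) = (\<Sum>\<nu>\<in>?D. (cmod (lk \<xi> (?g \<nu>)))\<^sup>2)"
    using D by (intro sum.cong) auto
  also have "\<dots> = (\<Sum>\<mu>\<in>?g ` ?D. (cmod (lk \<xi> \<mu>))\<^sup>2)"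
    by (simp add: sum.reindex[OF inj])
  also have "\<dots> \<le> (\<Sum>\<mu>\<in>Poly_Mapping.keys \<xi>. (cmod (lk \<xi> \<mu>))\<^sup>2)"
    using D by (intro sum_mono2) auto
  finally show ?thesis by (simp add: vnorm_def L2_set_def)
qed

lemma path_op_bounded:
  assumes "f \<in> F" shows "\<exists>c\<ge>0. \<forall>\<xi>. vnorm (path_op f \<xi>) \<le> c * vnorm \<xi>"
  using assms
proof (induction rule: free_induct_words)
  case (single w c)
  have "vnorm (path_op (Poly_Mapping.single w c) \<xi>) \<le> cmod c * vnorm \<xi>" for \<xi>
    using vnorm_path_op_word[OF single(2), of \<xi>]
    by (subst single_scal) (simp only: path_op_mult vnorm_path_op_scal mult_left_mono norm_ge_zero)
  then show ?case by (intro exI[of _ "cmod c"]) auto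
next
  case (add f g)
  then obtain c d where cd: "c \<ge> 0" "d \<ge> 0" "\<And>\<xi>. vnorm (path_op f \<xi>) \<le> c * vnorm \<xi>" "\<And>\<xi>. vnorm (path_op g \<xi>) \<le> d * vnorm \<xi>"
    by blast
  have "vnorm (path_op (f + g) \<xi>) \<le> (c + d) * vnorm \<xi>" for \<xi>
    using vnorm_triangle[of "path_op f \<xi>" "path_op g \<xi>"] cd(3)[of \<xi>] cd(4)[of \<xi>]
    by (simp add: path_op_add_left distrib_right)
  then show ?case using cd by (intro exI[of _ "c + d"]) auto
qed (auto intro: exI[of _ 0])

text \<open>The relation \<open>s\<^sub>v = \<Sum> s\<^sub>\<kappa> s\<^sub>\<kappa>\<^sup>*\<close> holds in the path representation only on sufficiently long paths,
  those in \<open>long_paths j\<close> for large \<open>j\<close>; the seminorm below ignores all others.\<close>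

definition long_paths :: "nat \<Rightarrow> 'a set" where
  "long_paths j = {\<mu> \<in> mor \<Lambda>. \<forall>i. deg \<Lambda> \<mu> $ i < j \<longrightarrow> paths \<Lambda> (src \<Lambda> \<mu>) (axis i 1) = {}}"

lemma long_paths_antimono: "j \<le> j' \<Longrightarrow> long_paths j' \<subseteq> long_paths j"
  by (auto simp: long_paths_def)

text \<open>Only adjoint letters shorten a path, in each coordinate by at most the total degree of
  the letter. The loss \<open>l\<close> therefore depends on the word alone.\<close>

lemma act_long_paths:
  assumes "fst ` set (letters w) \<subseteq> mor \<Lambda>"
  shows "\<exists>l. \<forall>j \<mu> \<nu>. \<mu> \<in> long_paths (j + l) \<longrightarrow> act w \<mu> = Some \<nu> \<longrightarrow> \<nu> \<in> long_paths j"
proof -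
  have letter: "\<exists>m. \<forall>j \<mu> \<nu>. \<mu> \<in> long_paths (j + m) \<longrightarrow> act1 l \<mu> = Some \<nu> \<longrightarrow> \<nu> \<in> long_paths j" if "fst l \<in> mor \<Lambda>" for l
  proof -
    obtain \<kappa> b where l: "l = (\<kappa>, b)" "\<kappa> \<in> mor \<Lambda>" using \<open>fst l \<in> mor \<Lambda>\<close> by (cases l) auto
    define m where "m = (\<Sum>i\<in>UNIV. deg \<Lambda> \<kappa> $ i)"
    have m: "deg \<Lambda> \<kappa> $ i \<le> m" for i unfolding m_def by (rule member_le_sum) auto
    have "\<nu> \<in> long_paths j" if "\<mu> \<in> long_paths (j + m)" "act1 l \<mu> = Some \<nu>" for j \<mu> \<nu>
    proof (cases b)
      case True
      then have *: "\<nu> \<in> mor \<Lambda>" "rng \<Lambda> \<nu> = src \<Lambda> \<kappa>" "\<mu> = cmp \<Lambda> \<kappa> \<nu>" using that l by (auto simp: act1_True)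
      have "deg \<Lambda> \<mu> $ i < j + m" if "deg \<Lambda> \<nu> $ i < j" for i
        using * l that m[of i] by simp
      then show ?thesis using * l that by (auto simp: long_paths_def)
    next
      case False
      then have *: "\<mu> \<in> mor \<Lambda>" "rng \<Lambda> \<mu> = src \<Lambda> \<kappa>" "\<nu> = cmp \<Lambda> \<kappa> \<mu>" using that l by (auto simp: act1_False)
      then show ?thesis using l that(1) by (auto simp: long_paths_def)
    qed
    then show ?thesis by blast
  qed
  have "\<exists>l. \<forall>j \<mu> \<nu>. \<mu> \<in> long_paths (j + l) \<longrightarrow> act (Word ls) \<mu> = Some \<nu> \<longrightarrow> \<nu> \<in> long_paths j"
    if "fst ` set ls \<subseteq> mor \<Lambda>" for ls
    using that
  proof (induction ls)
    case Nil
    then show ?case using act_zero unfolding zero_star_word_def by (intro exI[of _ 0]) auto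
  next
    case (Cons l ls)
    then obtain m where m: "\<And>j \<mu> \<nu>. \<mu> \<in> long_paths (j + m) \<Longrightarrow> act (Word ls) \<mu> = Some \<nu> \<Longrightarrow> \<nu> \<in> long_paths j"
      by auto
    obtain n where n: "\<And>j \<mu> \<nu>. \<mu> \<in> long_paths (j + n) \<Longrightarrow> act1 l \<mu> = Some \<nu> \<Longrightarrow> \<nu> \<in> long_paths j"
      using letter[of l] Cons by auto
    have 1: "Word (l # ls) = Word [l] + Word ls" by (simp add: plus_star_word_def)
    have "\<nu> \<in> long_paths j" if "\<mu> \<in> long_paths (j + (n + m))" "act (Word (l # ls)) \<mu> = Some \<nu>" for j \<mu> \<nu>
      using that m[of \<mu> "j + n"] n unfolding 1 by (auto simp: act_add bind_eq_Some_conv add.assoc)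
    then show ?case by blast
  qed
  from this[of "letters w"] assms show ?thesis by simp
qed

text \<open>Composing bounds, as in \<open>bounds_mult\<close>, requires that the image of a vector
  on long paths is again supported on long paths; a shift independent of \<open>j\<close> and
  \<open>\<xi>\<close> achieves this.\<close>

lemma path_op_long_paths:
  assumes "f \<in> F"
  shows "\<exists>l. \<forall>j \<xi>. Poly_Mapping.keys \<xi> \<subseteq> long_paths (j + l) \<longrightarrow> Poly_Mapping.keys (path_op f \<xi>) \<subseteq> long_paths j"
  using assms
proof (induction rule: free_induct_words)
  case (single w c)
  obtain l where l: "\<And>j \<mu> \<nu>. \<mu> \<in> long_paths (j + l) \<Longrightarrow> act w \<mu> = Some \<nu> \<Longrightarrow> \<nu> \<in> long_paths j"
    using act_long_paths[OF single(2)] by blast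
  have "Poly_Mapping.keys (path_op (Poly_Mapping.single w c) \<xi>) \<subseteq> long_paths j"
    if \<xi>: "Poly_Mapping.keys \<xi> \<subseteq> long_paths (j + l)" for j \<xi>
  proof
    fix \<nu> assume "\<nu> \<in> Poly_Mapping.keys (path_op (Poly_Mapping.single w c) \<xi>)"
    then obtain \<mu> where "act (word_adj w) \<nu> = Some \<mu>" "lk \<xi> \<mu> \<noteq> 0"
      by (subst (asm) single_scal)
        (auto simp: in_keys_iff path_op_mult lookup_path_op_scal lookup_path_op_word[OF single(2)] split: option.splits)
    then show "\<nu> \<in> long_paths j" using l[of \<mu> j \<nu>] \<xi> act_adj[OF single(2)] by (auto simp: in_keys_iff)
  qed
  then show ?case by blast
next
  case (add f g)
  then obtain l m where l: "\<And>j \<xi>. Poly_Mapping.keys \<xi> \<subseteq> long_paths (j + l) \<Longrightarrow> Poly_Mapping.keys (path_op f \<xi>) \<subseteq> long_paths j"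
    and m: "\<And>j \<xi>. Poly_Mapping.keys \<xi> \<subseteq> long_paths (j + m) \<Longrightarrow> Poly_Mapping.keys (path_op g \<xi>) \<subseteq> long_paths j" by blast
  have "Poly_Mapping.keys (path_op (f + g) \<xi>) \<subseteq> long_paths j" if "Poly_Mapping.keys \<xi> \<subseteq> long_paths (j + (l + m))" for j \<xi>
  proof -
    have "long_paths (j + (l + m)) \<subseteq> long_paths (j + l)" "long_paths (j + (l + m)) \<subseteq> long_paths (j + m)"
      by (auto intro!: long_paths_antimono)
    then have "Poly_Mapping.keys (path_op f \<xi>) \<subseteq> long_paths j" "Poly_Mapping.keys (path_op g \<xi>) \<subseteq> long_paths j"
      using l m that by blast+
    then show ?thesis using keys_add[of "path_op f \<xi>" "path_op g \<xi>"] by (simp add: path_op_add_left) blast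
  qed
  then show ?case by blast
qed auto

text \<open>The infimum of these numbers is the limit, as \<open>j\<close> grows, of the operator
  norms on vectors supported in \<open>long_paths j\<close>. Working with admissible bounds lets the
  threshold \<open>j\<close> be enlarged freely.\<close>

definition bounds :: "'a star_poly \<Rightarrow> real set" where
  "bounds f = {c. 0 \<le> c \<and> (\<exists>j. \<forall>\<xi>. Poly_Mapping.keys \<xi> \<subseteq> long_paths j \<longrightarrow> vnorm (path_op f \<xi>) \<le> c * vnorm \<xi>)}"

definition path_seminorm :: "'a star_poly \<Rightarrow> real" where
  "path_seminorm f = Inf (bounds f)"

lemma bounds_nonempty:
  assumes "f \<in> F" shows "bounds f \<noteq> {}"
proof -
  obtain c where "0 \<le> c" "\<forall>\<xi>. vnorm (path_op f \<xi>) \<le> c * vnorm \<xi>" using path_op_bounded[OF assms] by blast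
  then have "c \<in> bounds f" by (simp add: bounds_def)
  then show ?thesis by auto
qed

lemma bounds_nonneg: "c \<in> bounds f \<Longrightarrow> 0 \<le> c"
  by (simp add: bounds_def)

lemma path_seminorm_le: "c \<in> bounds f \<Longrightarrow> path_seminorm f \<le> c"
  unfolding path_seminorm_def by (rule cInf_lower) (auto intro!: bdd_belowI[of _ 0] bounds_nonneg)

lemma path_seminorm_greatest: "f \<in> F \<Longrightarrow> (\<And>c. c \<in> bounds f \<Longrightarrow> x \<le> c) \<Longrightarrow> x \<le> path_seminorm f"
  unfolding path_seminorm_def by (rule cInf_greatest[OF bounds_nonempty])

lemma bounds_add:
  assumes "c \<in> bounds f" "d \<in> bounds g" shows "c + d \<in> bounds (f + g)"
proof -
  obtain j j' where j: "\<forall>\<xi>. Poly_Mapping.keys \<xi> \<subseteq> long_paths j \<longrightarrow> vnorm (path_op f \<xi>) \<le> c * vnorm \<xi>"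
    and j': "\<forall>\<xi>. Poly_Mapping.keys \<xi> \<subseteq> long_paths j' \<longrightarrow> vnorm (path_op g \<xi>) \<le> d * vnorm \<xi>"
    using assms by (auto simp: bounds_def)
  have "vnorm (path_op (f + g) \<xi>) \<le> (c + d) * vnorm \<xi>" if "Poly_Mapping.keys \<xi> \<subseteq> long_paths (max j j')" for \<xi>
  proof -
    have "Poly_Mapping.keys \<xi> \<subseteq> long_paths j" "Poly_Mapping.keys \<xi> \<subseteq> long_paths j'"
      using that long_paths_antimono[of j "max j j'"] long_paths_antimono[of j' "max j j'"] by auto
    then have "vnorm (path_op f \<xi>) \<le> c * vnorm \<xi>" "vnorm (path_op g \<xi>) \<le> d * vnorm \<xi>" using j j' by auto
    then show ?thesis
      using vnorm_triangle[of "path_op f \<xi>" "path_op g \<xi>"] by (simp add: path_op_add_left distrib_right)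
  qed
  then show ?thesis using assms by (auto simp: bounds_def)
qed

lemma bounds_scal: "c \<in> bounds f \<Longrightarrow> cmod z * c \<in> bounds (scal z * f)"
  unfolding bounds_def by (fastforce simp: path_op_mult vnorm_path_op_scal mult.assoc intro!: mult_left_mono)

lemma bounds_mult:
  assumes "c \<in> bounds f" "d \<in> bounds g" "g \<in> F" shows "c * d \<in> bounds (f * g)"
proof -
  obtain j j' where j: "\<forall>\<xi>. Poly_Mapping.keys \<xi> \<subseteq> long_paths j \<longrightarrow> vnorm (path_op f \<xi>) \<le> c * vnorm \<xi>"
    and j': "\<forall>\<xi>. Poly_Mapping.keys \<xi> \<subseteq> long_paths j' \<longrightarrow> vnorm (path_op g \<xi>) \<le> d * vnorm \<xi>"
    and cd: "0 \<le> c" "0 \<le> d"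
    using assms by (auto simp: bounds_def)
  obtain l where l: "\<And>j \<xi>. Poly_Mapping.keys \<xi> \<subseteq> long_paths (j + l) \<Longrightarrow> Poly_Mapping.keys (path_op g \<xi>) \<subseteq> long_paths j"
    using path_op_long_paths[OF assms(3)] by blast
  have "vnorm (path_op (f * g) \<xi>) \<le> c * d * vnorm \<xi>" if "Poly_Mapping.keys \<xi> \<subseteq> long_paths (max (j + l) j')" for \<xi>
  proof -
    have "Poly_Mapping.keys \<xi> \<subseteq> long_paths (j + l)" "Poly_Mapping.keys \<xi> \<subseteq> long_paths j'"
      using that long_paths_antimono[of "j + l" "max (j + l) j'"] long_paths_antimono[of j' "max (j + l) j'"] by auto
    then have "vnorm (path_op f (path_op g \<xi>)) \<le> c * vnorm (path_op g \<xi>)" "vnorm (path_op g \<xi>) \<le> d * vnorm \<xi>"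
      using j j' l by auto
    then show ?thesis using cd mult_left_mono[of "vnorm (path_op g \<xi>)" "d * vnorm \<xi>" c] by (simp add: path_op_mult)
  qed
  then show ?thesis using cd by (auto simp: bounds_def)
qed

lemma vnorm_square: "f \<in> F \<Longrightarrow> (vnorm (path_op f \<xi>))\<^sup>2 \<le> vnorm \<xi> * vnorm (path_op (poly_adj f) (path_op f \<xi>))"
proof -
  assume f: "f \<in> F"
  have "(vnorm (path_op f \<xi>))\<^sup>2 = cmod (vinner (path_op f \<xi>) (path_op f \<xi>))"
    by (simp add: vinner_self norm_power)
  also have "\<dots> = cmod (vinner \<xi> (path_op (poly_adj f) (path_op f \<xi>)))" by (simp add: path_op_adj[OF f])
  also have "\<dots> \<le> vnorm \<xi> * vnorm (path_op (poly_adj f) (path_op f \<xi>))" by (rule vinner_le)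
  finally show ?thesis .
qed

lemma bounds_sqrt:
  assumes "c \<in> bounds (poly_adj f * f)" "f \<in> F" shows "sqrt c \<in> bounds f"
proof -
  obtain j where j: "\<forall>\<xi>. Poly_Mapping.keys \<xi> \<subseteq> long_paths j \<longrightarrow> vnorm (path_op (poly_adj f * f) \<xi>) \<le> c * vnorm \<xi>"
    and c: "0 \<le> c" using assms by (auto simp: bounds_def)
  have "vnorm (path_op f \<xi>) \<le> sqrt c * vnorm \<xi>" if "Poly_Mapping.keys \<xi> \<subseteq> long_paths j" for \<xi>
  proof (rule power2_le_imp_le)
    have "vnorm \<xi> * vnorm (path_op (poly_adj f) (path_op f \<xi>)) \<le> vnorm \<xi> * (c * vnorm \<xi>)"
      using j that by (intro mult_left_mono) (auto simp: path_op_mult)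
    then show "(vnorm (path_op f \<xi>))\<^sup>2 \<le> (sqrt c * vnorm \<xi>)\<^sup>2"
      using vnorm_square[OF assms(2), of \<xi>] c by (simp add: power_mult_distrib power2_eq_square[of "vnorm \<xi>"] algebra_simps)
  qed (use c in auto)
  then show ?thesis using c by (auto simp: bounds_def)
qed

text \<open>The square of the norm of \<open>f\<^sup>* \<xi>\<close> is at most the norm of
  \<open>\<xi>\<close> times that of \<open>f f\<^sup>* \<xi>\<close>. To bound the latter,
  \<open>f\<^sup>* \<xi>\<close> must still live on \<open>long_paths j\<close>, which explains the
  larger threshold \<open>j + l\<close>.\<close>

lemma bounds_adj:
  assumes "c \<in> bounds f" "f \<in> F" shows "c \<in> bounds (poly_adj f)"
proof -
  obtain j where j: "\<forall>\<xi>. Poly_Mapping.keys \<xi> \<subseteq> long_paths j \<longrightarrow> vnorm (path_op f \<xi>) \<le> c * vnorm \<xi>"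
    and c: "0 \<le> c" using assms by (auto simp: bounds_def)
  obtain l where l: "\<And>j \<xi>. Poly_Mapping.keys \<xi> \<subseteq> long_paths (j + l) \<Longrightarrow> Poly_Mapping.keys (path_op (poly_adj f) \<xi>) \<subseteq> long_paths j"
    using path_op_long_paths[of "poly_adj f"] assms by blast
  have "vnorm (path_op (poly_adj f) \<xi>) \<le> c * vnorm \<xi>" if "Poly_Mapping.keys \<xi> \<subseteq> long_paths (j + l)" for \<xi>
  proof (cases "vnorm (path_op (poly_adj f) \<xi>) = 0")
    case False
    let ?y = "vnorm (path_op (poly_adj f) \<xi>)"
    have "?y\<^sup>2 \<le> vnorm \<xi> * vnorm (path_op f (path_op (poly_adj f) \<xi>))"
      using vnorm_square[of "poly_adj f" \<xi>] assms by simp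
    also have "\<dots> \<le> vnorm \<xi> * (c * ?y)" using j l[OF that] by (intro mult_left_mono) auto
    finally have "?y * ?y \<le> (c * vnorm \<xi>) * ?y" by (simp add: power2_eq_square algebra_simps)
    then show ?thesis using False vnorm_nonneg[of "path_op (poly_adj f) \<xi>"] by simp
  qed (use c in simp)
  then show ?thesis using c by (auto simp: bounds_def)
qed

lemma cstar_path_seminorm: "cstar_seminorm (mor \<Lambda>) path_seminorm"
  unfolding cstar_seminorm_def
proof (intro ballI conjI allI)
  fix a assume a: "a \<in> F"
  show nn: "0 \<le> path_seminorm a" using a bounds_nonneg by (rule path_seminorm_greatest)
  have mult: "path_seminorm (f * g) \<le> path_seminorm f * path_seminorm g" if "f \<in> F" "g \<in> F" for f g
    unfolding path_seminorm_def[of f] path_seminorm_def[of g]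
    using that by (intro le_Inf_mult_Inf bounds_nonempty) (auto intro: bounds_nonneg path_seminorm_le bounds_mult)
  have adj: "path_seminorm (poly_adj a) \<le> path_seminorm a"
    using a by (rule path_seminorm_greatest) (auto intro: path_seminorm_le bounds_adj a)
  show "path_seminorm (poly_adj a * a) = (path_seminorm a)\<^sup>2"
  proof (rule antisym)
    have "path_seminorm (poly_adj a * a) \<le> path_seminorm (poly_adj a) * path_seminorm a"
      using a by (intro mult) auto
    also have "\<dots> \<le> path_seminorm a * path_seminorm a" using adj nn by (intro mult_right_mono) auto
    finally show "path_seminorm (poly_adj a * a) \<le> (path_seminorm a)\<^sup>2" by (simp add: power2_eq_square)
    have "(path_seminorm a)\<^sup>2 \<le> c" if c: "c \<in> bounds (poly_adj a * a)" for c
    proof -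
      have "path_seminorm a \<le> sqrt c" using bounds_sqrt[OF c a] by (rule path_seminorm_le)
      then have "(path_seminorm a)\<^sup>2 \<le> (sqrt c)\<^sup>2" using nn by (intro power_mono) auto
      then show ?thesis using bounds_nonneg[OF c] by simp
    qed
    then show "(path_seminorm a)\<^sup>2 \<le> path_seminorm (poly_adj a * a)" using a by (intro path_seminorm_greatest) auto
  qed
  have scal_le: "path_seminorm (scal z * f) \<le> cmod z * path_seminorm f" if f: "f \<in> F" for z f
  proof (cases "z = 0")
    case True
    have "path_seminorm (scal z * f) \<le> cmod z * c" if "c \<in> bounds f" for c
      using bounds_scal[OF that, of z] by (rule path_seminorm_le)
    then show ?thesis using bounds_nonempty[OF f] True by auto
  next
    case False
    have "path_seminorm (scal z * f) / cmod z \<le> path_seminorm f"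
    proof (rule path_seminorm_greatest[OF f])
      fix c assume "c \<in> bounds f"
      then have "path_seminorm (scal z * f) \<le> cmod z * c" by (intro path_seminorm_le bounds_scal)
      then show "path_seminorm (scal z * f) / cmod z \<le> c" using False by (simp add: field_simps)
    qed
    then show ?thesis using False by (simp add: field_simps)
  qed
  show "path_seminorm (poly_scale z a) = cmod z * path_seminorm a" for z
    unfolding poly_scale_scal
  proof (rule antisym)
    show "path_seminorm (scal z * a) \<le> cmod z * path_seminorm a" using a by (rule scal_le)
    show "cmod z * path_seminorm a \<le> path_seminorm (scal z * a)"
    proof (cases "z = 0")
      case False
      have "scal (1 / z) * (scal z * a) = a" using False by (simp add: scal_scal)
      then show ?thesis using scal_le[of "scal z * a" "1 / z"] a False by (simp add: norm_divide field_simps)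
    next
      case True
      have "0 \<le> path_seminorm 0" by (rule path_seminorm_greatest) (auto intro: bounds_nonneg)
      then show ?thesis using True by simp
    qed
  qed
  fix b assume b: "b \<in> F"
  show "path_seminorm (a * b) \<le> path_seminorm a * path_seminorm b" by (rule mult[OF a b])
  have "path_seminorm (a + b) - d \<le> path_seminorm a" if "d \<in> bounds b" for d
    using a by (rule path_seminorm_greatest) (use bounds_add[OF _ that, THEN path_seminorm_le, of _ a] in \<open>auto simp: algebra_simps\<close>)
  then have "path_seminorm (a + b) - path_seminorm a \<le> path_seminorm b"
    using b by (intro path_seminorm_greatest) (auto simp: algebra_simps)
  then show "path_seminorm (a + b) \<le> path_seminorm a + path_seminorm b" by simp
qed

section \<open>The relators act as zero on long paths\<close>

lemma path_op_gen:
  "path_op (gen \<kappa>) (Poly_Mapping.single \<mu> a) =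
    (if \<mu> \<in> mor \<Lambda> \<and> rng \<Lambda> \<mu> = src \<Lambda> \<kappa> then Poly_Mapping.single (cmp \<Lambda> \<kappa> \<mu>) a else 0)"
  by (auto simp: gen_def tm_def act1_def)

lemma path_op_adj_gen_cmp:
  assumes "\<kappa> \<in> mor \<Lambda>" "\<nu> \<in> mor \<Lambda>" "rng \<Lambda> \<nu> = src \<Lambda> \<kappa>"
  shows "path_op (poly_adj (gen \<kappa>)) (Poly_Mapping.single (cmp \<Lambda> \<kappa> \<nu>) a) = Poly_Mapping.single \<nu> a"
proof -
  have "act1 (\<kappa>, True) (cmp \<Lambda> \<kappa> \<nu>) = Some \<nu>" using assms by (simp add: act1_True)
  then show ?thesis by (simp add: gen_def poly_adj_single word_adj_def tm_def)
qed

lemma path_op_adj_gen_zero: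
  assumes "\<not> (\<exists>\<nu>\<in>mor \<Lambda>. rng \<Lambda> \<nu> = src \<Lambda> \<kappa> \<and> \<mu> = cmp \<Lambda> \<kappa> \<nu>)"
  shows "path_op (poly_adj (gen \<kappa>)) (Poly_Mapping.single \<mu> a) = 0"
proof -
  have "act1 (\<kappa>, True) \<mu> = None" using assms by (auto simp: act1_def)
  then show ?thesis by (simp add: gen_def poly_adj_single word_adj_def tm_def)
qed

lemma path_op_diff_left: "path_op (f - g) \<xi> = path_op f \<xi> - path_op g \<xi>"
  using path_op_add_left[of "f - g" g \<xi>] by simp

lemma path_op_sum_left: "path_op (sum h S) \<xi> = (\<Sum>x\<in>S. path_op (h x) \<xi>)"
  by (induction S rule: infinite_finite_induct) (auto simp: path_op_add_left)

text \<open>All relators but those of the sum relation vanish on every path. For a sum over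
  \<open>paths_le \<Lambda> v n\<close>, a path from \<open>v\<close> that is long compared with
  \<open>n\<close> has exactly one initial segment in that set, and only this summand acts on it, as
  the identity.\<close>

lemma path_op_relator:
  assumes "x \<in> ck_relators \<Lambda>"
  shows "\<exists>j. \<forall>\<mu>\<in>long_paths j. \<forall>a. path_op x (Poly_Mapping.single \<mu> a) = 0"
proof -
  have mor: "\<mu> \<in> mor \<Lambda>" if "\<mu> \<in> long_paths j" for \<mu> j using that by (simp add: long_paths_def)
  from assms show ?thesis
  proof (cases rule: ck_relator_cases)
    case (pi \<kappa>)
    have "path_op x (Poly_Mapping.single \<mu> a) = 0" if "\<mu> \<in> mor \<Lambda>" for \<mu> a
      using that pi by (auto simp: path_op_diff_left path_op_mult path_op_gen path_op_adj_gen_cmp)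
    then show ?thesis using mor by blast
  next
    case (vw v w)
    have "path_op x (Poly_Mapping.single \<mu> a) = 0" if "\<mu> \<in> mor \<Lambda>" for \<mu> a
      using that vw by (auto simp: path_op_diff_left path_op_mult path_op_gen)
    then show ?thesis using mor by blast
  next
    case (cmp \<kappa> \<mu>)
    have "path_op x (Poly_Mapping.single \<nu> a) = 0" if "\<nu> \<in> mor \<Lambda>" for \<nu> a
      using that cmp by (auto simp: path_op_diff_left path_op_mult path_op_gen cmp_assoc)
    then show ?thesis using mor by blast
  next
    case (src \<kappa>)
    have "path_op x (Poly_Mapping.single \<mu> a) = 0" if \<mu>: "\<mu> \<in> mor \<Lambda>" for \<mu> a
    proof -
      have "cmp \<Lambda> (src \<Lambda> \<kappa>) \<mu> = \<mu>" if "rng \<Lambda> \<mu> = src \<Lambda> \<kappa>" using cmp_id_left[OF \<mu>] that by simp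
      then show ?thesis using \<mu> src by (auto simp: path_op_diff_left path_op_mult path_op_gen path_op_adj_gen_cmp)
    qed
    then show ?thesis using mor by blast
  next
    case (sum v n)
    define j where "j = (\<Sum>i\<in>UNIV. n $ i)"
    have nj: "n $ i \<le> j" for i unfolding j_def by (rule member_le_sum) auto
    have "path_op x (Poly_Mapping.single \<mu> a) = 0" if \<mu>: "\<mu> \<in> long_paths j" for \<mu> a
    proof (cases "rng \<Lambda> \<mu> = v")
      case False
      have z: "path_op (poly_adj (gen \<kappa>)) (Poly_Mapping.single \<mu> a) = 0" if "\<kappa> \<in> paths_le \<Lambda> v n" for \<kappa>
        using False paths_leD[OF that] by (intro path_op_adj_gen_zero) auto
      then show ?thesis
        using False sum by (simp add: path_op_diff_left path_op_mult path_op_gen path_op_sum_left)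
    next
      case True
      \<comment> \<open>A coordinate of \<open>deg \<Lambda> \<mu>\<close> lies below
        \<open>m\<close> only if it lies below \<open>j\<close>, so a path in
        \<open>long_paths j\<close> belongs to \<open>paths_le \<Lambda> v m\<close>; moreover
        \<open>n \<le> m\<close>.\<close>
      define m where "m = (\<chi> i. max j (deg \<Lambda> \<mu> $ i))"
      have "\<mu> \<in> paths_le \<Lambda> v m" using \<mu> True by (auto simp: paths_le_def long_paths_def m_def less_eq_vec_def)
      moreover have "n \<le> m" using nj by (auto simp: m_def less_eq_vec_def le_max_iff_disj)
      ultimately obtain \<kappa>0 \<eta>0 where k0: "\<kappa>0 \<in> paths_le \<Lambda> v n" "\<eta>0 \<in> mor \<Lambda>" "src \<Lambda> \<kappa>0 = rng \<Lambda> \<eta>0" "\<mu> = cmp \<Lambda> \<kappa>0 \<eta>0"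
        by (rule paths_le_factor)
      note k0' = paths_leD[OF k0(1)]
      have "path_op (gen \<kappa> * poly_adj (gen \<kappa>)) (Poly_Mapping.single \<mu> a) = (if \<kappa> = \<kappa>0 then Poly_Mapping.single \<mu> a else 0)"
        if k: "\<kappa> \<in> paths_le \<Lambda> v n" for \<kappa>
      proof (cases "\<kappa> = \<kappa>0")
        case True
        have "path_op (poly_adj (gen \<kappa>0)) (Poly_Mapping.single \<mu> a) = Poly_Mapping.single \<eta>0 a"
          unfolding k0(4) using k0' k0(2,3) by (intro path_op_adj_gen_cmp) auto
        then show ?thesis using True k0(2,3) k0' by (simp add: path_op_mult path_op_gen k0(4)[symmetric])
      next
        case False
        then have "path_op (poly_adj (gen \<kappa>)) (Poly_Mapping.single \<mu> a) = 0"
          using paths_le_unique(1)[OF k _ _ k0(1-3)] k0(4) by (intro path_op_adj_gen_zero) metis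
        then show ?thesis using False by (simp add: path_op_mult)
      qed
      then have "path_op (\<Sum>\<kappa>\<in>paths_le \<Lambda> v n. gen \<kappa> * poly_adj (gen \<kappa>)) (Poly_Mapping.single \<mu> a) = Poly_Mapping.single \<mu> a"
        using k0(1) finite_paths_le[OF sum(1)] by (simp add: path_op_sum_left)
      moreover have "path_op (gen v) (Poly_Mapping.single \<mu> a) = Poly_Mapping.single \<mu> a"
        using True sum(1) mor[OF \<mu>] cmp_id_left[OF mor[OF \<mu>]] by (simp add: path_op_gen)
      ultimately show ?thesis by (simp add: sum(2) path_op_diff_left)
    qed
    then show ?thesis by blast
  qed
qed

lemma path_seminorm_relator:
  assumes "x \<in> ck_relators \<Lambda>" shows "path_seminorm x = 0"
proof -
  obtain j where j: "\<And>\<mu> a. \<mu> \<in> long_paths j \<Longrightarrow> path_op x (Poly_Mapping.single \<mu> a) = 0"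
    using path_op_relator[OF assms] by blast
  have "path_op x \<xi> = 0" if "Poly_Mapping.keys \<xi> \<subseteq> long_paths j" for \<xi>
    by (rule poly_mapping_sum_induct[of "\<lambda>\<xi>. path_op x \<xi> = 0"]) (use that j in \<open>auto simp: path_op_add_right\<close>)
  then have 0: "0 \<in> bounds x" unfolding bounds_def by (auto intro!: exI[of _ j])
  have "0 \<le> path_seminorm x" unfolding path_seminorm_def
    using 0 by (intro cInf_greatest) (auto intro: bounds_nonneg)
  with path_seminorm_le[OF 0] show ?thesis by simp
qed

text \<open>For every \<open>j\<close> the nonempty set \<open>paths_le\<close> at the constant
  degree \<open>j\<close> supplies a long path from \<open>v\<close>. It is fixed by
  \<open>gen v\<close>, so no bound below 1 is admissible.\<close>

lemma U_vertex: "v \<in> vertices \<Lambda> \<Longrightarrow> 0 < U (gen v)"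
proof -
  assume v: "v \<in> vertices \<Lambda>"
  have "1 \<le> path_seminorm (gen v)"
  proof (rule path_seminorm_greatest)
    fix c assume "c \<in> bounds (gen v)"
    then obtain j where j: "\<And>\<xi>. Poly_Mapping.keys \<xi> \<subseteq> long_paths j \<Longrightarrow> vnorm (path_op (gen v) \<xi>) \<le> c * vnorm \<xi>"
      by (auto simp: bounds_def)
    obtain \<mu> where \<mu>: "\<mu> \<in> paths_le \<Lambda> v (\<chi> i. j)" using paths_le_nonempty[OF v] by blast
    then have "\<mu> \<in> long_paths j" by (auto simp: paths_le_def long_paths_def)
    moreover have "path_op (gen v) (Poly_Mapping.single \<mu> 1) = Poly_Mapping.single \<mu> 1"
      using v paths_leD[OF \<mu>] cmp_id_left[of \<mu>] by (simp add: path_op_gen)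
    ultimately show "1 \<le> c" using j[of "Poly_Mapping.single \<mu> 1"] by simp
  qed (use v in auto)
  moreover have "path_seminorm (gen v) \<le> U (gen v)"
    using v cstar_path_seminorm path_seminorm_relator by (intro universal_upper) auto
  ultimately show ?thesis by simp
qed

end

section \<open>The gauge action\<close>

text \<open>The quantitative form of \<open>p_projection\<close>: small defects confine
  \<open>p k\<close> to a neighbourhood of 0 or of 1.\<close>

lemma (in free_seminorm) p_near_projection:
  assumes "k \<in> F" "p (k * k - k) \<le> a" "p (poly_adj k - k) \<le> b"
  shows "\<bar>(p k)\<^sup>2 - p k\<bar> \<le> a + b * p k"
proof -
  have "\<bar>p (poly_adj k * k) - p (k * k)\<bar> \<le> p (poly_adj k * k - k * k)"
    using assms by (intro p_abs_diff) auto
  also have "\<dots> \<le> p (poly_adj k - k) * p k"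
    using p_mult[of "poly_adj k - k" k] assms by (simp add: algebra_simps)
  also have "\<dots> \<le> b * p k" using assms by (intro mult_right_mono) auto
  finally have "\<bar>(p k)\<^sup>2 - p (k * k)\<bar> \<le> b * p k" using assms by (simp add: p_cstar)
  moreover have "\<bar>p (k * k) - p k\<bar> \<le> a" using assms p_abs_diff[of "k * k" k] by simp
  ultimately show ?thesis by linarith
qed

text \<open>Orthogonality of the characters of the cyclic group of order \<open>M\<close>; the bound
  on \<open>d\<close> excludes nonzero multiples of \<open>M\<close>.\<close>

lemma sum_roots_of_unity:
  assumes "0 < M" "\<bar>d\<bar> < int M"
  shows "(\<Sum>l<M. cis (2 * pi * real l / real M * real_of_int d)) = (if d = 0 then of_nat M else 0)"
proof (cases "d = 0")
  case False
  define x where "x = cis (2 * pi * real_of_int d / real M)"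
  have "x \<noteq> 1"
  proof
    assume "x = 1"
    then have "cos (2 * pi * real_of_int d / real M) = 1" by (simp add: x_def complex_eq_iff)
    then obtain n :: int where "2 * pi * real_of_int d / real M = real_of_int n * 2 * pi"
      by (auto simp: cos_one_2pi_int)
    then have "real_of_int d = real_of_int n * real M" using assms by (simp add: field_simps)
    then have "real_of_int d = real_of_int (n * int M)" by simp
    then have "d = n * int M" by (simp only: of_int_eq_iff)
    with False assms(2) show False
      by (auto simp: abs_mult)
  qed
  have "x ^ M = 1"
  proof -
    have "x ^ M = cis (real M * (2 * pi * real_of_int d / real M))" unfolding x_def by (rule Complex.DeMoivre)
    also have "real M * (2 * pi * real_of_int d / real M) = 2 * pi * real_of_int d" using assms(1) by simp
    also have "cis (2 * pi * real_of_int d) = 1" by (rule cis_multiple_2pi) simp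
    finally show ?thesis .
  qed
  have "(\<Sum>l<M. cis (2 * pi * real l / real M * real_of_int d)) = (\<Sum>l<M. x ^ l)"
    by (intro sum.cong) (auto simp: x_def Complex.DeMoivre field_simps)
  also have "\<dots> = 0" using geometric_sum[OF \<open>x \<noteq> 1\<close>, of M] \<open>x ^ M = 1\<close> by simp
  finally show ?thesis using False by simp
qed simp

context rf_lc_graph
begin

lemma word_degree_add: "word_degree (u + v) i = word_degree u i + word_degree v i"
  by (simp add: word_degree_def plus_star_word_def)

lemma word_degree_adj: "word_degree (word_adj w) i = - word_degree w i"
proof -
  have "word_degree (word_adj (Word ls)) i = - word_degree (Word ls) i" for ls
    by (induction ls) (auto simp: word_degree_def word_adj_def)
  from this[of "letters w"] show ?thesis by simp
qed

text \<open>The torus is parametrized by real angles, so that \<open>t \<mapsto> t \<theta>\<close>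
  is a path from the identity to any given gauge automorphism.\<close>

definition gauge :: "('k \<Rightarrow> real) \<Rightarrow> 'a star_poly \<Rightarrow> 'a star_poly" where
  "gauge \<theta> = twist (\<lambda>w. cis (\<Sum>i\<in>UNIV. \<theta> i * real_of_int (word_degree w i)))"

lemma gauge_char: "word_char (\<lambda>w. cis (\<Sum>i\<in>UNIV. \<theta> i * real_of_int (word_degree w i)))"
  by (auto simp: word_char_def word_degree_add word_degree_adj distrib_left sum.distrib cis_mult sum_negf cis_cnj)
    (simp add: word_degree_def zero_star_word_def)

lemma gauge_add: "gauge \<theta> (f + g) = gauge \<theta> f + gauge \<theta> g"
  and gauge_diff: "gauge \<theta> (f - g) = gauge \<theta> f - gauge \<theta> g"
  and gauge_mult: "gauge \<theta> (f * g) = gauge \<theta> f * gauge \<theta> g"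
  and gauge_adj: "gauge \<theta> (poly_adj f) = poly_adj (gauge \<theta> f)"
  and gauge_sum: "gauge \<theta> (sum h S) = (\<Sum>x\<in>S. gauge \<theta> (h x))"
  and gauge_zero [simp]: "gauge \<theta> 0 = 0"
  unfolding gauge_def
  by (simp_all add: twist_add twist_diff twist_mult[OF gauge_char] twist_adj[OF gauge_char] twist_sum)

lemma gauge_scal: "gauge \<theta> (scal z * f) = scal z * gauge \<theta> f"
  unfolding gauge_def by (rule twist_scal[OF gauge_char])

lemma gauge_F [simp, intro]: "f \<in> F \<Longrightarrow> gauge \<theta> f \<in> F"
  by (simp add: gauge_def)

lemma gauge_gauge: "gauge \<theta> (gauge \<theta>' f) = gauge (\<lambda>i. \<theta> i + \<theta>' i) f"
  by (rule poly_mapping_eqI) (simp add: gauge_def lookup_twist distrib_right sum.distrib flip: cis_mult)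

lemma gauge_trivial [simp]: "gauge (\<lambda>i. 0) f = f"
  by (rule poly_mapping_eqI) (simp add: gauge_def lookup_twist)

definition phase :: "('k \<Rightarrow> real) \<Rightarrow> 'a \<Rightarrow> complex" where
  "phase \<theta> \<kappa> = cis (\<Sum>i\<in>UNIV. \<theta> i * real (deg \<Lambda> \<kappa> $ i))"

lemma gauge_gen: "gauge \<theta> (gen \<kappa>) = scal (phase \<theta> \<kappa>) * gen \<kappa>"
  by (simp add: gauge_def twist_gen phase_def word_degree_def)

lemma phase_simps [simp]:
  "v \<in> vertices \<Lambda> \<Longrightarrow> phase \<theta> v = 1"
  "cnj (phase \<theta> \<kappa>) * phase \<theta> \<kappa> = 1" "phase \<theta> \<kappa> * cnj (phase \<theta> \<kappa>) = 1"
  by (simp_all add: phase_def cis_cnj cis_mult)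

lemma gauge_vertex: "v \<in> vertices \<Lambda> \<Longrightarrow> gauge \<theta> (gen v) = gen v"
  by (simp add: gauge_gen)

lemma gauge_gen_adj: "gauge \<theta> (gen \<kappa> * poly_adj (gen \<kappa>)) = gen \<kappa> * poly_adj (gen \<kappa>)"
proof -
  have "gauge \<theta> (gen \<kappa> * poly_adj (gen \<kappa>)) = scal (phase \<theta> \<kappa>) * (scal (cnj (phase \<theta> \<kappa>)) * (gen \<kappa> * poly_adj (gen \<kappa>)))"
    by (simp only: gauge_mult gauge_adj gauge_gen poly_adj_scal mult.assoc mult_scal_right[of "gen \<kappa>"])
  then show ?thesis by (simp add: scal_scal)
qed

lemma gauge_adj_gen: "gauge \<theta> (poly_adj (gen \<kappa>) * gen \<kappa>) = poly_adj (gen \<kappa>) * gen \<kappa>"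
proof -
  have "gauge \<theta> (poly_adj (gen \<kappa>) * gen \<kappa>) = scal (cnj (phase \<theta> \<kappa>)) * (scal (phase \<theta> \<kappa>) * (poly_adj (gen \<kappa>) * gen \<kappa>))"
    by (simp only: gauge_mult gauge_adj gauge_gen poly_adj_scal mult.assoc mult_scal_right[of "poly_adj (gen \<kappa>)"])
  then show ?thesis by (simp add: scal_scal)
qed

text \<open>All terms of a relator have the same degree, so the gauge action multiplies it by a
  single phase and preserves its vanishing.\<close>

lemma gauge_relator:
  assumes "x \<in> ck_relators \<Lambda>" shows "\<exists>z. gauge \<theta> x = scal z * x"
proof -
  from assms show ?thesis
  proof (cases rule: ck_relator_cases)
    case (pi \<kappa>)
    have "gauge \<theta> x = (gen \<kappa> * poly_adj (gen \<kappa>)) * (scal (phase \<theta> \<kappa>) * gen \<kappa>) - scal (phase \<theta> \<kappa>) * gen \<kappa>"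
      unfolding pi gauge_diff gauge_mult[of _ "gen \<kappa> * poly_adj (gen \<kappa>)"] gauge_gen_adj gauge_gen ..
    then show ?thesis by (intro exI[of _ "phase \<theta> \<kappa>"]) (simp add: pi right_diff_distrib mult_scal_right)
  next
    case (vw v w)
    then show ?thesis by (intro exI[of _ 1]) (auto simp: gauge_diff gauge_mult gauge_vertex)
  next
    case (cmp \<kappa> \<mu>)
    have "phase \<theta> (cmp \<Lambda> \<kappa> \<mu>) = phase \<theta> \<kappa> * phase \<theta> \<mu>"
      using cmp by (simp add: phase_def cis_mult distrib_left sum.distrib)
    then have "gauge \<theta> x = scal (phase \<theta> \<kappa>) * gen \<kappa> * (scal (phase \<theta> \<mu>) * gen \<mu>) - scal (phase \<theta> \<kappa> * phase \<theta> \<mu>) * gen (cmp \<Lambda> \<kappa> \<mu>)"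
      unfolding cmp(4) gauge_diff gauge_mult gauge_gen by simp
    also have "scal (phase \<theta> \<kappa>) * gen \<kappa> * (scal (phase \<theta> \<mu>) * gen \<mu>) = scal (phase \<theta> \<kappa> * phase \<theta> \<mu>) * (gen \<kappa> * gen \<mu>)"
      by (simp only: mult.assoc mult_scal_right[of "gen \<kappa>"] scal_scal)
    finally show ?thesis by (intro exI[of _ "phase \<theta> \<kappa> * phase \<theta> \<mu>"]) (simp add: cmp(4) right_diff_distrib)
  next
    case (src \<kappa>)
    then show ?thesis by (intro exI[of _ 1]) (simp add: gauge_diff gauge_adj_gen gauge_vertex)
  next
    case (sum v n)
    then show ?thesis by (intro exI[of _ 1]) (simp add: gauge_diff gauge_sum gauge_gen_adj gauge_vertex)
  qed
qed

lemma relators_F: "x \<in> ck_relators \<Lambda> \<Longrightarrow> x \<in> F"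
  by (auto simp: ck_relators_def paths_leD)

text \<open>Composing \<open>U\<close> with the gauge action gives another admissible seminorm,
  which cannot exceed the largest one.\<close>

lemma gauge_le: "f \<in> F \<Longrightarrow> U (gauge \<theta> f) \<le> U f"
proof (rule universal_upper)
  have "U (gauge \<theta> x) = 0" if "x \<in> ck_relators \<Lambda>" for x
    using gauge_relator[OF that, of \<theta>] relators_F[OF that] universal_relator[OF that] by (auto simp: p_scal)
  moreover have "cstar_seminorm (mor \<Lambda>) (\<lambda>f. U (gauge \<theta> f))"
    by (rule cstar_seminorm_pullback[OF cstar_seminorm_universal])
      (rule gauge_F gauge_add gauge_mult gauge_adj gauge_scal | assumption)+
  ultimately show "(\<lambda>f. U (gauge \<theta> f)) \<in> seminorms" by simp
qed

text \<open>Along the path a monomial is merely multiplied by \<open>cis (t * \<alpha>)\<close>,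
  where \<open>\<alpha>\<close> pairs \<open>\<theta>\<close> with its degree; a polynomial is a
  finite sum of these.\<close>

lemma gauge_continuous:
  assumes r: "cstar_seminorm (mor \<Lambda>) r" and f: "f \<in> F" and k: "k \<in> F"
  shows "isCont (\<lambda>t. r (k - gauge (\<lambda>i. t * \<theta> i) f)) s"
proof -
  interpret R: free_seminorm "mor \<Lambda>" r by unfold_locales (rule r)
  let ?g = "\<lambda>t. gauge (\<lambda>i. t * \<theta> i)"
  have lim: "((\<lambda>t. r (?g t f - ?g s f)) \<longlongrightarrow> 0) (at s)"
    using f
  proof (induction rule: free_induct_words)
    case (single w c)
    define \<alpha> where "\<alpha> = (\<Sum>i\<in>UNIV. \<theta> i * real_of_int (word_degree w i))"
    have g: "?g t (Poly_Mapping.single w c) = scal (cis (t * \<alpha>)) * Poly_Mapping.single w c" for t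
      by (simp add: gauge_def twist_single mult_single \<alpha>_def sum_distrib_left mult.assoc)
    have "r (?g t (Poly_Mapping.single w c) - ?g s (Poly_Mapping.single w c)) =
        cmod (cis (t * \<alpha>) - cis (s * \<alpha>)) * r (Poly_Mapping.single w c)" for t
      unfolding g left_diff_distrib[symmetric] single_diff[symmetric]
      by (rule R.p_scal) (use single in \<open>auto intro: free_single\<close>)
    moreover have "((\<lambda>t. cmod (cis (t * \<alpha>) - cis (s * \<alpha>)) * r (Poly_Mapping.single w c)) \<longlongrightarrow>
        cmod (cis (s * \<alpha>) - cis (s * \<alpha>)) * r (Poly_Mapping.single w c)) (at s)"
      by (intro tendsto_intros)
    ultimately show ?case by simp
  next
    case (add f g)
    have le: "r (?g t (f + g) - ?g s (f + g)) \<le> r (?g t f - ?g s f) + r (?g t g - ?g s g)" for t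
      using R.p_add[of "?g t f - ?g s f" "?g t g - ?g s g"] add by (simp add: gauge_add algebra_simps)
    show ?case
      by (rule tendsto_sandwich[OF _ _ tendsto_const tendsto_add_zero[OF add(3,4)]])
        (use le add in \<open>auto intro!: always_eventually\<close>)
  qed simp
  have "\<bar>r (k - ?g t f) - r (k - ?g s f)\<bar> \<le> r (?g t f - ?g s f)" for t
    using R.p_abs_diff[of "k - ?g t f" "k - ?g s f"] R.p_diff_commute[of "?g t f" "?g s f"] f k by simp
  then have "((\<lambda>t. \<bar>r (k - ?g t f) - r (k - ?g s f)\<bar>) \<longlongrightarrow> 0) (at s)"
    by (intro tendsto_sandwich[OF _ _ tendsto_const lim]) (auto intro!: always_eventually)
  then have "((\<lambda>t. r (k - ?g t f) - r (k - ?g s f)) \<longlongrightarrow> 0) (at s)" by (rule tendsto_rabs_zero_cancel)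
  then show ?thesis by (simp add: isCont_def LIM_zero_iff)
qed

text \<open>One coordinate at a time: averaging over sufficiently many roots of unity in direction
  \<open>i\<close> removes the words of nonzero degree there. The bounds survive because they are
  uniform in \<open>\<theta>\<close>, so every translate in the average satisfies them. Both
  seminorms are treated together since a single \<open>g\<close> has to serve both.\<close>

lemma word_degrees_average:
  assumes f: "f \<in> F" and r: "\<And>\<theta>. r1 (k1 - gauge \<theta> f) \<le> c" "\<And>\<theta>. r2 (k2 - gauge \<theta> f) \<le> c"
    and r1: "cstar_seminorm (mor \<Lambda>) r1" and r2: "cstar_seminorm (mor \<Lambda>) r2" and k: "k1 \<in> F" "k2 \<in> F"
  shows "\<exists>g\<in>F. (\<forall>\<theta>. r1 (k1 - gauge \<theta> g) \<le> c \<and> r2 (k2 - gauge \<theta> g) \<le> c) \<and>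
    (\<forall>w\<in>Poly_Mapping.keys g. \<forall>i\<in>S. word_degree w i = 0)"
proof (induction S rule: infinite_finite_induct)
  case (infinite S)
  then show ?case by simp
next
  case empty
  then show ?case using f r by auto
next
  case (insert i S)
  then obtain g where g: "g \<in> F" "\<And>\<theta>. r1 (k1 - gauge \<theta> g) \<le> c" "\<And>\<theta>. r2 (k2 - gauge \<theta> g) \<le> c"
    "\<And>w i. w \<in> Poly_Mapping.keys g \<Longrightarrow> i \<in> S \<Longrightarrow> word_degree w i = 0" by blast
  \<comment> \<open>Larger than every absolute degree in direction \<open>i\<close> that occurs in
    \<open>g\<close>, and positive even for \<open>g = 0\<close>.\<close>
  define M where "M = Suc (\<Sum>w\<in>Poly_Mapping.keys g. nat \<bar>word_degree w i\<bar>)"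
  have M: "0 < M" by (simp add: M_def)
  have dM: "\<bar>word_degree w i\<bar> < int M" if "w \<in> Poly_Mapping.keys g" for w
  proof -
    have "nat \<bar>word_degree w i\<bar> \<le> (\<Sum>w\<in>Poly_Mapping.keys g. nat \<bar>word_degree w i\<bar>)"
      by (rule member_le_sum) (use that in auto)
    then have "nat \<bar>word_degree w i\<bar> < M" unfolding M_def by (rule le_imp_less_Suc)
    then show ?thesis by linarith
  qed
  define \<theta>' where "\<theta>' l j = (if j = i then 2 * pi * real l / real M else 0)" for l :: nat and j
  define h where "h = scal (1 / of_nat M) * (\<Sum>l<M. gauge (\<theta>' l) g)"
  have hF: "h \<in> F" using g by (auto simp: h_def)
  have "lk h w = lk g w * (if word_degree w i = 0 then 1 else 0)" for w
  proof (cases "w \<in> Poly_Mapping.keys g")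
    case True
    have "lk (scal z * x) w = z * lk x w" for z and x :: "'a star_poly"
      by (simp flip: mult_map_scale_conv_mult add: map.rep_eq when_def)
    then have "lk h w = (1 / of_nat M) * (\<Sum>l<M. cis (2 * pi * real l / real M * real_of_int (word_degree w i))) * lk g w"
      by (simp add: h_def lookup_sum gauge_def lookup_twist \<theta>'_def if_distrib[of "\<lambda>x. x * _"] sum_distrib_right sum_distrib_left cong: if_cong)
    then show ?thesis using sum_roots_of_unity[OF M dM[OF True]] M by simp
  next
    case False
    have "lk (scal z * x) w = z * lk x w" for z and x :: "'a star_poly"
      by (simp flip: mult_map_scale_conv_mult add: map.rep_eq when_def)
    then show ?thesis using False by (simp add: h_def lookup_sum gauge_def lookup_twist in_keys_iff)
  qed
  then have deg: "word_degree w j = 0" if "w \<in> Poly_Mapping.keys h" "j \<in> insert i S" for w j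
    using that g(4)[of w j] by (auto simp: in_keys_iff split: if_splits)
  have avg: "s (k - gauge \<theta> h) \<le> c"
    if s: "cstar_seminorm (mor \<Lambda>) s" "\<And>\<theta>. s (k - gauge \<theta> g) \<le> c" "k \<in> F" for s k \<theta>
  proof -
    interpret S: free_seminorm "mor \<Lambda>" s by unfold_locales (rule s)
    have "scal (1 / of_nat M) * (of_nat M * k) = k"
      using M scal_scal[of "1 / of_nat M" "of_nat M" k] by simp
    then have "k - gauge \<theta> h = scal (1 / of_nat M) * (\<Sum>l<M. k - gauge (\<lambda>i. \<theta> i + \<theta>' l i) g)"
      by (simp add: h_def gauge_scal gauge_sum gauge_gauge sum_subtractf right_diff_distrib)
    also have "s \<dots> = s (\<Sum>l<M. k - gauge (\<lambda>i. \<theta> i + \<theta>' l i) g) / real M"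
      using g s(3) by (subst S.p_scal) (auto simp: norm_divide)
    also have "\<dots> \<le> (\<Sum>l<M. s (k - gauge (\<lambda>i. \<theta> i + \<theta>' l i) g)) / real M"
      using g s(3) by (intro divide_right_mono S.p_sum) auto
    also have "\<dots> \<le> (\<Sum>l<M. c) / real M" using s(2) by (intro divide_right_mono sum_mono) auto
    also have "\<dots> = c" using M by simp
    finally show ?thesis .
  qed
  have "\<forall>\<theta>. r1 (k1 - gauge \<theta> h) \<le> c \<and> r2 (k2 - gauge \<theta> h) \<le> c"
    using avg[OF r1 g(2) k(1)] avg[OF r2 g(3) k(2)] by simp
  moreover have "\<forall>w\<in>Poly_Mapping.keys h. \<forall>j\<in>insert i S. word_degree w j = 0" using deg by simp
  ultimately show ?case using hF by (intro bexI[of _ h] conjI)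
qed

section \<open>C*-seminorms below the universal one\<close>

lemma seminorm_eqv:
  assumes r: "cstar_seminorm (mor \<Lambda>) r" "\<And>f. f \<in> F \<Longrightarrow> r f \<le> U f" and fg: "f \<simeq> g"
  shows "r f = r g" "r (f - g) = 0"
proof -
  interpret R: free_seminorm "mor \<Lambda>" r by unfold_locales (rule r)
  have "f \<in> F" "g \<in> F" "U (f - g) = 0" using fg by (auto simp: eqv_def)
  then have "r (f - g) \<le> 0" using r(2)[of "f - g"] by auto
  then show 0: "r (f - g) = 0" using \<open>f \<in> F\<close> \<open>g \<in> F\<close> by (intro antisym) auto
  show "r f = r g" using R.p_abs_diff[of f g] 0 \<open>f \<in> F\<close> \<open>g \<in> F\<close> by auto
qed

lemma U_gen_le: "\<kappa> \<in> mor \<Lambda> \<Longrightarrow> U (gen \<kappa>) \<le> 1"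
  using gen_partial_isometry by (intro p_partial_isometry) (auto simp: eqv_def)

lemma seminorm_vertex:
  assumes r: "cstar_seminorm (mor \<Lambda>) r" "\<And>f. f \<in> F \<Longrightarrow> r f \<le> U f" and v: "v \<in> vertices \<Lambda>"
  shows "r (gen v) = 0 \<or> r (gen v) = 1"
proof -
  interpret R: free_seminorm "mor \<Lambda>" r by unfold_locales (rule r)
  show ?thesis
    using seminorm_eqv(2)[OF r gen_vertex_mult[OF v v]] seminorm_eqv(2)[OF r gen_vertex_adj[OF v]] v
    by (intro R.p_projection) auto
qed

lemma seminorm_gen_zero:
  assumes r: "cstar_seminorm (mor \<Lambda>) r" "\<And>f. f \<in> F \<Longrightarrow> r f \<le> U f" and \<kappa>: "\<kappa> \<in> mor \<Lambda>"
  shows "r (gen (src \<Lambda> \<kappa>)) = (r (gen \<kappa>))\<^sup>2" "r (gen (rng \<Lambda> \<kappa>)) = 0 \<Longrightarrow> r (gen \<kappa>) = 0"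
proof -
  interpret R: free_seminorm "mor \<Lambda>" r by unfold_locales (rule r)
  show "r (gen (src \<Lambda> \<kappa>)) = (r (gen \<kappa>))\<^sup>2"
    using seminorm_eqv(1)[OF r gen_adj_gen[OF \<kappa>]] R.p_cstar[of "gen \<kappa>"] \<kappa> by simp
  assume "r (gen (rng \<Lambda> \<kappa>)) = 0"
  then have "r (gen \<kappa>) \<le> 0"
    using seminorm_eqv(1)[OF r gen_rng[OF \<kappa>]] R.p_mult[of "gen (rng \<Lambda> \<kappa>)" "gen \<kappa>"] \<kappa> by simp
  then show "r (gen \<kappa>) = 0" using \<kappa> by (intro antisym) auto
qed

text \<open>The relation \<open>s\<^sub>\<kappa>\<^sup>* s\<^sub>\<kappa> = s\<^sub>w\<close> for
  \<open>w\<close> the source of \<open>\<kappa>\<close> moves vanishing from the range to the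
  source, and the sum relation moves it back to a vertex from the sources of
  \<open>paths_le\<close>.\<close>

lemma seminorm_zero_set:
  assumes r: "cstar_seminorm (mor \<Lambda>) r" "\<And>f. f \<in> F \<Longrightarrow> r f \<le> U f"
  shows "{v \<in> vertices \<Lambda>. r (gen v) = 0} \<in> sat_her \<Lambda>"
proof -
  interpret R: free_seminorm "mor \<Lambda>" r by unfold_locales (rule r)
  let ?H = "{v \<in> vertices \<Lambda>. r (gen v) = 0}"
  have "hereditary \<Lambda> ?H"
    unfolding hereditary_def
  proof (intro conjI ballI impI)
    fix \<kappa> assume \<kappa>: "\<kappa> \<in> mor \<Lambda>" "rng \<Lambda> \<kappa> \<in> ?H"
    then have "r (gen \<kappa>) = 0" using seminorm_gen_zero(2)[OF r \<kappa>(1)] by blast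
    then show "src \<Lambda> \<kappa> \<in> ?H" using seminorm_gen_zero(1)[OF r \<kappa>(1)] \<kappa>(1) by simp
  qed auto
  moreover have "saturated \<Lambda> ?H"
    unfolding saturated_def
  proof (intro conjI ballI impI)
    fix v assume v: "v \<in> vertices \<Lambda>" and "\<exists>n. src \<Lambda> ` paths_le \<Lambda> v n \<subseteq> ?H"
    then obtain n where n: "src \<Lambda> ` paths_le \<Lambda> v n \<subseteq> ?H" by blast
    have "r (gen v) = r (\<Sum>\<kappa>\<in>paths_le \<Lambda> v n. gen \<kappa> * poly_adj (gen \<kappa>))"
      by (rule seminorm_eqv(1)[OF r gen_vertex_sum[OF v]])
    also have "\<dots> \<le> (\<Sum>\<kappa>\<in>paths_le \<Lambda> v n. r (gen \<kappa> * poly_adj (gen \<kappa>)))"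
      by (rule R.p_sum) (auto simp: paths_leD)
    also have "\<dots> = (\<Sum>\<kappa>\<in>paths_le \<Lambda> v n. 0)"
    proof (rule sum.cong)
      fix \<kappa> assume \<kappa>: "\<kappa> \<in> paths_le \<Lambda> v n"
      then have "r (gen (src \<Lambda> \<kappa>)) = 0" using n by auto
      then show "r (gen \<kappa> * poly_adj (gen \<kappa>)) = 0"
        using seminorm_gen_zero(1)[OF r, of \<kappa>] R.p_cstar'[of "gen \<kappa>"] paths_leD[OF \<kappa>] by simp
    qed simp
    finally show "v \<in> ?H" using v by (auto intro: antisym)
  qed auto
  ultimately show ?thesis by (simp add: sat_her_def)
qed

lemma seminorm_all_zero:
  assumes r: "cstar_seminorm (mor \<Lambda>) r" "\<And>f. f \<in> F \<Longrightarrow> r f \<le> U f"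
    and 0: "\<And>v. v \<in> vertices \<Lambda> \<Longrightarrow> r (gen v) = 0" and f: "f \<in> F"
  shows "r f = 0"
proof -
  interpret R: free_seminorm "mor \<Lambda>" r by unfold_locales (rule r)
  have "R.null f" using f
  proof (induction rule: free_induct)
    case (gen \<kappa>)
    then show ?case using seminorm_gen_zero(2)[OF r gen 0] by (simp add: R.null_def)
  qed (auto intro: R.null_add R.null_scal R.null_mult_left R.null_adj)
  then show ?thesis by (simp add: R.null_def)
qed

end

section \<open>Decompositions are gauge invariant\<close>

text \<open>The intended seminorms are the norms of the two components of the class of
  \<open>f\<close>. Then \<open>approx\<close> says that polynomials approximate the first component
  of \<open>gen v\<close>, and \<open>le_sum\<close> lets smallness in both components be recombined
  into smallness in the universal seminorm.\<close>

locale seminorm_decomposition = rf_lc_graph \<Lambda> for \<Lambda> :: "('a, 'k::finite) kgraph" +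
  fixes r1 r2 :: "'a star_poly \<Rightarrow> real"
  assumes r1: "cstar_seminorm (mor \<Lambda>) r1" "\<And>f. f \<in> free_star_algebra (mor \<Lambda>) \<Longrightarrow> r1 f \<le> universal_seminorm (mor \<Lambda>) (ck_relators \<Lambda>) f"
    and r2: "cstar_seminorm (mor \<Lambda>) r2" "\<And>f. f \<in> free_star_algebra (mor \<Lambda>) \<Longrightarrow> r2 f \<le> universal_seminorm (mor \<Lambda>) (ck_relators \<Lambda>) f"
    and le_sum: "\<And>f. f \<in> free_star_algebra (mor \<Lambda>) \<Longrightarrow> universal_seminorm (mor \<Lambda>) (ck_relators \<Lambda>) f \<le> r1 f + r2 f"
    and approx: "\<And>v e. v \<in> vertices \<Lambda> \<Longrightarrow> 0 < e \<Longrightarrow> \<exists>g\<in>free_star_algebra (mor \<Lambda>). r1 (gen v - g) < e \<and> r2 g < e"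
begin

sublocale R1: free_seminorm "mor \<Lambda>" r1 by unfold_locales (rule r1)
sublocale R2: free_seminorm "mor \<Lambda>" r2 by unfold_locales (rule r2)

notation eqv (infix "\<simeq>" 50)

text \<open>The elements \<open>s\<^sub>v - \<gamma>\<^sub>\<theta>(g)\<close> and \<open>\<gamma>\<^sub>\<theta>(g)\<close> are almost projections, so their seminorms are near \<open>0\<close> or \<open>1\<close>.\<close>

lemma near_gauge_invariant:
  assumes v: "v \<in> vertices \<Lambda>" and g: "g \<in> F" "r1 (gen v - g) < 1 / 1000" "r2 g < 1 / 1000"
  shows "r1 (gen v - gauge \<theta> g) \<le> 1 / 10" "r2 (0 - gauge \<theta> g) \<le> 1 / 10"
proof -
  let ?s = "gen v" and ?d = "1 / 1000 :: real"
  define x where "x = ?s - g"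
  have s: "?s \<in> F" using v by auto
  have x: "x \<in> F" "r1 x \<le> ?d" "g = ?s - x" using g s by (auto simp: x_def)
  have s1: "r1 ?s \<le> 1" "r2 ?s \<le> 1" using U_gen_le[of v] r1(2)[OF s] r2(2)[OF s] v by auto
  have ss: "U (?s * ?s - ?s) = 0" and sa: "U (poly_adj ?s - ?s) = 0"
    using gen_vertex_mult[OF v v] gen_vertex_adj[OF v] by (auto simp: eqv_def)
  then have ss': "r1 (?s * ?s - ?s) \<le> 0" and sa': "r1 (poly_adj ?s - ?s) \<le> 0"
    using r1(2)[of "?s * ?s - ?s"] r1(2)[of "poly_adj ?s - ?s"] s by auto
  have sx: "r1 (?s * x) \<le> ?d" "r1 (x * ?s) \<le> ?d"
    using R1.p_mult[OF s x(1)] R1.p_mult[OF x(1) s] mult_mono[OF s1(1) x(2)] mult_mono[OF x(2) s1(1)] s x by auto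
  have xx: "r1 (x * x) \<le> ?d" using R1.p_mult[OF x(1) x(1)] mult_mono[OF x(2) x(2)] x by auto
  have gg: "r2 (g * g) \<le> ?d" using R2.p_mult[OF g(1) g(1)] mult_mono[of "r2 g" ?d "r2 g" ?d] g by auto
  have sg: "r2 (?s * g) \<le> ?d" "r2 (g * ?s) \<le> ?d"
    using R2.p_mult[OF s g(1)] R2.p_mult[OF g(1) s] mult_mono[OF s1(2), of "r2 g" ?d] mult_mono[OF _ s1(2), of "r2 g" ?d] s g by auto
  \<comment> \<open>The four defects are measured in \<open>U\<close>, the seminorm known to be
    invariant under \<open>gauge\<close>. In the first component \<open>g\<close> is
    \<open>?s\<close> minus the small \<open>x\<close>, in the second \<open>g\<close> itself is
    small, and \<open>le_sum\<close> adds the two estimates.\<close>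
  have U1: "U (g * g - g) \<le> 6 * ?d"
  proof -
    have "g * g - g = (?s * ?s - ?s) + ((x * x + x) - (?s * x + x * ?s))" unfolding x(3) by (simp add: algebra_simps)
    then have "r1 (g * g - g) \<le> r1 (?s * ?s - ?s) + ((r1 (x * x) + r1 x) + (r1 (?s * x) + r1 (x * ?s)))"
      using R1.p_add[of "?s * ?s - ?s" "(x * x + x) - (?s * x + x * ?s)"] R1.p_diff[of "x * x + x" "?s * x + x * ?s"]
        R1.p_add[of "x * x" x] R1.p_add[of "?s * x" "x * ?s"] s x(1) by auto
    moreover have "r2 (g * g - g) \<le> r2 (g * g) + r2 g" using g by (intro R2.p_diff) auto
    ultimately show ?thesis using le_sum[of "g * g - g"] ss' xx sx x(2) gg g by auto
  qed
  have U2: "U (poly_adj g - g) \<le> 4 * ?d"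
  proof -
    have "poly_adj g - g = (poly_adj ?s - ?s) + (x - poly_adj x)" unfolding x(3) by (simp add: poly_adj_diff)
    then have "r1 (poly_adj g - g) \<le> r1 (poly_adj ?s - ?s) + (r1 x + r1 x)"
      using R1.p_add[of "poly_adj ?s - ?s" "x - poly_adj x"] R1.p_diff[of x "poly_adj x"] s x(1) by auto
    moreover have "r2 (poly_adj g - g) \<le> r2 g + r2 g" using g R2.p_diff[of "poly_adj g" g] by auto
    ultimately show ?thesis using le_sum[of "poly_adj g - g"] sa' x(2) g by auto
  qed
  have U3: "U (?s * g - g) \<le> 4 * ?d"
  proof -
    have "?s * g - g = (?s * ?s - ?s) + (x - ?s * x)" unfolding x(3) by (simp add: algebra_simps)
    then have "r1 (?s * g - g) \<le> r1 (?s * ?s - ?s) + (r1 x + r1 (?s * x))"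
      using R1.p_add[of "?s * ?s - ?s" "x - ?s * x"] R1.p_diff[of x "?s * x"] s x(1) by auto
    moreover have "r2 (?s * g - g) \<le> r2 (?s * g) + r2 g" using g s by (intro R2.p_diff) auto
    ultimately show ?thesis using le_sum[of "?s * g - g"] ss' x(2) sx sg g s by auto
  qed
  have U4: "U (g * ?s - g) \<le> 4 * ?d"
  proof -
    have "g * ?s - g = (?s * ?s - ?s) + (x - x * ?s)" unfolding x(3) by (simp add: algebra_simps)
    then have "r1 (g * ?s - g) \<le> r1 (?s * ?s - ?s) + (r1 x + r1 (x * ?s))"
      using R1.p_add[of "?s * ?s - ?s" "x - x * ?s"] R1.p_diff[of x "x * ?s"] s x(1) by auto
    moreover have "r2 (g * ?s - g) \<le> r2 (g * ?s) + r2 g" using g s by (intro R2.p_diff) auto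
    ultimately show ?thesis using le_sum[of "g * ?s - g"] ss' x(2) sx sg g s by auto
  qed
  \<comment> \<open>The 14 collects 6 for \<open>h * h - h\<close> and 4 for each of the two mixed
    products with \<open>?s\<close>; the remaining 4 comes from the adjoint. The second estimate is
    relaxed to the same constants so that one argument about \<open>\<phi>\<close> serves
    both.\<close>
  have key: "\<bar>(r1 (?s - gauge \<theta> g))\<^sup>2 - r1 (?s - gauge \<theta> g)\<bar> \<le> 14 * ?d + 4 * ?d * r1 (?s - gauge \<theta> g)"
    "\<bar>(r2 (0 - gauge \<theta> g))\<^sup>2 - r2 (0 - gauge \<theta> g)\<bar> \<le> 14 * ?d + 4 * ?d * r2 (0 - gauge \<theta> g)" for \<theta>
  proof -
    define h where "h = gauge \<theta> g"
    have h: "h \<in> F" using g by (simp add: h_def)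
    have hs: "h * h - h = gauge \<theta> (g * g - g)" "poly_adj h - h = gauge \<theta> (poly_adj g - g)"
      "?s * h - h = gauge \<theta> (?s * g - g)" "h * ?s - h = gauge \<theta> (g * ?s - g)"
      by (simp_all add: h_def gauge_diff gauge_mult gauge_adj gauge_vertex[OF v])
    have V: "U (h * h - h) \<le> 6 * ?d" "U (poly_adj h - h) \<le> 4 * ?d" "U (?s * h - h) \<le> 4 * ?d" "U (h * ?s - h) \<le> 4 * ?d"
      unfolding hs using gauge_le[of "g * g - g" \<theta>] gauge_le[of "poly_adj g - g" \<theta>] gauge_le[of "?s * g - g" \<theta>]
        gauge_le[of "g * ?s - g" \<theta>] U1 U2 U3 U4 g s by (auto intro: order_trans)
    have W: "r1 (h * h - h) \<le> 6 * ?d" "r1 (poly_adj h - h) \<le> 4 * ?d" "r1 (?s * h - h) \<le> 4 * ?d" "r1 (h * ?s - h) \<le> 4 * ?d"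
      "r2 (h * h - h) \<le> 6 * ?d" "r2 (poly_adj h - h) \<le> 4 * ?d"
      using V h s r1(2)[of "h * h - h"] r1(2)[of "poly_adj h - h"] r1(2)[of "?s * h - h"] r1(2)[of "h * ?s - h"]
        r2(2)[of "h * h - h"] r2(2)[of "poly_adj h - h"] by auto
    let ?k = "?s - h"
    have eq: "?k * ?k - ?k = ((?s * ?s - ?s) + (h * h - h)) - ((?s * h - h) + (h * ?s - h))" by (simp add: algebra_simps)
    have "r1 (?k * ?k - ?k) \<le> (r1 (?s * ?s - ?s) + r1 (h * h - h)) + (r1 (?s * h - h) + r1 (h * ?s - h))"
      unfolding eq by (intro order_trans[OF R1.p_diff] add_mono R1.p_add) (use h s in auto)
    then have k1: "r1 (?k * ?k - ?k) \<le> 14 * ?d" using W ss' by linarith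
    have eq: "poly_adj ?k - ?k = (poly_adj ?s - ?s) - (poly_adj h - h)" by (simp add: poly_adj_diff)
    have "r1 (poly_adj ?k - ?k) \<le> r1 (poly_adj ?s - ?s) + r1 (poly_adj h - h)"
      unfolding eq by (rule R1.p_diff) (use h s in auto)
    then have k2: "r1 (poly_adj ?k - ?k) \<le> 4 * ?d" using W sa' by linarith
    show "\<bar>(r1 (?s - gauge \<theta> g))\<^sup>2 - r1 (?s - gauge \<theta> g)\<bar> \<le> 14 * ?d + 4 * ?d * r1 (?s - gauge \<theta> g)"
      using R1.p_near_projection[OF _ k1 k2] h s by (simp add: h_def)
    have "r2 (h * h - h) \<le> 14 * ?d" using W by simp
    from R2.p_near_projection[OF h this W(6)]
    show "\<bar>(r2 (0 - gauge \<theta> g))\<^sup>2 - r2 (0 - gauge \<theta> g)\<bar> \<le> 14 * ?d + 4 * ?d * r2 (0 - gauge \<theta> g)"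
      using h by (simp add: h_def)
  qed
  text \<open>Along the path \<open>t \<mapsto> t\<theta>\<close> the continuous function \<open>\<phi>\<close> starts near \<open>0\<close> and cannot jump to values near \<open>1\<close>.\<close>
  have small: "\<phi> 1 \<le> 1 / 10"
    if cont: "\<And>t. isCont \<phi> t" and k: "\<And>t. \<bar>(\<phi> t)\<^sup>2 - \<phi> t\<bar> \<le> 14 * ?d + 4 * ?d * \<phi> t" and 0: "\<phi> 0 < ?d"
      and nn: "\<And>t. 0 \<le> \<phi> t" for \<phi> :: "real \<Rightarrow> real"
  proof -
    \<comment> \<open>At the value 1/2 the left side of \<open>k\<close> is 1/4 while the right side
      is 0.016, so this value separates the two ranges.\<close>
    have half: "\<phi> t \<noteq> 1 / 2" for t
    proof
      assume "\<phi> t = 1 / 2"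
      from k[of t, unfolded this] show False by (simp add: power2_eq_square)
    qed
    have "\<phi> 1 < 1 / 2"
    proof (rule ccontr)
      assume "\<not> \<phi> 1 < 1 / 2"
      then have "\<exists>t. 0 \<le> t \<and> t \<le> 1 \<and> \<phi> t = 1 / 2" using 0 cont by (intro IVT) auto
      with half show False by blast
    qed
    \<comment> \<open>Below 1/2 the factor \<open>1 - \<phi> 1\<close> is at least 1/2, so half of
      \<open>\<phi> 1\<close> is at most 0.016.\<close>
    then have "\<phi> 1 * (1 / 2) \<le> \<phi> 1 * (1 - \<phi> 1)" using nn[of 1] by (intro mult_left_mono) auto
    moreover have "\<phi> 1 * (1 - \<phi> 1) \<le> 14 * ?d + 4 * ?d * \<phi> 1" using k[of 1] by (simp add: power2_eq_square algebra_simps)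
    ultimately show ?thesis using \<open>\<phi> 1 < 1 / 2\<close> by simp
  qed
  show "r1 (gen v - gauge \<theta> g) \<le> 1 / 10"
    using small[of "\<lambda>t. r1 (?s - gauge (\<lambda>i. t * \<theta> i) g)"] gauge_continuous[OF r1(1) g(1) s] key(1) g s by auto
  show "r2 (0 - gauge \<theta> g) \<le> 1 / 10"
    using small[of "\<lambda>t. r2 (0 - gauge (\<lambda>i. t * \<theta> i) g)"] gauge_continuous[OF r2(1) g(1), of 0] key(2) g by auto
qed

lemma vertex_splits:
  assumes v: "v \<in> vertices \<Lambda>"
  shows "\<exists>n. \<forall>\<tau>\<in>paths_le \<Lambda> v n. r1 (gen (src \<Lambda> \<tau>)) = 0 \<or> r2 (gen (src \<Lambda> \<tau>)) = 0"
proof -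
  have s: "gen v \<in> F" using v by auto
  obtain g where g: "g \<in> F" "r1 (gen v - g) < 1 / 1000" "r2 g < 1 / 1000"
    using approx[OF v, of "1 / 1000"] by auto
  \<comment> \<open>Averaging in all directions keeps only words of degree 0. The uniform bounds are
    needed as input here, and their instance at angle 0 is what is used of the result.\<close>
  from word_degrees_average[OF g(1) near_gauge_invariant[OF v g] r1(1) r2(1) s free_zero, of UNIV]
  obtain f where f: "f \<in> F" "\<And>\<theta>. r1 (gen v - gauge \<theta> f) \<le> 1 / 10" "\<And>\<theta>. r2 (0 - gauge \<theta> f) \<le> 1 / 10"
    and deg: "\<And>w i. w \<in> Poly_Mapping.keys f \<Longrightarrow> word_degree w i = 0" by auto
  have f1: "r1 (gen v - f) \<le> 1 / 10" "r2 f \<le> 1 / 10"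
    using f(2)[of "\<lambda>_. 0"] f(3)[of "\<lambda>_. 0"] f(1) by auto
  have "homogeneous (\<lambda>_. 0) f"
  proof (rule poly_mapping_sum_induct)
    fix w c assume w: "w \<in> Poly_Mapping.keys f"
    then have "w \<noteq> 0" "fst ` set (letters w) \<subseteq> mor \<Lambda>" using f(1) by (auto simp: free_star_algebra_iff)
    moreover have "word_degree w = (\<lambda>_. 0)" using deg[OF w] by auto
    ultimately have "homogeneous (\<lambda>_. 0) (Poly_Mapping.single w 1)" using homogeneous_word[of w] by simp
    then show "homogeneous (\<lambda>_. 0) (Poly_Mapping.single w c)" by (subst single_scal) (rule homogeneous.scal)
  qed (auto intro: homogeneous.intros)
  from homogeneous_zero_compress[OF this]
  obtain n where n: "\<forall>\<tau>\<in>paths_le \<Lambda> v n. \<exists>c. poly_adj (gen \<tau>) * f * gen \<tau> \<simeq> scal c * gen (src \<Lambda> \<tau>)" by blast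
  have "r1 (gen (src \<Lambda> \<tau>)) = 0 \<or> r2 (gen (src \<Lambda> \<tau>)) = 0" if \<tau>: "\<tau> \<in> paths_le \<Lambda> v n" for \<tau>
  proof -
    note \<tau>' = paths_leD[OF \<tau>]
    let ?w = "src \<Lambda> \<tau>"
    have w: "?w \<in> vertices \<Lambda>" "gen ?w \<in> F" using \<tau>' by auto
    obtain c where c: "poly_adj (gen \<tau>) * f * gen \<tau> \<simeq> scal c * gen ?w" using n \<tau> by blast
    have compress: "r (poly_adj (gen \<tau>) * h * gen \<tau>) \<le> 1 / 10"
      if r: "cstar_seminorm (mor \<Lambda>) r" "\<And>f. f \<in> F \<Longrightarrow> r f \<le> U f" and h: "h \<in> F" "r h \<le> 1 / 10" for r h
    proof -
      interpret R: free_seminorm "mor \<Lambda>" r by unfold_locales (rule r)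
      have t: "r (gen \<tau>) \<le> 1" "gen \<tau> \<in> F" using r(2)[of "gen \<tau>"] U_gen_le[of \<tau>] \<tau>' by auto
      have "r (poly_adj (gen \<tau>) * h * gen \<tau>) \<le> r (poly_adj (gen \<tau>)) * r h * r (gen \<tau>)"
        using h t by (intro order_trans[OF R.p_mult] mult_right_mono R.p_mult) auto
      also have "\<dots> \<le> 1 * (1 / 10) * 1" using h t by (intro mult_mono) auto
      finally show ?thesis by simp
    qed
    have "poly_adj (gen \<tau>) * gen v * gen \<tau> \<simeq> poly_adj (gen \<tau>) * gen \<tau>"
      using adj_gen_rng[OF \<tau>'(1)] \<tau>' by (intro eqv_mult_right) auto
    also have "\<dots> \<simeq> gen ?w" by (rule gen_adj_gen[OF \<tau>'(1)])
    finally have "poly_adj (gen \<tau>) * gen v * gen \<tau> \<simeq> gen ?w" .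
    \<comment> \<open>The compression by \<open>gen \<tau>\<close> sends \<open>gen v\<close> to
      \<open>gen ?w\<close> and \<open>f\<close> to \<open>c\<close> times it, so it sends
      \<open>gen v - f\<close>, small for \<open>r1\<close>, to \<open>1 - c\<close> times
      \<open>gen ?w\<close>.\<close>
    from eqv_diff[OF this c]
    have e1: "poly_adj (gen \<tau>) * (gen v - f) * gen \<tau> \<simeq> scal (1 - c) * gen ?w"
      by (simp add: left_diff_distrib right_diff_distrib single_diff)
    have "cmod (1 - c) * r1 (gen ?w) \<le> 1 / 10"
      using compress[OF r1, of "gen v - f"] seminorm_eqv(1)[OF r1 e1] s f f1 w by (simp add: R1.p_scal)
    moreover have "cmod c * r2 (gen ?w) \<le> 1 / 10"
      using compress[OF r2, of f] seminorm_eqv(1)[OF r2 c] f f1 w by (simp add: R2.p_scal)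
    \<comment> \<open>Both seminorms of \<open>gen ?w\<close> are 0 or 1. If both were 1, the
      numbers \<open>cmod (1 - c)\<close> and \<open>cmod c\<close> would be at most 1/10 each,
      contradicting this inequality.\<close>
    moreover have "1 \<le> cmod (1 - c) + cmod c" using norm_triangle_ineq[of "1 - c" c] by simp
    ultimately show ?thesis using seminorm_vertex[OF r1 w(1)] seminorm_vertex[OF r2 w(1)] by auto
  qed
  then show ?thesis by blast
qed

text \<open>The indices cross over: vanishing of the second seminorm places the vertex projection in
  the first summand. If one of the sets were empty, saturation would put all vertices into the other
  one, and the corresponding seminorm would vanish identically. A common vertex would have universal
  seminorm 0.\<close>

lemma splitting_pair_of_decomposition:
  assumes "\<exists>f\<in>F. r1 f \<noteq> 0" "\<exists>f\<in>F. r2 f \<noteq> 0"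
  shows "splitting_pair \<Lambda> {v \<in> vertices \<Lambda>. r2 (gen v) = 0} {v \<in> vertices \<Lambda>. r1 (gen v) = 0}"
proof -
  let ?H1 = "{v \<in> vertices \<Lambda>. r2 (gen v) = 0}" and ?H2 = "{v \<in> vertices \<Lambda>. r1 (gen v) = 0}"
  have sh: "?H1 \<in> sat_her \<Lambda>" "?H2 \<in> sat_her \<Lambda>" using seminorm_zero_set r1 r2 by blast+
  have split: "\<exists>n. src \<Lambda> ` paths_le \<Lambda> v n \<subseteq> ?H1 \<union> ?H2" if v: "v \<in> vertices \<Lambda>" for v
  proof -
    obtain n where n: "\<forall>\<tau>\<in>paths_le \<Lambda> v n. r1 (gen (src \<Lambda> \<tau>)) = 0 \<or> r2 (gen (src \<Lambda> \<tau>)) = 0"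
      using vertex_splits[OF v] by blast
    then have "src \<Lambda> ` paths_le \<Lambda> v n \<subseteq> ?H1 \<union> ?H2" by (auto simp: paths_leD)
    then show ?thesis by blast
  qed
  have "?H1 \<noteq> {}"
  proof
    assume e: "?H1 = {}"
    have "v \<in> ?H2" if "v \<in> vertices \<Lambda>" for v
      using split[OF that] sh(2) that unfolding e by (simp add: sat_her_def saturated_def)
    then show False using assms(1) seminorm_all_zero[OF r1] by blast
  qed
  moreover have "?H2 \<noteq> {}"
  proof
    assume e: "?H2 = {}"
    have "v \<in> ?H1" if "v \<in> vertices \<Lambda>" for v
      using split[OF that] sh(1) that unfolding e by (simp add: sat_her_def saturated_def)
    then show False using assms(2) seminorm_all_zero[OF r2] by blast
  qed
  moreover have "?H1 \<inter> ?H2 = {}"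
  proof -
    have "r1 (gen v) \<noteq> 0 \<or> r2 (gen v) \<noteq> 0" if "v \<in> vertices \<Lambda>" for v
      using U_vertex[OF that] le_sum[of "gen v"] that by fastforce
    then show ?thesis by blast
  qed
  ultimately show ?thesis using sh split by (simp add: splitting_pair_def)
qed

end

context rf_lc_graph
begin

lemma graph_cstar_eq: "graph_cstar \<Lambda> = A"
  by (simp add: graph_cstar_def universal_cstar_def)

lemma graph_gen_eq: "graph_gen \<Lambda> \<kappa> = emb (gen \<kappa>)"
  by (simp add: graph_gen_def universal_gen_def emb_def cls_def)

text \<open>Pulling the norm of \<open>B\<close> back along \<open>h\<close> gives a C*-seminorm
  that kills the relators, hence one below \<open>U\<close>.\<close>

lemma hom_seminorm_le:
  assumes B: "cstar_algebra B" and h: "star_hom A B h" and f: "f \<in> F"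
  shows "cnorm B (h (emb f)) \<le> U f"
proof (rule universal_upper[OF _ f])
  interpret B: cstar_algebra B by (rule B)
  interpret A: cstar_algebra A by (rule cstar_algebra_completion)
  have "h (czero A) = czero B"
    using star_homD(3)[OF h A.zero_closed, of 0] star_homD(1)[OF h A.zero_closed] by simp
  then have "cnorm B (h (emb x)) = 0" if x: "x \<in> ck_relators \<Lambda>" for x
    using emb_eq_iff[OF relators_F[OF x] free_zero] universal_relator[OF x] by (simp add: czero_cls)
  then show "(\<lambda>f. cnorm B (h (emb f))) \<in> seminorms"
    using cstar_seminorm_hom[OF B h] by simp
qed

lemma splitting_pair_of_decomposable:
  assumes "decomposable (graph_cstar \<Lambda>)" shows "\<exists>H1 H2. splitting_pair \<Lambda> H1 H2"
proof -
  interpret A: cstar_algebra A by (rule cstar_algebra_completion)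
  obtain S T where "internal_direct_sum A S T" and ne: "S \<noteq> {czero A}" "T \<noteq> {czero A}"
    using assms by (auto simp: decomposable_def graph_cstar_eq)
  then interpret S: cstar_splitting A S T by (intro A.splitting_of_internal_direct_sum)
  interpret T: cstar_splitting A T S by (rule S.swap)
  let ?r1 = "\<lambda>f. cnorm A (S.proj (emb f))" and ?r2 = "\<lambda>f. cnorm A (T.proj (emb f))"
  have C: "cstar_algebra A" by (rule cstar_algebra_completion)
  have decomp: "a = cadd A (S.proj a) (T.proj a)" if a: "a \<in> ccarrier A" for a
  proof -
    obtain s t where st: "s \<in> S" "t \<in> T" "a = cadd A s t" using a by (rule S.split_cases)
    then have "T.proj a = t" using A.add_commute[of s t] by simp
    then show ?thesis using st by simp
  qed
  interpret D: seminorm_decomposition \<Lambda> ?r1 ?r2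
  proof
    show "cstar_seminorm (mor \<Lambda>) ?r1" "cstar_seminorm (mor \<Lambda>) ?r2"
      using cstar_seminorm_hom[OF C S.star_hom_proj] cstar_seminorm_hom[OF C T.star_hom_proj] .
    fix f assume f: "f \<in> F"
    show "?r1 f \<le> U f" "?r2 f \<le> U f"
      using hom_seminorm_le[OF C S.star_hom_proj f] hom_seminorm_le[OF C T.star_hom_proj f] .
    show "U f \<le> ?r1 f + ?r2 f"
      using decomp[OF emb_carrier[OF f]] A.norm_triangle[of "S.proj (emb f)" "T.proj (emb f)"] f S.proj_in_S T.proj_in_S
      by simp
  next
    fix v and e :: real assume v: "v \<in> vertices \<Lambda>" and e: "0 < e"
    let ?a = "emb (gen v)"
    have a: "?a \<in> ccarrier A" "S.proj ?a \<in> S" using v S.proj_in_S by auto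
    obtain g where g: "g \<in> F" "cnorm A (cdiff A (S.proj ?a) (emb g)) < e"
      using emb_dense[of "S.proj ?a" e] a e by auto
    \<comment> \<open>The single error \<open>S.proj ?a - emb g\<close> controls both requirements:
      its part in \<open>S\<close> is that of \<open>?a - emb g\<close>, its part in
      \<open>T\<close> is that of \<open>emb g\<close> up to sign, and both projections are
      contractive.\<close>
    have "S.proj (cdiff A ?a (emb g)) = S.proj (cdiff A (S.proj ?a) (emb g))"
      using a g star_hom_diff[OF S.star_hom_proj _ _ C] by simp
    then have "?r1 (gen v - g) < e"
      using g v a S.norm_proj_le[of "cdiff A (S.proj ?a) (emb g)"] by (simp add: emb_diff)
    moreover have "T.proj (cdiff A (emb g) (S.proj ?a)) = T.proj (emb g)"
      using a g star_hom_diff[OF T.star_hom_proj _ _ C, of "emb g" "S.proj ?a"] T.proj_in_S by simp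
    then have "?r2 g < e"
      using g a T.norm_proj_le[of "cdiff A (emb g) (S.proj ?a)"] A.norm_diff_commute[of "emb g" "S.proj ?a"] by simp
    ultimately show "\<exists>g\<in>F. ?r1 (gen v - g) < e \<and> ?r2 g < e" using g by blast
  qed
  have nonzero: "\<exists>f\<in>F. cnorm A (cstar_splitting.proj A S' T' (emb f)) \<noteq> 0"
    if "cstar_splitting A S' T'" and ne': "S' \<noteq> {czero A}" for S' T'
  proof -
    interpret S': cstar_splitting A S' T' by fact
    obtain s where s: "s \<in> S'" "s \<noteq> czero A" using ne' S'.S_zero by blast
    then have "0 < cnorm A s" using A.norm_nonneg[of s] A.norm_eq_zero[of s] by (simp add: order_less_le)
    then obtain f where f: "f \<in> F" "cnorm A (cdiff A s (emb f)) < cnorm A s" using emb_dense[of s] s by auto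
    have "cnorm A (S'.proj (emb f)) \<noteq> 0"
    proof
      assume "cnorm A (S'.proj (emb f)) = 0"
      then have "S'.proj (emb f) = czero A" using f S'.proj_in_S by (simp add: A.norm_eq_zero)
      then have "S'.proj (cdiff A s (emb f)) = s"
        using star_hom_diff[OF S'.star_hom_proj _ _ C, of s "emb f"] s f by simp
      then show False using S'.norm_proj_le[of "cdiff A s (emb f)"] s f by simp
    qed
    then show ?thesis using f by blast
  qed
  show ?thesis
    using D.splitting_pair_of_decomposition nonzero[OF S.cstar_splitting_axioms ne(1)]
      nonzero[OF T.cstar_splitting_axioms ne(2)] by blast
qed

end

section \<open>Splitting pairs decompose the graph algebra\<close>

lemma closed_ideal_kernel:
  assumes A: "cstar_algebra A" and B: "cstar_algebra B" and h: "star_hom A B h"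
    and le: "\<And>a. a \<in> ccarrier A \<Longrightarrow> cnorm B (h a) \<le> cnorm A a"
  shows "closed_ideal A {a \<in> ccarrier A. h a = czero B}"
proof -
  interpret A: cstar_algebra A by (rule A)
  interpret B: cstar_algebra B by (rule B)
  have hB [simp]: "a \<in> A.C \<Longrightarrow> h a \<in> B.C" for a by (rule star_homD(1)[OF h])
  have h0: "h (czero A) = czero B"
    using star_homD(3)[OF h A.zero_closed, of 0] by simp
  have "l \<in> {a \<in> A.C. h a = czero B}"
    if l: "l \<in> A.C" and X: "\<forall>n. X n \<in> {a \<in> A.C. h a = czero B}" and conv: "cconverges A X l" for X l
  proof -
    have "cnorm B (h l) \<le> cnorm A (cdiff A (X n) l)" for n
    proof -
      have "h (cdiff A l (X n)) = h l" using star_hom_diff[OF h l _ A, of "X n"] X l by simp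
      then show ?thesis using le[of "cdiff A l (X n)"] X l A.norm_diff_commute[of l "X n"] by simp
    qed
    then have "cnorm B (h l) \<le> 0"
      using conv unfolding cconverges_def by (intro LIMSEQ_le_const) auto
    then have "cnorm B (h l) = 0" using B.norm_nonneg[of "h l"] l by simp
    then show ?thesis using l by (simp add: B.norm_eq_zero)
  qed
  then have "A.closed_set {a \<in> A.C. h a = czero B}"
    unfolding A.closed_set_def by blast
  then show ?thesis
    unfolding A.closed_ideal_iff by (auto simp: h0 star_homD[OF h] B.add_zero)
qed

lemma cstar_seminorm_mono: "G' \<subseteq> G \<Longrightarrow> cstar_seminorm G p \<Longrightarrow> cstar_seminorm G' p"
  unfolding cstar_seminorm_def by (meson free_mono)

lemma splitting_pair_commute: "splitting_pair \<Lambda> H1 H2 \<longleftrightarrow> splitting_pair \<Lambda> H2 H1"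
  by (auto simp: splitting_pair_def Un_commute)

context rf_lc_graph
begin

interpretation A: cstar_algebra A by (rule cstar_algebra_completion)

lemma emb_null: "null f \<Longrightarrow> emb f = czero A"
  by (simp add: czero_cls emb_eq_iff null_def)

lemma emb_eqv: "f \<simeq> g \<Longrightarrow> emb f = emb g"
  by (simp add: emb_eq_iff eqv_def)

abbreviation gens where "gens H \<equiv> (\<lambda>v. emb (gen v)) ` H"

lemma graph_ideal_eq: "graph_ideal \<Lambda> H = ideal_generated A (gens H)"
  by (simp add: graph_ideal_def graph_cstar_eq graph_gen_eq)

lemma gens_carrier: "H \<subseteq> vertices \<Lambda> \<Longrightarrow> gens H \<subseteq> ccarrier A"
  by auto

lemma gens_adj:
  assumes "H \<subseteq> vertices \<Lambda>" "y \<in> gens H" shows "cadj A y \<in> gens H"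
proof -
  obtain v where v: "v \<in> H" "y = emb (gen v)" "v \<in> vertices \<Lambda>" using assms by blast
  then have "cadj A y = emb (poly_adj (gen v))" by (simp only: emb_adj free_gen vertexD(1))
  also have "\<dots> = emb (gen v)" by (rule emb_eqv[OF gen_vertex_adj[OF v(3)]])
  finally show ?thesis using v(1) by blast
qed

lemma closed_graph_ideal: "H \<subseteq> vertices \<Lambda> \<Longrightarrow> closed_ideal A (graph_ideal \<Lambda> H)"
  unfolding graph_ideal_eq by (intro A.closed_ideal_generated gens_carrier)

lemma graph_ideal_adj: "H \<subseteq> vertices \<Lambda> \<Longrightarrow> a \<in> graph_ideal \<Lambda> H \<Longrightarrow> cadj A a \<in> graph_ideal \<Lambda> H"
  unfolding graph_ideal_eq using A.generated_adj[OF gens_carrier gens_adj] by blast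

lemma gen_in_graph_ideal: "v \<in> H \<Longrightarrow> emb (gen v) \<in> graph_ideal \<Lambda> H"
  unfolding graph_ideal_eq by (rule subsetD[OF A.generated_superset]) (rule imageI)

lemma emb_sum_in_ideal:
  assumes K: "closed_ideal A K" and h: "\<And>x. x \<in> S \<Longrightarrow> h x \<in> F" "\<And>x. x \<in> S \<Longrightarrow> emb (h x) \<in> K"
  shows "emb (sum h S) \<in> K"
  using h
proof (induction S rule: infinite_finite_induct)
  case (insert x S)
  then show ?case using K by (simp add: emb_add A.closed_ideal_iff)
qed (use K in \<open>auto simp: A.closed_ideal_iff czero_cls\<close>)

lemma emb_mult_in_ideal:
  assumes K: "closed_ideal A K" and "f \<in> F" "g \<in> F" "emb f \<in> K \<or> emb g \<in> K"
  shows "emb (f * g) \<in> K"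
  using assms by (auto simp: emb_mult A.closed_ideal_iff)

text \<open>The projection at the range of a path is a unit for its generator on the left and for
  the adjoint on the right, so all letters lie in \<open>K\<close>; words, polynomials and limits
  follow.\<close>

lemma ideal_with_vertices:
  assumes K: "closed_ideal A K" and v: "\<And>v. v \<in> vertices \<Lambda> \<Longrightarrow> emb (gen v) \<in> K"
  shows "ccarrier A \<subseteq> K"
proof
  have lett: "emb (lett l) \<in> K" if l: "fst l \<in> mor \<Lambda>" for l
  proof (cases "snd l")
    case True
    have "emb (poly_adj (gen (fst l)) * gen (rng \<Lambda> (fst l))) \<in> K"
      using K v l by (intro emb_mult_in_ideal) auto
    then show ?thesis using True emb_eqv[OF adj_gen_rng[OF l]] by (simp add: lett_def)
  next
    case False
    have "emb (gen (rng \<Lambda> (fst l)) * gen (fst l)) \<in> K"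
      using K v l by (intro emb_mult_in_ideal) auto
    then show ?thesis using False emb_eqv[OF gen_rng[OF l]] by (simp add: lett_def)
  qed
  have emb: "emb f \<in> K" if "f \<in> F" for f
    using that
  proof (induction rule: free_induct_words)
    case zero
    then show ?case using K by (simp add: A.closed_ideal_iff flip: czero_cls)
  next
    case (single w c)
    from single have "emb (Poly_Mapping.single w 1) \<in> K"
    proof (induction rule: word_induct)
      case (lett l)
      show ?case using \<open>\<And>l. fst l \<in> mor \<Lambda> \<Longrightarrow> emb (lett l) \<in> K\<close> lett by blast
    next
      case (Cons l u)
      then show ?case using K by (intro emb_mult_in_ideal) (auto intro: free_single)
    qed
    then show ?case using K single
      by (subst single_scal) (auto simp: emb_scal free_single A.closed_ideal_iff)
  next
    case (add f g)
    then show ?case using K by (simp add: emb_add A.closed_ideal_iff)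
  qed
  fix a assume a: "a \<in> ccarrier A"
  obtain X where X: "\<And>n. X n \<in> F" "\<And>n. cnorm A (cdiff A a (emb (X n))) < 1 / real (Suc n)"
    by (rule emb_sequence[of "\<lambda>_. a", OF a]) blast
  have conv: "cconverges A (\<lambda>n. emb (X n)) a"
  proof (rule A.converges_le)
    show "cnorm A (cdiff A (emb (X n)) a) \<le> 1 / real (Suc n)" for n
      using X(2)[of n] A.norm_diff_commute[of a "emb (X n)"] X(1) a by simp
    show "(\<lambda>n. 1 / real (Suc n)) \<longlonglongrightarrow> 0" using LIMSEQ_inverse_real_of_nat by (simp add: inverse_eq_divide)
  qed (use X a in auto)
  have "A.closed_set K" using K by (simp add: A.closed_ideal_iff)
  from this[unfolded A.closed_set_def, rule_format, OF a _ conv]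
  show "a \<in> K" using emb X(1) by simp
qed

text \<open>For polynomial middle factors this is \<open>hereditary_orthogonal\<close>. Density
  extends it to arbitrary middle factors, and \<open>generated_orthogonal\<close> then passes from
  the generators to the ideals.\<close>

lemma hereditary_orthogonal_ideals:
  assumes H: "hereditary \<Lambda> H1" "hereditary \<Lambda> H2" "H1 \<inter> H2 = {}"
    and "a \<in> graph_ideal \<Lambda> H1" "b \<in> graph_ideal \<Lambda> H2"
  shows "cmult A a b = czero A"
proof -
  have sub: "H1 \<subseteq> vertices \<Lambda>" "H2 \<subseteq> vertices \<Lambda>" using H by (auto simp: hereditary_def)
  have emb0: "cmult A (cmult A (emb (gen v)) (emb f)) (emb (gen w)) = czero A"
    if "v \<in> H1" "w \<in> H2" "f \<in> F" for v w f
  proof -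
    have vw: "gen v \<in> F" "gen w \<in> F" using that sub by (auto simp: subset_iff)
    then show ?thesis using emb_null[OF hereditary_orthogonal[OF H that]] that(3) by (simp add: emb_mult)
  qed
  have zero: "cmult A (cmult A (emb (gen v)) c) (emb (gen w)) = czero A"
    if vw: "v \<in> H1" "w \<in> H2" and c: "c \<in> ccarrier A" for v w c
  proof -
    let ?v = "emb (gen v)" and ?w = "emb (gen w)"
    let ?p = "cmult A (cmult A ?v c) ?w"
    have v: "v \<in> mor \<Lambda>" "w \<in> mor \<Lambda>" using vw sub by auto
    then have C: "?v \<in> ccarrier A" "?w \<in> ccarrier A" by auto
    have n1: "cnorm A ?v \<le> 1" "cnorm A ?w \<le> 1" using U_gen_le v by auto
    have "cnorm A ?p \<le> e" if e: "0 < e" for e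
    proof -
      obtain f where f: "f \<in> F" "cnorm A (cdiff A c (emb f)) < e" using emb_dense[OF c e] .
      let ?d = "cdiff A c (emb f)"
      have d: "?d \<in> ccarrier A" using c f by simp
      have "cmult A (cmult A ?v ?d) ?w = cdiff A ?p (cmult A (cmult A ?v (emb f)) ?w)"
        using C c f by (simp add: A.diff_mult_left A.diff_mult_right)
      then have "cmult A (cmult A ?v ?d) ?w = ?p" using emb0[OF vw f(1)] C c by simp
      then have "cnorm A ?p \<le> cnorm A (cmult A ?v ?d) * cnorm A ?w"
        using A.norm_mult[of "cmult A ?v ?d" ?w] C d by simp
      also have "\<dots> \<le> cnorm A ?v * cnorm A ?d * cnorm A ?w"
        using C d by (intro mult_right_mono A.norm_mult A.norm_nonneg) auto
      also have "\<dots> \<le> 1 * e * 1"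
        using n1 f(2) C d e by (intro mult_mono) (auto intro: A.norm_nonneg mult_nonneg_nonneg)
      finally show ?thesis by simp
    qed
    then have "cnorm A ?p \<le> 0" by (meson dense not_less)
    then have "cnorm A ?p = 0" using A.norm_nonneg[of ?p] C c by simp
    then show ?thesis using C c by (simp add: A.norm_eq_zero)
  qed
  show ?thesis
  proof (rule A.generated_orthogonal[of "gens H1" "gens H2"])
    show "gens H1 \<subseteq> ccarrier A" "gens H2 \<subseteq> ccarrier A" using sub by (auto simp: subset_iff)
    show "a \<in> ideal_generated A (gens H1)" "b \<in> ideal_generated A (gens H2)"
      using assms(4,5) by (auto simp: graph_ideal_eq)
    show "cmult A (cmult A y c) z = czero A" if "y \<in> gens H1" "c \<in> ccarrier A" "z \<in> gens H2" for y c z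
      using that zero by auto
    show "cmult A y z = czero A" if yz: "y \<in> gens H1" "z \<in> gens H2" for y z
    proof -
      obtain v w where vw: "v \<in> H1" "w \<in> H2" "y = emb (gen v)" "z = emb (gen w)" using yz by auto
      then have "v \<in> vertices \<Lambda>" "w \<in> vertices \<Lambda>" "v \<noteq> w" using sub H by auto
      then have "null (gen v * gen w)" using gen_mult_null[of v w] by simp
      then show ?thesis using vw \<open>v \<in> vertices \<Lambda>\<close> \<open>w \<in> vertices \<Lambda>\<close> emb_null by (simp flip: emb_mult)
    qed
  qed
qed

text \<open>For a vertex \<open>v\<close> outside both sets, \<open>gen v\<close> is a sum of range
  projections of paths ending in \<open>H1\<close> or \<open>H2\<close>, each of which lies in one
  of the two ideals. Hence a closed ideal containing both contains all vertex projections.\<close>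

lemma splitting_pair_splits:
  assumes "splitting_pair \<Lambda> H1 H2"
  shows "cstar_splitting A (graph_ideal \<Lambda> H1) (graph_ideal \<Lambda> H2)"
proof (rule A.splitting_of_orthogonal_ideals)
  have H: "hereditary \<Lambda> H1" "hereditary \<Lambda> H2" "H1 \<inter> H2 = {}" "H1 \<subseteq> vertices \<Lambda>" "H2 \<subseteq> vertices \<Lambda>"
    using assms by (auto simp: splitting_pair_def sat_her_def hereditary_def)
  show "closed_ideal A (graph_ideal \<Lambda> H1)" "closed_ideal A (graph_ideal \<Lambda> H2)"
    using H by (auto intro: closed_graph_ideal)
  show "cadj A a \<in> graph_ideal \<Lambda> H1" if "a \<in> graph_ideal \<Lambda> H1" for a by (rule graph_ideal_adj[OF H(4) that])
  show "cadj A a \<in> graph_ideal \<Lambda> H2" if "a \<in> graph_ideal \<Lambda> H2" for a by (rule graph_ideal_adj[OF H(5) that])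
  show "cmult A a b = czero A" if "a \<in> graph_ideal \<Lambda> H1" "b \<in> graph_ideal \<Lambda> H2" for a b
    by (rule hereditary_orthogonal_ideals[OF H(1-3) that])
  fix K assume K: "closed_ideal A K" and sub: "graph_ideal \<Lambda> H1 \<subseteq> K" "graph_ideal \<Lambda> H2 \<subseteq> K"
  then have HK: "emb (gen v) \<in> K" if "v \<in> H1 \<union> H2" for v using gen_in_graph_ideal that by blast
  show "ccarrier A \<subseteq> K"
  proof (rule ideal_with_vertices[OF K])
    fix v assume v: "v \<in> vertices \<Lambda>"
    show "emb (gen v) \<in> K"
    proof (cases "v \<in> H1 \<union> H2")
      case False
      then obtain n where n: "src \<Lambda> ` paths_le \<Lambda> v n \<subseteq> H1 \<union> H2"
        using assms v unfolding splitting_pair_def by blast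
      have "emb (\<Sum>\<kappa>\<in>paths_le \<Lambda> v n. gen \<kappa> * poly_adj (gen \<kappa>)) \<in> K"
      proof (rule emb_sum_in_ideal[OF K])
        fix \<kappa> assume \<kappa>: "\<kappa> \<in> paths_le \<Lambda> v n"
        then have m: "\<kappa> \<in> mor \<Lambda>" "src \<Lambda> \<kappa> \<in> H1 \<union> H2" using paths_leD[OF \<kappa>] n by auto
        show "gen \<kappa> * poly_adj (gen \<kappa>) \<in> F" using m by auto
        have "emb (gen \<kappa> * gen (src \<Lambda> \<kappa>)) \<in> K"
          using HK[OF m(2)] m(1) by (intro emb_mult_in_ideal[OF K]) auto
        then have "emb (gen \<kappa>) \<in> K" using emb_eqv[OF gen_src[OF m(1)]] by simp
        then show "emb (gen \<kappa> * poly_adj (gen \<kappa>)) \<in> K"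
          using m(1) by (intro emb_mult_in_ideal[OF K]) auto
      qed
      then show ?thesis using emb_eqv[OF gen_vertex_sum[OF v, of n]] by simp
    qed (use HK in blast)
  qed
qed

lemma splitting_pair_direct_sum:
  assumes "splitting_pair \<Lambda> H1 H2"
  shows "internal_direct_sum (graph_cstar \<Lambda>) (graph_ideal \<Lambda> H1) (graph_ideal \<Lambda> H2)"
proof -
  interpret S: cstar_splitting A "graph_ideal \<Lambda> H1" "graph_ideal \<Lambda> H2" by (rule splitting_pair_splits[OF assms])
  have "H1 \<subseteq> vertices \<Lambda>" "H2 \<subseteq> vertices \<Lambda>"
    using assms by (auto simp: splitting_pair_def sat_her_def hereditary_def)
  then have "closed_ideal A (graph_ideal \<Lambda> H1)" "closed_ideal A (graph_ideal \<Lambda> H2)"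
    by (auto intro: closed_graph_ideal)
  then show ?thesis unfolding graph_cstar_eq A.closed_ideal_iff by (intro S.internal_direct_sum) auto
qed

lemma splitting_pair_decomposable:
  assumes "splitting_pair \<Lambda> H1 H2" shows "decomposable (graph_cstar \<Lambda>)"
proof -
  have ne: "graph_ideal \<Lambda> H \<noteq> {czero A}" if H: "H \<subseteq> vertices \<Lambda>" "H \<noteq> {}" for H
  proof -
    obtain v where v: "v \<in> H" "v \<in> vertices \<Lambda>" using H by auto
    then have "cnorm A (emb (gen v)) \<noteq> 0" using U_vertex[OF v(2)] by auto
    then have "emb (gen v) \<noteq> czero A" by auto
    then show ?thesis using gen_in_graph_ideal[OF v(1)] by auto
  qed
  have "H1 \<subseteq> vertices \<Lambda>" "H2 \<subseteq> vertices \<Lambda>" "H1 \<noteq> {}" "H2 \<noteq> {}"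
    using assms by (auto simp: splitting_pair_def sat_her_def hereditary_def)
  then have "graph_ideal \<Lambda> H1 \<noteq> {czero A}" "graph_ideal \<Lambda> H2 \<noteq> {czero A}" using ne by simp_all
  with splitting_pair_direct_sum[OF assms] show ?thesis
    unfolding decomposable_def graph_cstar_eq by (intro exI conjI)
qed

section \<open>Removing a saturated hereditary set\<close>

lemma remove_simps [simp]:
  "mor (remove \<Lambda> H) = {\<kappa> \<in> mor \<Lambda>. src \<Lambda> \<kappa> \<notin> H}" "rng (remove \<Lambda> H) = rng \<Lambda>" "src (remove \<Lambda> H) = src \<Lambda>"
  "cmp (remove \<Lambda> H) = cmp \<Lambda>" "deg (remove \<Lambda> H) = deg \<Lambda>"
  by (simp_all add: remove_def)

lemma vertices_remove: "vertices (remove \<Lambda> H) = vertices \<Lambda> - H"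
proof -
  have "src \<Lambda> v = v" if "v \<in> mor \<Lambda>" "deg \<Lambda> v = 0" for v
    using vertexD(3)[OF deg_zero_vertex[OF that]] .
  then show ?thesis by (auto simp: vertices_def simp del: vertexD)
qed

lemma paths_remove: "paths (remove \<Lambda> H) v n = {\<kappa> \<in> paths \<Lambda> v n. src \<Lambda> \<kappa> \<notin> H}"
  by (auto simp: paths_def)

text \<open>The only other candidate is the vertex \<open>u\<close> itself, and it is excluded
  because an edge of direction \<open>i\<close> leaves it.\<close>

lemma paths_le_axis:
  assumes "u \<in> vertices \<Lambda>" "paths \<Lambda> u (axis i 1) \<noteq> {}"
  shows "paths_le \<Lambda> u (axis i 1) \<subseteq> paths \<Lambda> u (axis i 1)"
proof
  fix \<kappa> assume \<kappa>: "\<kappa> \<in> paths_le \<Lambda> u (axis i 1)"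
  note \<kappa>' = paths_leD[OF \<kappa>]
  have j: "deg \<Lambda> \<kappa> $ j = 0" if "j \<noteq> i" for j
    using \<kappa>'(3) that by (auto simp: less_eq_vec_def axis_def dest: spec[of _ j])
  have "deg \<Lambda> \<kappa> $ i \<noteq> 0"
  proof
    assume "deg \<Lambda> \<kappa> $ i = 0"
    with j have "deg \<Lambda> \<kappa> $ l = 0" for l by (cases "l = i") auto
    then have "deg \<Lambda> \<kappa> = 0" by (simp add: vec_eq_iff)
    then have "\<kappa> \<in> vertices \<Lambda>" using deg_zero_vertex \<kappa>' by blast
    then have "src \<Lambda> \<kappa> = u" using \<kappa>'(2) by simp
    moreover have "paths \<Lambda> (src \<Lambda> \<kappa>) (axis i 1) = {}"
      using \<kappa> \<open>deg \<Lambda> \<kappa> $ i = 0\<close> by (auto simp: paths_le_def axis_def)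
    ultimately show False using assms by simp
  qed
  moreover have "deg \<Lambda> \<kappa> $ i \<le> 1" using \<kappa>'(3) by (auto simp: less_eq_vec_def axis_def dest: spec[of _ i])
  ultimately have "deg \<Lambda> \<kappa> $ i = 1" by linarith
  with j have "deg \<Lambda> \<kappa> = axis i 1" by (auto simp: vec_eq_iff axis_def)
  then show "\<kappa> \<in> paths \<Lambda> u (axis i 1)" using \<kappa>' by (simp add: paths_def)
qed

text \<open>Saturation guarantees that removal creates no new dead ends: if all edges of direction
  \<open>i\<close> from \<open>u\<close> ended in \<open>H\<close>, then \<open>u\<close> itself
  would belong to \<open>H\<close>.\<close>

lemma paths_le_remove:
  assumes H: "saturated \<Lambda> H"
  shows "paths_le (remove \<Lambda> H) v n = {\<kappa> \<in> paths_le \<Lambda> v n. src \<Lambda> \<kappa> \<notin> H}"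
proof -
  have "paths (remove \<Lambda> H) u (axis i 1) = {} \<longleftrightarrow> paths \<Lambda> u (axis i 1) = {}" if u: "u \<in> vertices \<Lambda>" "u \<notin> H" for u i
  proof
    assume e: "paths (remove \<Lambda> H) u (axis i 1) = {}"
    show "paths \<Lambda> u (axis i 1) = {}"
    proof (rule ccontr)
      assume "paths \<Lambda> u (axis i 1) \<noteq> {}"
      then have "src \<Lambda> ` paths_le \<Lambda> u (axis i 1) \<subseteq> H"
        using e paths_le_axis[OF u(1), of i] by (auto simp: paths_remove)
      then show False using H u by (auto simp: saturated_def)
    qed
  qed (simp add: paths_remove)
  then have "paths (remove \<Lambda> H) (src \<Lambda> \<kappa>) (axis i 1) = {} \<longleftrightarrow> paths \<Lambda> (src \<Lambda> \<kappa>) (axis i 1) = {}"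
    if "\<kappa> \<in> mor \<Lambda>" "src \<Lambda> \<kappa> \<notin> H" for \<kappa> i
    using that by (simp del: One_nat_def)
  then show ?thesis by (auto simp: paths_le_def simp del: One_nat_def)
qed

text \<open>A 0-1 character on letters; the result is a *-homomorphism onto the free algebra of the
  smaller graph that restricts to the identity there.\<close>

definition drop :: "'a set \<Rightarrow> 'a star_poly \<Rightarrow> 'a star_poly" where
  "drop H = twist (char_of (\<lambda>\<kappa>. if src \<Lambda> \<kappa> \<in> H then 0 else 1))"

lemma drop_gen: "drop H (gen \<kappa>) = (if src \<Lambda> \<kappa> \<in> H then 0 else gen \<kappa>)"
  by (simp add: drop_def twist_char_of_gen)

lemma drop_add: "drop H (f + g) = drop H f + drop H g"
  and drop_diff: "drop H (f - g) = drop H f - drop H g"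
  and drop_mult: "drop H (f * g) = drop H f * drop H g"
  and drop_adj: "drop H (poly_adj f) = poly_adj (drop H f)"
  and drop_sum: "drop H (sum h S) = (\<Sum>x\<in>S. drop H (h x))"
  and drop_zero [simp]: "drop H 0 = 0"
  unfolding drop_def
  by (simp_all add: twist_add twist_diff twist_mult[OF word_char_char_of] twist_adj[OF word_char_char_of] twist_sum)

lemma drop_scal: "drop H (scal z * f) = scal z * drop H f"
  unfolding drop_def by (rule twist_scal[OF word_char_char_of])

lemma drop_F: "f \<in> F \<Longrightarrow> drop H f \<in> free_star_algebra (mor (remove \<Lambda> H))"
proof (induction rule: free_induct)
  case (scal z f)
  then show ?case unfolding drop_scal by (intro free_scal)
qed (auto simp: drop_gen drop_add drop_mult drop_adj)

lemma drop_id: "f \<in> free_star_algebra (mor (remove \<Lambda> H)) \<Longrightarrow> drop H f = f"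
proof (induction rule: free_induct)
  case (scal z f)
  then show ?case by (simp only: drop_scal)
qed (auto simp: drop_gen drop_add drop_mult drop_adj)

text \<open>Heredity ensures that dropping one factor of a composite also drops the composite, and
  that all paths from a vertex of \<open>H\<close> disappear; saturation makes the surviving paths
  exactly those of the sum relation in the smaller graph.\<close>

lemma drop_relator:
  assumes H: "hereditary \<Lambda> H" "saturated \<Lambda> H" and x: "x \<in> ck_relators \<Lambda>"
  shows "drop H x \<in> ck_relators (remove \<Lambda> H) \<or> drop H x = 0"
proof -
  from x show ?thesis
  proof (cases rule: ck_relator_cases)
    case (pi \<kappa>)
    then show ?thesis
      by (cases "src \<Lambda> \<kappa> \<in> H") (auto simp: drop_diff drop_mult drop_adj drop_gen ck_relators_def)
  next
    case (vw v w)
    show ?thesis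
    proof (cases "v \<in> H \<or> w \<in> H")
      case True
      then show ?thesis using vw by (auto simp: drop_diff drop_mult drop_gen)
    next
      case False
      then have "drop H x = gen v * gen w - (if v = w then gen v else 0)" "v \<in> vertices (remove \<Lambda> H)" "w \<in> vertices (remove \<Lambda> H)"
        using vw by (auto simp: drop_diff drop_mult drop_gen vertices_remove)
      then show ?thesis unfolding ck_relators_def by blast
    qed
  next
    case (cmp \<kappa> \<mu>)
    show ?thesis
    proof (cases "src \<Lambda> \<mu> \<in> H")
      case True
      then show ?thesis using cmp by (simp add: drop_diff drop_mult drop_gen)
    next
      case False
      then have "src \<Lambda> \<kappa> \<notin> H" using H cmp by (auto simp: hereditary_def)
      then have "drop H x = gen \<kappa> * gen \<mu> - gen (cmp (remove \<Lambda> H) \<kappa> \<mu>)" "\<kappa> \<in> mor (remove \<Lambda> H)" "\<mu> \<in> mor (remove \<Lambda> H)"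
        "src (remove \<Lambda> H) \<kappa> = rng (remove \<Lambda> H) \<mu>"
        using False cmp by (simp_all add: drop_diff drop_mult drop_gen)
      then show ?thesis unfolding ck_relators_def by blast
    qed
  next
    case (src \<kappa>)
    show ?thesis
    proof (cases "src \<Lambda> \<kappa> \<in> H")
      case True
      then show ?thesis using src by (simp add: drop_diff drop_mult drop_adj drop_gen)
    next
      case False
      then have "drop H x = poly_adj (gen \<kappa>) * gen \<kappa> - gen (src (remove \<Lambda> H) \<kappa>)" "\<kappa> \<in> mor (remove \<Lambda> H)"
        using src by (simp_all add: drop_diff drop_mult drop_adj drop_gen)
      then show ?thesis unfolding ck_relators_def by blast
    qed
  next
    case (sum v n)
    have d: "drop H (gen \<kappa> * poly_adj (gen \<kappa>)) = (if src \<Lambda> \<kappa> \<notin> H then gen \<kappa> * poly_adj (gen \<kappa>) else 0)" for \<kappa>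
      by (simp add: drop_mult drop_adj drop_gen)
    have "drop H (\<Sum>\<kappa>\<in>paths_le \<Lambda> v n. gen \<kappa> * poly_adj (gen \<kappa>)) =
        (\<Sum>\<kappa>\<in>paths_le (remove \<Lambda> H) v n. gen \<kappa> * poly_adj (gen \<kappa>))"
      unfolding drop_sum d paths_le_remove[OF H(2)]
      by (rule sum.inter_filter[symmetric]) (rule finite_paths_le[OF sum(1)])
    then have dx: "drop H x = drop H (gen v) - (\<Sum>\<kappa>\<in>paths_le (remove \<Lambda> H) v n. gen \<kappa> * poly_adj (gen \<kappa>))"
      by (simp add: sum(2) drop_diff)
    show ?thesis
    proof (cases "v \<in> H")
      case True
      have "paths_le (remove \<Lambda> H) v n = {}"
        using H(1) True unfolding paths_le_remove[OF H(2)] by (auto simp: hereditary_def paths_leD)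
      then show ?thesis using dx True sum(1) by (simp add: drop_gen)
    next
      case False
      then have "drop H (gen v) = gen v" "v \<in> vertices (remove \<Lambda> H)" using sum(1) by (simp_all add: drop_gen vertices_remove)
      then show ?thesis using dx unfolding ck_relators_def by auto
    qed
  qed
qed

text \<open>Only the sum relation changes under removal. There the two relators differ by the range
  projections of paths ending in \<open>H\<close>, and these lie in the ideal.\<close>

lemma relator_remove:
  assumes H: "saturated \<Lambda> H" and x: "x \<in> ck_relators (remove \<Lambda> H)"
  shows "emb x \<in> graph_ideal \<Lambda> H"
proof -
  have sub: "H \<subseteq> vertices \<Lambda>" using H by (simp add: saturated_def)
  have I: "closed_ideal A (graph_ideal \<Lambda> H)" by (rule closed_graph_ideal[OF sub])
  have rel: "emb y \<in> graph_ideal \<Lambda> H" if "y \<in> ck_relators \<Lambda>" for y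
    using emb_null[of y] universal_relator[OF that] relators_F[OF that] I by (simp add: null_def A.closed_ideal_iff)
  from x show ?thesis
  proof (cases rule: ck_relator_cases)
    case (pi \<kappa>)
    then have "x \<in> ck_relators \<Lambda>" unfolding ck_relators_def by auto
    then show ?thesis by (rule rel)
  next
    case (vw v w)
    then have "v \<in> vertices \<Lambda>" "w \<in> vertices \<Lambda>" by (auto simp: vertices_remove)
    then have "x \<in> ck_relators \<Lambda>" using vw(3) unfolding ck_relators_def by blast
    then show ?thesis by (rule rel)
  next
    case (cmp \<kappa> \<mu>)
    then have "\<kappa> \<in> mor \<Lambda>" "\<mu> \<in> mor \<Lambda>" "src \<Lambda> \<kappa> = rng \<Lambda> \<mu>" "x = gen \<kappa> * gen \<mu> - gen (cmp \<Lambda> \<kappa> \<mu>)" by auto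
    then have "x \<in> ck_relators \<Lambda>" unfolding ck_relators_def by blast
    then show ?thesis by (rule rel)
  next
    case (src \<kappa>)
    then have "\<kappa> \<in> mor \<Lambda>" "x = poly_adj (gen \<kappa>) * gen \<kappa> - gen (src \<Lambda> \<kappa>)" by auto
    then have "x \<in> ck_relators \<Lambda>" unfolding ck_relators_def by blast
    then show ?thesis by (rule rel)
  next
    case (sum v n)
    let ?e = "\<lambda>\<kappa>. gen \<kappa> * poly_adj (gen \<kappa>)" and ?P = "paths_le \<Lambda> v n"
    have v: "v \<in> vertices \<Lambda>" using sum(1) by (simp add: vertices_remove)
    define y where "y = gen v - sum ?e ?P"
    have y: "y \<in> ck_relators \<Lambda>" unfolding y_def ck_relators_def using v by blast
    let ?R = "{\<kappa> \<in> ?P. src \<Lambda> \<kappa> \<in> H}"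
    have "sum ?e ?P = sum ?e (?P - ?R) + sum ?e ?R"
      by (rule sum.subset_diff) (auto simp: finite_paths_le[OF v])
    moreover have "?P - ?R = paths_le (remove \<Lambda> H) v n" unfolding paths_le_remove[OF H] by auto
    ultimately have "x = y + sum ?e ?R" by (simp add: sum(2) y_def)
    moreover have "emb (sum ?e ?R) \<in> graph_ideal \<Lambda> H"
    proof (rule emb_sum_in_ideal[OF I])
      fix \<kappa> assume \<kappa>: "\<kappa> \<in> ?R"
      then have m: "\<kappa> \<in> mor \<Lambda>" "src \<Lambda> \<kappa> \<in> H" by (auto simp: paths_leD)
      have "emb (gen \<kappa> * gen (src \<Lambda> \<kappa>)) \<in> graph_ideal \<Lambda> H"
        using m by (intro emb_mult_in_ideal[OF I]) (auto intro: gen_in_graph_ideal)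
      then have "emb (gen \<kappa>) \<in> graph_ideal \<Lambda> H" using emb_eqv[OF gen_src[OF m(1)]] by simp
      then show "emb (?e \<kappa>) \<in> graph_ideal \<Lambda> H"
        using m(1) by (intro emb_mult_in_ideal[OF I]) auto
    qed (auto simp: paths_leD)
    moreover have "sum ?e ?R \<in> F" by (auto simp: paths_leD)
    ultimately show ?thesis using rel[OF y] I relators_F[OF y] by (simp add: emb_add A.closed_ideal_iff)
  qed
qed

lemma graph_ideal_isomorphic:
  assumes pair: "splitting_pair \<Lambda> H1 H2"
  shows "graph_cstar \<Lambda> \<restriction>\<^sub>* graph_ideal \<Lambda> H1 \<cong>\<^sub>* graph_cstar (remove \<Lambda> H2)"
proof -
  let ?I1 = "graph_ideal \<Lambda> H1" and ?I2 = "graph_ideal \<Lambda> H2" and ?G = "mor (remove \<Lambda> H2)"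
  let ?d = "drop H2"
  have H: "hereditary \<Lambda> H2" "saturated \<Lambda> H2" "H1 \<subseteq> vertices \<Lambda>" "H2 \<subseteq> vertices \<Lambda>"
    using pair by (auto simp: splitting_pair_def sat_her_def hereditary_def)
  interpret S: cstar_splitting A ?I1 ?I2 by (rule splitting_pair_splits[OF pair])
  interpret B: partial_isometry_relators ?G "ck_relators (remove \<Lambda> H2)" by (rule partial_isometry_ck_relators)
  have CA: "cstar_algebra A" and CB: "cstar_algebra B.A"
    by (rule cstar_algebra_completion, rule B.cstar_algebra_completion)
  interpret CB: cstar_algebra B.A by (rule CB)
  have I1: "closed_ideal A ?I1" and I2: "closed_ideal A ?I2" using H by (auto intro: closed_graph_ideal)
  have sub: "?G \<subseteq> mor \<Lambda>" by auto
  have FG: "f \<in> F" if "f \<in> B.F" for f using free_mono[OF sub] that by blast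
  have le: "B.U (?d f) \<le> U f" if f: "f \<in> F" for f
  proof (rule universal_upper[OF _ f])
    have "cstar_seminorm (mor \<Lambda>) (\<lambda>f. B.U (?d f))"
      by (rule cstar_seminorm_pullback[OF B.cstar_seminorm_universal])
        (rule drop_F drop_add drop_mult drop_adj drop_scal | assumption)+
    moreover have "B.U (?d x) = 0" if "x \<in> ck_relators \<Lambda>" for x
      using drop_relator[OF H(1,2) that]
    proof
      assume "?d x \<in> ck_relators (remove \<Lambda> H2)"
      then show ?thesis by (rule B.universal_relator)
    next
      assume "?d x = 0"
      then show ?thesis by (simp only: B.p_zero)
    qed
    ultimately show "(\<lambda>f. B.U (?d f)) \<in> seminorms" by simp
  qed
  obtain h where h: "star_hom A B.A h" "\<And>f. f \<in> F \<Longrightarrow> h (emb f) = B.emb (?d f)"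
    "\<And>a. a \<in> ccarrier A \<Longrightarrow> cnorm B.A (h a) \<le> cnorm A a"
    by (rule induced_hom[OF cstar_seminorm_universal B.cstar_seminorm_universal, of ?d],
        (rule drop_F drop_add drop_mult drop_adj drop_scal le | assumption)+) blast
  have kill: "h a = czero B.A" if "a \<in> ?I2" for a
  proof -
    have "gens H2 \<subseteq> {a \<in> ccarrier A. h a = czero B.A}"
    proof
      fix y assume "y \<in> gens H2"
      then obtain v where v: "v \<in> H2" "y = emb (gen v)" by auto
      then have "v \<in> vertices \<Lambda>" using H by auto
      then have "h y = B.emb (?d (gen v))" "?d (gen v) = 0" using v h(2)[of "gen v"] by (simp_all add: drop_gen)
      then have "h y = czero B.A" by (simp only: B.czero_cls)
      then show "y \<in> {a \<in> ccarrier A. h a = czero B.A}" using v \<open>v \<in> vertices \<Lambda>\<close> by simp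
    qed
    then have "?I2 \<subseteq> {a \<in> ccarrier A. h a = czero B.A}"
      unfolding graph_ideal_eq by (intro A.generated_least closed_ideal_kernel[OF CA CB h(1,3)])
    then show ?thesis using that by auto
  qed
  \<comment> \<open>Thus \<open>f\<close> and \<open>?d f\<close> have the same first component,
    which therefore depends on \<open>?d f\<close> alone. Products are treated by
    telescoping.\<close>
  have dropI2: "emb (f - ?d f) \<in> ?I2" if "f \<in> F" for f
    using that
  proof (induction rule: free_induct)
    case zero
    then show ?case using I2 by (simp add: A.closed_ideal_iff flip: czero_cls)
  next
    case (gen \<kappa>)
    show ?case
    proof (cases "src \<Lambda> \<kappa> \<in> H2")
      case True
      have "emb (gen \<kappa> * gen (src \<Lambda> \<kappa>)) \<in> ?I2"
        using gen True by (intro emb_mult_in_ideal[OF I2]) (auto intro: gen_in_graph_ideal)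
      then show ?thesis using emb_eqv[OF gen_src[OF gen]] True by (simp add: drop_gen)
    next
      case False
      then show ?thesis using I2 by (simp add: drop_gen A.closed_ideal_iff flip: czero_cls)
    qed
  next
    case (add f g)
    have eq: "f + g - ?d (f + g) = (f - ?d f) + (g - ?d g)" by (simp add: drop_add)
    have "f - ?d f \<in> F" "g - ?d g \<in> F" using add drop_F FG by auto
    then show ?case unfolding eq using add I2 by (simp add: emb_add A.closed_ideal_iff)
  next
    case (scal z f)
    have "scal z * f - ?d (scal z * f) = scal z * (f - ?d f)" by (simp only: drop_scal right_diff_distrib)
    moreover have "f - ?d f \<in> F" using scal drop_F FG by auto
    ultimately show ?case using scal I2 by (simp add: emb_scal A.closed_ideal_iff)
  next
    case (mult f g)
    have F: "f - ?d f \<in> F" "g - ?d g \<in> F" "?d f \<in> F" using mult drop_F FG by auto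
    have "f * g - ?d (f * g) = (f - ?d f) * g + ?d f * (g - ?d g)" by (simp add: drop_mult algebra_simps)
    moreover have "emb ((f - ?d f) * g) \<in> ?I2" "emb (?d f * (g - ?d g)) \<in> ?I2"
      using mult F by (auto intro!: emb_mult_in_ideal[OF I2])
    ultimately show ?case using F mult I2 by (simp add: emb_add A.closed_ideal_iff)
  next
    case (adj f)
    have "poly_adj f - ?d (poly_adj f) = poly_adj (f - ?d f)" by (simp add: drop_adj poly_adj_diff)
    moreover have "f - ?d f \<in> F" using adj drop_F FG by auto
    ultimately show ?case using graph_ideal_adj[OF H(4) adj(2)] by (simp add: emb_adj)
  qed
  have proj_le: "cnorm A (S.proj (emb f)) \<le> B.U f" if f: "f \<in> B.F" for f
  proof (rule B.universal_upper[OF _ f])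
    have "cstar_seminorm ?G (\<lambda>f. cnorm A (S.proj (emb f)))"
      by (rule cstar_seminorm_mono[OF sub cstar_seminorm_hom[OF CA S.star_hom_proj]])
    then show "(\<lambda>f. cnorm A (S.proj (emb f))) \<in> B.seminorms"
      using relator_remove[OF H(2)] by simp
  qed
  have proj_emb: "cnorm A (S.proj (emb f)) \<le> cnorm B.A (h (emb f))" if f: "f \<in> F" for f
  proof -
    have d: "?d f \<in> B.F" "?d f \<in> F" using drop_F[OF f] FG by auto
    have "S.proj (emb (f - ?d f)) = czero A" by (rule S.proj_T[OF dropI2[OF f]])
    then have "cdiff A (S.proj (emb f)) (S.proj (emb (?d f))) = czero A"
      using star_hom_diff[OF S.star_hom_proj emb_carrier[OF f] emb_carrier[OF d(2)] CA] f d by (simp add: emb_diff)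
    then have "S.proj (emb f) = S.proj (emb (?d f))"
      using f d S.proj_in_S by (simp add: A.diff_eq_zero)
    then show ?thesis using proj_le[OF d(1)] by (simp only: h(2)[OF f] B.cnorm_emb[OF d(1)])
  qed
  \<comment> \<open>Both \<open>S.proj\<close> and \<open>h\<close> are contractive, so passing from
    a polynomial within \<open>e / 2\<close> of \<open>a\<close> to \<open>a\<close> costs
    \<open>e / 2\<close> on each side.\<close>
  have norm_proj: "cnorm A (S.proj a) \<le> cnorm B.A (h a)" if a: "a \<in> ccarrier A" for a
  proof (rule field_le_epsilon)
    fix e :: real assume "0 < e"
    then have "0 < e / 2" by simp
    then obtain f where f: "f \<in> F" "cnorm A (cdiff A a (emb f)) < e / 2" by (rule emb_dense[OF a])
    have ef: "emb f \<in> ccarrier A" using f by simp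
    have hC: "h a \<in> ccarrier B.A" "h (emb f) \<in> ccarrier B.A" using star_homD(1)[OF h(1)] a ef by auto
    have "cnorm A (S.proj a) \<le> cnorm A (cdiff A (S.proj a) (S.proj (emb f))) + cnorm A (S.proj (emb f))"
      using a ef S.proj_in_S by (intro A.norm_le_diff) auto
    also have "cdiff A (S.proj a) (S.proj (emb f)) = S.proj (cdiff A a (emb f))"
      using star_hom_diff[OF S.star_hom_proj a ef CA] by simp
    also have "cnorm A (S.proj (cdiff A a (emb f))) \<le> cnorm A (cdiff A a (emb f))"
      using a ef by (intro S.norm_proj_le) auto
    finally have 1: "cnorm A (S.proj a) \<le> cnorm A (cdiff A a (emb f)) + cnorm A (S.proj (emb f))" by simp
    have "cnorm B.A (h (emb f)) \<le> cnorm B.A (cdiff B.A (h (emb f)) (h a)) + cnorm B.A (h a)"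
      using hC by (intro CB.norm_le_diff) auto
    also have "cdiff B.A (h (emb f)) (h a) = h (cdiff A (emb f) a)"
      using star_hom_diff[OF h(1) ef a CA] by simp
    also have "cnorm B.A (h (cdiff A (emb f) a)) \<le> cnorm A (cdiff A (emb f) a)" using a ef by (intro h(3)) auto
    finally have 2: "cnorm B.A (h (emb f)) \<le> cnorm A (cdiff A a (emb f)) + cnorm B.A (h a)"
      using A.norm_diff_commute[OF ef a] by simp
    show "cnorm A (S.proj a) \<le> cnorm B.A (h a) + e" using 1 2 proj_emb[OF f(1)] f(2) by linarith
  qed
  have "A \<restriction>\<^sub>* ?I1 \<cong>\<^sub>* B.A"
  proof (rule star_iso_isometric_dense[OF CA CB h(1) I1])
    fix a assume a: "a \<in> ?I1"
    then show "cnorm B.A (h a) = cnorm A a"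
      using norm_proj[of a] h(3)[of a] by (intro antisym) auto
  next
    fix b and e :: real assume b: "b \<in> ccarrier B.A" "0 < e"
    obtain f where f: "f \<in> B.F" "cnorm B.A (cdiff B.A b (B.emb f)) < e" using B.emb_dense[OF b] .
    have fF: "f \<in> F" using FG[OF f(1)] .
    \<comment> \<open>The first component \<open>s\<close> is the preimage sought: \<open>h\<close>
      kills \<open>t\<close>, and \<open>drop H2\<close> fixes \<open>f\<close>.\<close>
    obtain s t where st: "s \<in> ?I1" "t \<in> ?I2" "emb f = cadd A s t" using S.split_cases[OF emb_carrier[OF fF]] .
    have "h (emb f) = cadd B.A (h s) (h t)" using st star_homD(2)[OF h(1), of s t] by simp
    also have "\<dots> = h s"
      unfolding kill[OF st(2)] by (rule CB.add_zero[OF star_homD(1)[OF h(1) S.S_C[OF st(1)]]])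
    finally have "h s = B.emb f" by (simp only: h(2)[OF fF] drop_id[OF f(1)])
    with f(2) have "cnorm B.A (cdiff B.A b (h s)) < e" by (simp only:)
    with st(1) show "\<exists>a\<in>?I1. cnorm B.A (cdiff B.A b (h a)) < e" by (rule bexI[rotated])
  qed
  then show ?thesis
    by (simp add: graph_cstar_eq) (simp add: graph_cstar_def universal_cstar_def)
qed

section \<open>Splitting sets\<close>

lemma Delta_eq: "Delta \<Lambda> (vertices \<Lambda>) H = {v \<in> vertices \<Lambda>. \<forall>\<mu>\<in>mor \<Lambda>. rng \<Lambda> \<mu> = v \<longrightarrow> src \<Lambda> \<mu> \<notin> H}"
  by (auto simp: Delta_def tree_def)

text \<open>For saturation, suppose a path \<open>\<mu>\<close> from \<open>v\<close> ends in
  \<open>H\<close>. Extended to degree bound \<open>m\<close>, which dominates both \<open>n\<close>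
  and the degree of \<open>\<mu>\<close>, it still ends in \<open>H\<close>, but it also passes
  through the source of some \<open>\<alpha>\<close> in \<open>paths_le \<Lambda> v n\<close>, a
  vertex from which \<open>H\<close> cannot be reached.\<close>

lemma Delta_sat_her:
  assumes H: "hereditary \<Lambda> H" shows "Delta \<Lambda> (vertices \<Lambda>) H \<in> sat_her \<Lambda>"
proof -
  let ?D = "Delta \<Lambda> (vertices \<Lambda>) H"
  have her: "hereditary \<Lambda> ?D"
    unfolding hereditary_def
  proof (intro conjI ballI impI)
    fix \<kappa> assume \<kappa>: "\<kappa> \<in> mor \<Lambda>" "rng \<Lambda> \<kappa> \<in> ?D"
    have "src \<Lambda> \<mu> \<notin> H" if "\<mu> \<in> mor \<Lambda>" "rng \<Lambda> \<mu> = src \<Lambda> \<kappa>" for \<mu>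
    proof -
      have "cmp \<Lambda> \<kappa> \<mu> \<in> mor \<Lambda>" "rng \<Lambda> (cmp \<Lambda> \<kappa> \<mu>) = rng \<Lambda> \<kappa>" "src \<Lambda> (cmp \<Lambda> \<kappa> \<mu>) = src \<Lambda> \<mu>"
        using that \<kappa> by auto
      then show ?thesis using \<kappa>(2) by (auto simp: Delta_eq)
    qed
    then show "src \<Lambda> \<kappa> \<in> ?D" using \<kappa>(1) by (simp add: Delta_eq)
  qed (auto simp: Delta_eq)
  moreover have "saturated \<Lambda> ?D"
    unfolding saturated_def
  proof (intro conjI ballI impI)
    fix v assume v: "v \<in> vertices \<Lambda>" and "\<exists>n. src \<Lambda> ` paths_le \<Lambda> v n \<subseteq> ?D"
    then obtain n where n: "src \<Lambda> ` paths_le \<Lambda> v n \<subseteq> ?D" by blast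
    have "src \<Lambda> \<mu> \<notin> H" if \<mu>: "\<mu> \<in> mor \<Lambda>" "rng \<Lambda> \<mu> = v" for \<mu>
    proof
      assume sH: "src \<Lambda> \<mu> \<in> H"
      define m where "m = n + deg \<Lambda> \<mu>"
      have m: "deg \<Lambda> \<mu> \<le> m" "n \<le> m" by (auto simp: m_def less_eq_vec_def)
      obtain \<nu> where \<nu>: "\<nu> \<in> mor \<Lambda>" "src \<Lambda> \<mu> = rng \<Lambda> \<nu>" "cmp \<Lambda> \<mu> \<nu> \<in> paths_le \<Lambda> (rng \<Lambda> \<mu>) m"
        using paths_le_extend[OF \<mu>(1) m(1)] .
      obtain \<alpha> \<beta> where \<alpha>: "\<alpha> \<in> paths_le \<Lambda> (rng \<Lambda> \<mu>) n" "\<beta> \<in> mor \<Lambda>" "src \<Lambda> \<alpha> = rng \<Lambda> \<beta>" "cmp \<Lambda> \<mu> \<nu> = cmp \<Lambda> \<alpha> \<beta>"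
        using paths_le_factor[OF \<nu>(3) m(2)] .
      have "src \<Lambda> \<nu> \<in> H" using H \<nu> sH by (simp add: hereditary_def)
      moreover have "src \<Lambda> \<nu> = src \<Lambda> \<beta>"
        using src_cmp[OF \<mu>(1) \<nu>(1,2)] src_cmp[OF paths_leD(1)[OF \<alpha>(1)] \<alpha>(2,3)] \<alpha>(4) by simp
      moreover have "src \<Lambda> \<alpha> \<in> ?D" using n \<alpha>(1) \<mu>(2) by auto
      then have "src \<Lambda> \<beta> \<notin> H" using \<alpha>(2,3) by (simp add: Delta_eq)
      ultimately show False by simp
    qed
    then show "v \<in> ?D" using v by (simp add: Delta_eq)
  qed (auto simp: Delta_eq)
  ultimately show ?thesis by (simp add: sat_her_def)
qed

text \<open>Hence the set \<open>H'\<close> of the theorem is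
  \<open>Delta \<Lambda> (vertices \<Lambda>) H\<close> itself.\<close>

lemma saturation_Delta:
  "hereditary \<Lambda> H \<Longrightarrow> saturation \<Lambda> (Delta \<Lambda> (vertices \<Lambda>) H) = Delta \<Lambda> (vertices \<Lambda>) H"
  using Delta_sat_her[of H] by (auto simp: saturation_def sat_her_def)

lemma splitting_pair_of_splitting_set:
  assumes "splitting_set \<Lambda> H" shows "splitting_pair \<Lambda> (Delta \<Lambda> (vertices \<Lambda>) H) H"
proof -
  let ?D = "Delta \<Lambda> (vertices \<Lambda>) H"
  have H: "H \<in> sat_her \<Lambda>" "H \<noteq> {}" "?D \<noteq> {}" "hereditary \<Lambda> H"
    and om: "\<And>v. v \<in> Omega \<Lambda> (vertices \<Lambda>) H \<Longrightarrow> \<exists>n. src \<Lambda> ` paths_le \<Lambda> v n \<subseteq> H \<union> ?D"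
    using assms by (auto simp: splitting_set_def succ_rel_def sat_her_def)
  have "?D \<inter> H = {}"
  proof -
    have False if "v \<in> ?D" "v \<in> H" for v
    proof -
      have "v \<in> vertices \<Lambda>" using that(1) by (simp add: Delta_eq)
      then have "v \<in> mor \<Lambda>" "rng \<Lambda> v = v" "src \<Lambda> v = v" by simp_all
      moreover have "\<forall>\<mu>\<in>mor \<Lambda>. rng \<Lambda> \<mu> = v \<longrightarrow> src \<Lambda> \<mu> \<notin> H" using that(1) unfolding Delta_eq by blast
      ultimately show ?thesis using that(2) by metis
    qed
    then show ?thesis by blast
  qed
  moreover have "\<exists>n. src \<Lambda> ` paths_le \<Lambda> v n \<subseteq> ?D \<union> H" if "v \<in> vertices \<Lambda> - (?D \<union> H)" for v
  proof -
    have "v \<in> Omega \<Lambda> (vertices \<Lambda>) H" using that by (auto simp: Omega_def Delta_def)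
    from om[OF this] show ?thesis by (simp add: Un_commute)
  qed
  ultimately show ?thesis using H Delta_sat_her[OF H(4)] by (simp add: splitting_pair_def)
qed

lemma splitting_set_of_splitting_pair:
  assumes "splitting_pair \<Lambda> H1 H2" shows "splitting_set \<Lambda> H2"
proof -
  have H: "H1 \<in> sat_her \<Lambda>" "H2 \<in> sat_her \<Lambda>" "H1 \<noteq> {}" "H2 \<noteq> {}" "H1 \<inter> H2 = {}"
    and split: "\<And>v. v \<in> vertices \<Lambda> - (H1 \<union> H2) \<Longrightarrow> \<exists>n. src \<Lambda> ` paths_le \<Lambda> v n \<subseteq> H1 \<union> H2"
    using assms by (auto simp: splitting_pair_def)
  \<comment> \<open>Paths from \<open>H1\<close> stay in \<open>H1\<close> by heredity and so never
    meet \<open>H2\<close>.\<close>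
  have sub: "H1 \<subseteq> Delta \<Lambda> (vertices \<Lambda>) H2"
    using H by (auto simp: Delta_eq sat_her_def hereditary_def)
  have "\<exists>n. src \<Lambda> ` paths_le \<Lambda> v n \<subseteq> H2 \<union> Delta \<Lambda> (vertices \<Lambda>) H2" if v: "v \<in> Omega \<Lambda> (vertices \<Lambda>) H2" for v
  proof -
    have "v \<notin> Delta \<Lambda> (vertices \<Lambda>) H2" using v by (auto simp: Omega_def Delta_def)
    then have "v \<in> vertices \<Lambda> - (H1 \<union> H2)" using v sub by (auto simp: Omega_def)
    from split[OF this] show ?thesis using sub by blast
  qed
  moreover have "H2 \<subseteq> vertices \<Lambda>" using H by (simp add: sat_her_def hereditary_def)
  ultimately show ?thesis using H sub by (auto simp: splitting_set_def succ_rel_def)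
qed

end

theorem theorem6p6:
  fixes \<Lambda> :: "('a, 'k::finite) kgraph"
  assumes "k_graph \<Lambda>" "row_finite \<Lambda>" "locally_convex \<Lambda>"
  shows "(decomposable (graph_cstar \<Lambda>) \<longleftrightarrow> (\<exists>H1 H2. splitting_pair \<Lambda> H1 H2)) \<and>
    ((\<exists>H1 H2. splitting_pair \<Lambda> H1 H2) \<longleftrightarrow> (\<exists>H. splitting_set \<Lambda> H)) \<and>
    (\<forall>H1 H2. splitting_pair \<Lambda> H1 H2 \<longrightarrow>
      internal_direct_sum (graph_cstar \<Lambda>) (graph_ideal \<Lambda> H1) (graph_ideal \<Lambda> H2) \<and>
      graph_cstar \<Lambda> \<restriction>\<^sub>* graph_ideal \<Lambda> H1 \<oplus>\<^sub>* graph_cstar \<Lambda> \<restriction>\<^sub>* graph_ideal \<Lambda> H2 \<cong>\<^sub>*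
        graph_cstar (remove \<Lambda> H2) \<oplus>\<^sub>* graph_cstar (remove \<Lambda> H1)) \<and>
    (\<forall>H. splitting_set \<Lambda> H \<longrightarrow>
      (let H' = saturation \<Lambda> (Delta \<Lambda> (vertices \<Lambda>) H) in
        graph_cstar \<Lambda> \<cong>\<^sub>*
          graph_cstar (remove \<Lambda> H) \<oplus>\<^sub>* graph_cstar \<Lambda> \<restriction>\<^sub>* graph_ideal \<Lambda> H \<and>
        graph_cstar (remove \<Lambda> H) \<oplus>\<^sub>* graph_cstar \<Lambda> \<restriction>\<^sub>* graph_ideal \<Lambda> H \<cong>\<^sub>*
          graph_cstar (remove \<Lambda> H) \<oplus>\<^sub>* graph_cstar (remove \<Lambda> H')))"
proof -
  interpret rf_lc_graph \<Lambda>
    using assms by (auto simp: rf_lc_graph_def rf_lc_graph_axioms_def)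
  show ?thesis
  proof (intro conjI allI impI)
    show "decomposable (graph_cstar \<Lambda>) \<longleftrightarrow> (\<exists>H1 H2. splitting_pair \<Lambda> H1 H2)"
      using splitting_pair_of_decomposable splitting_pair_decomposable by blast
    show "(\<exists>H1 H2. splitting_pair \<Lambda> H1 H2) \<longleftrightarrow> (\<exists>H. splitting_set \<Lambda> H)"
      using splitting_pair_of_splitting_set splitting_set_of_splitting_pair by blast
  next
    fix H1 H2 assume pair: "splitting_pair \<Lambda> H1 H2"
    then have pair': "splitting_pair \<Lambda> H2 H1" by (simp add: splitting_pair_commute)
    show "internal_direct_sum (graph_cstar \<Lambda>) (graph_ideal \<Lambda> H1) (graph_ideal \<Lambda> H2)"
      by (rule splitting_pair_direct_sum[OF pair])
    show "graph_cstar \<Lambda> \<restriction>\<^sub>* graph_ideal \<Lambda> H1 \<oplus>\<^sub>* graph_cstar \<Lambda> \<restriction>\<^sub>* graph_ideal \<Lambda> H2 \<cong>\<^sub>*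
        graph_cstar (remove \<Lambda> H2) \<oplus>\<^sub>* graph_cstar (remove \<Lambda> H1)"
      by (intro star_isomorphic_direct_sum graph_ideal_isomorphic pair pair')
  next
    fix H assume set: "splitting_set \<Lambda> H"
    let ?D = "Delta \<Lambda> (vertices \<Lambda>) H"
    have pair: "splitting_pair \<Lambda> ?D H" by (rule splitting_pair_of_splitting_set[OF set])
    then have pair': "splitting_pair \<Lambda> H ?D" by (simp add: splitting_pair_commute)
    have sat: "saturation \<Lambda> ?D = ?D"
      using set by (intro saturation_Delta) (simp add: splitting_set_def sat_her_def)
    have "graph_cstar \<Lambda> \<cong>\<^sub>* graph_cstar \<Lambda> \<restriction>\<^sub>* graph_ideal \<Lambda> ?D \<oplus>\<^sub>* graph_cstar \<Lambda> \<restriction>\<^sub>* graph_ideal \<Lambda> H"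
      by (rule isomorphic_of_internal_direct_sum[OF splitting_pair_direct_sum[OF pair]])
    moreover have "\<dots> \<cong>\<^sub>* graph_cstar (remove \<Lambda> H) \<oplus>\<^sub>* graph_cstar \<Lambda> \<restriction>\<^sub>* graph_ideal \<Lambda> H"
      by (intro star_isomorphic_direct_sum graph_ideal_isomorphic[OF pair] star_isomorphic_refl)
    ultimately have "graph_cstar \<Lambda> \<cong>\<^sub>* graph_cstar (remove \<Lambda> H) \<oplus>\<^sub>* graph_cstar \<Lambda> \<restriction>\<^sub>* graph_ideal \<Lambda> H"
      by (rule star_isomorphic_trans)
    moreover have "graph_cstar (remove \<Lambda> H) \<oplus>\<^sub>* graph_cstar \<Lambda> \<restriction>\<^sub>* graph_ideal \<Lambda> H \<cong>\<^sub>*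
          graph_cstar (remove \<Lambda> H) \<oplus>\<^sub>* graph_cstar (remove \<Lambda> ?D)"
      by (intro star_isomorphic_direct_sum graph_ideal_isomorphic[OF pair'] star_isomorphic_refl)
    ultimately show "let H' = saturation \<Lambda> (Delta \<Lambda> (vertices \<Lambda>) H) in
        graph_cstar \<Lambda> \<cong>\<^sub>*
          graph_cstar (remove \<Lambda> H) \<oplus>\<^sub>* graph_cstar \<Lambda> \<restriction>\<^sub>* graph_ideal \<Lambda> H \<and>
        graph_cstar (remove \<Lambda> H) \<oplus>\<^sub>* graph_cstar \<Lambda> \<restriction>\<^sub>* graph_ideal \<Lambda> H \<cong>\<^sub>*
          graph_cstar (remove \<Lambda> H) \<oplus>\<^sub>* graph_cstar (remove \<Lambda> H')"
      by (simp add: Let_def sat)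
  qed
qed

end
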